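(* Let $n\ge2$, let $K\subset\mathbb{R}^n$ be a convex body, let $\beta\subset\mathbb{R}^n$ be a Borel set, and let $r,s\in\mathbb{N}_0$. Then $$\int_{A(n,1)}\phi_0^{r,s,0}(K\cap E,\beta\cap E)\,\mu_1(\mathrm{d}E)=\pi^{\frac{n-2}2}\,\frac{\Gamma(\frac n2)}{\Gamma(\frac{n+1}2)}\,\frac{\Gamma(\lfloor\frac{s+1}2\rfloor+\frac12)}{\Gamma(\frac n2+\lfloor\frac{s+1}2\rfloor)}\,Q^{\lfloor\frac s2\rfloor}\,\phi_{n-1}^{r,s-2\lfloor\frac s2\rfloor,0}(K,\beta).$$
   Context: A convex body is a non-empty compact convex subset of $\mathbb{R}^n$. $S^{n-1}$ is the unit sphere, $B^n$ the unit ball, $\kappa_m$ the volume of $B^m$, $\omega_m=m\kappa_m=2\pi^{m/2}/\Gamma(m/2)$, $\mathcal{H}^m$ is $m$-dimensional Hausdorff measure. $G(n,k)$ is the Grassmannian of $k$-dimensional linear subspaces with rotation invariant Haar probability measure $\nu_k$. $A(n,k)$ is the set of affine $k$-flats in $\mathbb{R}^n$ with the motion invariant measure $\mu_k=\int_{G(n,k)}\int_{L^\perp}\mathbf{1}\{L+t\in\cdot\}\,\mathcal{H}^{n-k}(\mathrm{d}t)\,\nu_k(\mathrm{d}L)$. Symmetric tensors of rank $p$ over $\mathbb{R}^n$ are identified with symmetric $p$-linear forms via the scalar product; $ab$ denotes the symmetric (symmetrized) tensor product, powers are with respect to this product, so $x^p(y_1,\dots,y_p)=\prod_i x\cdot y_i$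 for $x\in\mathbb{R}^n$; zeroth powers equal $1$. Tensor-valued integrals are componentwise. The metric tensor is $Q(x,y)=x\cdot y$. Support measures: for a convex body $K$, let $p(K,x)$ be the metric projection of $x$ onto $K$ and $u(K,x)=(x-p(K,x))/\|x-p(K,x)\|$ for $x\notin K$. The support measures $\Lambda_0(K,\cdot),\dots,\Lambda_{n-1}(K,\cdot)$ are the finite Borel measures on $\mathbb{R}^n\times S^{n-1}$ determined by $\mathcal{H}^n(\{x\in(K+\epsilon B^n)\setminus K:(p(K,x),u(K,x))\in\eta\})=\sum_{j=0}^{n-1}\kappa_{n-j}\Lambda_j(K,\eta)\epsilon^{n-j}$ for all $\epsilon\ge0$ and all Borel sets $\eta$. Tensorial curvature measures (with respect to the ambient space $\mathbb{R}^n$): for $0\le j\le n-1$, $\phi_j^{r,s,0}(K,\beta)=\omega_{n-j}\int_{\beta\times S^{n-1}}x^ru^s\,\Lambda_j(K,\mathrm{d}(x,u))$, and $0$ for the empty set. In particular $\phi_0^{r,s,0}(K\cap E,\cdot)$ is computed in $\mathbb{R}^n$, not in $E$. *)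

theory Defs
  imports "HOL-Probability.Probability"
begin

section \<open>Symmetric tensors\<close>

text \<open>
  A tensor of rank \<open>p\<close> is a \<open>p\<close>-linear form; its arguments are the first \<open>p\<close> entries
  of a sequence of vectors, and all further entries are ignored.  The rank is not part of
  the type, so the operations below take the ranks of their arguments as parameters.
\<close>

type_synonym 'n tensor = "(nat \<Rightarrow> real^'n) \<Rightarrow> real"

definition sym_prod :: "nat \<Rightarrow> nat \<Rightarrow> 'n tensor \<Rightarrow> 'n tensor \<Rightarrow> 'n tensor" where
  "sym_prod p q a b y =
     (\<Sum>\<sigma> | \<sigma> permutes {..<p + q}. a (\<lambda>i. y (\<sigma> i)) * b (\<lambda>i. y (\<sigma> (p + i)))) / fact (p + q)"

primrec sym_power :: "nat \<Rightarrow> 'n tensor \<Rightarrow> nat \<Rightarrow> 'n tensor" where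
  "sym_power p a 0 = (\<lambda>y. 1)"
| "sym_power p a (Suc k) = sym_prod p (k * p) a (sym_power p a k)"

definition vec_tensor :: "real^'n \<Rightarrow> 'n tensor" where
  "vec_tensor x y = x \<bullet> y 0"

definition metric_tensor :: "'n::finite tensor" where
  "metric_tensor y = y 0 \<bullet> y 1"

lemma sym_power_vec_tensor:
  "sym_power 1 (vec_tensor x) p y = (\<Prod>i<p. x \<bullet> y i)"
proof (induction p arbitrary: y)
  case 0
  show ?case by simp
next
  case (Suc p)
  have "x \<bullet> y (\<sigma> 0) * (\<Prod>i<p. x \<bullet> y (\<sigma> (Suc i))) = (\<Prod>i<Suc p. x \<bullet> y i)"
    if "\<sigma> permutes {..<Suc p}" for \<sigma>
  proof -
    have "x \<bullet> y (\<sigma> 0) * (\<Prod>i<p. x \<bullet> y (\<sigma> (Suc i))) = (\<Prod>i<Suc p. x \<bullet> y (\<sigma> i))"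
      by (rule prod.lessThan_Suc_shift [symmetric])
    also have "\<dots> = (\<Prod>i<Suc p. x \<bullet> y i)"
      using prod.permute [OF that, of "\<lambda>i. x \<bullet> y i"] by (simp add: comp_def)
    finally show ?thesis .
  qed
  note perm = this
  have "sym_power 1 (vec_tensor x) (Suc p) y =
      (\<Sum>\<sigma> | \<sigma> permutes {..<Suc p}. x \<bullet> y (\<sigma> 0) * (\<Prod>i<p. x \<bullet> y (\<sigma> (Suc i)))) / fact (Suc p)"
    using Suc.IH by (simp add: sym_prod_def vec_tensor_def [abs_def])
  also have "\<dots> = (\<Sum>\<sigma> | \<sigma> permutes {..<Suc p}. (\<Prod>i<Suc p. x \<bullet> y i)) / fact (Suc p)"
    by (intro arg_cong2 [where f = "(/)"] sum.cong refl perm) simp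
  also have "\<dots> = (\<Prod>i<Suc p. x \<bullet> y i)"
    by (simp only: sum_constant card_permutations [OF card_lessThan finite_lessThan] of_nat_fact)
      (simp del: fact_Suc prod.lessThan_Suc)
  finally show ?case .
qed


section \<open>Support measures and tensorial curvature measures\<close>

definition convex_body :: "(real^'n) set \<Rightarrow> bool" where
  "convex_body K \<longleftrightarrow> K \<noteq> {} \<and> compact K \<and> convex K"

definition outer_normal :: "(real^'n) set \<Rightarrow> real^'n \<Rightarrow> real^'n" where
  "outer_normal K x = (x - closest_point K x) /\<^sub>R norm (x - closest_point K x)"

definition local_parallel_set ::
    "(real^'n) set \<Rightarrow> real \<Rightarrow> ((real^'n) \<times> (real^'n)) set \<Rightarrow> (real^'n) set" where
  "local_parallel_set K \<epsilon> \<eta> =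
     {x \<in> {a + b | a b. a \<in> K \<and> b \<in> cball 0 \<epsilon>} - K. (closest_point K x, outer_normal K x) \<in> \<eta>}"

abbreviation normal_space :: "((real^'n) \<times> (real^'n)) measure" where
  "normal_space \<equiv> restrict_space borel (UNIV \<times> sphere 0 1)"

text \<open>
  The defining property (local Steiner formula) of \<open>\<Lambda> 0, \<dots>, \<Lambda> (n - 1)\<close>, where \<open>n = CARD('n)\<close>;
  the values of \<open>\<Lambda>\<close> at other indices are left unspecified.
\<close>

definition support_measures_of ::
    "(real^'n) set \<Rightarrow> (nat \<Rightarrow> ((real^'n) \<times> (real^'n)) measure) \<Rightarrow> bool" where
  "support_measures_of K \<Lambda> \<longleftrightarrow>
     (\<forall>j<CARD('n). finite_measure (\<Lambda> j) \<and> sets (\<Lambda> j) = sets normal_space) \<and>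
     (\<forall>\<epsilon>\<ge>0. \<forall>\<eta>\<in>sets normal_space.
        measure lborel (local_parallel_set K \<epsilon> \<eta>) =
        (\<Sum>j<CARD('n). unit_ball_vol (real (CARD('n) - j)) * measure (\<Lambda> j) \<eta> * \<epsilon> ^ (CARD('n) - j)))"

definition support_measure ::
    "(real^'n) set \<Rightarrow> nat \<Rightarrow> ((real^'n) \<times> (real^'n)) measure" where
  "support_measure K j = (THE M. \<exists>\<Lambda>. support_measures_of K \<Lambda> \<and> M = \<Lambda> j)"

definition unit_sphere_area :: "nat \<Rightarrow> real" where
  "unit_sphere_area m = real m * unit_ball_vol (real m)"

text \<open>
  The tensor \<open>\<phi>\<^sub>j\<^sup>r\<^sup>,\<^sup>s\<^sup>,\<^sup>0(K, \<beta>)\<close>, which has rank \<open>r + s\<close>, evaluated at the vectors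
  \<open>y 0, \<dots>, y (r + s - 1)\<close>.
\<close>

definition tensorial_curvature_measure ::
    "nat \<Rightarrow> nat \<Rightarrow> nat \<Rightarrow> (real^'n) set \<Rightarrow> (real^'n) set \<Rightarrow> 'n tensor" where
  "tensorial_curvature_measure j r s K \<beta> y =
     (if K = {} then 0
      else unit_sphere_area (CARD('n) - j) *
        (LINT z : \<beta> \<times> sphere 0 1 | support_measure K j.
           sym_prod r s (sym_power 1 (vec_tensor (fst z)) r) (sym_power 1 (vec_tensor (snd z)) s) y))"


section \<open>Invariant measures on linear subspaces and affine flats\<close>

definition linear_subspaces :: "nat \<Rightarrow> (real^'n) set set" where
  "linear_subspaces k = {L. subspace L \<and> dim L = k}"

definition affine_flats :: "nat \<Rightarrow> (real^'n) set set" where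
  "affine_flats k = {E. affine E \<and> aff_dim E = int k}"

text \<open>
  The Borel \<open>\<sigma>\<close>-algebra of the Fell topology (the usual topology of the Grassmannians),
  restricted to a family \<open>X\<close> of closed sets.  It is generated by the sets of all members of
  \<open>X\<close> that hit a given compact set.
\<close>

definition hit_algebra :: "(real^'n) set set \<Rightarrow> (real^'n) set measure" where
  "hit_algebra X = sigma X {{E \<in> X. E \<inter> C \<noteq> {}} | C. compact C}"

definition rotation :: "(real^'n \<Rightarrow> real^'n) \<Rightarrow> bool" where
  "rotation \<rho> \<longleftrightarrow> orthogonal_transformation \<rho> \<and> det (matrix \<rho>) = 1"

definition grassmannian_measure :: "nat \<Rightarrow> (real^'n) set measure" where
  "grassmannian_measure k =
     (THE \<nu>. sets \<nu> = sets (hit_algebra (linear_subspaces k)) \<and> prob_space \<nu> \<and>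
        (\<forall>\<rho>. rotation \<rho> \<longrightarrow> distr \<nu> \<nu> (image \<rho>) = \<nu>))"

text \<open>
  Lebesgue measure on a linear subspace \<open>V\<close>, that is, the restriction to \<open>V\<close> of the
  \<open>dim V\<close>-dimensional Hausdorff measure: the image of the product Lebesgue measure on
  coordinates with respect to an orthonormal basis of \<open>V\<close>.  By rotation invariance of
  Lebesgue measure the choice of the basis is irrelevant.
\<close>

definition orthonormal_basis :: "(real^'n) set \<Rightarrow> (real^'n) set \<Rightarrow> bool" where
  "orthonormal_basis V B \<longleftrightarrow> pairwise orthogonal B \<and> (\<forall>b\<in>B. norm b = 1) \<and> span B = V"

definition subspace_lebesgue :: "(real^'n) set \<Rightarrow> (real^'n) measure" where
  "subspace_lebesgue V =
     (let B = (SOME B. orthonormal_basis V B)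
      in distr (\<Pi>\<^sub>M b\<in>B. lborel) (restrict_space borel V) (\<lambda>c. \<Sum>b\<in>B. c b *\<^sub>R b))"

definition flat_measure :: "nat \<Rightarrow> (real^'n) set measure" where
  "flat_measure k =
     measure_of (affine_flats k) (sets (hit_algebra (affine_flats k)))
       (\<lambda>A. \<integral>\<^sup>+ L. (\<integral>\<^sup>+ t. indicator A ((\<lambda>x. x + t) ` L) \<partial>subspace_lebesgue (L\<^sup>\<bottom>))
          \<partial>grassmannian_measure k)"

end

theory Submission
  imports Defs
begin

text \<open>
  A line \<open>E\<close> meets \<open>K\<close> in a segment, and the support measure of index zero of this segment, taken in the ambient
  space, sits at its ends: if \<open>w\<close> is a uniformly distributed direction and \<open>p\<close> is the end of \<open>K \<inter> E\<close> that is extreme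
  in direction \<open>w\<close>, then \<open>(p, w)\<close> is distributed according to \<open>\<Lambda>\<^sub>0(K \<inter> E)\<close>
  (\<open>integral_support_measure_zero_chord\<close>). The left-hand side is therefore an integral over \<open>w\<close> and \<open>E\<close>.

  Fix \<open>w\<close>, write \<open>E\<close> as a line with direction \<open>v\<close>, oriented such that \<open>v \<bullet> w > 0\<close>, and let it run through all translates.
  Then \<open>p\<close> is the last point of \<open>K\<close> on \<open>E\<close>, and projecting the boundary of \<open>K\<close> along \<open>v\<close> replaces the integral over the
  translates by the integral of \<open>2 * max 0 (u \<bullet> v)\<close> with respect to \<open>\<Lambda>\<^sub>n\<^sub>-\<^sub>1(K)\<close>, where \<open>u\<close> is the normal
  (\<open>projection_formula\<close>). Averaging this weight over the directions \<open>v\<close> gives a multiple of \<open>1 + u \<bullet> w\<close>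
  (\<open>integral_orientation_weight\<close>). The result is a Crofton formula for arbitrary functions
  (\<open>crofton_lines\<close>): up to a constant, integrating \<open>f\<close> with respect to \<open>\<Lambda>\<^sub>0(K \<inter> E)\<close> and then over \<open>E\<close> amounts to integrating the
  average over \<open>w\<close> of \<open>f (x, w) * (1 + u \<bullet> w)\<close> with respect to \<open>\<Lambda>\<^sub>n\<^sub>-\<^sub>1(K)\<close>.

  For \<open>f (x, w) = x\<^sup>r w\<^sup>s\<close> the average over \<open>w\<close> is a moment tensor of the uniform distribution on the sphere. Odd moments vanish, so
  that only \<open>w\<^sup>s\<close> contributes for even \<open>s\<close> and only \<open>w\<^sup>s (u \<bullet> w)\<close> for odd \<open>s\<close>. By rotation invariance these moments are multiples of
  \<open>Q\<^sup>k\<close> and \<open>Q\<^sup>k u\<close> with \<open>k = s div 2\<close>. Polarization reduces this to the values of the tensors on the diagonal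
  (\<open>integral_dir_power_tensor\<close>), and the powers of \<open>Q\<close> come out of the symmetric product because it
  is associative and commutative (\<open>sym_prod_left_commute\<close>).

  Two of the objects involved are introduced by definite descriptions, which are meaningful only after existence and uniqueness have
  been shown. The support measures exist because the local Steiner formula holds for polytopes, where the metric projection is
  affine on finitely many cells, and carries over to convex bodies by approximation (\<open>support_measures_exist\<close>). The invariant
  measure on the Grassmannian of lines is unique because two rotation invariant measures on the sphere with the same total mass
  coincide (\<open>spherical_measure_unique\<close>); this identifies the measure on affine lines as the distribution of a line with a
  uniformly distributed direction through a point of a slab orthogonal to this direction (\<open>flat_measure_1\<close>). The slab,
  of width one, represents the space of translates of a line.
\<close>

section \<open>Lebesgue integrals in orthonormal coordinates\<close>

text \<open>
  Uniqueness of Haar measure by Tonelli's theorem: \<open>f (h c + y)\<close> is integrated over \<open>c\<close> and over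
  \<open>y\<close> in the unit ball. Invariance of the image of \<open>M\<close> under translations evaluates the inner integral
  over \<open>c\<close>; a shift by \<open>h c\<close> followed by the same invariance evaluates the integral in the other
  order.
\<close>

lemma lborel_invariant_unique:
  fixes h :: "'a \<Rightarrow> 'b::euclidean_space"
  assumes M: "sigma_finite_measure M" and h[measurable]: "h \<in> borel_measurable M"
    and inv: "\<And>f y. f \<in> borel_measurable borel \<Longrightarrow> (\<integral>\<^sup>+c. f (h c + y) \<partial>M) = (\<integral>\<^sup>+c. f (h c) \<partial>M)"
    and f[measurable]: "f \<in> borel_measurable borel"
  shows "emeasure lborel (cball (0::'b) 1) * (\<integral>\<^sup>+c. f (h c) \<partial>M)
       = (\<integral>\<^sup>+c. indicator (cball 0 1) (h c) \<partial>M) * (\<integral>\<^sup>+x. f x \<partial>lborel)"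
proof -
  interpret M: sigma_finite_measure M by fact
  interpret pair_sigma_finite M "lborel :: 'b measure" ..
  let ?B = "cball (0::'b) 1"
  have B[measurable]: "?B \<in> sets borel" by simp
  have ad[measurable]: "(\<lambda>x. h (fst x) + snd x) \<in> borel_measurable (M \<Otimes>\<^sub>M lborel)"
    "(\<lambda>x. snd x - h (fst x)) \<in> borel_measurable (M \<Otimes>\<^sub>M lborel)"
    by measurable
  have [measurable]: "(\<lambda>x. f (h (fst x) + snd x)) \<in> borel_measurable (M \<Otimes>\<^sub>M lborel)"
    by (rule measurable_compose[OF ad(1) f])
  have [measurable]: "(\<lambda>x. indicator ?B (snd x - h (fst x)) :: ennreal) \<in> borel_measurable (M \<Otimes>\<^sub>M lborel)"
    by (rule measurable_compose[OF ad(2)]) simp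
  have "emeasure lborel ?B * (\<integral>\<^sup>+c. f (h c) \<partial>M) = (\<integral>\<^sup>+y. indicator ?B y * (\<integral>\<^sup>+c. f (h c) \<partial>M) \<partial>lborel)"
    by (subst nn_integral_multc) (auto intro: borel_measurable_indicator)
  also have "\<dots> = (\<integral>\<^sup>+y. (\<integral>\<^sup>+c. indicator ?B y * f (h c + y) \<partial>M) \<partial>lborel)"
    using inv[OF f] by (subst nn_integral_cmult) (auto intro: borel_measurable_indicator)
  also have "\<dots> = (\<integral>\<^sup>+c. (\<integral>\<^sup>+y. indicator ?B y * f (h c + y) \<partial>lborel) \<partial>M)"
    by (rule Fubini') measurable
  also have "\<dots> = (\<integral>\<^sup>+c. (\<integral>\<^sup>+y. indicator ?B (y - h c) * f y \<partial>lborel) \<partial>M)"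
  proof (rule nn_integral_cong)
    fix c
    have "(\<integral>\<^sup>+y. indicator ?B (y - h c) * f y \<partial>lborel) = (\<integral>\<^sup>+y. indicator ?B (y - h c) * f y \<partial>distr lborel borel ((+) (h c)))"
      by (simp add: lborel_distr_plus)
    also have "\<dots> = (\<integral>\<^sup>+y. indicator ?B y * f (h c + y) \<partial>lborel)"
      by (subst nn_integral_distr) auto
    finally show "(\<integral>\<^sup>+y. indicator ?B y * f (h c + y) \<partial>lborel) = (\<integral>\<^sup>+y. indicator ?B (y - h c) * f y \<partial>lborel)" ..
  qed
  also have "\<dots> = (\<integral>\<^sup>+y. (\<integral>\<^sup>+c. indicator ?B (y - h c) * f y \<partial>M) \<partial>lborel)"
    by (rule Fubini'[symmetric]) measurable
  also have "\<dots> = (\<integral>\<^sup>+y. (\<integral>\<^sup>+c. indicator ?B (h c + - y) \<partial>M) * f y \<partial>lborel)"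
  proof (rule nn_integral_cong)
    fix y
    have "indicator ?B (y - h c) = (indicator ?B (h c + - y) :: ennreal)" for c
      by (auto simp: indicator_def dist_norm norm_minus_commute)
    then show "(\<integral>\<^sup>+c. indicator ?B (y - h c) * f y \<partial>M) = (\<integral>\<^sup>+c. indicator ?B (h c + - y) \<partial>M) * f y"
      by (subst nn_integral_multc[symmetric]) auto
  qed
  also have "\<dots> = (\<integral>\<^sup>+y. (\<integral>\<^sup>+c. indicator ?B (h c) \<partial>M) * f y \<partial>lborel)"
    by (subst inv) auto
  also have "\<dots> = (\<integral>\<^sup>+c. indicator ?B (h c) \<partial>M) * (\<integral>\<^sup>+x. f x \<partial>lborel)"
    by (subst nn_integral_cmult) (auto intro: borel_measurable_indicator)
  finally show ?thesis .
qed

lemma emeasure_cball_pos_finite: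
  "0 < emeasure lborel (cball (0::'b::euclidean_space) 1)" "emeasure lborel (cball (0::'b::euclidean_space) 1) < \<infinity>"
proof -
  have "emeasure lborel (cball (0::'b) 1) = ennreal (unit_ball_vol (real DIM('b)))"
    by (simp add: emeasure_cball)
  then show "0 < emeasure lborel (cball (0::'b::euclidean_space) 1)" "emeasure lborel (cball (0::'b::euclidean_space) 1) < \<infinity>"
    by auto
qed

text \<open>
  The image of Lebesgue measure under an orthogonal map is invariant under translations, hence a
  multiple of Lebesgue measure; the factor is one because the unit ball is preserved.
\<close>

lemma nn_integral_orthogonal_transformation:
  fixes T :: "'b::euclidean_space \<Rightarrow> 'b"
  assumes T: "orthogonal_transformation T" and f[measurable]: "f \<in> borel_measurable borel"
  shows "(\<integral>\<^sup>+x. f (T x) \<partial>lborel) = (\<integral>\<^sup>+x. f x \<partial>lborel)"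
proof -
  have lin: "linear T" using T by (simp add: orthogonal_transformation_linear)
  have [measurable]: "T \<in> borel_measurable borel"
    by (intro borel_measurable_continuous_onI linear_continuous_on linear_conv_bounded_linear[THEN iffD1] lin)
  have surj: "surj T" by (rule orthogonal_transformation_surj[OF T])
  have "emeasure lborel (cball (0::'b) 1) * (\<integral>\<^sup>+c. f (T c) \<partial>lborel)
       = (\<integral>\<^sup>+c. indicator (cball 0 1) (T c) \<partial>lborel) * (\<integral>\<^sup>+x. f x \<partial>lborel)"
  proof (rule lborel_invariant_unique[OF _ _ _ f])
    fix f :: "'b \<Rightarrow> ennreal" and y assume [measurable]: "f \<in> borel_measurable borel"
    obtain z where z: "y = T z" using surj by (metis surjE)
    have "(\<integral>\<^sup>+c. f (T c) \<partial>lborel) = (\<integral>\<^sup>+c. f (T c) \<partial>distr lborel borel ((+) z))"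
      by (simp add: lborel_distr_plus)
    also have "\<dots> = (\<integral>\<^sup>+c. f (T (z + c)) \<partial>lborel)"
      by (subst nn_integral_distr) auto
    finally show "(\<integral>\<^sup>+c. f (T c + y) \<partial>lborel) = (\<integral>\<^sup>+c. f (T c) \<partial>lborel)"
      by (simp add: z linear_add[OF lin] add.commute)
  qed (auto simp: sigma_finite_lborel)
  also have "(\<integral>\<^sup>+c. indicator (cball 0 1) (T c) \<partial>lborel) = (\<integral>\<^sup>+c. indicator (cball 0 1) (c::'b) \<partial>lborel)"
    by (intro nn_integral_cong) (auto simp: indicator_def orthogonal_transformation_norm[OF T])
  also have "\<dots> = emeasure lborel (cball (0::'b) 1)"
    by simp
  finally show ?thesis
    using emeasure_cball_pos_finite[where 'b='b] by (subst (asm) ennreal_mult_cancel_left) (auto simp: less_top)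
qed

lemma nn_integral_lborel_scale:
  fixes f :: "'b::euclidean_space \<Rightarrow> ennreal"
  assumes [measurable]: "f \<in> borel_measurable borel" and c: "c > 0"
  shows "(\<integral>\<^sup>+x. f x \<partial>lborel) = ennreal (c ^ DIM('b)) * (\<integral>\<^sup>+x. f (c *\<^sub>R x) \<partial>lborel)"
  using c by (subst lborel_affine[of c 0]) (simp_all add: nn_integral_density nn_integral_distr nn_integral_cmult)

text \<open>
  Translation invariance of the product measure, which is the hypothesis of
  \<open>lborel_invariant_unique\<close> when points are written in coordinates.
\<close>

lemma PiM_lborel_shift:
  fixes a :: "'i \<Rightarrow> real"
  assumes I: "finite I"
  shows "distr (\<Pi>\<^sub>M i\<in>I. lborel) (\<Pi>\<^sub>M i\<in>I. lborel) (\<lambda>c. \<lambda>i\<in>I. a i + c i) = (\<Pi>\<^sub>M i\<in>I. lborel)"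
proof -
  interpret product_sigma_finite "\<lambda>i::'i. lborel :: real measure" ..
  interpret F: finite_product_sigma_finite "\<lambda>i::'i. lborel :: real measure" I by standard (rule I)
  show ?thesis
  proof (rule PiM_eqI[OF I])
    show "sets (distr (\<Pi>\<^sub>M i\<in>I. lborel) (\<Pi>\<^sub>M i\<in>I. lborel) (\<lambda>c. \<lambda>i\<in>I. a i + c i)) = sets (\<Pi>\<^sub>M i\<in>I. lborel)" by simp
    fix A :: "'i \<Rightarrow> real set" assume A: "\<And>i. i \<in> I \<Longrightarrow> A i \<in> sets lborel"
    have m: "(\<lambda>c. \<lambda>i\<in>I. a i + c i) \<in> (\<Pi>\<^sub>M i\<in>I. lborel) \<rightarrow>\<^sub>M (\<Pi>\<^sub>M i\<in>I. (lborel::real measure))"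
      by measurable
    have eq: "(\<lambda>c. \<lambda>i\<in>I. a i + c i) -` Pi\<^sub>E I A \<inter> space (\<Pi>\<^sub>M i\<in>I. (lborel::real measure)) = Pi\<^sub>E I (\<lambda>i. (+) (a i) -` A i)"
      by (auto simp: space_PiM PiE_def Pi_def extensional_def)
    have mA: "(+) (a i) -` A i \<in> sets borel" if "i \<in> I" for i
      using measurable_sets[of "(+) (a i)" borel borel "A i"] A[OF that] by auto
    have "emeasure (distr (\<Pi>\<^sub>M i\<in>I. lborel) (\<Pi>\<^sub>M i\<in>I. lborel) (\<lambda>c. \<lambda>i\<in>I. a i + c i)) (Pi\<^sub>E I A) = emeasure (\<Pi>\<^sub>M i\<in>I. lborel) (Pi\<^sub>E I (\<lambda>i. (+) (a i) -` A i))"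
      using A I by (subst emeasure_distr[OF m]) (auto simp: eq intro!: sets_PiM_I_finite)
    also have "\<dots> = (\<Prod>i\<in>I. emeasure lborel ((+) (a i) -` A i))"
      using mA by (intro emeasure_PiM I) auto
    also have "\<dots> = (\<Prod>i\<in>I. emeasure lborel (A i))"
    proof (rule prod.cong[OF refl])
      fix i assume i: "i \<in> I"
      have "emeasure lborel (A i) = emeasure (distr lborel borel ((+) (a i))) (A i)"
        by (simp add: lborel_distr_plus)
      also have "\<dots> = emeasure lborel ((+) (a i) -` A i)"
        using A[OF i] by (subst emeasure_distr) auto
      finally show "emeasure lborel ((+) (a i) -` A i) = emeasure lborel (A i)" ..
    qed
    finally show "emeasure (distr (\<Pi>\<^sub>M i\<in>I. lborel) (\<Pi>\<^sub>M i\<in>I. lborel) (\<lambda>c. \<lambda>i\<in>I. a i + c i)) (Pi\<^sub>E I A) = (\<Prod>i\<in>I. emeasure lborel (A i))" .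
  qed
qed


lemma borel_measurable_fst_snd:
  "fst \<in> borel_measurable (borel :: ('a::second_countable_topology \<times> 'b::second_countable_topology) measure)"
  "snd \<in> borel_measurable (borel :: ('a::second_countable_topology \<times> 'b::second_countable_topology) measure)"
  unfolding borel_prod[symmetric] by measurable

lemma measurable_lborel_pair:
  "f \<in> measurable (lborel \<Otimes>\<^sub>M lborel) N \<longleftrightarrow> f \<in> measurable (borel :: ('a::euclidean_space \<times> 'b::euclidean_space) measure) N"
proof -
  have "sets (lborel \<Otimes>\<^sub>M lborel) = sets (borel :: ('a \<times> 'b) measure)"
    by (metis borel_prod sets_lborel sets_pair_measure_cong)
  then show ?thesis by (intro iffI) (simp_all cong: measurable_cong_sets)
qed

lemma Gamma_half_nat: "Gamma (real k + 1/2) = sqrt pi * fact (2 * k) / (2 ^ (2 * k) * fact k)"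
proof (induction k)
  case 0 then show ?case by (simp add: Gamma_one_half_real)
next
  case (Suc k)
  have "Gamma (real (Suc k) + 1/2) = (real k + 1/2) * Gamma (real k + 1/2)"
    using Gamma_plus1[of "real k + 1/2"] nonpos_Ints_nonpos[of "real k + 1/2"] by (auto simp: add_ac)
  also have "\<dots> = sqrt pi * fact (2 * Suc k) / (2 ^ (2 * Suc k) * fact (Suc k))"
    unfolding Suc.IH by (simp add: divide_simps) (simp add: algebra_simps)
  finally show ?case .
qed

lemma has_bochner_integral_nn_integral_eq:
  assumes "has_bochner_integral M f c" "\<And>x. 0 \<le> f x"
  shows "(\<integral>\<^sup>+x. ennreal (f x) \<partial>M) = ennreal c"
  using assms by (auto simp: has_bochner_integral_iff nn_integral_eq_integral)

lemma nn_integral_gauss_half_moment: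
  "(\<integral>\<^sup>+x. ennreal (indicator {0..} x * (\<bar>x\<bar> ^ m * exp (- x\<^sup>2))) \<partial>lborel) = ennreal (Gamma ((real m + 1) / 2) / 2)"
  proof (cases "even m")
    case True
    then obtain k where k: "m = 2 * k" by (auto elim: evenE)
    have "has_bochner_integral lborel (\<lambda>x::real. indicator {0..} x *\<^sub>R (exp (-x\<^sup>2)*x^(2 * k))) (Gamma ((real m + 1) / 2) / 2)"
    proof -
      have "(real m + 1) / 2 = real k + 1/2" by (simp add: k add_divide_distrib)
      then have "Gamma ((real m + 1) / 2) / 2 = (sqrt pi / 2) * (fact (2 * k) / (2 ^ (2 * k) * fact k))"
        by (simp only: Gamma_half_nat) simp
      then show ?thesis using gaussian_moment_even_pos[of k] by (simp only:)
    qed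
    from has_bochner_integral_nn_integral_eq[OF this]
    have "(\<integral>\<^sup>+x. ennreal (indicator {0..} x *\<^sub>R (exp (-x\<^sup>2)*x^(2 * k))) \<partial>lborel) = ennreal (Gamma ((real m + 1) / 2) / 2)"
      by (auto simp: indicator_def)
    then show ?thesis by (simp add: k mult.commute[of _ "exp _"] power_even_abs)
  next
    case False
    then obtain k where k: "m = 2 * k + 1" by (auto elim: oddE)
    have "Gamma ((real m + 1) / 2) = fact k" 
    proof -
      have "(real m + 1) / 2 = 1 + real k" by (simp add: k)
      then show ?thesis using Gamma_fact[of k, where 'a=real] by (simp only: of_nat_eq_iff)
    qed
    then have "has_bochner_integral lborel (\<lambda>x::real. indicator {0..} x *\<^sub>R (exp (-x\<^sup>2)*x^(2 * k + 1))) (Gamma ((real m + 1) / 2) / 2)"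
      using gaussian_moment_odd_pos[of k] by (simp add: k)
    from has_bochner_integral_nn_integral_eq[OF this]
    have *: "(\<integral>\<^sup>+x. ennreal (indicator {0..} x *\<^sub>R (exp (-x\<^sup>2)*x^(2 * k + 1))) \<partial>lborel) = ennreal (Gamma ((real m + 1) / 2) / 2)"
      by (auto simp: indicator_def)
    have "(\<integral>\<^sup>+x. ennreal (indicator {0..} x * (\<bar>x\<bar> ^ m * exp (- x\<^sup>2))) \<partial>lborel) = (\<integral>\<^sup>+x. ennreal (indicator {0..} x *\<^sub>R (exp (-x\<^sup>2)*x^(2 * k + 1))) \<partial>lborel)"
      by (intro nn_integral_cong) (auto simp: k indicator_def)
    then show ?thesis using * by simp
  qed

lemma nn_integral_gauss_abs_moment:
  "(\<integral>\<^sup>+x. ennreal (\<bar>x\<bar> ^ m * exp (- x\<^sup>2)) \<partial>lborel) = ennreal (Gamma ((real m + 1) / 2))"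
proof -
  let ?f = "\<lambda>x::real. \<bar>x\<bar> ^ m * exp (- x\<^sup>2)"
  note half = nn_integral_gauss_half_moment[of m]
  have "(\<integral>\<^sup>+x. ennreal (?f x) \<partial>lborel) = (\<integral>\<^sup>+x. ennreal (indicator {0..} x * ?f x) + ennreal (indicator {0<..} (-x) * ?f (-x)) \<partial>lborel)"
    by (intro nn_integral_cong) (auto simp: indicator_def)
  also have "\<dots> = (\<integral>\<^sup>+x. ennreal (indicator {0..} x * ?f x) \<partial>lborel) + (\<integral>\<^sup>+x. ennreal (indicator {0<..} (-x) * ?f (-x)) \<partial>lborel)"
    by (rule nn_integral_add) auto
  also have "(\<integral>\<^sup>+x. ennreal (indicator {0<..} (-x) * ?f (-x)) \<partial>lborel) = (\<integral>\<^sup>+x. ennreal (indicator {0<..} x * ?f x) \<partial>lborel)"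
    using nn_integral_real_affine[of "\<lambda>x. ennreal (indicator {0<..} x * ?f x)" "-1" 0] by simp
  also have "\<dots> = (\<integral>\<^sup>+x. ennreal (indicator {0..} x * ?f x) \<partial>lborel)"
    by (intro nn_integral_cong_AE eventually_mono[OF AE_lborel_singleton[of 0]]) (auto simp: indicator_def)
  finally show ?thesis
    by (simp add: half Gamma_real_pos less_imp_le flip: ennreal_plus)
qed

lemma nn_integral_gauss: "(\<integral>\<^sup>+x. ennreal (exp (- x\<^sup>2)) \<partial>lborel) = ennreal (sqrt pi)"
  using nn_integral_gauss_abs_moment[of 0] by (simp add: Gamma_one_half_real)

definition onb :: "'b::euclidean_space set \<Rightarrow> bool" where
  "onb B \<longleftrightarrow> finite B \<and> pairwise orthogonal B \<and> (\<forall>b\<in>B. norm b = 1) \<and> span B = UNIV"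

lemma onb_inner_sum:
  fixes B :: "'b::euclidean_space set"
  assumes "finite B" "pairwise orthogonal B" "\<forall>b\<in>B. norm b = 1" "e \<in> B"
  shows "(\<Sum>b\<in>B. c b *\<^sub>R b) \<bullet> e = c e"
proof -
  have "(\<Sum>b\<in>B. c b *\<^sub>R b) \<bullet> e = (\<Sum>b\<in>B. if b = e then c e else 0)"
    unfolding inner_sum_left using assms
    by (intro sum.cong) (auto simp: pairwise_def orthogonal_def norm_eq_1)
  then show ?thesis using assms by simp
qed

lemma onb_norm_sum:
  assumes "finite B" "pairwise orthogonal B" "\<forall>b\<in>B. norm b = 1"
  shows "(norm (\<Sum>b\<in>B. c b *\<^sub>R b))\<^sup>2 = (\<Sum>b\<in>B. (c b)\<^sup>2)"
proof -
  have "(norm (\<Sum>b\<in>B. c b *\<^sub>R b))\<^sup>2 = (\<Sum>b\<in>B. (norm (c b *\<^sub>R b))\<^sup>2)"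
    using assms by (intro norm_sum_Pythagorean) (auto simp: pairwise_def orthogonal_clauses)
  also have "\<dots> = (\<Sum>b\<in>B. (c b)\<^sup>2)" using assms by (intro sum.cong) auto
  finally show ?thesis .
qed

lemma onb_expand:
  assumes "onb B" shows "(\<Sum>b\<in>B. (x \<bullet> b) *\<^sub>R b) = x"
proof -
  have B: "finite B" "pairwise orthogonal B" "\<forall>b\<in>B. norm b = 1" using assms by (auto simp: onb_def)
  have "x \<in> span B" using assms by (simp add: onb_def)
  then obtain u where u: "x = (\<Sum>b\<in>B. u b *\<^sub>R b)" using B(1) by (auto simp: span_finite)
  show ?thesis by (subst (2) u, rule sum.cong) (auto simp: u onb_inner_sum[OF B])
qed

lemma onb_card: assumes "onb (B :: 'b::euclidean_space set)" shows "card B = DIM('b)"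
proof -
  have "0 \<notin> B" using assms by (auto simp: onb_def)
  then have "independent B" using assms pairwise_orthogonal_independent by (auto simp: onb_def)
  then have "card B = dim (UNIV :: 'b set)" using assms by (metis onb_def dim_span dim_eq_card_independent)
  then show ?thesis by simp
qed

lemma prod_ennreal_mult: "finite B \<Longrightarrow> (\<And>b. b \<in> B \<Longrightarrow> 0 \<le> s b) \<Longrightarrow> (\<Prod>b\<in>B. ennreal (s b) * g) = ennreal (prod s B) * g ^ card B"
  by (induction B rule: finite_induct) (auto simp: ennreal_mult prod_nonneg mult_ac)

text \<open>
  By uniqueness of Haar measure both sides agree up to a constant. The constant is found by testing
  with the Gaussian \<open>exp (- \<parallel>x\<parallel>\<^sup>2)\<close>, which factorizes in every orthonormal basis. The scaling
  factors \<open>s\<close> make it possible to stretch a subset of the coordinates, as the cells of a polytope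
  require.
\<close>

lemma nn_integral_orthonormal_coordinates:
  fixes B :: "'b::euclidean_space set"
  assumes onb: "onb B" and s: "\<And>b. b \<in> B \<Longrightarrow> 0 < s b"
    and f[measurable]: "f \<in> borel_measurable borel"
  shows "(\<integral>\<^sup>+c. f (\<Sum>b\<in>B. (s b * c b) *\<^sub>R b) \<partial>(\<Pi>\<^sub>M b\<in>B. lborel)) = ennreal (\<Prod>b\<in>B. 1 / s b) * (\<integral>\<^sup>+x. f x \<partial>lborel)"
proof -
  have B: "finite B" "pairwise orthogonal B" "\<forall>b\<in>B. norm b = 1" using onb by (auto simp: onb_def)
  interpret product_sigma_finite "\<lambda>i::'b. lborel :: real measure" ..
  interpret F: finite_product_sigma_finite "\<lambda>i::'b. lborel :: real measure" B by standard (rule B)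
  let ?M = "\<Pi>\<^sub>M b\<in>B. (lborel :: real measure)"
  let ?h = "\<lambda>c. (\<Sum>b\<in>B. (s b * c b) *\<^sub>R b)"
  let ?C = "cball (0::'b) 1"
  let ?g = "\<lambda>b. \<integral>\<^sup>+x. ennreal (exp (- (s b * x)\<^sup>2)) \<partial>lborel"
  let ?E = "\<lambda>x::'b. ennreal (exp (- (norm x)\<^sup>2))"
  have main: "emeasure lborel ?C * (\<integral>\<^sup>+c. f (?h c) \<partial>?M)
       = (\<integral>\<^sup>+c. indicator ?C (?h c) \<partial>?M) * (\<integral>\<^sup>+x. f x \<partial>lborel)" if [measurable]: "f \<in> borel_measurable borel" for f
  proof (rule lborel_invariant_unique[OF _ _ _ that])
    show "sigma_finite_measure ?M" ..
    show "?h \<in> borel_measurable ?M" by measurable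
    fix f :: "'b \<Rightarrow> ennreal" and y assume [measurable]: "f \<in> borel_measurable borel"
    let ?a = "\<lambda>b. (y \<bullet> b) / s b"
    let ?S = "\<lambda>c. \<lambda>b\<in>B. ?a b + c b"
    have m: "?S \<in> ?M \<rightarrow>\<^sub>M ?M" by measurable
    have eq: "?h (?S c) = ?h c + y" for c
    proof -
      have "?h (?S c) = (\<Sum>b\<in>B. (y \<bullet> b) *\<^sub>R b + (s b * c b) *\<^sub>R b)"
      proof (intro sum.cong refl)
        fix b assume b: "b \<in> B"
        have "s b * ?S c b = y \<bullet> b + s b * c b" using s[OF b] b by (simp add: distrib_left)
        then show "(s b * ?S c b) *\<^sub>R b = (y \<bullet> b) *\<^sub>R b + (s b * c b) *\<^sub>R b" by (simp add: scaleR_left_distrib)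
      qed
      also have "\<dots> = ?h c + y" by (simp add: sum.distrib onb_expand[OF onb])
      finally show ?thesis .
    qed
    have "(\<integral>\<^sup>+c. f (?h c) \<partial>?M) = (\<integral>\<^sup>+c. f (?h c) \<partial>distr ?M ?M ?S)"
      by (simp add: PiM_lborel_shift B)
    also have "\<dots> = (\<integral>\<^sup>+c. f (?h (?S c)) \<partial>?M)"
      by (rule nn_integral_distr[OF m]) measurable
    also have "\<dots> = (\<integral>\<^sup>+c. f (?h c + y) \<partial>?M)" by (simp only: eq)
    finally show "(\<integral>\<^sup>+c. f (?h c + y) \<partial>?M) = (\<integral>\<^sup>+c. f (?h c) \<partial>?M)" ..
  qed
  have gauss: "(\<integral>\<^sup>+x. ?E x \<partial>lborel) = ennreal (sqrt pi) ^ DIM('b)"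
  proof -
    have "(\<integral>\<^sup>+x. ?E x \<partial>lborel) = (\<integral>\<^sup>+x. (\<Prod>b\<in>Basis. ennreal (exp (- ((x::'b) \<bullet> b)\<^sup>2))) \<partial>lborel)"
    proof (rule nn_integral_cong)
      fix x :: 'b
      have "(norm x)\<^sup>2 = (\<Sum>b\<in>Basis. (x \<bullet> b)\<^sup>2)"
        by (simp add: euclidean_inner[of x x] power2_norm_eq_inner flip: power2_eq_square)
      then show "?E x = (\<Prod>b\<in>Basis. ennreal (exp (- (x \<bullet> b)\<^sup>2)))"
        by (simp add: exp_sum sum_negf[symmetric] prod_ennreal)
    qed
    also have "\<dots> = (\<Prod>b\<in>(Basis::'b set). (\<integral>\<^sup>+x. ennreal (exp (- x\<^sup>2)) \<partial>lborel))"
      by (rule nn_integral_lborel_prod) auto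
    finally show ?thesis by (simp add: nn_integral_gauss)
  qed
  have "(\<integral>\<^sup>+c. ?E (?h c) \<partial>?M) = (\<integral>\<^sup>+c. (\<Prod>b\<in>B. ennreal (exp (- (s b * c b)\<^sup>2))) \<partial>?M)"
    by (intro nn_integral_cong) (simp add: onb_norm_sum[OF B] exp_sum sum_negf[symmetric] prod_ennreal B)
  also have "\<dots> = (\<Prod>b\<in>B. ?g b)"
    by (rule product_nn_integral_prod[OF B(1)]) auto
  also have "\<dots> = (\<Prod>b\<in>B. ennreal (1 / s b) * ennreal (sqrt pi))"
  proof (rule prod.cong[OF refl])
    fix b assume b: "b \<in> B"
    have "ennreal (s b) * ?g b = ennreal (sqrt pi)"
      using nn_integral_real_affine[of "\<lambda>x. ennreal (exp (- x\<^sup>2))" "s b" 0] s[OF b] nn_integral_gauss by simp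
    then have "ennreal (1 / s b) * (ennreal (s b) * ?g b) = ennreal (1 / s b) * ennreal (sqrt pi)"
      by simp
    then show "?g b = ennreal (1 / s b) * ennreal (sqrt pi)"
      using s[OF b] by (simp add: mult.assoc[symmetric] ennreal_mult[symmetric])
  qed
  also have "\<dots> = ennreal (\<Prod>b\<in>B. 1 / s b) * ennreal (sqrt pi) ^ DIM('b)"
    using s B by (subst prod_ennreal_mult) (auto simp: onb_card[OF onb] less_imp_le)
  finally have "emeasure lborel ?C * (ennreal (\<Prod>b\<in>B. 1 / s b) * ennreal (sqrt pi) ^ DIM('b)) = (\<integral>\<^sup>+c. indicator ?C (?h c) \<partial>?M) * ennreal (sqrt pi) ^ DIM('b)"
    using main[of ?E] gauss by simp
  then have "emeasure lborel ?C * ennreal (\<Prod>b\<in>B. 1 / s b) = (\<integral>\<^sup>+c. indicator ?C (?h c) \<partial>?M)"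
    using zero_less_power[of "sqrt pi" "DIM('b)", THEN not_le[THEN iffD2]] real_sqrt_gt_zero[OF pi_gt_zero]
    by (auto simp: mult.assoc[symmetric] ennreal_power mult_right_ennreal_cancel)
  with main[OF f] have "emeasure lborel ?C * (\<integral>\<^sup>+c. f (?h c) \<partial>?M) = emeasure lborel ?C * (ennreal (\<Prod>b\<in>B. 1 / s b) * (\<integral>\<^sup>+x. f x \<partial>lborel))"
    by (metis mult.assoc)
  then show ?thesis
    using emeasure_cball_pos_finite[where 'b='b] by (subst (asm) ennreal_mult_cancel_left) (auto simp: less_top)
qed

text \<open>
  For \<open>h\<close> homogeneous of degree zero the image of \<open>h\<close> times Lebesgue measure under the norm has the
  distribution function \<open>r ^ n\<close> times a constant, by scaling; its density gives the radial factor.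
  The unit ball takes the place of the sphere, so that no surface measure has to be introduced.
\<close>

lemma nn_integral_polar:
  fixes h :: "'b::euclidean_space \<Rightarrow> ennreal"
  assumes [measurable]: "h \<in> borel_measurable borel" "\<phi> \<in> borel_measurable borel"
    and hom: "\<And>c x. c > 0 \<Longrightarrow> h (c *\<^sub>R x) = h x"
    and fin: "(\<integral>\<^sup>+x. indicator (cball 0 1) x * h x \<partial>lborel) < \<infinity>"
  shows "(\<integral>\<^sup>+x. \<phi> (norm x) * h x \<partial>lborel) =
     (\<integral>\<^sup>+r. indicator {0..} r * ennreal (real DIM('b) * r ^ (DIM('b) - 1)) * \<phi> r \<partial>lborel) * (\<integral>\<^sup>+x. indicator (cball 0 1) x * h x \<partial>lborel)"
proof -
  define I where "I = (\<integral>\<^sup>+x. indicator (cball 0 1) x * h x \<partial>lborel)"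
  let ?N = "distr (density lborel h) borel (norm :: 'b \<Rightarrow> real)"
  let ?w = "\<lambda>r::real. indicator {0..} r * ennreal (real DIM('b) * r ^ (DIM('b) - 1))"
  let ?R = "density lborel (\<lambda>r. I * ?w r)"
  let ?P = "\<lambda>r. \<integral>\<^sup>+x. ennreal (real DIM('b) * x ^ (DIM('b) - 1)) * indicator {0..r} x \<partial>lborel"
  have N: "emeasure ?N {..r} = ennreal (r ^ DIM('b)) * I" if r: "r > 0" for r
  proof -
    have "emeasure ?N {..r} = (\<integral>\<^sup>+x. indicator (cball 0 r) x * h x \<partial>lborel)"
    proof -
      have "norm -` {..r} = cball (0::'b) r" by auto
      then show ?thesis by (simp add: emeasure_distr emeasure_density mult.commute)
    qed
    also have "(\<integral>\<^sup>+x. indicator (cball 0 r) x * h x \<partial>lborel) = ennreal (r ^ DIM('b)) * (\<integral>\<^sup>+x. indicator (cball 0 r) (r *\<^sub>R x) * h (r *\<^sub>R x) \<partial>lborel)"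
      by (rule nn_integral_lborel_scale) (use r in \<open>auto intro!: borel_measurable_times_ennreal borel_measurable_indicator\<close>)
    also have "(\<integral>\<^sup>+x. indicator (cball 0 r) (r *\<^sub>R x) * h (r *\<^sub>R x) \<partial>lborel) = I"
      unfolding I_def using r by (intro nn_integral_cong) (auto simp: hom indicator_def)
    finally show ?thesis .
  qed
  have N0: "emeasure ?N {..r} = 0" if r: "r \<le> 0" for r
  proof -
    have "emeasure ?N {..r} = (\<integral>\<^sup>+x. indicator {..r} (norm x) * h x \<partial>lborel)"
    proof -
      have "norm -` {..r} = cball (0::'b) r" by auto
      moreover have "(\<integral>\<^sup>+x. indicator {..r} (norm x) * h x \<partial>lborel) = (\<integral>\<^sup>+x. h x * indicator (cball 0 r) x \<partial>lborel)"
        by (intro nn_integral_cong) (auto simp: indicator_def)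
      ultimately show ?thesis by (simp add: emeasure_distr emeasure_density)
    qed
    also have "\<dots> = (\<integral>\<^sup>+x. 0 \<partial>(lborel :: 'b measure))"
      by (intro nn_integral_cong_AE eventually_mono[OF AE_lborel_singleton[of 0]]) (use r in \<open>auto simp: indicator_def dest: order_trans\<close>)
    finally show ?thesis by simp
  qed
  have R: "emeasure ?R {..r} = (if r > 0 then ennreal (r ^ DIM('b)) * I else 0)" for r
  proof -
    have "emeasure ?R {..r} = (\<integral>\<^sup>+x. I * (ennreal (real DIM('b) * x ^ (DIM('b) - 1)) * indicator {0..r} x) \<partial>lborel)"
      by (subst emeasure_density) (auto simp: indicator_def intro!: nn_integral_cong)
    also have "\<dots> = I * ?P r"
      by (rule nn_integral_cmult) auto
    also have "?P r = (if r > 0 then ennreal (r ^ DIM('b)) else 0)"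
    proof (cases "r > 0")
      case True
      have "?P r = r ^ DIM('b) - 0 ^ DIM('b)"
        by (rule nn_integral_FTC_Icc) (use True in \<open>auto intro!: derivative_eq_intros\<close>)
      then show ?thesis using True by (simp add: zero_power)
    next
      case False
      have "?P r = (\<integral>\<^sup>+x. 0 \<partial>(lborel :: real measure))"
        by (intro nn_integral_cong_AE eventually_mono[OF AE_lborel_singleton[of 0]]) (use False in \<open>auto simp: indicator_def\<close>)
      then show ?thesis using False by simp
    qed
    finally show ?thesis by (simp add: mult.commute)
  qed
  have "?N = ?R"
  proof (rule measure_eqI_generator_eq[where E="range (\<lambda>a::real. {..a})" and \<Omega>=UNIV and A="\<lambda>i. {..real i}"])
    show "Int_stable (range (\<lambda>a::real. {..a}))" by (auto simp: Int_stable_def)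
    show "emeasure ?N X = emeasure ?R X" if "X \<in> range (\<lambda>a::real. {..a})" for X
      using that N N0 R by (auto simp: not_less)
    show "sets ?N = sigma_sets UNIV (range (\<lambda>a::real. {..a}))" "sets ?R = sigma_sets UNIV (range (\<lambda>a::real. {..a}))"
      by (simp_all add: borel_eq_atMost)
    show "(\<Union>i. {..real i}) = UNIV" using real_arch_simple by auto
    show "emeasure ?N {..real i} \<noteq> \<infinity>" for i
      using N[of "real i"] N0[of "real i"] fin[folded I_def] by (cases "i = 0") (auto simp: ennreal_mult_eq_top_iff)
  qed auto
  have "(\<integral>\<^sup>+x. \<phi> (norm x) * h x \<partial>lborel) = (\<integral>\<^sup>+r. \<phi> r \<partial>?N)"
    by (simp add: nn_integral_distr nn_integral_density mult.commute)
  also have "\<dots> = (\<integral>\<^sup>+r. \<phi> r \<partial>?R)" by (simp only: \<open>?N = ?R\<close>)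
  also have "\<dots> = (\<integral>\<^sup>+r. I * (?w r * \<phi> r) \<partial>lborel)"
    by (subst nn_integral_density) (auto simp: mult.assoc)
  also have "\<dots> = I * (\<integral>\<^sup>+r. (?w r * \<phi> r) \<partial>lborel)"
    by (rule nn_integral_cmult) auto
  finally show ?thesis by (simp add: I_def mult.commute)
qed

text \<open>
  Every line parallel to \<open>v\<close> meets the slab in a segment of length one. The slab therefore stands in
  for the quotient of the space by the direction \<open>v\<close>: integrating over the slab and along lines counts
  every point once.
\<close>

lemma nn_integral_slab:
  fixes v :: "'b::euclidean_space"
  assumes [measurable]: "f \<in> borel_measurable borel" and v: "norm v = 1"
  shows "(\<integral>\<^sup>+x. indicator {x. \<bar>x \<bullet> v\<bar> \<le> 1/2} x * (\<integral>\<^sup>+s. f (x + s *\<^sub>R v) \<partial>lborel) \<partial>lborel) = (\<integral>\<^sup>+x. f x \<partial>lborel)"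
proof -
  let ?S = "{x. \<bar>x \<bullet> v\<bar> \<le> 1/2}"
  have "(\<integral>\<^sup>+x. indicator ?S x * (\<integral>\<^sup>+s. f (x + s *\<^sub>R v) \<partial>lborel) \<partial>lborel) = (\<integral>\<^sup>+x. \<integral>\<^sup>+s. indicator ?S x * f (x + s *\<^sub>R v) \<partial>lborel \<partial>lborel)"
    by (intro nn_integral_cong) (subst nn_integral_cmult, auto)
  also have "\<dots> = (\<integral>\<^sup>+s. \<integral>\<^sup>+x. indicator ?S x * f (x + s *\<^sub>R v) \<partial>lborel \<partial>lborel)"
    by (rule lborel_pair.Fubini') measurable
  also have "\<dots> = (\<integral>\<^sup>+s. \<integral>\<^sup>+x. indicator {x \<bullet> v - 1/2 .. x \<bullet> v + 1/2} s * f x \<partial>lborel \<partial>lborel)"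
  proof (rule nn_integral_cong)
    fix s
    have "(\<integral>\<^sup>+x. indicator {x \<bullet> v - 1/2 .. x \<bullet> v + 1/2} s * f x \<partial>lborel) = (\<integral>\<^sup>+x. indicator ?S (x - s *\<^sub>R v) * f x \<partial>lborel)"
    proof -
      have "x - s *\<^sub>R v \<in> ?S \<longleftrightarrow> s \<in> {x \<bullet> v - 1/2 .. x \<bullet> v + 1/2}" for x
      proof -
        have *: "(x - s *\<^sub>R v) \<bullet> v = x \<bullet> v - s" using v by (simp add: inner_diff_left norm_eq_1)
        show ?thesis unfolding mem_Collect_eq atLeastAtMost_iff * abs_le_iff by linarith
      qed
      then show ?thesis by (simp only: indicator_def)
    qed
    also have "\<dots> = (\<integral>\<^sup>+x. indicator ?S (x - s *\<^sub>R v) * f x \<partial>distr lborel borel ((+) (s *\<^sub>R v)))"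
      by (simp add: lborel_distr_plus)
    also have "\<dots> = (\<integral>\<^sup>+x. indicator ?S x * f (x + s *\<^sub>R v) \<partial>lborel)"
      by (subst nn_integral_distr) (auto simp: add.commute)
    finally show "(\<integral>\<^sup>+x. indicator ?S x * f (x + s *\<^sub>R v) \<partial>lborel) = (\<integral>\<^sup>+x. indicator {x \<bullet> v - 1/2 .. x \<bullet> v + 1/2} s * f x \<partial>lborel)" ..
  qed
  also have "\<dots> = (\<integral>\<^sup>+x. \<integral>\<^sup>+s. indicator {x \<bullet> v - 1/2 .. x \<bullet> v + 1/2} s * f x \<partial>lborel \<partial>lborel)"
  proof (rule lborel_pair.Fubini'[symmetric])
    have [measurable]: "Measurable.pred borel (\<lambda>x::real \<times> 'b. fst x \<in> {snd x \<bullet> v - 1/2 .. snd x \<bullet> v + 1/2})"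
      unfolding atLeastAtMost_iff by (simp add: borel_prod[symmetric])
    have [measurable]: "(\<lambda>x::real \<times> 'b. f (snd x)) \<in> borel_measurable borel"
      by (simp add: borel_prod[symmetric])
    show "(\<lambda>(x::real, y). indicator {y \<bullet> v - 1/2 .. y \<bullet> v + 1/2} x * f y) \<in> borel_measurable (lborel \<Otimes>\<^sub>M lborel)"
      unfolding measurable_lborel_pair split_beta' by measurable
  qed
  also have "\<dots> = (\<integral>\<^sup>+x. f x \<partial>lborel)"
    by (intro nn_integral_cong) (subst nn_integral_multc, auto)
  finally show ?thesis .
qed

text \<open>
  The Gaussian integral of \<open>\<bar>x \<bullet> e\<bar> ^ m\<close> is computed twice: in polar coordinates it is a value of the Gamma
  function times the wanted integral, and in orthonormal coordinates with first axis \<open>e\<close> it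
  factorizes into one-dimensional integrals.
\<close>

lemma nn_integral_ball_direction_moment:
  fixes e :: "real^'n"
  assumes e: "norm e = 1"
  shows "(\<integral>\<^sup>+x. indicator (cball 0 1) x * ennreal ((\<bar>x \<bullet> e\<bar> / norm x) ^ m) \<partial>lborel) =
    ennreal (2 / real CARD('n) * Gamma ((real m + 1) / 2) * sqrt pi ^ (CARD('n) - 1) / Gamma ((real CARD('n) + real m) / 2))"
proof -
  let ?G = "\<integral>\<^sup>+(x::real^'n). ennreal (norm x ^ m * exp (- (norm x)\<^sup>2)) * ennreal ((\<bar>x \<bullet> e\<bar> / norm x) ^ m) \<partial>lborel"
  let ?n = "CARD('n)"
  obtain B where B: "e \<in> B" "pairwise orthogonal B" "\<And>x. x \<in> B \<Longrightarrow> norm x = 1" "independent B" "card B = CARD('n)" "span B = UNIV"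
    using vector_in_orthonormal_basis[OF e] by (auto simp: DIM_cart)
  have fB: "finite B" using B(4) by (simp add: independent_imp_finite)
  have onb: "onb B" using B fB by (simp add: onb_def)
  interpret product_sigma_finite "\<lambda>i::real^'n. lborel :: real measure" ..
  define I where "I = (\<integral>\<^sup>+(x::real^'n). indicator (cball 0 1) x * ennreal ((\<bar>x \<bullet> e\<bar> / norm x) ^ m) \<partial>lborel)"
  have le1: "(\<bar>x \<bullet> e\<bar> / norm x) ^ m \<le> 1" for x
    using Cauchy_Schwarz_ineq2[of x e] e by (intro power_le_one) (auto simp: divide_le_eq_1)
  have Ifin: "I < \<infinity>"
  proof -
    have "I \<le> (\<integral>\<^sup>+(x::real^'n). indicator (cball 0 1) x \<partial>lborel)"
      unfolding I_def using le1 by (intro nn_integral_mono) (auto simp: indicator_def)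
    also have "\<dots> < \<infinity>" using emeasure_cball_pos_finite(2) by simp
    finally show ?thesis .
  qed
  have "?G =
     (\<integral>\<^sup>+r. indicator {0..} r * ennreal (real DIM(real^'n) * r ^ (DIM(real^'n) - 1)) * ennreal (r ^ m * exp (- r\<^sup>2)) \<partial>lborel) * I"
    unfolding I_def
  proof (rule nn_integral_polar)
    show "(\<integral>\<^sup>+(x::real^'n). indicator (cball 0 1) x * ennreal ((\<bar>x \<bullet> e\<bar> / norm x) ^ m) \<partial>lborel) < \<infinity>"
      using Ifin by (simp add: I_def)
  qed (auto simp: abs_mult)
  also have "(\<integral>\<^sup>+r. indicator {0..} r * ennreal (real DIM(real^'n) * r ^ (DIM(real^'n) - 1)) * ennreal (r ^ m * exp (- r\<^sup>2)) \<partial>lborel)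
    = (\<integral>\<^sup>+r. ennreal (real ?n) * ennreal (indicator {0..} r * (\<bar>r\<bar> ^ (?n - 1 + m) * exp (- r\<^sup>2))) \<partial>lborel)"
  proof (intro nn_integral_cong)
    fix r :: real
    have "r ^ (DIM(real^'n) - 1) * r ^ m = r ^ (?n - 1 + m)" by (simp only: power_add DIM_cart DIM_real mult_1_right)
    then show "indicator {0..} r * ennreal (real DIM(real^'n) * r ^ (DIM(real^'n) - 1)) * ennreal (r ^ m * exp (- r\<^sup>2))
      = ennreal (real ?n) * ennreal (indicator {0..} r * (\<bar>r\<bar> ^ (?n - 1 + m) * exp (- r\<^sup>2)))"
      by (auto simp: indicator_def ennreal_mult[symmetric] mult.assoc simp del: One_nat_def)
        (metis (no_types, opaque_lifting) mult.assoc)?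
  qed
  also have "\<dots> = ennreal (real ?n) * ennreal (Gamma ((real (?n - 1 + m) + 1) / 2) / 2)"
    by (subst nn_integral_cmult) (simp_all add: nn_integral_gauss_half_moment)
  also have "(real (?n - 1 + m) + 1) / 2 = (real ?n + real m) / 2"
    using zero_less_card_finite[where 'a='n] by (simp add: of_nat_diff Suc_le_eq)
  finally have 1: "?G =
     ennreal (real ?n) * ennreal (Gamma ((real ?n + real m) / 2) / 2) * I" .
  have "?G
     = (\<integral>\<^sup>+(x::real^'n). ennreal (\<bar>x \<bullet> e\<bar> ^ m * exp (- (norm x)\<^sup>2)) \<partial>lborel)"
  proof (rule nn_integral_cong)
    fix x :: "real^'n"
    have "norm x ^ m * (\<bar>x \<bullet> e\<bar> / norm x) ^ m = \<bar>x \<bullet> e\<bar> ^ m"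
      by (cases "x = 0") (auto simp: power_mult_distrib[symmetric])
    then show "ennreal (norm x ^ m * exp (- (norm x)\<^sup>2)) * ennreal ((\<bar>x \<bullet> e\<bar> / norm x) ^ m) = ennreal (\<bar>x \<bullet> e\<bar> ^ m * exp (- (norm x)\<^sup>2))"
      by (simp add: ennreal_mult[symmetric] mult_ac)
  qed
  also have "\<dots> = (\<integral>\<^sup>+c. ennreal (\<bar>(\<Sum>b\<in>B. (1 * c b) *\<^sub>R b) \<bullet> e\<bar> ^ m * exp (- (norm (\<Sum>b\<in>B. (1 * c b) *\<^sub>R b))\<^sup>2)) \<partial>(\<Pi>\<^sub>M b\<in>B. lborel))"
    by (subst nn_integral_orthonormal_coordinates[OF onb, of "\<lambda>_. 1" "\<lambda>x. ennreal (\<bar>x \<bullet> e\<bar> ^ m * exp (- (norm x)\<^sup>2))"]) auto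
  also have "\<dots> = (\<integral>\<^sup>+c. (\<Prod>b\<in>B. ennreal (\<bar>c b\<bar> ^ (if b = e then m else 0) * exp (- (c b)\<^sup>2))) \<partial>(\<Pi>\<^sub>M b\<in>B. lborel))"
  proof (rule nn_integral_cong)
    fix c :: "real^'n \<Rightarrow> real"
    have "(\<Prod>b\<in>B. \<bar>c b\<bar> ^ (if b = e then m else 0) * exp (- (c b)\<^sup>2)) = \<bar>c e\<bar> ^ m * (\<Prod>b\<in>B. exp (- (c b)\<^sup>2))"
      using B(1) fB by (simp add: prod.distrib if_distrib[of "\<lambda>k. _ ^ k"] prod.delta cong: if_cong)
    then show "ennreal (\<bar>(\<Sum>b\<in>B. (1 * c b) *\<^sub>R b) \<bullet> e\<bar> ^ m * exp (- (norm (\<Sum>b\<in>B. (1 * c b) *\<^sub>R b))\<^sup>2)) = (\<Prod>b\<in>B. ennreal (\<bar>c b\<bar> ^ (if b = e then m else 0) * exp (- (c b)\<^sup>2)))"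
      using B fB by (simp add: onb_inner_sum onb_norm_sum prod_ennreal exp_sum sum_negf[symmetric])
  qed
  also have "\<dots> = (\<Prod>b\<in>B. (\<integral>\<^sup>+x. ennreal (\<bar>x\<bar> ^ (if b = e then m else 0) * exp (- x\<^sup>2)) \<partial>lborel))"
    by (rule product_nn_integral_prod[OF fB]) auto
  also have "\<dots> = (\<Prod>b\<in>B. if b = e then ennreal (Gamma ((real m + 1) / 2)) else ennreal (sqrt pi))"
    by (intro prod.cong) (auto simp: nn_integral_gauss_abs_moment nn_integral_gauss Gamma_one_half_real)
  also have "\<dots> = ennreal (Gamma ((real m + 1) / 2)) * ennreal (sqrt pi) ^ (?n - 1)"
  proof -
    have "B = insert e (B - {e})" "card (B - {e}) = ?n - 1" using B fB by auto
    then show ?thesis using fB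
      by (subst \<open>B = insert e (B - {e})\<close>) (subst prod.insert, auto)
  qed
  finally have "ennreal (real ?n) * ennreal (Gamma ((real ?n + real m) / 2) / 2) * I = ennreal (Gamma ((real m + 1) / 2)) * ennreal (sqrt pi) ^ (?n - 1)"
    using 1 by simp
  moreover obtain i where i: "I = ennreal i" "i \<ge> 0" using Ifin by (cases I) auto
  moreover have "Gamma ((real ?n + real m) / 2) > 0" "Gamma ((real m + 1) / 2) > 0"
    by (auto intro!: Gamma_real_pos simp: add_pos_nonneg)
  ultimately have "real ?n * (Gamma ((real ?n + real m) / 2) / 2) * i = Gamma ((real m + 1) / 2) * sqrt pi ^ (?n - 1)"
    by (simp add: ennreal_mult[symmetric] ennreal_power)
  then have "i = 2 / real ?n * Gamma ((real m + 1) / 2) * sqrt pi ^ (?n - 1) / Gamma ((real ?n + real m) / 2)"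
    using \<open>Gamma ((real ?n + real m) / 2) > 0\<close> by (simp add: field_simps)
  then show ?thesis using i(1) by (simp add: I_def)
qed

lemma nn_integral_scale_coordinates:
  fixes B :: "'b::euclidean_space set" and a :: 'b
  assumes onb: "onb B" and s: "\<And>b. b \<in> B \<Longrightarrow> 0 < s b" and F[measurable]: "(F :: 'b \<Rightarrow> ennreal) \<in> borel_measurable borel"
  shows "(\<integral>\<^sup>+x. F (a + (\<Sum>b\<in>B. (s b * ((x - a) \<bullet> b)) *\<^sub>R b)) \<partial>lborel) = ennreal (\<Prod>b\<in>B. 1 / s b) * (\<integral>\<^sup>+x. F x \<partial>lborel)"
proof -
  have B: "finite B" "pairwise orthogonal B" "\<forall>b\<in>B. norm b = 1" using onb by (auto simp: onb_def)
  have tr: "(\<integral>\<^sup>+x. G (a + x) \<partial>lborel) = (\<integral>\<^sup>+x. G x \<partial>lborel)" if [measurable]: "G \<in> borel_measurable borel" for G :: "'b \<Rightarrow> ennreal"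
    by (subst (2) lborel_distr_plus[of a, symmetric]) (simp add: nn_integral_distr)
  have "(\<integral>\<^sup>+x. F (a + (\<Sum>b\<in>B. (s b * ((x - a) \<bullet> b)) *\<^sub>R b)) \<partial>lborel) = (\<integral>\<^sup>+x. F (a + (\<Sum>b\<in>B. (s b * (x \<bullet> b)) *\<^sub>R b)) \<partial>lborel)"
    by (subst tr[symmetric]) auto
  also have "\<dots> = (\<integral>\<^sup>+c. F (a + (\<Sum>b\<in>B. (s b * ((\<Sum>b\<in>B. (1 * c b) *\<^sub>R b) \<bullet> b)) *\<^sub>R b)) \<partial>(\<Pi>\<^sub>M b\<in>B. lborel))"
    by (subst nn_integral_orthonormal_coordinates[OF onb, of "\<lambda>_. 1"]) auto
  also have "\<dots> = (\<integral>\<^sup>+c. F (a + (\<Sum>b\<in>B. (s b * c b) *\<^sub>R b)) \<partial>(\<Pi>\<^sub>M b\<in>B. lborel))"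
    by (intro nn_integral_cong arg_cong[where f=F] arg_cong2[where f="(+)"] sum.cong refl) (simp add: onb_inner_sum[OF B])
  also have "\<dots> = ennreal (\<Prod>b\<in>B. 1 / s b) * (\<integral>\<^sup>+x. F (a + x) \<partial>lborel)"
    by (rule nn_integral_orthonormal_coordinates[OF onb s, where f="\<lambda>x. F (a + x)"]) auto
  finally show ?thesis by (simp add: tr)
qed

lemma onb_subspace_extension:
  assumes V: "subspace (V :: 'b::euclidean_space set)"
  obtains B1 B2 where "onb (B1 \<union> B2)" "B1 \<inter> B2 = {}" "span B1 = V" "span B2 = V\<^sup>\<bottom>" "B1 \<subseteq> V" "B2 \<subseteq> V\<^sup>\<bottom>"
    "card B1 = dim V"
proof -
  obtain B1 where B1: "B1 \<subseteq> V" "pairwise orthogonal B1" "\<And>x. x \<in> B1 \<Longrightarrow> norm x = 1" "independent B1" "card B1 = dim V" "span B1 = V"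
    using orthonormal_basis_subspace[OF V] by metis
  obtain B2 where B2: "B2 \<subseteq> V\<^sup>\<bottom>" "pairwise orthogonal B2" "\<And>x. x \<in> B2 \<Longrightarrow> norm x = 1" "independent B2" "span B2 = V\<^sup>\<bottom>"
    using orthonormal_basis_subspace[OF subspace_orthogonal_comp[of V]] by metis
  have fin: "finite B1" "finite B2" using B1 B2 by (auto simp: independent_imp_finite)
  have orth: "orthogonal x y" if "x \<in> B1" "y \<in> B2" for x y
    using that B1(1) B2(1) by (auto simp: orthogonal_comp_def)
  have "pairwise orthogonal (B1 \<union> B2)"
    using B1(2) B2(2) orth by (auto simp: pairwise_def) (metis orthogonal_commute)
  moreover have "span (B1 \<union> B2) = UNIV"
    using subspace_sum_orthogonal_comp[OF V] B1(6) B2(5) by (simp add: span_Un set_plus_def set_eq_iff) blast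
  moreover have "B1 \<inter> B2 = {}"
  proof -
    have False if "x \<in> B1" "x \<in> B2" for x
      using orth[OF that] B1(3)[OF that(1)] by (auto simp: orthogonal_def norm_eq_1)
    then show ?thesis by blast
  qed
  moreover have "\<forall>b\<in>B1 \<union> B2. norm b = 1" using B1(3) B2(3) by blast
  ultimately have "onb (B1 \<union> B2)" using fin by (simp add: onb_def)
  then show ?thesis using that[of B1 B2] B1 B2 \<open>B1 \<inter> B2 = {}\<close> by blast
qed


section \<open>Metric projection and parallel shells\<close>

definition shell :: "(real^'n) set \<Rightarrow> real \<Rightarrow> (real^'n) set" where
  "shell K eps = {x. 0 < infdist x K \<and> infdist x K \<le> eps}"

definition foot_normal :: "(real^'n) set \<Rightarrow> real^'n \<Rightarrow> (real^'n) \<times> (real^'n)" where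
  "foot_normal K x = (closest_point K x, outer_normal K x)"

definition shell_integral :: "(real^'n) set \<Rightarrow> ((real^'n) \<times> (real^'n) \<Rightarrow> ennreal) \<Rightarrow> real \<Rightarrow> ennreal" where
  "shell_integral K f eps = (\<integral>\<^sup>+x. indicator (shell K eps) x * f (foot_normal K x) \<partial>lborel)"

context
  fixes K :: "(real^'n) set"
  assumes K: "convex_body K"
begin

lemma bodyD: "K \<noteq> {}" "compact K" "convex K" "closed K" "bounded K"
  using K by (auto simp: convex_body_def compact_imp_closed compact_imp_bounded)

lemma infdist_closest: "infdist x K = norm (x - closest_point K x)"
  using setdist_closest_point[OF bodyD(4,1)] by (simp add: infdist_eq_setdist dist_norm)

lemma closest_in: "closest_point K x \<in> K"
  using bodyD closest_point_in_set by blast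

lemma borel_measurable_closest_point[measurable]: "closest_point K \<in> borel_measurable borel"
  by (intro borel_measurable_continuous_onI continuous_on_closest_point bodyD)

lemma borel_measurable_infdist_body[measurable]: "(\<lambda>x. infdist x K) \<in> borel_measurable borel"
  by (intro borel_measurable_continuous_onI continuous_intros)

lemma borel_measurable_outer_normal[measurable]: "outer_normal K \<in> borel_measurable borel"
  unfolding outer_normal_def[abs_def] by measurable

lemma borel_measurable_foot_normal[measurable]: "foot_normal K \<in> borel_measurable borel"
  unfolding foot_normal_def[abs_def] by (simp add: borel_prod[symmetric])

lemma borel_shell[measurable]: "shell K eps \<in> sets borel"
  unfolding shell_def by measurable

lemma closest_point_iff: "closest_point K x = p \<longleftrightarrow> p \<in> K \<and> (\<forall>z\<in>K. (x - p) \<bullet> (z - p) \<le> 0)"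
proof
  assume "closest_point K x = p"
  then show "p \<in> K \<and> (\<forall>z\<in>K. (x - p) \<bullet> (z - p) \<le> 0)"
    using closest_in closest_point_dot[OF bodyD(3,4)] by blast
next
  assume p: "p \<in> K \<and> (\<forall>z\<in>K. (x - p) \<bullet> (z - p) \<le> 0)"
  have "dist x p \<le> dist x z" if "z \<in> K" for z
  proof -
    have "(norm (x - z))\<^sup>2 = (norm (x - p))\<^sup>2 - 2 * ((x - p) \<bullet> (z - p)) + (norm (z - p))\<^sup>2"
      using dot_norm_neg[of "x - p" "z - p"] by simp
    moreover have "(x - p) \<bullet> (z - p) \<le> 0" using p that by blast
    ultimately have "(norm (x - p))\<^sup>2 \<le> (norm (x - z))\<^sup>2"
      using zero_le_power2[of "norm (z - p)"] by linarith
    then show ?thesis by (simp add: dist_norm abs_le_square_iff[symmetric])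
  qed
  then show "closest_point K x = p"
    using closest_point_unique[OF bodyD(3,4), of p x] p by auto
qed

lemma closest_point_obtuse:
  assumes "z \<in> K" shows "(norm (x - z))\<^sup>2 \<ge> (infdist x K)\<^sup>2 + (norm (z - closest_point K x))\<^sup>2"
proof -
  let ?p = "closest_point K x"
  have "(norm (x - z))\<^sup>2 = (norm (x - ?p))\<^sup>2 - 2 * ((x - ?p) \<bullet> (z - ?p)) + (norm (z - ?p))\<^sup>2"
    using dot_norm_neg[of "x - ?p" "z - ?p"] by simp
  moreover have "(x - ?p) \<bullet> (z - ?p) \<le> 0" using assms by (intro closest_point_dot bodyD)
  ultimately show ?thesis by (simp add: infdist_closest)
qed

lemma infdist_pos_iff: "0 < infdist x K \<longleftrightarrow> x \<notin> K"
  using in_closed_iff_infdist_zero[OF bodyD(4,1), of x] infdist_nonneg[of x K] by auto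

lemma norm_outer_normal: "x \<notin> K \<Longrightarrow> norm (outer_normal K x) = 1"
  using infdist_pos_iff[of x] by (auto simp: infdist_closest outer_normal_def)

lemma foot_normal_sphere: "x \<notin> K \<Longrightarrow> foot_normal K x \<in> UNIV \<times> sphere 0 1"
  by (simp add: foot_normal_def norm_outer_normal)

lemma local_parallel_set_eq: "local_parallel_set K eps \<eta> = {x \<in> shell K eps. foot_normal K x \<in> \<eta>}"
proof -
  have "x \<in> {a + b | a b. a \<in> K \<and> b \<in> cball 0 eps} \<longleftrightarrow> infdist x K \<le> eps" for x
  proof
    assume "x \<in> {a + b | a b. a \<in> K \<and> b \<in> cball 0 eps}"
    then obtain a b where "a \<in> K" "norm b \<le> eps" "x = a + b" by auto
    then show "infdist x K \<le> eps" using infdist_le[of a K x] by (simp add: dist_norm)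
  next
    assume "infdist x K \<le> eps"
    then have "x = closest_point K x + (x - closest_point K x)" "x - closest_point K x \<in> cball 0 eps"
      by (auto simp: infdist_closest)
    then show "x \<in> {a + b | a b. a \<in> K \<and> b \<in> cball 0 eps}" using closest_in by blast
  qed
  then show ?thesis
    unfolding local_parallel_set_def shell_def foot_normal_def using infdist_pos_iff by auto
qed

lemma shell_subset_cball:
  assumes "K \<subseteq> cball 0 R" shows "shell K eps \<subseteq> cball 0 (R + eps)"
proof
  fix x assume "x \<in> shell K eps"
  then have "norm (x - closest_point K x) \<le> eps" by (simp add: shell_def infdist_closest)
  moreover have "norm (closest_point K x) \<le> R" using closest_in[of x] assms by auto
  ultimately show "x \<in> cball 0 (R + eps)" using norm_triangle_sub[of x "closest_point K x"] by simp
qed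

lemma emeasure_shell_finite: "emeasure lborel (shell K eps) < \<infinity>"
proof -
  obtain R where "K \<subseteq> cball 0 R" using bodyD(5) unfolding bounded_iff subset_iff mem_cball_0 by blast
  then have "bounded (shell K eps)" by (rule bounded_subset[OF bounded_cball shell_subset_cball])
  then show ?thesis using emeasure_bounded_finite by blast
qed

text \<open>
  Points on the ray from a foot point through \<open>x\<close> have the same foot point and the same normal. This is
  what makes parallel shells scale.
\<close>

lemma foot_normal_ray:
  assumes t: "t > 0" and y_def: "y = closest_point K x + t *\<^sub>R (x - closest_point K x)"
  shows "closest_point K y = closest_point K x" "infdist y K = t * infdist x K" "outer_normal K y = outer_normal K x"
proof -
  show 1: "closest_point K y = closest_point K x"
  proof -
    let ?p = "closest_point K x"
    have dot: "(x - ?p) \<bullet> (z - ?p) \<le> 0" if "z \<in> K" for z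
      using that by (intro closest_point_dot bodyD)
    have "(y - ?p) \<bullet> (z - ?p) \<le> 0" if "z \<in> K" for z
      
    proof -
      have "y - ?p = t *\<^sub>R (x - ?p)" by (simp add: y_def)
      then show ?thesis using dot[OF that] t by (simp add: mult_nonneg_nonpos)
    qed
    then show ?thesis using closest_in[of x] by (intro closest_point_iff[THEN iffD2] conjI ballI)
  qed
  have 2: "y - closest_point K y = t *\<^sub>R (x - closest_point K x)" unfolding 1 by (simp add: y_def)
  show "infdist y K = t * infdist x K" using t unfolding infdist_closest 2 by simp
  show "outer_normal K y = outer_normal K x" using t unfolding outer_normal_def 2 by simp
qed

end


section \<open>The local Steiner formula for polytopes\<close>

text \<open>
  There is no constant term, because the shell shrinks to the empty set. The signs of the coefficients are part
  of the notion: they give the bounds needed for compactness, and the coefficients are to become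
  masses.
\<close>

definition steiner_polynomial :: "(real^'n) set \<Rightarrow> ((real^'n) \<times> (real^'n) \<Rightarrow> ennreal) \<Rightarrow> (nat \<Rightarrow> real) \<Rightarrow> bool" where
  "steiner_polynomial K f a \<longleftrightarrow> (\<forall>k. 0 \<le> a k) \<and>
     (\<forall>eps>0. shell_integral K f eps = ennreal (\<Sum>k=1..CARD('n). a k * eps ^ k))"

lemma convex_body_hull:
  assumes "finite W" "W \<noteq> {}" shows "convex_body (convex hull W :: (real^'n) set)"
  using assms by (auto simp: convex_body_def finite_imp_compact_convex_hull)

text \<open>
  For \<open>x\<close> outside of \<open>K\<close> these are the points of \<open>W\<close> on the supporting hyperplane of \<open>K\<close> at the foot
  point of \<open>x\<close>; the active set stands in for the face that carries the foot point.
\<close>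

definition active :: "(real^'n) set \<Rightarrow> (real^'n) set \<Rightarrow> real^'n \<Rightarrow> (real^'n) set" where
  "active W K x = {w \<in> W. (x - closest_point K x) \<bullet> (w - closest_point K x) = 0}"

text \<open>
  All points of \<open>W\<close> lie on one side of the supporting hyperplane, so in a convex combination
  representing the foot point the points off the hyperplane have weight zero.
\<close>

lemma closest_point_in_active_hull:
  assumes W: "finite W" "W \<noteq> {}"
  defines "K \<equiv> convex hull W"
  shows "closest_point K x \<in> convex hull (active W K x)"
proof -
  let ?p = "closest_point K x"
  have K: "convex_body K" unfolding K_def by (rule convex_body_hull[OF W])
  have "?p \<in> convex hull W" using closest_in[OF K] by (simp add: K_def)
  then obtain u where u: "\<And>w. w \<in> W \<Longrightarrow> 0 \<le> u w" "sum u W = 1" "(\<Sum>w\<in>W. u w *\<^sub>R w) = ?p"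
    using W(1) by (auto simp: convex_hull_finite)
  have le: "(x - ?p) \<bullet> (w - ?p) \<le> 0" if "w \<in> W" for w
    using closest_point_iff[OF K, of x ?p] that by (auto simp: K_def hull_inc)
  have "(\<Sum>w\<in>W. u w * ((x - ?p) \<bullet> (w - ?p))) = (x - ?p) \<bullet> (\<Sum>w\<in>W. u w *\<^sub>R (w - ?p))"
    by (simp add: inner_sum_right)
  also have "(\<Sum>w\<in>W. u w *\<^sub>R (w - ?p)) = 0"
    using u by (simp add: scaleR_diff_right sum_subtractf scaleR_sum_left[symmetric])
  finally have "(\<Sum>w\<in>W. - (u w * ((x - ?p) \<bullet> (w - ?p)))) = 0" by (simp add: sum_negf)
  then have z: "u w * ((x - ?p) \<bullet> (w - ?p)) = 0" if "w \<in> W" for w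
    using sum_nonneg_eq_0_iff[of W "\<lambda>w. - (u w * ((x - ?p) \<bullet> (w - ?p)))"] W(1) that u(1) le
    by (auto simp: mult_nonneg_nonpos)
  let ?A = "active W K x"
  have A: "?A \<subseteq> W" "finite ?A" using W by (auto simp: active_def)
  have u0: "u w = 0" if "w \<in> W - ?A" for w using z[of w] that by (auto simp: active_def)
  have "sum u ?A = 1" "(\<Sum>w\<in>?A. u w *\<^sub>R w) = ?p"
    using u u0 A W sum.mono_neutral_left[of W ?A u] sum.mono_neutral_left[of W ?A "\<lambda>w. u w *\<^sub>R w"] by auto
  then show ?thesis using u(1) A by (auto simp: convex_hull_finite intro!: exI[of _ u])
qed

lemma borel_active:
  assumes W: "finite W" "W \<noteq> {}"
  shows "{x. active W (convex hull W) x = A} \<in> sets borel"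
proof -
  note [measurable] = borel_measurable_closest_point[OF convex_body_hull[OF W]]
  let ?p = "closest_point (convex hull W)"
  have "{x. active W (convex hull W) x = A} = {x. A \<subseteq> W \<and> (\<forall>w\<in>W. (w \<in> A) = ((x - ?p x) \<bullet> (w - ?p x) = 0))}"
    by (auto simp: active_def)
  also have "\<dots> \<in> sets borel" using countable_finite[OF W(1)] by measurable
  finally show ?thesis .
qed

text \<open>
  On the cell of points with active set \<open>A\<close> the metric projection is the orthogonal projection onto the
  affine hull of \<open>A\<close>. Stretching by \<open>t\<close> orthogonally to this hull keeps the foot point and the normal
  and multiplies the distance by \<open>t\<close>, so it maps the cell in the shell of width one onto the cell in
  the shell of width \<open>t\<close>. Its determinant is \<open>t ^ k\<close>, where \<open>k\<close> is the codimension of the hull.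
\<close>

lemma steiner_polytope_cell:
  fixes W :: "(real^'n) set"
  assumes W: "finite W" "W \<noteq> {}" and f[measurable]: "f \<in> borel_measurable borel"
  defines "K \<equiv> convex hull W"
  shows "\<exists>k\<in>{1..CARD('n)}. \<forall>t>0.
    (\<integral>\<^sup>+x. indicator (shell K t \<inter> {x. active W K x = A}) x * f (foot_normal K x) \<partial>lborel) =
    ennreal (t ^ k) * (\<integral>\<^sup>+x. indicator (shell K 1 \<inter> {x. active W K x = A}) x * f (foot_normal K x) \<partial>lborel)"
proof (cases "\<exists>x. x \<notin> K \<and> active W K x = A")
  case False
  have K: "convex_body K" unfolding K_def by (rule convex_body_hull[OF W])
  have e: "shell K t \<inter> {x. active W K x = A} = {}" for t using False by (auto simp: shell_def infdist_pos_iff[OF K])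
  show ?thesis using zero_less_card_finite[where 'a='n] by (intro bexI[of _ 1]) (auto simp: e)
next
  case True
  then obtain x0 where x0: "x0 \<notin> K" "active W K x0 = A" by blast
  have K: "convex_body K" unfolding K_def by (rule convex_body_hull[OF W])
  note [measurable] = borel_measurable_closest_point[OF K] borel_measurable_foot_normal[OF K] borel_shell[OF K]
  let ?p = "closest_point K"
  have "A \<noteq> {}" using closest_point_in_active_hull[OF W, of x0] x0 by (auto simp: K_def)
  then obtain a where a: "a \<in> A" by blast
  \<comment> \<open>the direction space of the affine hull of the active set\<close>
  define V where "V = span ((\<lambda>w. w - a) ` A)"
  have V: "subspace V" by (simp add: V_def)
  obtain B1 B2 where B: "onb (B1 \<union> B2)" "B1 \<inter> B2 = {}" "span B1 = V" "span B2 = V\<^sup>\<bottom>" "B1 \<subseteq> V" "B2 \<subseteq> V\<^sup>\<bottom>" "card B1 = dim V"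
    using onb_subspace_extension[OF V] by metis
  have fin: "finite B1" "finite B2" using B(1) by (auto simp: onb_def)
  have pV: "?p x - a \<in> V" if "active W K x = A" for x
  proof -
    have "?p x \<in> convex hull A" using closest_point_in_active_hull[OF W, of x] that by (simp add: K_def)
    then have "?p x \<in> affine hull A" using convex_hull_subset_affine_hull by blast
    then show ?thesis using affine_hull_span2[OF a] by (auto simp: V_def intro: span_mono[THEN subsetD, rotated])
  qed
  have perp: "x - ?p x \<in> V\<^sup>\<bottom>" if "active W K x = A" for x
  proof -
    have *: "(x - ?p x) \<bullet> (w - a) = 0" if "w \<in> A" for w
    proof -
      have "(x - ?p x) \<bullet> (w - ?p x) = 0" "(x - ?p x) \<bullet> (a - ?p x) = 0"
        using that a \<open>active W K x = A\<close> by (auto simp: active_def)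
      then show ?thesis by (simp add: inner_diff_right)
    qed
    have "orthogonal (x - ?p x) y" if "y \<in> V" for y
      using that unfolding V_def
      by (rule orthogonal_to_span) (use * in \<open>auto simp: orthogonal_def\<close>)
    then show ?thesis by (auto simp: orthogonal_comp_def orthogonal_commute)
  qed
  have "x0 - ?p x0 \<noteq> 0" using x0(1) closest_in[OF K, of x0] by auto
  then have B2ne: "B2 \<noteq> {}" using perp[OF x0(2)] unfolding B(4)[symmetric] by auto
  have k: "card B2 \<in> {1..CARD('n)}"
    using B2ne fin card_mono[of "B1 \<union> B2" B2] onb_card[OF B(1)] by (auto simp: Suc_le_eq card_gt_0_iff)
  let ?c = "\<lambda>t b. if b \<in> B2 then t else 1 :: real"
  \<comment> \<open>stretching by \<open>t\<close> orthogonally to the affine hull of \<open>A\<close>\<close>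
  let ?T = "\<lambda>t x. a + (\<Sum>b\<in>B1 \<union> B2. (?c t b * ((x - a) \<bullet> b)) *\<^sub>R b)"
  have T: "?T t x = ?p x + t *\<^sub>R (x - ?p x)" if A: "active W K x = A" for t x
  proof -
    have 1: "(?p x - a) \<bullet> b = 0" if "b \<in> B2" for b
      using B(6) pV[OF A] that by (auto simp: orthogonal_comp_def orthogonal_def)
    have 2: "(x - ?p x) \<bullet> b = 0" if "b \<in> B1" for b
      using B(5) perp[OF A] that by (auto simp: orthogonal_comp_def orthogonal_def inner_commute)
    have "(\<Sum>b\<in>B1 \<union> B2. (?c t b * ((x - a) \<bullet> b)) *\<^sub>R b) =
      (\<Sum>b\<in>B1 \<union> B2. ((?p x - a) \<bullet> b) *\<^sub>R b + t *\<^sub>R (((x - ?p x) \<bullet> b) *\<^sub>R b))"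
    proof (rule sum.cong[OF refl])
      fix b assume "b \<in> B1 \<union> B2"
      then consider "b \<in> B2" | "b \<in> B1" "b \<notin> B2" by blast
      then show "(?c t b * ((x - a) \<bullet> b)) *\<^sub>R b = ((?p x - a) \<bullet> b) *\<^sub>R b + t *\<^sub>R (((x - ?p x) \<bullet> b) *\<^sub>R b)"
      proof cases
        case 1 then show ?thesis using \<open>\<And>b. b \<in> B2 \<Longrightarrow> (?p x - a) \<bullet> b = 0\<close>[of b] by (simp add: inner_diff_left)
      next
        case 2 then show ?thesis using \<open>\<And>b. b \<in> B1 \<Longrightarrow> (x - ?p x) \<bullet> b = 0\<close>[of b] by (simp add: inner_diff_left)
      qed
    qed
    also have "\<dots> = (?p x - a) + t *\<^sub>R (x - ?p x)"
      by (simp only: sum.distrib scaleR_sum_right[symmetric] onb_expand[OF B(1)])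
    finally show ?thesis by simp
  qed
  have Ta: "active W K (?T t x) = A" if A: "active W K x = A" and t: "t > 0" for t x
  proof -
    have "(?T t x) - ?p (?T t x) = t *\<^sub>R (x - ?p x)" "?p (?T t x) = ?p x"
      using T[OF A, of t] foot_normal_ray[OF K t, of "?T t x" x] by simp_all
    then show ?thesis using t A by (simp add: active_def)
  qed
  have Tinv: "?T (1/t) (?T t x) = x" if t: "t > 0" for t x
  proof -
    have i: "(\<Sum>b\<in>B1 \<union> B2. (?c t b * ((x - a) \<bullet> b)) *\<^sub>R b) \<bullet> b = ?c t b * ((x - a) \<bullet> b)" if "b \<in> B1 \<union> B2" for b
      using onb_inner_sum[of "B1 \<union> B2" b "\<lambda>b. ?c t b * ((x - a) \<bullet> b)"] B(1) that by (simp add: onb_def)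
    have "?T (1/t) (?T t x) = a + (\<Sum>b\<in>B1 \<union> B2. ((x - a) \<bullet> b) *\<^sub>R b)"
    proof (intro arg_cong2[where f="(+)"] sum.cong refl)
      fix b assume "b \<in> B1 \<union> B2"
      from i[OF this] show "(?c (1/t) b * ((?T t x - a) \<bullet> b)) *\<^sub>R b = ((x - a) \<bullet> b) *\<^sub>R b"
        using t by simp
    qed
    then show ?thesis by (simp add: onb_expand[OF B(1)])
  qed
  note act[measurable] = borel_active[OF W, folded K_def, of A]
  show ?thesis
  proof (rule bexI[OF _ k], intro allI impI)
    fix t :: real assume t: "t > 0"
    let ?G = "\<lambda>t x. indicator (shell K t \<inter> {x. active W K x = A}) x * f (foot_normal K x)"
    have G: "?G t (?T t x) = ?G 1 x" for x
    proof (cases "active W K x = A")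
      case True
      have "closest_point K (?T t x) = ?p x" "infdist (?T t x) K = t * infdist x K" "outer_normal K (?T t x) = outer_normal K x"
        using foot_normal_ray[OF K t, of "?T t x" x] T[OF True] by auto
      then show ?thesis using t Ta[OF True t] True zero_less_mult_iff[of t "infdist x K"]
        by (auto simp: shell_def foot_normal_def indicator_def)
    next
      case False
      then have "active W K (?T t x) \<noteq> A" using Ta[of "?T t x" "1/t"] Tinv[OF t, of x] t by auto
      then show ?thesis using False by simp
    qed
    have "(\<integral>\<^sup>+x. ?G 1 x \<partial>lborel) = (\<integral>\<^sup>+x. ?G t (?T t x) \<partial>lborel)" by (simp only: G)
    also have "\<dots> = ennreal (\<Prod>b\<in>B1 \<union> B2. 1 / ?c t b) * (\<integral>\<^sup>+x. ?G t x \<partial>lborel)"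
      by (rule nn_integral_scale_coordinates[OF B(1)]) (use t in auto)
    also have "(\<Prod>b\<in>B1 \<union> B2. 1 / ?c t b) = (1 / t) ^ card B2"
      using fin B(2) by (subst prod.union_disjoint) (auto simp: disjoint_iff intro!: prod.neutral)
    finally have "ennreal (t ^ card B2) * (\<integral>\<^sup>+x. ?G 1 x \<partial>lborel) = ennreal (t ^ card B2) * (ennreal ((1/t) ^ card B2) * (\<integral>\<^sup>+x. ?G t x \<partial>lborel))"
      by simp
    also have "\<dots> = (\<integral>\<^sup>+x. ?G t x \<partial>lborel)"
      using t by (simp add: mult.assoc[symmetric] ennreal_mult[symmetric] power_mult_distrib[symmetric])
    finally show "(\<integral>\<^sup>+x. ?G t x \<partial>lborel) = ennreal (t ^ card B2) * (\<integral>\<^sup>+x. ?G 1 x \<partial>lborel)" ..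
  qed
qed

lemma shell_integral_le:
  assumes K: "convex_body K" and f: "\<And>z. f z \<le> ennreal C"
  shows "shell_integral K f eps \<le> ennreal C * emeasure lborel (shell K eps)"
proof -
  note [measurable] = borel_shell[OF K]
  have "shell_integral K f eps \<le> (\<integral>\<^sup>+x. ennreal C * indicator (shell K eps) x \<partial>lborel)"
    unfolding shell_integral_def by (intro nn_integral_mono) (auto simp: indicator_def f)
  also have "\<dots> = ennreal C * emeasure lborel (shell K eps)" by (rule nn_integral_cmult_indicator) simp
  finally show ?thesis .
qed

text \<open>
  There are finitely many cells, one for each possible active set; collecting them by codimension
  gives the coefficients.
\<close>

lemma steiner_polytope:
  fixes W :: "(real^'n) set"
  assumes W: "finite W" "W \<noteq> {}" and f[measurable]: "f \<in> borel_measurable borel" and fC: "\<And>z. f z \<le> ennreal C"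
  shows "\<exists>a. steiner_polynomial (convex hull W) f a"
proof -
  let ?K = "convex hull W"
  let ?n = "CARD('n)"
  have K: "convex_body ?K" by (rule convex_body_hull[OF W])
  note [measurable] = borel_measurable_closest_point[OF K] borel_measurable_foot_normal[OF K] borel_shell[OF K]
  define I where "I A t = (\<integral>\<^sup>+x. indicator (shell ?K t \<inter> {x. active W ?K x = A}) x * f (foot_normal ?K x) \<partial>lborel)" for A t
  have "\<forall>A. \<exists>k. k \<in> {1..?n} \<and> (\<forall>t>0. I A t = ennreal (t ^ k) * I A 1)"
    using steiner_polytope_cell[OF W f] unfolding I_def Bex_def by blast
  then obtain d where d: "\<And>A. d A \<in> {1..?n}" "\<And>A t. t > 0 \<Longrightarrow> I A t = ennreal (t ^ d A) * I A 1" by metis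
  note act[measurable] = borel_active[OF W]
  have S: "shell_integral ?K f t = (\<Sum>A\<in>Pow W. I A t)" for t
  proof -
    have "(\<Sum>A\<in>Pow W. indicator (shell ?K t \<inter> {x. active W ?K x = A}) x * f (foot_normal ?K x)) = indicator (shell ?K t) x * f (foot_normal ?K x)" for x
    proof -
      have "(\<Sum>A\<in>Pow W. indicator (shell ?K t \<inter> {x. active W ?K x = A}) x * f (foot_normal ?K x))
        = (\<Sum>A\<in>Pow W. if A = active W ?K x then indicator (shell ?K t) x * f (foot_normal ?K x) else 0)"
        by (intro sum.cong) (auto simp: indicator_def)
      also have "\<dots> = indicator (shell ?K t) x * f (foot_normal ?K x)"
        using W(1) by (subst sum.delta) (auto simp: active_def)
      finally show ?thesis .
    qed
    then show ?thesis unfolding shell_integral_def I_def by (subst nn_integral_sum[symmetric]) auto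
  qed
  have fin: "I A t < \<infinity>" if "A \<in> Pow W" for A t
  proof -
    have "I A t \<le> shell_integral ?K f t" unfolding S using that W(1) by (intro member_le_sum) auto
    also have "\<dots> \<le> ennreal C * emeasure lborel (shell ?K t)" by (rule shell_integral_le[OF K fC])
    also have "\<dots> < \<infinity>" using emeasure_shell_finite[OF K, of t] by (auto simp: ennreal_mult_less_top)
    finally show ?thesis .
  qed
  define a where "a k = (\<Sum>A | A \<in> Pow W \<and> d A = k. enn2real (I A 1))" for k
  have "shell_integral ?K f t = ennreal (\<Sum>k=1..?n. a k * t ^ k)" if t: "t > 0" for t
  proof -
    have "shell_integral ?K f t = (\<Sum>A\<in>Pow W. ennreal (t ^ d A * enn2real (I A 1)))"
      unfolding S using fin t by (intro sum.cong) (auto simp: d(2)[OF t] ennreal_mult)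
    also have "\<dots> = ennreal (\<Sum>A\<in>Pow W. t ^ d A * enn2real (I A 1))"
      using t by (intro sum_ennreal) auto
    also have "(\<Sum>A\<in>Pow W. t ^ d A * enn2real (I A 1)) = (\<Sum>k=1..?n. \<Sum>A | A \<in> Pow W \<and> d A = k. t ^ d A * enn2real (I A 1))"
      using d(1) W(1) by (intro sum.group[symmetric]) auto
    also have "\<dots> = (\<Sum>k=1..?n. a k * t ^ k)"
      unfolding a_def sum_distrib_right by (intro sum.cong refl) (auto simp: mult.commute)
    finally show ?thesis .
  qed
  moreover have "0 \<le> a k" for k by (simp add: a_def sum_nonneg)
  ultimately show ?thesis unfolding steiner_polynomial_def by blast
qed


section \<open>The local Steiner formula for convex bodies\<close>

lemma bounded_coefficients_subsequence:
  fixes a :: "nat \<Rightarrow> nat \<Rightarrow> real"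
  assumes "\<And>i k. k \<le> n \<Longrightarrow> \<bar>a i k\<bar> \<le> C"
  shows "\<exists>r l. strict_mono r \<and> (\<forall>k\<le>n. (\<lambda>i. a (r i) k) \<longlonglongrightarrow> l k)"
  using assms
proof (induction n)
  case 0
  have "bounded (range (\<lambda>i. a i 0))" using 0 by (auto simp: bounded_iff)
  then obtain l r where "strict_mono r" "((\<lambda>i. a i 0) \<circ> r) \<longlonglongrightarrow> l" using bounded_imp_convergent_subsequence by blast
  then show ?case by (intro exI[of _ r] exI[of _ "\<lambda>_. l"]) (auto simp: o_def)
next
  case (Suc n)
  then obtain r l where r: "strict_mono r" "\<And>k. k \<le> n \<Longrightarrow> (\<lambda>i. a (r i) k) \<longlonglongrightarrow> l k" by (metis le_SucI)
  have "bounded (range (\<lambda>i. a (r i) (Suc n)))" using Suc.prems by (auto simp: bounded_iff)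
  then obtain m r' where r': "strict_mono r'" "((\<lambda>i. a (r i) (Suc n)) \<circ> r') \<longlonglongrightarrow> m" using bounded_imp_convergent_subsequence by blast
  have "(\<lambda>i. a ((r \<circ> r') i) k) \<longlonglongrightarrow> (l(Suc n := m)) k" if "k \<le> Suc n" for k
  proof (cases "k = Suc n")
    case True then show ?thesis using r' by (simp add: o_def)
  next
    case False
    then have "(\<lambda>i. a (r i) k) \<longlonglongrightarrow> l k" using r that by auto
    from LIMSEQ_subseq_LIMSEQ[OF this r'(1)] show ?thesis using False by (simp add: o_def)
  qed
  then show ?case using strict_mono_o[OF r(1) r'(1)] by blast
qed

lemma steiner_polynomial_coefficient_le:
  fixes K :: "(real^'n) set"
  assumes "steiner_polynomial K f a" "shell_integral K f 1 \<le> ennreal C" "0 \<le> C" "k \<in> {1..CARD('n)}"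
  shows "\<bar>a k\<bar> \<le> C"
proof -
  have nn: "0 \<le> a k" for k using assms by (simp add: steiner_polynomial_def)
  have "ennreal (\<Sum>k=1..CARD('n). a k * 1 ^ k) \<le> ennreal C"
    using assms(1,2) unfolding steiner_polynomial_def by (metis zero_less_one)
  then have "(\<Sum>k=1..CARD('n). a k) \<le> C" using assms(3) by (simp add: ennreal_le_iff)
  moreover have "a k \<le> (\<Sum>k=1..CARD('n). a k)" using assms(4) nn by (intro member_le_sum) auto
  ultimately show ?thesis using nn by simp
qed

text \<open>
  Nonnegative coefficients are bounded by the value of the polynomial at one, so Bolzano-Weierstrass
  applies to them.
\<close>

lemma steiner_polynomials_subsequence:
  fixes K :: "nat \<Rightarrow> (real^'n) set"
  assumes "\<And>i. steiner_polynomial (K i) (f i) (a i)" "\<And>i. shell_integral (K i) (f i) 1 \<le> ennreal C" "0 \<le> C"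
  obtains r l where "strict_mono (r :: nat \<Rightarrow> nat)" "\<And>k. 0 \<le> l k"
    "\<And>eps. (\<lambda>i. \<Sum>k=1..CARD('n). a (r i) k * eps ^ k) \<longlonglongrightarrow> (\<Sum>k=1..CARD('n). l k * eps ^ k)"
proof -
  let ?b = "\<lambda>i k. if k \<in> {1..CARD('n)} then a i k else 0"
  have "\<bar>?b i k\<bar> \<le> C" for i k
    using steiner_polynomial_coefficient_le[OF assms, of k i] assms(3) by auto
  then obtain r l where r: "strict_mono r" "\<And>k. k \<le> CARD('n) \<Longrightarrow> (\<lambda>i. ?b (r i) k) \<longlonglongrightarrow> l k"
    using bounded_coefficients_subsequence[of "CARD('n)" ?b C] by blast
  have l: "(\<lambda>i. a (r i) k) \<longlonglongrightarrow> l k" if "k \<in> {1..CARD('n)}" for k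
    using r(2)[of k] that by simp
  have nn: "0 \<le> a i k" for i k using assms(1) by (auto simp: steiner_polynomial_def)
  have "0 \<le> l k" if "k \<in> {1..CARD('n)}" for k
    using l[OF that] nn by (intro LIMSEQ_le_const[OF l[OF that]]) auto
  then have "0 \<le> max 0 (l k)" "k \<in> {1..CARD('n)} \<Longrightarrow> max 0 (l k) = l k" for k by auto
  moreover have "(\<lambda>i. \<Sum>k=1..CARD('n). a (r i) k * eps ^ k) \<longlonglongrightarrow> (\<Sum>k=1..CARD('n). max 0 (l k) * eps ^ k)" for eps
    using calculation(2) l by (intro tendsto_sum tendsto_mult tendsto_const) auto
  ultimately show ?thesis using that[of r "\<lambda>k. max 0 (l k)"] r(1) by blast
qed

text \<open>
  Passing to the limit in the coefficients along a subsequence shows that limits of shell integrals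
  are again polynomials; this upgrades classes of functions in the following lemmas.
\<close>

lemma steiner_polynomial_limit:
  fixes K :: "(real^'n) set"
  assumes P: "\<And>i. \<exists>a. steiner_polynomial K (f i) a" and le: "\<And>i. shell_integral K (f i) 1 \<le> ennreal C" and C: "0 \<le> C"
    and lim: "\<And>eps. eps > 0 \<Longrightarrow> (\<lambda>i. shell_integral K (f i) eps) \<longlonglongrightarrow> shell_integral K g eps"
  shows "\<exists>a. steiner_polynomial K g a"
proof -
  obtain a where a: "\<And>i. steiner_polynomial K (f i) (a i)" using P by metis
  obtain r l where r: "strict_mono (r :: nat \<Rightarrow> nat)" "\<And>k. 0 \<le> l k"
    "\<And>eps. (\<lambda>i. \<Sum>k=1..CARD('n). a (r i) k * eps ^ k) \<longlonglongrightarrow> (\<Sum>k=1..CARD('n). l k * eps ^ k)"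
    by (rule steiner_polynomials_subsequence[of "\<lambda>_. K" f a, OF a le C]) (rule that)
  have "shell_integral K g eps = ennreal (\<Sum>k=1..CARD('n). l k * eps ^ k)" if e: "eps > 0" for eps
  proof (rule LIMSEQ_unique)
    show "(\<lambda>i. shell_integral K (f (r i)) eps) \<longlonglongrightarrow> shell_integral K g eps"
      using LIMSEQ_subseq_LIMSEQ[OF lim[OF e] r(1)] by (simp add: o_def)
    have "shell_integral K (f (r i)) eps = ennreal (\<Sum>k=1..CARD('n). a (r i) k * eps ^ k)" for i
      using a e by (auto simp: steiner_polynomial_def)
    then show "(\<lambda>i. shell_integral K (f (r i)) eps) \<longlonglongrightarrow> ennreal (\<Sum>k=1..CARD('n). l k * eps ^ k)"
      using tendsto_ennrealI[OF r(3)[of eps]] by simp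
  qed
  then show ?thesis using r(2) unfolding steiner_polynomial_def by blast
qed

text \<open>
  Convex hulls of finite nets of the compact set \<open>K\<close>.
\<close>

lemma inner_polytopes:
  assumes K: "convex_body (K :: (real^'n) set)"
  obtains W where "\<And>i. finite (W i)" "\<And>i. W i \<noteq> {}" "\<And>i. convex hull (W i) \<subseteq> K"
    "\<And>i x. infdist x (convex hull (W i)) \<le> infdist x K + 1 / real (Suc i)"
proof -
  have "\<exists>W. finite W \<and> W \<noteq> {} \<and> convex hull W \<subseteq> K \<and> (\<forall>x. infdist x (convex hull W) \<le> infdist x K + 1 / real (Suc i))" for i
  proof -
    obtain W where W: "finite W" "W \<subseteq> K" "K \<subseteq> (\<Union>x\<in>W. ball x (1 / real (Suc i)))"
      using seq_compact_imp_totally_bounded[OF compact_imp_seq_compact[OF bodyD(2)[OF K]]] by (metis of_nat_0_less_iff zero_less_Suc zero_less_divide_1_iff)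
    have ne: "W \<noteq> {}" using W(3) bodyD(1)[OF K] by auto
    have "infdist x (convex hull W) \<le> infdist x K + 1 / real (Suc i)" for x
    proof -
      obtain w where w: "w \<in> W" "dist w (closest_point K x) < 1 / real (Suc i)"
        using W(3) closest_in[OF K, of x] by auto
      have "infdist x (convex hull W) \<le> dist x w" using w(1) by (intro infdist_le) (simp add: hull_inc)
      also have "\<dots> \<le> dist x (closest_point K x) + dist w (closest_point K x)" by (rule dist_triangle2)
      finally show ?thesis using w(2) by (simp add: infdist_closest[OF K] dist_norm)
    qed
    moreover have "convex hull W \<subseteq> K" using W(2) bodyD(3)[OF K] by (simp add: hull_minimal)
    ultimately show ?thesis using W(1) ne by blast
  qed
  then have "\<exists>W. \<forall>i. finite (W i) \<and> W i \<noteq> {} \<and> convex hull (W i) \<subseteq> K \<and>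
      (\<forall>x. infdist x (convex hull (W i)) \<le> infdist x K + 1 / real (Suc i))"
    by (intro choice allI)
  then obtain W where "\<forall>i. finite (W i) \<and> W i \<noteq> {} \<and> convex hull (W i) \<subseteq> K \<and>
      (\<forall>x. infdist x (convex hull (W i)) \<le> infdist x K + 1 / real (Suc i))" ..
  then show ?thesis by (intro that[of W]) simp_all
qed

lemma closest_point_inner_limit:
  fixes K :: "(real^'n) set"
  assumes K: "convex_body K" and L: "\<And>i. convex_body (L i)" "\<And>i. L i \<subseteq> K"
    and d: "\<And>i x. infdist x (L i) \<le> infdist x K + 1 / real (Suc i)"
  shows "(\<lambda>i. infdist x (L i)) \<longlonglongrightarrow> infdist x K" "(\<lambda>i. closest_point (L i) x) \<longlonglongrightarrow> closest_point K x"
proof -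
  have lo: "infdist x K \<le> infdist x (L i)" for i
    using infdist_le[of "closest_point (L i) x" K x] L(2) closest_in[OF L(1), of i x]
    by (auto simp: infdist_closest[OF L(1)] dist_norm)
  have up: "(\<lambda>i. infdist x K + 1 / real (Suc i)) \<longlonglongrightarrow> infdist x K + 0"
    by (intro tendsto_add tendsto_const LIMSEQ_Suc lim_1_over_n)
  show 1: "(\<lambda>i. infdist x (L i)) \<longlonglongrightarrow> infdist x K"
    by (rule tendsto_sandwich[OF always_eventually always_eventually tendsto_const up[unfolded add_0_right]])
      (use lo d in blast)+
  have "(\<lambda>i. (infdist x (L i))\<^sup>2 - (infdist x K)\<^sup>2) \<longlonglongrightarrow> (infdist x K)\<^sup>2 - (infdist x K)\<^sup>2"
    by (intro tendsto_diff tendsto_power 1 tendsto_const)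
  then have "(\<lambda>i. sqrt ((infdist x (L i))\<^sup>2 - (infdist x K)\<^sup>2)) \<longlonglongrightarrow> sqrt ((infdist x K)\<^sup>2 - (infdist x K)\<^sup>2)"
    by (rule tendsto_real_sqrt)
  then have sq: "(\<lambda>i. sqrt ((infdist x (L i))\<^sup>2 - (infdist x K)\<^sup>2)) \<longlonglongrightarrow> 0"
    by simp
  have le: "norm (closest_point (L i) x - closest_point K x) \<le> sqrt ((infdist x (L i))\<^sup>2 - (infdist x K)\<^sup>2)" for i
  proof (rule real_le_rsqrt)
    have "closest_point (L i) x \<in> K" using L(2) closest_in[OF L(1), of i x] by blast
    from closest_point_obtuse[OF K this, of x]
    show "(norm (closest_point (L i) x - closest_point K x))\<^sup>2 \<le> (infdist x (L i))\<^sup>2 - (infdist x K)\<^sup>2"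
      by (simp add: infdist_closest[OF L(1)])
  qed
  have "(\<lambda>i. norm (closest_point (L i) x - closest_point K x)) \<longlonglongrightarrow> 0"
    by (rule tendsto_sandwich[OF always_eventually always_eventually tendsto_const sq]) (simp_all only: le norm_ge_zero simp_thms)
  then have "(\<lambda>i. closest_point (L i) x - closest_point K x) \<longlonglongrightarrow> 0"
    by (rule tendsto_norm_zero_cancel)
  then show "(\<lambda>i. closest_point (L i) x) \<longlonglongrightarrow> closest_point K x"
    by (rule LIM_zero_cancel)
qed

text \<open>
  The points at distance \<open>eps\<close> lie on the frontier of the parallel body, which is convex. This makes the
  indicators of distance shells converge almost everywhere.
\<close>

lemma AE_infdist_neq:
  assumes K: "convex_body (K :: (real^'n) set)" and e: "eps > 0"
  shows "AE x in lborel. infdist x K \<noteq> eps"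
proof -
  let ?S = "{x. infdist x K \<le> eps}"
  have S: "?S = (\<Union>x\<in>K. \<Union>y\<in>cball 0 eps. {x + y})"
  proof -
    have "x \<in> ?S \<longleftrightarrow> (\<exists>a\<in>K. \<exists>b\<in>cball 0 eps. x = a + b)" for x
    proof
      assume "x \<in> ?S"
      then have "x = closest_point K x + (x - closest_point K x)" "x - closest_point K x \<in> cball 0 eps"
        by (auto simp: infdist_closest[OF K])
      then show "\<exists>a\<in>K. \<exists>b\<in>cball 0 eps. x = a + b" using closest_in[OF K] by blast
    next
      assume "\<exists>a\<in>K. \<exists>b\<in>cball 0 eps. x = a + b"
      then obtain a b where "a \<in> K" "norm b \<le> eps" "x = a + b" by auto
      then show "x \<in> ?S" using infdist_le[of a K x] by (simp add: dist_norm)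
    qed
    then show ?thesis by auto
  qed
  have "convex ?S" unfolding S by (rule convex_sums[OF bodyD(3)[OF K] convex_cball])
  then have "negligible (frontier ?S)" by (rule negligible_convex_frontier)
  then have "frontier ?S \<in> null_sets lebesgue" by (simp add: negligible_iff_null_sets)
  then have n: "frontier ?S \<in> null_sets lborel"
    using null_sets_completion_iff[of "frontier ?S" lborel] by auto
  have sub: "{x. infdist x K = eps} \<subseteq> frontier ?S"
  proof
    fix x assume x: "x \<in> {x. infdist x K = eps}"
    let ?p = "closest_point K x"
    have "x \<notin> interior ?S"
    proof
      assume "x \<in> interior ?S"
      then obtain \<delta> where \<delta>: "\<delta> > 0" "ball x \<delta> \<subseteq> ?S" by (auto simp: mem_interior)
      define s where "s = 1 + \<delta> / (2 * eps)"
      have s: "s > 1" using \<delta> e by (simp add: s_def)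
      have nx: "norm (x - ?p) = eps" using x by (simp add: infdist_closest[OF K])
      have "?p + s *\<^sub>R (x - ?p) - x = (\<delta> / (2 * eps)) *\<^sub>R (x - ?p)" by (simp add: s_def algebra_simps)
      then have "norm (?p + s *\<^sub>R (x - ?p) - x) = \<delta> / 2" using nx e \<delta> by simp
      then have "?p + s *\<^sub>R (x - ?p) \<in> ball x \<delta>" using \<delta> by (simp add: dist_norm norm_minus_commute)
      moreover have "infdist (?p + s *\<^sub>R (x - ?p)) K = s * infdist x K"
        using s by (intro foot_normal_ray[OF K]) auto
      ultimately have "s * eps \<le> eps" using \<delta>(2) x by auto
      then show False using s e by simp
    qed
    then show "x \<in> frontier ?S" using x closure_subset[of ?S] by (auto simp: frontier_def)
  qed
  show ?thesis by (rule AE_I'[OF n]) (use sub in auto)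
qed


text \<open>
  Rings stay away from \<open>K\<close>. This matters for inner approximations \<open>L\<close> of \<open>K\<close>: points of \<open>K\<close> that are
  outside of \<open>L\<close> may lie in shells of \<open>L\<close>, and their normals need not converge.
\<close>

definition ring_integral :: "(real^'n) set \<Rightarrow> ((real^'n) \<times> (real^'n) \<Rightarrow> ennreal) \<Rightarrow> real \<Rightarrow> real \<Rightarrow> ennreal" where
  "ring_integral K f \<delta> eps = (\<integral>\<^sup>+x. indicator {x. \<delta> < infdist x K \<and> infdist x K \<le> eps} x * f (foot_normal K x) \<partial>lborel)"

lemma borel_ring: "{x. \<delta> < infdist x K \<and> infdist x K \<le> eps} \<in> sets borel"
proof -
  have [measurable]: "(\<lambda>x. infdist x K) \<in> borel_measurable borel"
    by (intro borel_measurable_continuous_onI continuous_intros)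
  show ?thesis by measurable
qed

lemma borel_measurable_ring_integrand:
  assumes K: "convex_body K" and f: "f \<in> borel_measurable borel"
  shows "(\<lambda>x. indicator {x. \<delta> < infdist x K \<and> infdist x K \<le> eps} x * (f (foot_normal K x) :: ennreal)) \<in> borel_measurable lborel"
proof -
  have "(\<lambda>x. f (foot_normal K x)) \<in> borel_measurable borel"
    by (rule measurable_compose[OF borel_measurable_foot_normal[OF K] f])
  moreover have "(indicator {x. \<delta> < infdist x K \<and> infdist x K \<le> eps} :: _ \<Rightarrow> ennreal) \<in> borel_measurable borel"
    by (rule borel_measurable_indicator[OF borel_ring])
  ultimately show ?thesis unfolding measurable_lborel2 by (intro borel_measurable_times_ennreal)
qed

lemma borel_measurable_shell_integrand:
  assumes K: "convex_body K" and f: "f \<in> borel_measurable borel"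
  shows "(\<lambda>x. indicator (shell K eps) x * (f (foot_normal K x) :: ennreal)) \<in> borel_measurable lborel"
  using borel_measurable_ring_integrand[OF assms, of 0 eps] by (simp only: shell_def)

lemma ring_integral_eq:
  fixes K :: "(real^'n) set"
  assumes K: "convex_body K" and [measurable]: "f \<in> borel_measurable borel"
    and P: "steiner_polynomial K f a" and d: "0 < \<delta>" "\<delta> \<le> eps"
  shows "ring_integral K f \<delta> eps = ennreal ((\<Sum>k=1..CARD('n). a k * eps ^ k) - (\<Sum>k=1..CARD('n). a k * \<delta> ^ k))"
proof -
  note [measurable] = borel_measurable_foot_normal[OF K] borel_shell[OF K] borel_ring[of _ K]
  let ?q = "\<lambda>eps. \<Sum>k=1..CARD('n). a k * eps ^ k"
  have q: "?q t \<ge> 0" if "t > 0" for t using P that by (auto simp: steiner_polynomial_def intro!: sum_nonneg)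
  have S: "shell_integral K f t = ennreal (?q t)" if "t > 0" for t using P that by (auto simp: steiner_polynomial_def)
  have "shell_integral K f eps = ring_integral K f \<delta> eps + shell_integral K f \<delta>"
    unfolding shell_integral_def ring_integral_def
  proof (subst nn_integral_add[symmetric])
    show "(\<integral>\<^sup>+x. indicator (shell K eps) x * f (foot_normal K x) \<partial>lborel) =
      (\<integral>\<^sup>+x. indicator {x. \<delta> < infdist x K \<and> infdist x K \<le> eps} x * f (foot_normal K x) + indicator (shell K \<delta>) x * f (foot_normal K x) \<partial>lborel)"
      using d by (intro nn_integral_cong) (auto simp: shell_def indicator_def)
  qed measurable
  then have "ring_integral K f \<delta> eps = ennreal (?q eps) - ennreal (?q \<delta>)"
    using d by (simp add: S)
  then show ?thesis using q[of \<delta>] d by (simp add: ennreal_minus)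
qed

lemma foot_normal_inner_limit:
  fixes K :: "(real^'n) set"
  assumes K: "convex_body K" and L: "\<And>i. convex_body (L i)" "\<And>i. L i \<subseteq> K"
    and d: "\<And>i x. infdist x (L i) \<le> infdist x K + 1 / real (Suc i)" and x: "x \<notin> K"
  shows "(\<lambda>i. foot_normal (L i) x) \<longlonglongrightarrow> foot_normal K x"
proof -
  note c = closest_point_inner_limit(2)[OF K L d, of x]
  have "norm (x - closest_point K x) \<noteq> 0" using infdist_pos_iff[OF K, of x] x infdist_closest[OF K, of x] by simp
  then show ?thesis unfolding foot_normal_def outer_normal_def by (intro tendsto_intros c)
qed

lemma bounded_cball_superset: assumes "convex_body K" obtains R where "R \<ge> 0" "K \<subseteq> cball 0 R"
  using bodyD(5)[OF assms] unfolding bounded_iff subset_iff mem_cball_0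
  by (meson bodyD(1)[OF assms] ex_in_conv norm_ge_zero order_trans)

text \<open>
  For continuous functions the ring integrals of inner polytopes converge to those of \<open>K\<close> by dominated
  convergence, while their Steiner polynomials converge along a subsequence. Letting the inner radius
  of the ring tend to zero recovers the shell.
\<close>

lemma steiner_continuous:
  fixes K :: "(real^'n) set" and g :: "(real^'n) \<times> (real^'n) \<Rightarrow> real"
  assumes K: "convex_body K" and g: "continuous_on UNIV g" and g0: "\<And>z. 0 \<le> g z" and gC: "\<And>z. g z \<le> C"
  shows "\<exists>a. steiner_polynomial K (\<lambda>z. ennreal (g z)) a"
proof -
  let ?f = "\<lambda>z. ennreal (g z)"
  let ?r = "\<lambda>\<delta> eps L x. indicator {x. \<delta> < infdist x L \<and> infdist x L \<le> eps} x * ennreal (g (foot_normal L x))"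
  have C: "0 \<le> C" using g0 gC order_trans by blast
  have fC: "?f z \<le> ennreal C" for z using gC by (simp add: ennreal_leI)
  have [measurable]: "g \<in> borel_measurable borel" using g by (rule borel_measurable_continuous_onI)
  then have gm: "?f \<in> borel_measurable borel" by measurable
  obtain W where W: "\<And>i. finite (W i)" "\<And>i. W i \<noteq> {}" "\<And>i. convex hull (W i) \<subseteq> K"
    "\<And>i x. infdist x (convex hull (W i)) \<le> infdist x K + 1 / real (Suc i)"
    by (rule inner_polytopes[OF K]) (rule that)
  define L where "L i = convex hull (W i)" for i
  have L: "convex_body (L i)" "L i \<subseteq> K" for i
    by (simp_all add: L_def W(3) convex_body_hull[OF W(1,2)])
  have Ld: "\<And>i x. infdist x (L i) \<le> infdist x K + 1 / real (Suc i)" using W(4) by (simp add: L_def)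
  have "\<exists>a. steiner_polynomial (L i) ?f a" for i
    unfolding L_def by (rule steiner_polytope[OF W(1,2) _ fC]) measurable
  then obtain a where a: "\<And>i. steiner_polynomial (L i) ?f (a i)" by metis
  obtain R where R: "R \<ge> 0" "K \<subseteq> cball 0 R" using bounded_cball_superset[OF K] by blast
  note [measurable] = borel_measurable_foot_normal[OF K] borel_shell[OF K] borel_ring
    borel_measurable_foot_normal[OF L(1)] borel_shell[OF L(1)]
  have fin: "emeasure lborel (cball (0::real^'n) r) < \<infinity>" for r
    using emeasure_bounded_finite[OF bounded_cball] by blast
  have le: "shell_integral (L i) ?f 1 \<le> ennreal (C * measure lborel (cball (0::real^'n) (R + 1)))" for i
  proof -
    have "shell_integral (L i) ?f 1 \<le> ennreal C * emeasure lborel (shell (L i) 1)" by (rule shell_integral_le[OF L(1) fC])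
    also have "\<dots> \<le> ennreal C * emeasure lborel (cball (0::real^'n) (R + 1))"
      using shell_subset_cball[OF L(1), of i R 1] L(2) R by (intro mult_left_mono emeasure_mono) auto
    also have "\<dots> = ennreal (C * measure lborel (cball (0::real^'n) (R + 1)))"
      using fin[of "R + 1"] C by (simp add: emeasure_eq_ennreal_measure ennreal_mult less_top)
    finally show ?thesis .
  qed
  obtain r l where r: "strict_mono (r :: nat \<Rightarrow> nat)" "\<And>k. 0 \<le> l k"
    "\<And>eps. (\<lambda>i. \<Sum>k=1..CARD('n). a (r i) k * eps ^ k) \<longlonglongrightarrow> (\<Sum>k=1..CARD('n). l k * eps ^ k)"
    by (rule steiner_polynomials_subsequence[of L "\<lambda>_. ?f" a, OF a le]) (use C in simp, rule that)
  let ?q = "\<lambda>eps. \<Sum>k=1..CARD('n). l k * eps ^ k"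
  have ring: "ring_integral K ?f \<delta> eps = ennreal (?q eps - ?q \<delta>)" if d: "0 < \<delta>" "\<delta> < eps" for \<delta> eps
  proof (rule LIMSEQ_unique)
    have "(\<lambda>i. ring_integral (L i) ?f \<delta> eps) \<longlonglongrightarrow> ring_integral K ?f \<delta> eps"
      unfolding ring_integral_def
    proof (rule nn_integral_dominated_convergence[where w="\<lambda>x. ennreal C * indicator (cball 0 (R + eps)) x"])
      show "(\<integral>\<^sup>+x. ennreal C * indicator (cball (0::real^'n) (R + eps)) x \<partial>lborel) < \<infinity>"
        using fin[of "R + eps"] by (simp add: nn_integral_cmult_indicator ennreal_mult_less_top)
      show "AE x in lborel. ?r \<delta> eps (L i) x \<le> ennreal C * indicator (cball 0 (R + eps)) x" for i
      proof (rule AE_I2)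
        fix x :: "real^'n"
        have "x \<in> cball 0 (R + eps)" if "\<delta> < infdist x (L i)" "infdist x (L i) \<le> eps"
        proof -
          have "x \<in> shell (L i) eps" using that d by (simp add: shell_def)
          moreover have "L i \<subseteq> cball 0 R" using L(2) R(2) by blast
          ultimately show ?thesis using shell_subset_cball[OF L(1)] by blast
        qed
        then show "?r \<delta> eps (L i) x \<le> ennreal C * indicator (cball 0 (R + eps)) x"
          using fC[of "foot_normal (L i) x"] by (auto simp: indicator_def)
      qed
      have "AE x in lborel. infdist x K \<noteq> \<delta> \<and> infdist x K \<noteq> eps"
        using AE_infdist_neq[OF K, of \<delta>] AE_infdist_neq[OF K, of eps] d by auto
      then show "AE x in lborel. (\<lambda>i. ?r \<delta> eps (L i) x) \<longlonglongrightarrow>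
          ?r \<delta> eps K x"
      proof (rule AE_mp, intro AE_I2 impI)
        fix x assume x: "infdist x K \<noteq> \<delta> \<and> infdist x K \<noteq> eps"
        note dl = closest_point_inner_limit(1)[OF K L Ld, of x]
        show "(\<lambda>i. ?r \<delta> eps (L i) x) \<longlonglongrightarrow>
          ?r \<delta> eps K x"
        proof (cases "\<delta> < infdist x K \<and> infdist x K < eps")
          case True
          then have "\<forall>\<^sub>F i in sequentially. \<delta> < infdist x (L i) \<and> infdist x (L i) < eps"
            using order_tendstoD[OF dl] by (auto intro: eventually_conj)
          then have ev: "\<forall>\<^sub>F i in sequentially. ennreal (g (foot_normal (L i) x)) = ?r \<delta> eps (L i) x"
            by (rule eventually_mono) auto
          have "x \<notin> K" using True d infdist_pos_iff[OF K, of x] by auto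
          have "isCont g (foot_normal K x)" using g continuous_on_eq_continuous_at[OF open_UNIV] by blast
          from isCont_tendsto_compose[OF this foot_normal_inner_limit[OF K L Ld \<open>x \<notin> K\<close>]]
          have "(\<lambda>i. ennreal (g (foot_normal (L i) x))) \<longlonglongrightarrow> ennreal (g (foot_normal K x))"
            by (rule tendsto_ennrealI)
          from Lim_transform_eventually[OF this ev] show ?thesis using True by simp
        next
          case False
          then have "infdist x K < \<delta> \<or> eps < infdist x K" using x by auto
          then have "\<forall>\<^sub>F i in sequentially. infdist x (L i) < \<delta> \<or> eps < infdist x (L i)"
            using order_tendstoD(2)[OF dl, of \<delta>] order_tendstoD(1)[OF dl, of eps] by (auto elim!: eventually_mono)
          then have ev: "\<forall>\<^sub>F i in sequentially. 0 = ?r \<delta> eps (L i) x"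
            by (rule eventually_mono) auto
          from Lim_transform_eventually[OF tendsto_const this] show ?thesis using False x by auto
        qed
      qed
    qed (intro borel_measurable_ring_integrand K L gm, intro borel_measurable_ring_integrand K L gm,
        simp only: measurable_lborel2, intro borel_measurable_times_ennreal borel_measurable_const borel_measurable_indicator, simp)
    then show "(\<lambda>i. ring_integral (L (r i)) ?f \<delta> eps) \<longlonglongrightarrow> ring_integral K ?f \<delta> eps"
      using LIMSEQ_subseq_LIMSEQ[OF _ r(1)] by (auto simp: o_def)
    have "ring_integral (L (r i)) ?f \<delta> eps = ennreal ((\<Sum>k=1..CARD('n). a (r i) k * eps ^ k) - (\<Sum>k=1..CARD('n). a (r i) k * \<delta> ^ k))" for i
      by (rule ring_integral_eq[OF L(1) _ a]) (use d in auto)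
    then show "(\<lambda>i. ring_integral (L (r i)) ?f \<delta> eps) \<longlonglongrightarrow> ennreal (?q eps - ?q \<delta>)"
      by (simp only:) (intro tendsto_ennrealI tendsto_diff r(3))
  qed
  have "shell_integral K ?f eps = ennreal (?q eps)" if e: "eps > 0" for eps
  proof (rule LIMSEQ_unique)
    \<comment> \<open>inner radii that are smaller than \<open>eps\<close> and tend to zero\<close>
    let ?d = "\<lambda>m. eps / real (Suc (Suc m))"
    have d: "0 < ?d m" "?d m < eps" for m using e by (auto simp: divide_less_eq)
    have d0: "?d \<longlonglongrightarrow> 0" by (intro LIMSEQ_Suc lim_const_over_n)
    show "(\<lambda>m. ring_integral K ?f (?d m) eps) \<longlonglongrightarrow> shell_integral K ?f eps"
      unfolding ring_integral_def shell_integral_def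
    proof (rule nn_integral_dominated_convergence[where w="\<lambda>x. ennreal C * indicator (shell K eps) x"])
      show "(\<integral>\<^sup>+x. ennreal C * indicator (shell K eps) x \<partial>lborel) < \<infinity>"
        using emeasure_shell_finite[OF K, of eps] by (simp add: nn_integral_cmult_indicator ennreal_mult_less_top)
      show "AE x in lborel. ?r (?d i) eps K x \<le> ennreal C * indicator (shell K eps) x" for i
        using fC d(1)[of i] by (intro AE_I2) (auto simp: indicator_def shell_def)
      show "AE x in lborel. (\<lambda>i. ?r (?d i) eps K x) \<longlonglongrightarrow>
          indicator (shell K eps) x * ennreal (g (foot_normal K x))"
      proof (rule AE_I2)
        fix x
        show "(\<lambda>i. ?r (?d i) eps K x) \<longlonglongrightarrow>
          indicator (shell K eps) x * ennreal (g (foot_normal K x))"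
        proof (cases "infdist x K > 0")
          case True
          then have "\<forall>\<^sub>F i in sequentially. ?d i < infdist x K" by (rule order_tendstoD(2)[OF d0])
          then have "\<forall>\<^sub>F i in sequentially. indicator (shell K eps) x * ennreal (g (foot_normal K x)) = ?r (?d i) eps K x"
            by (rule eventually_mono) (use True in \<open>auto simp: shell_def indicator_def\<close>)
          from Lim_transform_eventually[OF tendsto_const this] show ?thesis .
        next
          case False
          then have "\<not> ?d i < infdist x K" for i using d(1)[of i] by linarith
          then show ?thesis using False by (simp add: shell_def)
        qed
      qed
    qed (intro borel_measurable_ring_integrand K gm, intro borel_measurable_shell_integrand K gm,
        simp only: measurable_lborel2, intro borel_measurable_times_ennreal borel_measurable_const borel_measurable_indicator borel_shell[OF K])
    have "(\<lambda>m. ?q eps - ?q (?d m)) \<longlonglongrightarrow> ?q eps - ?q 0"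
      by (intro tendsto_diff tendsto_const tendsto_sum tendsto_mult tendsto_power d0)
    moreover have "?q 0 = 0" by (intro sum.neutral) auto
    ultimately have "(\<lambda>m. ?q eps - ?q (?d m)) \<longlonglongrightarrow> ?q eps" by simp
    then show "(\<lambda>m. ring_integral K ?f (?d m) eps) \<longlonglongrightarrow> ennreal (?q eps)"
      unfolding ring[OF d] by (rule tendsto_ennrealI)
  qed
  then show ?thesis using r(2) unfolding steiner_polynomial_def by blast
qed

lemma shell_integral_dominated:
  fixes K :: "(real^'n) set"
  assumes K: "convex_body K" and [measurable]: "\<And>i. f i \<in> borel_measurable borel" "g \<in> borel_measurable borel"
    and C: "\<And>i z. f i z \<le> ennreal C" and lim: "\<And>z. (\<lambda>i. f i z) \<longlonglongrightarrow> g z"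
  shows "(\<lambda>i. shell_integral K (f i) eps) \<longlonglongrightarrow> shell_integral K g eps"
proof -
  note [measurable] = borel_measurable_foot_normal[OF K] borel_shell[OF K]
  show ?thesis unfolding shell_integral_def
  proof (rule nn_integral_dominated_convergence[where w="\<lambda>x. ennreal C * indicator (shell K eps) x"])
    show "(\<integral>\<^sup>+x. ennreal C * indicator (shell K eps) x \<partial>lborel) < \<infinity>"
      using emeasure_shell_finite[OF K, of eps] by (simp add: nn_integral_cmult_indicator ennreal_mult_less_top)
    show "AE x in lborel. indicator (shell K eps) x * f i (foot_normal K x) \<le> ennreal C * indicator (shell K eps) x" for i
      using C by (intro AE_I2) (auto simp: indicator_def)
    show "AE x in lborel. (\<lambda>i. indicator (shell K eps) x * f i (foot_normal K x)) \<longlonglongrightarrow> indicator (shell K eps) x * g (foot_normal K x)"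
      by (intro AE_I2) (auto simp: indicator_def lim)
  qed measurable
qed

lemma shell_integral_le_measure:
  fixes K :: "(real^'n) set"
  assumes K: "convex_body K" and f: "\<And>z. f z \<le> 1"
  shows "shell_integral K f eps \<le> ennreal (measure lborel (shell K eps))"
  using shell_integral_le[OF K, of f 1 eps] f emeasure_shell_finite[OF K, of eps]
  by (simp add: emeasure_eq_ennreal_measure less_top)

lemma closed_indicator_limit:
  fixes C :: "'a :: metric_space set"
  assumes "closed C" "C \<noteq> {}"
  shows "(\<lambda>m. ennreal (max 0 (1 - real m * infdist z C))) \<longlonglongrightarrow> indicator C z"
proof (cases "z \<in> C")
  case True then show ?thesis by simp
next
  case F: False
  then have pos: "infdist z C > 0" using infdist_pos_not_in_closed[OF assms] by blast
  obtain N where N: "real N * infdist z C > 1" using reals_Archimedean3[OF pos] by blast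
  have "\<forall>\<^sub>F m in sequentially. 0 = ennreal (max 0 (1 - real m * infdist z C))"
  proof (rule eventually_sequentiallyI)
    fix m assume "N \<le> m"
    then have "real N * infdist z C \<le> real m * infdist z C" using pos by (intro mult_right_mono) auto
    then show "0 = ennreal (max 0 (1 - real m * infdist z C))" using N by simp
  qed
  from Lim_transform_eventually[OF tendsto_const this] show ?thesis using F by simp
qed

text \<open>
  The indicator of a closed set is a pointwise limit of continuous functions.
\<close>

lemma steiner_closed:
  fixes K :: "(real^'n) set"
  assumes K: "convex_body K" and C: "closed C"
  shows "\<exists>a. steiner_polynomial K (indicator C) a"
proof (cases "C = {}")
  case True
  then show ?thesis by (intro exI[of _ "\<lambda>_. 0"]) (auto simp: steiner_polynomial_def shell_integral_def)
next
  case False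
  let ?g = "\<lambda>m z. max 0 (1 - real m * infdist z C)"
  have [measurable]: "C \<in> sets borel" using C by simp
  have g: "continuous_on UNIV (?g m)" for m by (intro continuous_intros)
  have m: "?g m \<in> borel_measurable borel" for m using g by (rule borel_measurable_continuous_onI)
  have le: "ennreal (?g m z) \<le> 1" for m z using infdist_nonneg[of z C] by simp
  note lim = closed_indicator_limit[OF C False]
  show ?thesis
  proof (rule steiner_polynomial_limit[where f="\<lambda>m z. ennreal (?g m z)"])
    show "\<exists>a. steiner_polynomial K (\<lambda>z. ennreal (?g m z)) a" for m
      by (rule steiner_continuous[OF K g, where C=1]) (auto simp: infdist_nonneg)
    show "shell_integral K (\<lambda>z. ennreal (?g m z)) 1 \<le> ennreal (measure lborel (shell K 1))" for m
      by (rule shell_integral_le_measure[OF K le])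
    show "(\<lambda>i. shell_integral K (\<lambda>z. ennreal (?g i z)) eps) \<longlonglongrightarrow> shell_integral K (indicator C) eps" for eps
      by (rule shell_integral_dominated[OF K measurable_compose[OF m measurable_ennreal] _ _ lim, where C=1]) (use le in auto)
  qed simp
qed

text \<open>
  Inner regularity has to produce one sequence of compact sets that is good for all \<open>eps\<close>. The set \<open>C m\<close>
  is chosen with respect to the shell of width \<open>m\<close>; then it approximates \<open>\<eta>\<close> for all \<open>eps \<le> m\<close>, because
  shells increase with \<open>eps\<close>.
\<close>

lemma steiner_borel:
  fixes K :: "(real^'n) set"
  assumes K: "convex_body K" and \<eta>: "\<eta> \<in> sets borel"
  shows "\<exists>a. steiner_polynomial K (indicator \<eta>) a"
proof -
  note [measurable] = borel_measurable_foot_normal[OF K] borel_shell[OF K] \<eta>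
  \<comment> \<open>the image of Lebesgue measure on the shell under foot point and normal; it is finite, hence inner regular\<close>
  define \<rho> where "\<rho> m = distr (density lborel (indicator (shell K m))) borel (foot_normal K)" for m
  have \<rho>: "emeasure (\<rho> m) A = shell_integral K (indicator A) m" if [measurable]: "A \<in> sets borel" for m A
  proof -
    have "emeasure (\<rho> m) A = emeasure (density lborel (indicator (shell K m))) (foot_normal K -` A)"
      unfolding \<rho>_def by (subst emeasure_distr) auto
    also have "\<dots> = (\<integral>\<^sup>+x. indicator (shell K m) x * indicator (foot_normal K -` A) x \<partial>lborel)"
      using measurable_sets[OF borel_measurable_foot_normal[OF K] that] by (intro emeasure_density) auto
    finally show ?thesis by (simp add: shell_integral_def indicator_def)
  qed
  have fin: "emeasure (\<rho> m) A \<noteq> \<infinity>" if "A \<in> sets borel" for m A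
  proof -
    have "emeasure (\<rho> m) A \<le> ennreal (measure lborel (shell K m))"
      unfolding \<rho>[OF that] by (rule shell_integral_le_measure[OF K]) (auto simp: indicator_def)
    then show ?thesis by (auto simp: top_unique)
  qed
  have "\<exists>C. compact C \<and> C \<subseteq> \<eta> \<and> emeasure (\<rho> (real m)) \<eta> < emeasure (\<rho> (real m)) C + ennreal (1 / real (Suc m))" for m
  proof -
    let ?M = "\<rho> (real m)"
    have "emeasure ?M \<eta> = (SUP C \<in> {C. C \<subseteq> \<eta> \<and> compact C}. emeasure ?M C)"
      by (rule inner_regular) (use \<eta> fin[of UNIV] in \<open>auto simp: \<rho>_def\<close>)
    then have "\<exists>C\<in>{C. C \<subseteq> \<eta> \<and> compact C}. emeasure ?M \<eta> < emeasure ?M C + ennreal (1 / real (Suc m))"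
      using fin[OF \<eta>, of "real m"] by (intro SUP_approx_ennreal) (auto intro: exI[of _ "{}"])
    then show ?thesis by blast
  qed
  then have "\<exists>C. \<forall>m. compact (C m) \<and> C m \<subseteq> \<eta> \<and> emeasure (\<rho> (real m)) \<eta> < emeasure (\<rho> (real m)) (C m) + ennreal (1 / real (Suc m))"
    by (intro choice allI)
  then obtain C where "\<forall>m. compact (C m) \<and> C m \<subseteq> \<eta> \<and> emeasure (\<rho> (real m)) \<eta> < emeasure (\<rho> (real m)) (C m) + ennreal (1 / real (Suc m))" ..
  then have C: "\<And>m. compact (C m)" "\<And>m. C m \<subseteq> \<eta>"
    "\<And>m. emeasure (\<rho> (real m)) \<eta> < emeasure (\<rho> (real m)) (C m) + ennreal (1 / real (Suc m))" by simp_all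
  have Cb[measurable]: "C m \<in> sets borel" for m using C(1) by (simp add: borel_compact)
  show ?thesis
  proof (rule steiner_polynomial_limit[where f="\<lambda>m. indicator (C m)"])
    show "\<exists>a. steiner_polynomial K (indicator (C m)) a" for m
      by (rule steiner_closed[OF K]) (simp add: C(1) compact_imp_closed)
    show "shell_integral K (indicator (C m)) 1 \<le> ennreal (measure lborel (shell K 1))" for m
      by (rule shell_integral_le_measure[OF K]) (auto simp: indicator_def)
    fix eps :: real assume e: "eps > 0"
    let ?S = "\<lambda>A eps. shell_integral K (indicator A) eps"
    have split: "?S \<eta> t = ?S (C m) t + ?S (\<eta> - C m) t" for m t
      unfolding shell_integral_def using C(2)[of m]
      by (subst nn_integral_add[symmetric]) (auto simp: indicator_def intro!: nn_integral_cong)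
    have small: "?S (\<eta> - C m) eps \<le> ennreal (1 / real (Suc m))" if "eps \<le> real m" for m
    proof -
      have "?S (\<eta> - C m) eps \<le> ?S (\<eta> - C m) (real m)"
        unfolding shell_integral_def using that by (intro nn_integral_mono) (auto simp: indicator_def shell_def)
      also have "?S (C m) (real m) + ?S (\<eta> - C m) (real m) \<le> ?S (C m) (real m) + ennreal (1 / real (Suc m))"
        using C(3)[of m] by (simp add: \<rho> split[symmetric])
      then have "?S (\<eta> - C m) (real m) \<le> ennreal (1 / real (Suc m))"
        using fin[OF Cb, of "real m" m] by (simp add: \<rho> ennreal_add_left_cancel_le)
      finally show ?thesis .
    qed
    obtain N where N: "eps \<le> real N" using real_arch_simple by blast
    have "(\<lambda>m. ?S (\<eta> - C m) eps) \<longlonglongrightarrow> 0"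
    proof (rule tendsto_sandwich[OF _ _ tendsto_const])
      show "\<forall>\<^sub>F m in sequentially. ?S (\<eta> - C m) eps \<le> ennreal (1 / real (Suc m))"
        by (rule eventually_sequentiallyI[of N], rule small) (use N in linarith)
      have "(\<lambda>m. ennreal (1 / real (Suc m))) \<longlonglongrightarrow> ennreal 0"
        by (intro tendsto_ennrealI LIMSEQ_Suc lim_1_over_n)
      then show "(\<lambda>m. ennreal (1 / real (Suc m))) \<longlonglongrightarrow> 0" by simp
    qed simp
    moreover have "?S \<eta> eps - ?S (C m) eps = ?S (\<eta> - C m) eps" for m
    proof -
      have "?S (C m) eps \<noteq> \<infinity>" using fin[OF Cb, of eps m] \<rho>[OF Cb, of eps m] by simp
      then show ?thesis unfolding split[of eps m] by simp
    qed
    ultimately have "(\<lambda>m. ?S \<eta> eps - ?S (C m) eps) \<longlonglongrightarrow> 0" by (simp only:)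
    note diff = this
    have le: "?S (C m) eps \<le> ?S \<eta> eps" for m using split[of eps m] by simp
    show "(\<lambda>m. ?S (C m) eps) \<longlonglongrightarrow> ?S \<eta> eps"
      by (rule ennreal_tendsto_const_minus[OF always_eventually diff]) (simp only: le simp_thms)
  qed simp
qed


section \<open>Existence and uniqueness of the support measures\<close>

lemma polynomial_coefficients_unique:
  fixes a b :: "nat \<Rightarrow> real"
  assumes "\<And>eps. eps > 0 \<Longrightarrow> (\<Sum>k=1..n. a k * eps ^ k) = (\<Sum>k=1..n. b k * eps ^ k)" "k \<in> {1..n}"
  shows "a k = b k"
proof (rule ccontr)
  let ?c = "\<lambda>k. if k = 0 then 0 else a k - b k"
  assume "a k \<noteq> b k"
  then have "\<exists>k. k \<le> n \<and> ?c k \<noteq> 0" using assms(2) by (intro exI[of _ k]) auto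
  from polyfun_rootbound[OF this] have "finite {z. (\<Sum>i\<le>n. ?c i * z ^ i) = 0}" by blast
  moreover have "{0<..<1::real} \<subseteq> {z. (\<Sum>i\<le>n. ?c i * z ^ i) = 0}"
  proof
    fix z :: real assume z: "z \<in> {0<..<1}"
    have "(\<Sum>i\<le>n. ?c i * z ^ i) = (\<Sum>i=1..n. ?c i * z ^ i)"
      by (rule sum.mono_neutral_right) auto
    also have "\<dots> = (\<Sum>i=1..n. a i * z ^ i) - (\<Sum>i=1..n. b i * z ^ i)"
      unfolding sum_subtractf[symmetric] by (intro sum.cong refl) (auto simp: left_diff_distrib)
    finally show "z \<in> {z. (\<Sum>i\<le>n. ?c i * z ^ i) = 0}" using assms(1)[of z] z by simp
  qed
  ultimately have "finite {0<..<1::real}" by (rule finite_subset[rotated])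
  then show False using infinite_Ioo[of 0 "1::real"] by simp
qed

lemma steiner_polynomial_unique:
  fixes K :: "(real^'n) set"
  assumes "steiner_polynomial K f a" "steiner_polynomial K f b" "k \<in> {1..CARD('n)}"
  shows "a k = b k"
proof (rule polynomial_coefficients_unique[OF _ assms(3)])
  fix eps :: real assume e: "eps > 0"
  then have "ennreal (\<Sum>k=1..CARD('n). a k * eps ^ k) = ennreal (\<Sum>k=1..CARD('n). b k * eps ^ k)"
    using assms(1,2) unfolding steiner_polynomial_def by metis
  moreover have "0 \<le> (\<Sum>k=1..CARD('n). a k * eps ^ k)" "0 \<le> (\<Sum>k=1..CARD('n). b k * eps ^ k)"
    using assms(1,2) e by (auto simp: steiner_polynomial_def intro!: sum_nonneg)
  ultimately show "(\<Sum>k=1..CARD('n). a k * eps ^ k) = (\<Sum>k=1..CARD('n). b k * eps ^ k)" by simp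
qed

definition steiner_coefficient :: "(real^'n) set \<Rightarrow> ((real^'n) \<times> (real^'n)) set \<Rightarrow> nat \<Rightarrow> real" where
  "steiner_coefficient K \<eta> = (SOME a. steiner_polynomial K (indicator \<eta>) a)"

lemma steiner_coefficient:
  assumes "convex_body K" "\<eta> \<in> sets borel"
  shows "steiner_polynomial K (indicator \<eta>) (steiner_coefficient K \<eta>)"
  unfolding steiner_coefficient_def by (rule someI_ex[OF steiner_borel[OF assms]])

text \<open>
  Shell integrals are countably additive in the set, and coefficients of polynomials are determined
  by their values.
\<close>

lemma steiner_coefficient_sums:
  fixes K :: "(real^'n) set"
  assumes K: "convex_body K" and A: "range A \<subseteq> sets borel" "disjoint_family A" and k: "k \<in> {1..CARD('n)}"
  shows "(\<Sum>i. ennreal (steiner_coefficient K (A i) k)) = ennreal (steiner_coefficient K (\<Union>i. A i) k)"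
proof -
  note [measurable] = borel_measurable_foot_normal[OF K] borel_shell[OF K]
  have [measurable]: "A i \<in> sets borel" for i using A by auto
  let ?n = "CARD('n)" and ?a = "\<lambda>i. steiner_coefficient K (A i)" and ?U = "\<Union>i. A i"
  have a: "steiner_polynomial K (indicator (A i)) (?a i)" for i by (rule steiner_coefficient[OF K]) simp
  have u: "steiner_polynomial K (indicator ?U) (steiner_coefficient K ?U)" by (rule steiner_coefficient[OF K]) measurable
  have a0: "0 \<le> ?a i k" for i k using a[of i] by (simp add: steiner_polynomial_def)
  have S: "shell_integral K (indicator ?U) eps = (\<Sum>k=1..?n. (\<Sum>i. ennreal (?a i k)) * ennreal (eps ^ k))" if e: "eps > 0" for eps
  proof -
    have "shell_integral K (indicator ?U) eps = (\<integral>\<^sup>+x. (\<Sum>i. indicator (shell K eps) x * indicator (A i) (foot_normal K x)) \<partial>lborel)"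
      unfolding shell_integral_def by (simp add: suminf_indicator[OF A(2)] ennreal_suminf_cmult)
    also have "\<dots> = (\<Sum>i. shell_integral K (indicator (A i)) eps)"
      unfolding shell_integral_def by (rule nn_integral_suminf) measurable
    also have "\<dots> = (\<Sum>i. \<Sum>k=1..?n. ennreal (?a i k) * ennreal (eps ^ k))"
      using a e a0 by (simp add: steiner_polynomial_def sum_ennreal[symmetric] ennreal_mult)
    also have "\<dots> = (\<Sum>k=1..?n. (\<Sum>i. ennreal (?a i k)) * ennreal (eps ^ k))"
      by (subst suminf_sum) (auto intro!: sum.cong ennreal_suminf_multc summableI)
    finally show ?thesis .
  qed
  have fin: "(\<Sum>i. ennreal (?a i k)) \<noteq> \<infinity>" if "k \<in> {1..?n}" for k
  proof -
    have "shell_integral K (indicator ?U) 1 = ennreal (\<Sum>k=1..?n. steiner_coefficient K ?U k * 1 ^ k)"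
      using u unfolding steiner_polynomial_def by (metis zero_less_one)
    then have lt: "(\<Sum>k=1..?n. (\<Sum>i. ennreal (?a i k))) < \<infinity>" using S[of 1] by simp
    have le: "(\<Sum>i. ennreal (?a i k)) \<le> (\<Sum>k=1..?n. (\<Sum>i. ennreal (?a i k)))"
      using that by (intro member_le_sum) auto
    show ?thesis using order.strict_trans1[OF le lt] by simp
  qed
  define b where "b k = (if k \<in> {1..?n} then enn2real (\<Sum>i. ennreal (?a i k)) else 0)" for k
  have b: "ennreal (b k) = (\<Sum>i. ennreal (?a i k))" if "k \<in> {1..?n}" for k
    using fin[OF that] that by (auto simp: b_def less_top)
  have "steiner_polynomial K (indicator ?U) b"
    unfolding steiner_polynomial_def
  proof (intro conjI allI impI)
    show b0: "0 \<le> b k" for k by (simp add: b_def)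
    fix eps :: real assume e: "eps > 0"
    have "shell_integral K (indicator ?U) eps = (\<Sum>k=1..?n. ennreal (b k) * ennreal (eps ^ k))"
      unfolding S[OF e] by (intro sum.cong refl) (simp add: b)
    then show "shell_integral K (indicator ?U) eps = ennreal (\<Sum>k=1..?n. b k * eps ^ k)"
      using e b0 by (simp add: sum_ennreal[symmetric] ennreal_mult)
  qed
  from steiner_polynomial_unique[OF this u k] show ?thesis using b[OF k] by simp
qed

lemma space_normal_space:
  "space (normal_space :: ((real^'n) \<times> (real^'n)) measure) = UNIV \<times> sphere 0 1"
  "sets (normal_space :: ((real^'n) \<times> (real^'n)) measure) \<subseteq> sets borel"
  "UNIV \<times> sphere 0 1 \<in> sets (borel :: ((real^'n) \<times> (real^'n)) measure)"
proof -
  have "closed (UNIV \<times> sphere 0 1 :: ((real^'n) \<times> (real^'n)) set)" by (intro closed_Times) auto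
  then show *: "UNIV \<times> sphere 0 1 \<in> sets (borel :: ((real^'n) \<times> (real^'n)) measure)" by simp
  then show "sets (normal_space :: ((real^'n) \<times> (real^'n)) measure) \<subseteq> sets borel" by (auto simp: sets_restrict_space)
  show "space (normal_space :: ((real^'n) \<times> (real^'n)) measure) = UNIV \<times> sphere 0 1"
    by (simp add: space_restrict_space)
qed

lemma unit_ball_vol_nat_pos: "0 < unit_ball_vol (real k)"
  by (simp add: unit_ball_vol_pos)

text \<open>
  The coefficient of \<open>eps ^ k\<close> in the Steiner polynomial of the indicator of \<open>\<eta>\<close>, divided by the volume of the
  \<open>k\<close>-dimensional unit ball, is countably additive in \<open>\<eta>\<close>; it is the mass of \<open>\<eta>\<close> under the support
  measure of index \<open>n - k\<close>.
\<close>

theorem support_measures_exist: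
  fixes K :: "(real^'n) set"
  assumes K: "convex_body K"
  shows "\<exists>\<Lambda>. support_measures_of K \<Lambda>"
proof -
  let ?n = "CARD('n)"
  let ?N = "normal_space :: ((real^'n) \<times> (real^'n)) measure"
  define m where "m j \<eta> = ennreal (steiner_coefficient K \<eta> (?n - j) / unit_ball_vol (real (?n - j)))" for j \<eta>
  define \<Lambda> where "\<Lambda> j = measure_of (space ?N) (sets ?N) (m j)" for j
  have sets: "sets (\<Lambda> j) = sets ?N" for j by (simp add: \<Lambda>_def sets.sigma_sets_eq)
  have c0: "0 \<le> steiner_coefficient K \<eta> k" if "\<eta> \<in> sets ?N" for \<eta> k
    using steiner_coefficient[OF K, of \<eta>] that space_normal_space(2) by (auto simp: steiner_polynomial_def)
  have em: "emeasure (\<Lambda> j) \<eta> = m j \<eta>" if j: "j < ?n" and \<eta>: "\<eta> \<in> sets ?N" for j \<eta>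
    unfolding \<Lambda>_def
  proof (rule emeasure_measure_of_sigma)
    show "sigma_algebra (space ?N) (sets ?N)" ..
    show "positive (sets ?N) (m j)"
    proof -
      have "steiner_polynomial K (indicator {}) (\<lambda>_. 0)" by (simp add: steiner_polynomial_def shell_integral_def)
      from steiner_polynomial_unique[OF steiner_coefficient[OF K, of "{}"] this, of "?n - j"] j
      show ?thesis by (simp add: positive_def m_def)
    qed
    show "countably_additive (sets ?N) (m j)"
    proof (rule countably_additiveI)
      fix A :: "nat \<Rightarrow> ((real^'n) \<times> (real^'n)) set"
      assume A: "range A \<subseteq> sets ?N" "disjoint_family A"
      have "range A \<subseteq> sets borel" using A(1) space_normal_space(2) by blast
      from steiner_coefficient_sums[OF K this A(2), of "?n - j"] j
      have "(\<Sum>i. ennreal (steiner_coefficient K (A i) (?n - j)) / ennreal (unit_ball_vol (real (?n - j)))) = ennreal (steiner_coefficient K (\<Union>i. A i) (?n - j)) / ennreal (unit_ball_vol (real (?n - j)))"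
        by (simp add: divide_ennreal_def ennreal_suminf_multc)
      moreover have mN: "A i \<in> sets ?N" for i using A(1) by blast
      moreover have "(\<Union>i. A i) \<in> sets ?N" by (rule sets.countable_UN[OF A(1)])
      moreover have "ennreal (steiner_coefficient K \<eta> (?n - j)) / ennreal (unit_ball_vol (real (?n - j))) = m j \<eta>" if "\<eta> \<in> sets ?N" for \<eta>
        unfolding m_def by (rule divide_ennreal[OF c0[OF that] unit_ball_vol_nat_pos])
      ultimately show "(\<Sum>i. m j (A i)) = m j (\<Union>i. A i)" by (simp only:)
    qed
  qed (rule \<eta>)
  have "support_measures_of K \<Lambda>"
    unfolding support_measures_of_def
  proof (intro conjI allI impI ballI)
    fix j assume j: "j < ?n"
    show "sets (\<Lambda> j) = sets ?N" by (rule sets)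
    show "finite_measure (\<Lambda> j)"
    proof
      have "space (\<Lambda> j) = space ?N" using sets sets_eq_imp_space_eq by blast
      then show "emeasure (\<Lambda> j) (space (\<Lambda> j)) \<noteq> \<infinity>" using em[OF j, of "space ?N"] by (simp add: m_def)
    qed
  next
    fix eps :: real and \<eta> assume e: "0 \<le> eps" and \<eta>: "\<eta> \<in> sets ?N"
    have \<eta>b: "\<eta> \<in> sets borel" using \<eta> space_normal_space(2) by blast
    have meas: "measure (\<Lambda> j) \<eta> = steiner_coefficient K \<eta> (?n - j) / unit_ball_vol (real (?n - j))" if "j < ?n" for j
      using em[OF that \<eta>] c0[OF \<eta>] unit_ball_vol_nat_pos[of "?n - j"] by (simp add: measure_def m_def)
    have "(\<Sum>j<?n. unit_ball_vol (real (?n - j)) * measure (\<Lambda> j) \<eta> * eps ^ (?n - j)) = (\<Sum>j<?n. steiner_coefficient K \<eta> (?n - j) * eps ^ (?n - j))"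
      using unit_ball_vol_nat_pos by (intro sum.cong refl) (simp add: meas less_imp_neq[THEN not_sym])
    also have "\<dots> = (\<Sum>k=1..?n. steiner_coefficient K \<eta> k * eps ^ k)"
      by (rule sum.reindex_bij_witness[of _ "\<lambda>k. ?n - k" "\<lambda>j. ?n - j"]) auto
    also have "\<dots> = measure lborel (local_parallel_set K eps \<eta>)"
    proof (cases "eps = 0")
      case True
      then have "local_parallel_set K eps \<eta> = {}" by (auto simp: local_parallel_set_eq[OF K] shell_def)
      moreover have "(\<Sum>k=1..?n. steiner_coefficient K \<eta> k * eps ^ k) = 0" using True by (intro sum.neutral) auto
      ultimately show ?thesis by simp
    next
      case False
      note [measurable] = borel_measurable_foot_normal[OF K] borel_shell[OF K] \<eta>b
      have "local_parallel_set K eps \<eta> \<in> sets borel" unfolding local_parallel_set_eq[OF K] by measurable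
      then have "emeasure lborel (local_parallel_set K eps \<eta>) = (\<integral>\<^sup>+x. indicator (local_parallel_set K eps \<eta>) x \<partial>lborel)" by simp
      also have "\<dots> = shell_integral K (indicator \<eta>) eps"
        unfolding shell_integral_def local_parallel_set_eq[OF K] by (intro nn_integral_cong) (auto simp: indicator_def)
      also have "\<dots> = ennreal (\<Sum>k=1..?n. steiner_coefficient K \<eta> k * eps ^ k)"
        using steiner_coefficient[OF K \<eta>b] e False by (simp add: steiner_polynomial_def)
      finally show ?thesis using c0[OF \<eta>] e by (simp add: measure_def sum_nonneg)
    qed
    finally show "measure lborel (local_parallel_set K eps \<eta>) = (\<Sum>j<?n. unit_ball_vol (real (?n - j)) * measure (\<Lambda> j) \<eta> * eps ^ (?n - j))" ..
  qed
  then show ?thesis by blast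
qed

lemma support_measures_unique:
  fixes K :: "(real^'n) set"
  assumes L: "support_measures_of K \<Lambda>" and M: "support_measures_of K M" and j: "j < CARD('n)"
  shows "\<Lambda> j = M j"
proof (rule measure_eqI)
  let ?n = "CARD('n)"
  show "sets (\<Lambda> j) = sets (M j)" using assms by (simp add: support_measures_of_def)
  fix \<eta> assume "\<eta> \<in> sets (\<Lambda> j)"
  then have \<eta>: "\<eta> \<in> sets normal_space" using L j by (simp add: support_measures_of_def)
  have re: "(\<Sum>j<?n. unit_ball_vol (real (?n - j)) * measure (\<Lambda> j) \<eta> * eps ^ (?n - j)) = (\<Sum>k=1..?n. (unit_ball_vol (real k) * measure (\<Lambda> (?n - k)) \<eta>) * eps ^ k)" for \<Lambda> :: "nat \<Rightarrow> ((real^'n) \<times> (real^'n)) measure" and eps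
    by (rule sum.reindex_bij_witness[of _ "\<lambda>k. ?n - k" "\<lambda>j. ?n - j"]) auto
  have "unit_ball_vol (real (?n - j)) * measure (\<Lambda> (?n - (?n - j))) \<eta> = unit_ball_vol (real (?n - j)) * measure (M (?n - (?n - j))) \<eta>"
  proof (rule polynomial_coefficients_unique[where n="?n" and k="?n - j"
      and a="\<lambda>k. unit_ball_vol (real k) * measure (\<Lambda> (?n - k)) \<eta>" and b="\<lambda>k. unit_ball_vol (real k) * measure (M (?n - k)) \<eta>"])
    fix eps :: real assume "eps > 0"
    then show "(\<Sum>k=1..?n. (unit_ball_vol (real k) * measure (\<Lambda> (?n - k)) \<eta>) * eps ^ k) = (\<Sum>k=1..?n. (unit_ball_vol (real k) * measure (M (?n - k)) \<eta>) * eps ^ k)"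
    proof -
      have "measure lborel (local_parallel_set K eps \<eta>) = (\<Sum>k=1..?n. (unit_ball_vol (real k) * measure (N (?n - k)) \<eta>) * eps ^ k)"
        if N: "support_measures_of K N" for N
        unfolding re[symmetric] using conjunct2[OF N[unfolded support_measures_of_def]] \<eta> less_imp_le[OF \<open>eps > 0\<close>] by blast
      from this[OF L] this[OF M] show ?thesis by (simp only:)
    qed
  qed (use j in auto)
  then have "unit_ball_vol (real (?n - j)) * measure (\<Lambda> j) \<eta> = unit_ball_vol (real (?n - j)) * measure (M j) \<eta>"
    by (simp only: diff_diff_cancel[OF less_imp_le[OF j]])
  then have "measure (\<Lambda> j) \<eta> = measure (M j) \<eta>"
    using unit_ball_vol_nat_pos[of "?n - j"] by (metis mult_left_cancel less_irrefl)
  moreover have "finite_measure (\<Lambda> j)" "finite_measure (M j)" using L M j by (auto simp: support_measures_of_def)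
  ultimately show "emeasure (\<Lambda> j) \<eta> = emeasure (M j) \<eta>" by (simp add: finite_measure.emeasure_eq_measure)
qed

lemma support_measures_of_support_measure:
  fixes K :: "(real^'n) set"
  assumes K: "convex_body K"
  shows "support_measures_of K (support_measure K)"
proof -
  obtain \<Lambda> where L: "support_measures_of K \<Lambda>" using support_measures_exist[OF K] by blast
  have "support_measure K j = \<Lambda> j" if "j < CARD('n)" for j
    unfolding support_measure_def
  proof (rule the_equality)
    show "\<exists>\<Lambda>'. support_measures_of K \<Lambda>' \<and> \<Lambda> j = \<Lambda>' j" using L by blast
    show "M = \<Lambda> j" if "\<exists>\<Lambda>'. support_measures_of K \<Lambda>' \<and> M = \<Lambda>' j" for M
      using that support_measures_unique[OF _ L \<open>j < CARD('n)\<close>] by blast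
  qed
  then show ?thesis using L unfolding support_measures_of_def by simp
qed


section \<open>Integration with respect to the support measures\<close>

lemma sets_support_measure:
  fixes K :: "(real^'n) set"
  assumes "convex_body K" "j < CARD('n)"
  shows "sets (support_measure K j) = sets normal_space" "finite_measure (support_measure K j)"
    "space (support_measure K j) = UNIV \<times> sphere 0 1"
proof -
  show *: "sets (support_measure K j) = sets normal_space" "finite_measure (support_measure K j)"
    using support_measures_of_support_measure[OF assms(1)] assms(2) by (auto simp: support_measures_of_def)
  show "space (support_measure K j) = UNIV \<times> sphere 0 1"
    using sets_eq_imp_space_eq[OF *(1)] by (simp only: space_normal_space)
qed

lemma measurable_support_measure:
  fixes K :: "(real^'n) set"
  assumes "convex_body K" "j < CARD('n)" "f \<in> measurable borel N"
  shows "f \<in> measurable (support_measure K j) N"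
proof -
  have "f \<in> measurable normal_space N" using assms(3) by (rule measurable_restrict_space1)
  then show ?thesis using measurable_cong_sets[OF sets_support_measure(1)[OF assms(1,2)] refl] by blast
qed

text \<open>
  The defining formula extends from indicators to nonnegative functions by linearity and monotone
  limits.
\<close>

lemma shell_integral_support_measures:
  fixes K :: "(real^'n) set"
  assumes K: "convex_body K" and f: "f \<in> borel_measurable borel" and e: "eps > 0"
  shows "shell_integral K f eps =
    (\<Sum>j<CARD('n). ennreal (unit_ball_vol (real (CARD('n) - j)) * eps ^ (CARD('n) - j)) * (\<integral>\<^sup>+z. f z \<partial>support_measure K j))"
  using f
proof (induction rule: borel_measurable_induct)
  case (cong f g)
  then have "f = g" by auto
  then show ?case using cong by simp
next
  case (set A)
  let ?n = "CARD('n)"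
  let ?\<eta> = "A \<inter> (UNIV \<times> sphere 0 1)"
  note [measurable] = borel_measurable_foot_normal[OF K] borel_shell[OF K] set
  have \<eta>: "?\<eta> \<in> sets normal_space" unfolding sets_restrict_space by (rule image_eqI[OF Int_commute set])
  then have \<eta>b: "?\<eta> \<in> sets borel" using space_normal_space(2) by blast
  note [measurable] = \<eta>b
  have lb: "local_parallel_set K eps ?\<eta> \<in> sets borel" unfolding local_parallel_set_eq[OF K] by measurable
  have sub: "local_parallel_set K eps ?\<eta> \<subseteq> shell K eps" by (auto simp: local_parallel_set_eq[OF K])
  have "shell_integral K (indicator A) eps = (\<integral>\<^sup>+x. indicator (local_parallel_set K eps ?\<eta>) x \<partial>lborel)"
    unfolding shell_integral_def local_parallel_set_eq[OF K] using foot_normal_sphere[OF K]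
    by (intro nn_integral_cong) (auto simp: indicator_def shell_def infdist_pos_iff[OF K])
  also have "\<dots> = emeasure lborel (local_parallel_set K eps ?\<eta>)" using lb by simp
  also have "\<dots> = ennreal (measure lborel (local_parallel_set K eps ?\<eta>))"
    using emeasure_mono[OF sub, of lborel] emeasure_shell_finite[OF K, of eps] borel_shell[OF K]
    by (intro emeasure_eq_ennreal_measure) (auto simp: top_unique)
  also have "measure lborel (local_parallel_set K eps ?\<eta>) = (\<Sum>j<?n. unit_ball_vol (real (?n - j)) * measure (support_measure K j) ?\<eta> * eps ^ (?n - j))"
    using conjunct2[OF support_measures_of_support_measure[OF K, unfolded support_measures_of_def]] e \<eta> by (meson less_imp_le)
  also have "ennreal \<dots> = (\<Sum>j<?n. ennreal (unit_ball_vol (real (?n - j)) * measure (support_measure K j) ?\<eta> * eps ^ (?n - j)))"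
    using e unit_ball_vol_nat_pos by (intro sum_ennreal[symmetric]) (simp add: less_imp_le)
  also have "\<dots> = (\<Sum>j<?n. ennreal (unit_ball_vol (real (?n - j)) * eps ^ (?n - j)) * (\<integral>\<^sup>+z. indicator A z \<partial>support_measure K j))"
  proof (intro sum.cong refl)
    fix j assume j: "j \<in> {..<?n}"
    interpret finite_measure "support_measure K j" using sets_support_measure(2)[OF K] j by simp
    have "(\<integral>\<^sup>+z. indicator A z \<partial>support_measure K j) = (\<integral>\<^sup>+z. indicator ?\<eta> z \<partial>support_measure K j)"
      using sets_support_measure(3)[OF K, of j] j by (intro nn_integral_cong) (auto simp: indicator_def)
    also have "\<dots> = ennreal (measure (support_measure K j) ?\<eta>)"
      using sets_support_measure(1)[OF K, of j] j \<eta> by (simp add: emeasure_eq_measure)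
    finally show "ennreal (unit_ball_vol (real (?n - j)) * measure (support_measure K j) ?\<eta> * eps ^ (?n - j)) =
        ennreal (unit_ball_vol (real (?n - j)) * eps ^ (?n - j)) * (\<integral>\<^sup>+z. indicator A z \<partial>support_measure K j)"
      using e unit_ball_vol_nat_pos[of "?n - j"] by (simp add: ennreal_mult[symmetric] mult_ac)
  qed
  finally show ?case .
next
  case (mult u c)
  have "shell_integral K (\<lambda>z. c * u z) eps = c * shell_integral K u eps"
    unfolding shell_integral_def
    using borel_measurable_shell_integrand[OF K mult(2)] by (subst nn_integral_cmult[symmetric]) (auto simp: mult_ac)
  then show ?case unfolding mult.IH sum_distrib_left
    using measurable_support_measure[OF K _ mult(2)]
    by (auto intro!: sum.cong simp: nn_integral_cmult mult_ac)
next
  case (add u v)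
  have "shell_integral K (\<lambda>z. v z + u z) eps = shell_integral K v eps + shell_integral K u eps"
    unfolding shell_integral_def distrib_left
    using borel_measurable_shell_integrand[OF K] add.hyps(1,3) by (intro nn_integral_add) auto
  then show ?case unfolding add.IH sum.distrib[symmetric]
    using measurable_support_measure[OF K _ add.hyps(1)] measurable_support_measure[OF K _ add.hyps(3)]
    by (auto intro!: sum.cong simp: nn_integral_add distrib_left)
next
  case (seq U)
  have sup: "(SUP i. U i) z = (SUP i. U i z)" for z by (simp add: image_image)
  have inc: "incseq (\<lambda>i. U i z)" for z
    unfolding incseq_def using le_funD[OF incseqD[OF seq.hyps(3)]] by blast
  have "shell_integral K (SUP i. U i) eps = (\<integral>\<^sup>+x. (SUP i. indicator (shell K eps) x * U i (foot_normal K x)) \<partial>lborel)"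
    unfolding shell_integral_def sup by (simp add: SUP_mult_left_ennreal)
  also have "\<dots> = (SUP i. shell_integral K (U i) eps)"
    unfolding shell_integral_def
    using borel_measurable_shell_integrand[OF K seq.hyps(1)]
    by (intro nn_integral_monotone_convergence_SUP) (auto simp: incseq_def le_fun_def intro!: mult_left_mono incseqD[OF inc])
  also have "\<dots> = (\<Sum>j<CARD('n). SUP i. ennreal (unit_ball_vol (real (CARD('n) - j)) * eps ^ (CARD('n) - j)) * (\<integral>\<^sup>+z. U i z \<partial>support_measure K j))"
    unfolding seq.IH using inc
    by (intro ennreal_SUP_sum) (auto simp: incseq_def intro!: mult_left_mono nn_integral_mono)
  also have "\<dots> = (\<Sum>j<CARD('n). ennreal (unit_ball_vol (real (CARD('n) - j)) * eps ^ (CARD('n) - j)) * (\<integral>\<^sup>+z. (SUP i. U i) z \<partial>support_measure K j))"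
  proof (intro sum.cong refl)
    fix j assume j: "j \<in> {..<CARD('n)}"
    have "(\<integral>\<^sup>+z. (SUP i. U i z) \<partial>support_measure K j) = (SUP i. (\<integral>\<^sup>+z. U i z \<partial>support_measure K j))"
      using measurable_support_measure[OF K _ seq.hyps(1)] j seq.hyps(3)
      by (intro nn_integral_monotone_convergence_SUP) auto
    then show "(SUP i. ennreal (unit_ball_vol (real (CARD('n) - j)) * eps ^ (CARD('n) - j)) * (\<integral>\<^sup>+z. U i z \<partial>support_measure K j)) =
      ennreal (unit_ball_vol (real (CARD('n) - j)) * eps ^ (CARD('n) - j)) * (\<integral>\<^sup>+z. (SUP i. U i) z \<partial>support_measure K j)"
      unfolding sup by (simp add: SUP_mult_left_ennreal)
  qed
  finally show ?case .
qed

lemma integrable_support_measure: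
  fixes K :: "(real^'n) set" and f :: "(real^'n) \<times> (real^'n) \<Rightarrow> real"
  assumes K: "convex_body K" and j: "j < CARD('n)" and f: "f \<in> borel_measurable borel" and C: "\<And>x u. norm u = 1 \<Longrightarrow> \<bar>f (x, u)\<bar> \<le> C"
  shows "integrable (support_measure K j) f"
proof -
  interpret finite_measure "support_measure K j" by (rule sets_support_measure[OF K j])
  show ?thesis
    using measurable_support_measure[OF K j f] C
    by (intro integrable_const_bound[of _ C] AE_I2) (auto simp: sets_support_measure[OF K j])
qed

lemma integrable_shell:
  fixes K :: "(real^'n) set" and f :: "(real^'n) \<times> (real^'n) \<Rightarrow> real"
  assumes K: "convex_body K" and f[measurable]: "f \<in> borel_measurable borel" and C: "\<And>x u. norm u = 1 \<Longrightarrow> \<bar>f (x, u)\<bar> \<le> C"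
  shows "integrable lborel (\<lambda>x. indicator (shell K eps) x * f (foot_normal K x))"
proof -
  note [measurable] = borel_measurable_foot_normal[OF K] borel_shell[OF K]
  have "integrable lborel (\<lambda>x. indicator (shell K eps) x *\<^sub>R (C :: real))"
    using emeasure_shell_finite[OF K, of eps] by (intro integrable_scaleR_left integrable_real_indicator) auto
  then show ?thesis
  proof (rule Bochner_Integration.integrable_bound)
    show "AE x in lborel. norm (indicator (shell K eps) x * f (foot_normal K x)) \<le> norm (indicator (shell K eps) x *\<^sub>R C)"
    proof (rule AE_I2)
      fix x
      show "norm (indicator (shell K eps) x * f (foot_normal K x)) \<le> norm (indicator (shell K eps) x *\<^sub>R C)"
      proof (cases "x \<in> shell K eps")
        case True
        then have "x \<notin> K" by (simp add: shell_def infdist_pos_iff[OF K])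
        then have "\<bar>f (foot_normal K x)\<bar> \<le> C" using C[OF norm_outer_normal[OF K]] by (simp add: foot_normal_def)
        then show ?thesis using True by simp
      qed simp
    qed
  qed measurable
qed

lemma integral_shell_support_measures:
  fixes K :: "(real^'n) set" and f :: "(real^'n) \<times> (real^'n) \<Rightarrow> real"
  assumes K: "convex_body K" and f[measurable]: "f \<in> borel_measurable borel" and C: "\<And>x u. norm u = 1 \<Longrightarrow> \<bar>f (x, u)\<bar> \<le> C" and e: "eps > 0"
  shows "(\<integral>x. indicator (shell K eps) x * f (foot_normal K x) \<partial>lborel) =
    (\<Sum>j<CARD('n). unit_ball_vol (real (CARD('n) - j)) * eps ^ (CARD('n) - j) * (\<integral>z. f z \<partial>support_measure K j))"
proof -
  let ?n = "CARD('n)"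
  let ?Lam = "support_measure K"
  define c where "c j = unit_ball_vol (real (?n - j)) * eps ^ (?n - j)" for j
  have c0: "0 \<le> c j" for j using e unit_ball_vol_nat_pos[of "?n - j"] by (simp add: c_def)
  have "enn2real (shell_integral K (\<lambda>z. ennreal (s * f z)) eps) = (\<Sum>j<?n. c j * enn2real (\<integral>\<^sup>+z. ennreal (s * f z) \<partial>?Lam j))" for s
  proof -
    have fin: "(\<integral>\<^sup>+z. ennreal (s * f z) \<partial>?Lam j) < \<top>" if "j < ?n" for j
    proof -
      have "integrable (?Lam j) (\<lambda>z. s * f z)" using integrable_support_measure[OF K that f C] by simp
      then show ?thesis by (metis infinity_ennreal_def integrableE less_top nn_integral_eq_integral real_integrable_def)
    qed
    have "shell_integral K (\<lambda>z. ennreal (s * f z)) eps = (\<Sum>j<?n. ennreal (c j) * (\<integral>\<^sup>+z. ennreal (s * f z) \<partial>?Lam j))"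
      unfolding c_def by (rule shell_integral_support_measures[OF K _ e]) measurable
    also have "\<dots> = (\<Sum>j<?n. ennreal (c j * enn2real (\<integral>\<^sup>+z. ennreal (s * f z) \<partial>?Lam j)))"
      using fin c0 by (intro sum.cong refl) (simp add: ennreal_mult)
    also have "\<dots> = ennreal (\<Sum>j<?n. c j * enn2real (\<integral>\<^sup>+z. ennreal (s * f z) \<partial>?Lam j))"
      using c0 by (intro sum_ennreal) simp
    finally show ?thesis using c0 by (simp add: sum_nonneg)
  qed
  from this[of 1] this[of "-1"]
  have 1: "enn2real (shell_integral K (\<lambda>z. ennreal (f z)) eps) = (\<Sum>j<?n. c j * enn2real (\<integral>\<^sup>+z. ennreal (f z) \<partial>?Lam j))"
    "enn2real (shell_integral K (\<lambda>z. ennreal (- f z)) eps) = (\<Sum>j<?n. c j * enn2real (\<integral>\<^sup>+z. ennreal (- f z) \<partial>?Lam j))"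
    by simp_all
  have ind: "(\<integral>\<^sup>+x. ennreal (indicator (shell K eps) x * f (foot_normal K x)) \<partial>lborel) = shell_integral K (\<lambda>z. ennreal (f z)) eps"
    "(\<integral>\<^sup>+x. ennreal (- (indicator (shell K eps) x * f (foot_normal K x))) \<partial>lborel) = shell_integral K (\<lambda>z. ennreal (- f z)) eps"
    unfolding shell_integral_def by (auto intro!: nn_integral_cong simp: indicator_def)
  have "(\<integral>x. indicator (shell K eps) x * f (foot_normal K x) \<partial>lborel) =
    enn2real (shell_integral K (\<lambda>z. ennreal (f z)) eps) - enn2real (shell_integral K (\<lambda>z. ennreal (- f z)) eps)"
    unfolding ind[symmetric] by (rule real_lebesgue_integral_def[OF integrable_shell[OF K f C]])
  also have "\<dots> = (\<Sum>j<?n. c j * (\<integral>z. f z \<partial>?Lam j))"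
    unfolding 1 sum_subtractf[symmetric]
    by (intro sum.cong refl) (simp add: real_lebesgue_integral_def[OF integrable_support_measure[OF K _ f C]] right_diff_distrib)
  finally show ?thesis by (simp only: c_def)
qed

text \<open>
  For small \<open>eps\<close> the linear term dominates; the factor \<open>2\<close> is the length of the one-dimensional unit
  ball.
\<close>

lemma support_measure_top_limit:
  fixes K :: "(real^'n) set" and f :: "(real^'n) \<times> (real^'n) \<Rightarrow> real"
  assumes K: "convex_body K" and f: "f \<in> borel_measurable borel" and C: "\<And>x u. norm u = 1 \<Longrightarrow> \<bar>f (x, u)\<bar> \<le> C"
  shows "(\<lambda>m. real (Suc m) * (\<integral>x. indicator (shell K (1 / real (Suc m))) x * f (foot_normal K x) \<partial>lborel))
     \<longlonglongrightarrow> 2 * (\<integral>z. f z \<partial>support_measure K (CARD('n) - 1))"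
proof -
  let ?lim = "\<lambda>m. \<integral>x. indicator (shell K (1 / real (Suc m))) x * f (foot_normal K x) \<partial>lborel"
  let ?n = "CARD('n)"
  let ?I = "\<lambda>j. (\<integral>z. f z \<partial>support_measure K j)"
  have n: "?n > 0" by simp
  have "(\<lambda>m. \<Sum>j<?n. unit_ball_vol (real (?n - j)) * (1 / real (Suc m)) ^ (?n - j - 1) * ?I j) \<longlonglongrightarrow>
     (\<Sum>j<?n. unit_ball_vol (real (?n - j)) * 0 ^ (?n - j - 1) * ?I j)"
    by (intro tendsto_sum tendsto_mult tendsto_const tendsto_power LIMSEQ_Suc lim_1_over_n)
  also have "(\<Sum>j<?n. unit_ball_vol (real (?n - j)) * 0 ^ (?n - j - 1) * ?I j) = (\<Sum>j<?n. if j = ?n - 1 then 2 * ?I (?n - 1) else 0)"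
    using n by (intro sum.cong refl) (auto simp: power_0_left)
  also have "\<dots> = 2 * ?I (?n - 1)" using n by (subst sum.delta) auto
  also have "(\<lambda>m. \<Sum>j<?n. unit_ball_vol (real (?n - j)) * (1 / real (Suc m)) ^ (?n - j - 1) * ?I j) =
    (\<lambda>m. real (Suc m) * ?lim m)"
  proof
    fix m
    have "real (Suc m) * ?lim m =
      (\<Sum>j<?n. real (Suc m) * (unit_ball_vol (real (?n - j)) * (1 / real (Suc m)) ^ (?n - j) * ?I j))"
      by (subst integral_shell_support_measures[OF K f C]) (simp_all add: sum_distrib_left)
    also have "\<dots> = (\<Sum>j<?n. unit_ball_vol (real (?n - j)) * (1 / real (Suc m)) ^ (?n - j - 1) * ?I j)"
    proof (intro sum.cong refl)
      fix j assume "j \<in> {..<?n}"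
      then have "(1 / real (Suc m)) ^ (?n - j) = (1 / real (Suc m)) * (1 / real (Suc m)) ^ (?n - j - 1)"
        by (metis Suc_diff_1 lessThan_iff power_Suc zero_less_diff)
      then show "real (Suc m) * (unit_ball_vol (real (?n - j)) * (1 / real (Suc m)) ^ (?n - j) * ?I j) = unit_ball_vol (real (?n - j)) * (1 / real (Suc m)) ^ (?n - j - 1) * ?I j"
        by simp
    qed
    finally show "(\<Sum>j<?n. unit_ball_vol (real (?n - j)) * (1 / real (Suc m)) ^ (?n - j - 1) * ?I j) = real (Suc m) * ?lim m" ..
  qed
  finally show ?thesis .
qed

text \<open>
  For large \<open>eps\<close> the term of degree \<open>n\<close> dominates.
\<close>

lemma support_measure_zero_limit:
  fixes K :: "(real^'n) set" and f :: "(real^'n) \<times> (real^'n) \<Rightarrow> real"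
  assumes K: "convex_body K" and f: "f \<in> borel_measurable borel" and C: "\<And>x u. norm u = 1 \<Longrightarrow> \<bar>f (x, u)\<bar> \<le> C"
  shows "(\<lambda>m. (\<integral>x. indicator (shell K (real (Suc m))) x * f (foot_normal K x) \<partial>lborel) / real (Suc m) ^ CARD('n))
     \<longlonglongrightarrow> unit_ball_vol (real CARD('n)) * (\<integral>z. f z \<partial>support_measure K 0)"
proof -
  let ?lim = "\<lambda>m. \<integral>x. indicator (shell K (real (Suc m))) x * f (foot_normal K x) \<partial>lborel"
  let ?n = "CARD('n)"
  let ?I = "\<lambda>j. (\<integral>z. f z \<partial>support_measure K j)"
  have n: "?n > 0" by simp
  have "(\<lambda>m. \<Sum>j<?n. unit_ball_vol (real (?n - j)) * (1 / real (Suc m)) ^ j * ?I j) \<longlonglongrightarrow>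
     (\<Sum>j<?n. unit_ball_vol (real (?n - j)) * 0 ^ j * ?I j)"
    by (intro tendsto_sum tendsto_mult tendsto_const tendsto_power LIMSEQ_Suc lim_1_over_n)
  also have "(\<Sum>j<?n. unit_ball_vol (real (?n - j)) * 0 ^ j * ?I j) = (\<Sum>j<?n. if j = 0 then unit_ball_vol (real ?n) * ?I 0 else 0)"
    using n by (intro sum.cong refl) (auto simp: power_0_left)
  also have "\<dots> = unit_ball_vol (real ?n) * ?I 0" using n by (subst sum.delta) auto
  also have "(\<lambda>m. \<Sum>j<?n. unit_ball_vol (real (?n - j)) * (1 / real (Suc m)) ^ j * ?I j) =
    (\<lambda>m. ?lim m / real (Suc m) ^ ?n)"
  proof
    fix m
    have "?lim m / real (Suc m) ^ ?n =
      (\<Sum>j<?n. (unit_ball_vol (real (?n - j)) * (real (Suc m)) ^ (?n - j) * ?I j) / real (Suc m) ^ ?n)"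
      by (subst integral_shell_support_measures[OF K f C]) (simp_all add: sum_divide_distrib)
    also have "\<dots> = (\<Sum>j<?n. unit_ball_vol (real (?n - j)) * (1 / real (Suc m)) ^ j * ?I j)"
    proof (intro sum.cong refl)
      fix j assume j: "j \<in> {..<?n}"
      then have "real (Suc m) ^ ?n = real (Suc m) ^ (?n - j) * real (Suc m) ^ j"
        by (metis le_add_diff_inverse2 lessThan_iff less_imp_le power_add)
      then show "(unit_ball_vol (real (?n - j)) * (real (Suc m)) ^ (?n - j) * ?I j) / real (Suc m) ^ ?n = unit_ball_vol (real (?n - j)) * (1 / real (Suc m)) ^ j * ?I j"
        by (simp add: power_one_over field_simps)
    qed
    finally show "(\<Sum>j<?n. unit_ball_vol (real (?n - j)) * (1 / real (Suc m)) ^ j * ?I j) =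
      ?lim m / real (Suc m) ^ ?n" ..
  qed
  finally show ?thesis .
qed


section \<open>The support measure of index zero of a segment\<close>

lemma integral_lborel_scale:
  fixes f :: "'b::euclidean_space \<Rightarrow> real"
  assumes f[measurable]: "f \<in> borel_measurable borel" and c: "c > 0"
  shows "(\<integral>x. f x \<partial>lborel) = c ^ DIM('b) * (\<integral>x. f (c *\<^sub>R x) \<partial>lborel)"
proof -
  have "(\<integral>x. f x \<partial>lborel) = (\<integral>x. f x \<partial>density (distr lborel borel (\<lambda>x. 0 + c *\<^sub>R x)) (\<lambda>_. \<bar>c\<bar>^DIM('b)))"
    by (subst lborel_affine[of c 0]) (use c in auto)
  also have "\<dots> = (\<integral>x. \<bar>c\<bar>^DIM('b) *\<^sub>R f x \<partial>distr lborel borel (\<lambda>x. 0 + c *\<^sub>R x))"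
    by (rule integral_density) auto
  also have "\<dots> = (\<integral>x. \<bar>c\<bar>^DIM('b) *\<^sub>R f (0 + c *\<^sub>R x) \<partial>lborel)"
    by (rule integral_distr) auto
  finally show ?thesis using c by simp
qed

definition segment_end :: "real^'n \<Rightarrow> real^'n \<Rightarrow> real \<Rightarrow> real^'n \<Rightarrow> real^'n" where
  "segment_end a v \<tau> w = (if w \<bullet> v > 0 then a + \<tau> *\<^sub>R v else a)"

definition segment :: "real^'n \<Rightarrow> real^'n \<Rightarrow> real \<Rightarrow> (real^'n) set" where
  "segment a v \<tau> = (\<lambda>s. a + s *\<^sub>R v) ` {0..\<tau>}"

lemma convex_body_segment: "\<tau> \<ge> 0 \<Longrightarrow> convex_body (segment a v \<tau>)"
proof -
  assume t: "\<tau> \<ge> 0"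
  have "segment a v \<tau> = (\<lambda>x. a + x) ` ((\<lambda>s. s *\<^sub>R v) ` {0..\<tau>})" by (auto simp: segment_def image_image)
  moreover have "convex ((\<lambda>s. s *\<^sub>R v) ` {0..\<tau>})"
    by (intro convex_linear_image linearI) (auto simp: scaleR_left_distrib)
  moreover have "compact (segment a v \<tau>)"
    unfolding segment_def by (intro compact_continuous_image continuous_intros compact_Icc)
  ultimately show ?thesis using t by (auto simp: convex_body_def convex_translation_eq segment_def)
qed

text \<open>
  Seen from far away in direction \<open>w\<close>, the foot point is the end of the segment that is extreme in
  direction \<open>w\<close>.
\<close>

lemma closest_point_segment_far:
  fixes a v w :: "real^'n"
  assumes t: "\<tau> \<ge> 0" and w: "w \<bullet> v \<noteq> 0"
  shows "\<forall>\<^sub>F m in sequentially. closest_point (segment a v \<tau>) (real (Suc m) *\<^sub>R w) = segment_end a v \<tau> w"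
proof -
  let ?e = "segment_end a v \<tau> w"
  obtain N where N: "real N \<ge> \<bar>?e \<bullet> v\<bar> / \<bar>w \<bullet> v\<bar>" using real_arch_simple by blast
  show ?thesis
  proof (rule eventually_sequentiallyI[of N])
    fix m assume m: "N \<le> m"
    let ?M = "real (Suc m)"
    have "\<bar>?e \<bullet> v\<bar> / \<bar>w \<bullet> v\<bar> \<le> ?M" using N m by linarith
    then have big: "\<bar>?e \<bullet> v\<bar> \<le> ?M * \<bar>w \<bullet> v\<bar>" using w by (simp add: divide_le_eq)
    have e: "?e \<in> segment a v \<tau>" using t by (auto simp: segment_end_def segment_def)
    have "(?M *\<^sub>R w - ?e) \<bullet> (z - ?e) \<le> 0" if z: "z \<in> segment a v \<tau>" for z
    proof -
      obtain s where s: "0 \<le> s" "s \<le> \<tau>" "z = a + s *\<^sub>R v" using z by (auto simp: segment_def)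
      show ?thesis
      proof (cases "w \<bullet> v > 0")
        case True
        then have "z - ?e = (s - \<tau>) *\<^sub>R v" using s by (simp add: segment_end_def scaleR_diff_left)
        then have "(?M *\<^sub>R w - ?e) \<bullet> (z - ?e) = (s - \<tau>) * (?M * (w \<bullet> v) - ?e \<bullet> v)"
          by (simp only: inner_scaleR_right inner_scaleR_left inner_diff_left)
        moreover have "?M * (w \<bullet> v) - ?e \<bullet> v \<ge> 0" using big True by linarith
        ultimately show ?thesis using s by (simp only:) (rule mult_nonpos_nonneg, auto)
      next
        case False
        then have "z - ?e = s *\<^sub>R v" using s by (simp add: segment_end_def)
        then have "(?M *\<^sub>R w - ?e) \<bullet> (z - ?e) = s * (?M * (w \<bullet> v) - ?e \<bullet> v)"
          by (simp only: inner_scaleR_right inner_scaleR_left inner_diff_left)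
        moreover have "?M * (w \<bullet> v) - ?e \<bullet> v \<le> 0"
        proof -
          have "\<bar>w \<bullet> v\<bar> = - (w \<bullet> v)" using False by linarith
          then have "?M * \<bar>w \<bullet> v\<bar> = - (?M * (w \<bullet> v))" by (simp only: mult_minus_right)
          then show ?thesis using big by linarith
        qed
        ultimately show ?thesis using s by (simp only:) (rule mult_nonneg_nonpos, auto)
      qed
    qed
    then show "closest_point (segment a v \<tau>) (?M *\<^sub>R w) = ?e"
      by (intro closest_point_iff[OF convex_body_segment[OF t], THEN iffD2] conjI ballI e)
  qed
qed

lemma AE_inner_neq_0: "v \<noteq> 0 \<Longrightarrow> AE w in lborel. w \<bullet> (v::real^'n) \<noteq> 0"
proof -
  assume v: "v \<noteq> 0"
  have "negligible {x. v \<bullet> x = 0}" by (rule negligible_hyperplane) (use v in simp)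
  moreover have "closed {x. v \<bullet> x = 0}" by (rule closed_hyperplane)
  ultimately have "{x. v \<bullet> x = 0} \<in> null_sets lborel"
    by (metis borel_closed negligible_iff_null_sets null_sets_completion_iff sets_lborel)
  then show ?thesis by (rule AE_I') (auto simp: inner_commute)
qed

lemma AE_norm_neq: "r > 0 \<Longrightarrow> AE w in lborel. norm (w::real^'n) \<noteq> r"
proof -
  assume r: "r > 0"
  have "negligible (frontier (cball (0::real^'n) r))" by (rule negligible_convex_frontier) simp
  then have "negligible (sphere (0::real^'n) r)" using r by simp
  then have "sphere (0::real^'n) r \<in> null_sets lborel"
    by (metis borel_closed closed_sphere negligible_iff_null_sets null_sets_completion_iff sets_lborel)
  then show ?thesis by (rule AE_I') auto
qed

lemma shell_scaled_limit:
  fixes K :: "(real^'n) set"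
  assumes K: "convex_body K" and w: "norm w \<noteq> 1" "w \<noteq> 0"
    and ev: "\<forall>\<^sub>F m in sequentially. closest_point K (real (Suc m) *\<^sub>R w) = e"
  shows "\<forall>\<^sub>F m in sequentially. indicator (shell K (real (Suc m))) (real (Suc m) *\<^sub>R w) = (indicator (cball 0 1) w :: real)"
    "(\<lambda>m. outer_normal K (real (Suc m) *\<^sub>R w)) \<longlonglongrightarrow> w /\<^sub>R norm w"
proof -
  let ?M = "\<lambda>m. real (Suc m)"
  have "(\<lambda>m. w - (1 / ?M m) *\<^sub>R e) \<longlonglongrightarrow> w - 0 *\<^sub>R e"
    by (intro tendsto_intros LIMSEQ_Suc lim_1_over_n)
  then have l: "(\<lambda>m. w - (1 / ?M m) *\<^sub>R e) \<longlonglongrightarrow> w" by simp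
  have eq: "?M m *\<^sub>R w - e = ?M m *\<^sub>R (w - (1 / ?M m) *\<^sub>R e)" for m
    by (simp add: scaleR_diff_right)
  have nl: "(\<lambda>m. norm (w - (1 / ?M m) *\<^sub>R e)) \<longlonglongrightarrow> norm w" by (intro tendsto_norm l)
  have ne: "norm (?M m *\<^sub>R w - e) = ?M m * norm (w - (1 / ?M m) *\<^sub>R e)" for m
    unfolding eq by simp
  have pos: "\<forall>\<^sub>F m in sequentially. 0 < norm (w - (1 / ?M m) *\<^sub>R e)"
    using order_tendstoD(1)[OF nl, of 0] w(2) by simp
  have side: "\<forall>\<^sub>F m in sequentially. (norm (w - (1 / ?M m) *\<^sub>R e) \<le> 1) = (norm w \<le> 1)"
  proof (cases "norm w < 1")
    case True
    then show ?thesis using order_tendstoD(2)[OF nl, of 1] by (auto elim!: eventually_mono)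
  next
    case False
    then have "norm w > 1" using w(1) by simp
    then show ?thesis using order_tendstoD(1)[OF nl, of 1] by (auto elim!: eventually_mono)
  qed
  show "\<forall>\<^sub>F m in sequentially. indicator (shell K (?M m)) (?M m *\<^sub>R w) = (indicator (cball 0 1) w :: real)"
    using ev pos side
  proof eventually_elim
    case (elim m)
    have "infdist (?M m *\<^sub>R w) K = ?M m * norm (w - (1 / ?M m) *\<^sub>R e)"
      unfolding infdist_closest[OF K] elim(1) by (rule ne)
    then have "?M m *\<^sub>R w \<in> shell K (?M m) \<longleftrightarrow> norm w \<le> 1"
      using elim(2,3) by (simp add: shell_def zero_less_mult_iff del: of_nat_Suc)
    then show ?case by (simp add: indicator_def del: of_nat_Suc)
  qed
  have "(\<lambda>m. (w - (1 / ?M m) *\<^sub>R e) /\<^sub>R norm (w - (1 / ?M m) *\<^sub>R e)) \<longlonglongrightarrow> w /\<^sub>R norm w"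
    by (intro tendsto_intros l nl) (use w(2) in simp)
  moreover have "\<forall>\<^sub>F m in sequentially. (w - (1 / ?M m) *\<^sub>R e) /\<^sub>R norm (w - (1 / ?M m) *\<^sub>R e) = outer_normal K (?M m *\<^sub>R w)"
    using ev
  proof eventually_elim
    case (elim m)
    show ?case unfolding outer_normal_def elim ne unfolding eq by (simp add: field_simps del: of_nat_Suc)
  qed
  ultimately show "(\<lambda>m. outer_normal K (?M m *\<^sub>R w)) \<longlonglongrightarrow> w /\<^sub>R norm w"
    by (rule Lim_transform_eventually)
qed

text \<open>
  The substitution \<open>x = eps w\<close> in the limit for large \<open>eps\<close> turns the shell into the unit ball. For almost every
  \<open>w\<close> the foot point of \<open>eps w\<close> is eventually an end of the segment, whereas the normal only converges to
  \<open>w / \<parallel>w\<parallel>\<close>; this is where the continuity of \<open>f\<close> in the second argument enters.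
\<close>

lemma integral_support_measure_zero_segment:
  fixes a v :: "real^'n" and f :: "(real^'n) \<times> (real^'n) \<Rightarrow> real"
  assumes t: "\<tau> \<ge> 0" and v: "v \<noteq> 0" and f[measurable]: "f \<in> borel_measurable borel"
    and C: "\<And>x u. norm u = 1 \<Longrightarrow> \<bar>f (x, u)\<bar> \<le> C" and cont: "\<And>x u. isCont (\<lambda>u. f (x, u)) u"
  shows "unit_ball_vol (real CARD('n)) * (\<integral>z. f z \<partial>support_measure (segment a v \<tau>) 0) =
    (\<integral>w. indicator (cball 0 1) w * f (segment_end a v \<tau> w, w /\<^sub>R norm w) \<partial>lborel)"
proof (rule LIMSEQ_unique)
  let ?K = "segment a v \<tau>"
  let ?M = "\<lambda>m. real (Suc m)"
  have K: "convex_body ?K" by (rule convex_body_segment[OF t])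
  note [measurable] = borel_measurable_foot_normal[OF K] borel_shell[OF K]
  let ?F = "\<lambda>m x. indicator (shell ?K (?M m)) x * f (foot_normal ?K x)"
  have Fm: "?F m \<in> borel_measurable borel" for m by measurable
  have C0: "C \<ge> 0" using C[of "axis undefined 1" 0] by (simp add: norm_axis_1) 
  obtain R where R: "R \<ge> 0" "?K \<subseteq> cball 0 R" using bounded_cball_superset[OF K] by blast
  show "(\<lambda>m. (\<integral>x. ?F m x \<partial>lborel) / ?M m ^ CARD('n)) \<longlonglongrightarrow> unit_ball_vol (real CARD('n)) * (\<integral>z. f z \<partial>support_measure ?K 0)"
    by (rule support_measure_zero_limit[OF K f C])
  have "(\<integral>x. ?F m x \<partial>lborel) / ?M m ^ CARD('n) = (\<integral>w. ?F m (?M m *\<^sub>R w) \<partial>lborel)" for m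
    using integral_lborel_scale[OF Fm, of "?M m" m] by (simp del: of_nat_Suc)
  moreover have "(\<lambda>m. \<integral>w. ?F m (?M m *\<^sub>R w) \<partial>lborel) \<longlonglongrightarrow> (\<integral>w. indicator (cball 0 1) w * f (segment_end a v \<tau> w, w /\<^sub>R norm w) \<partial>lborel)"
  proof (rule integral_dominated_convergence[where w="\<lambda>w. indicator (cball 0 (1 + R)) w * C"])
    have [measurable]: "(\<lambda>w. (segment_end a v \<tau> w, w /\<^sub>R norm w)) \<in> borel_measurable borel"
      unfolding borel_prod[symmetric] segment_end_def by measurable
    show "(\<lambda>w. indicator (cball 0 1) w * f (segment_end a v \<tau> w, w /\<^sub>R norm w)) \<in> borel_measurable lborel"
      unfolding measurable_lborel2
      by (intro borel_measurable_times borel_measurable_indicator measurable_compose[OF _ f]) auto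
    show "(\<lambda>w. ?F m (?M m *\<^sub>R w)) \<in> borel_measurable lborel" for m
      unfolding measurable_lborel2 by (rule measurable_compose[OF _ Fm[of m]]) measurable
    show "integrable lborel (\<lambda>w. indicator (cball (0::real^'n) (1 + R)) w * C)"
      using emeasure_bounded_finite[OF bounded_cball[of "0::real^'n" "1 + R"]]
      by (intro integrable_mult_left integrable_real_indicator) auto
    show "AE w in lborel. norm (?F m (?M m *\<^sub>R w)) \<le> indicator (cball 0 (1 + R)) w * C" for m
    proof (rule AE_I2)
      fix w :: "real^'n"
      show "norm (?F m (?M m *\<^sub>R w)) \<le> indicator (cball 0 (1 + R)) w * C"
      proof (cases "?M m *\<^sub>R w \<in> shell ?K (?M m)")
        case True
        then have "?M m *\<^sub>R w \<notin> ?K" by (simp add: shell_def infdist_pos_iff[OF K] del: of_nat_Suc)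
        then have "\<bar>f (foot_normal ?K (?M m *\<^sub>R w))\<bar> \<le> C"
          using C[OF norm_outer_normal[OF K]] by (simp add: foot_normal_def del: of_nat_Suc)
        note fC = this
        have "?M m * norm w \<le> R + ?M m" using subsetD[OF shell_subset_cball[OF K R(2)] True] by (simp del: of_nat_Suc)
        moreover have "1 * R \<le> ?M m * R" using R(1) by (intro mult_right_mono) auto
        then have "R + ?M m \<le> ?M m * R + ?M m * 1" by (simp only: mult_1 mult_1_right add_right_mono)
        ultimately have "?M m * norm w \<le> ?M m * (1 + R)" unfolding distrib_left by (metis add.commute order_trans)
        then have "norm w \<le> 1 + R" by (simp only: mult_le_cancel_left_pos of_nat_0_less_iff zero_less_Suc)
        then show ?thesis using True fC by (simp del: of_nat_Suc)
      qed (use C0 in \<open>simp del: of_nat_Suc\<close>)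
    qed
    have "AE w in lborel. w \<bullet> v \<noteq> 0 \<and> norm w \<noteq> 1"
      using AE_inner_neq_0[OF v] AE_norm_neq[of 1] by auto
    then show "AE w in lborel. (\<lambda>m. ?F m (?M m *\<^sub>R w)) \<longlonglongrightarrow> indicator (cball 0 1) w * f (segment_end a v \<tau> w, w /\<^sub>R norm w)"
    proof (rule AE_mp, intro AE_I2 impI)
      fix w :: "real^'n" assume w: "w \<bullet> v \<noteq> 0 \<and> norm w \<noteq> 1"
      let ?e = "segment_end a v \<tau> w"
      have w0: "w \<noteq> 0" "norm w \<noteq> 1" "w \<bullet> v \<noteq> 0" using w by auto
      note ev = closest_point_segment_far[OF t w0(3), of a]
      note lim = shell_scaled_limit[OF K w0(2,1) ev]
      have "(\<lambda>m. indicator (cball 0 1) w * f (?e, outer_normal ?K (?M m *\<^sub>R w))) \<longlonglongrightarrow> indicator (cball 0 1) w * f (?e, w /\<^sub>R norm w)"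
        by (intro tendsto_mult tendsto_const isCont_tendsto_compose[OF cont] lim)
      moreover have "\<forall>\<^sub>F m in sequentially. indicator (cball 0 1) w * f (?e, outer_normal ?K (?M m *\<^sub>R w)) = ?F m (?M m *\<^sub>R w)"
        using ev lim(1)
      proof eventually_elim
        case (elim m)
        show ?case unfolding elim(2) foot_normal_def elim(1) ..
      qed
      ultimately show "(\<lambda>m. ?F m (?M m *\<^sub>R w)) \<longlonglongrightarrow> indicator (cball 0 1) w * f (?e, w /\<^sub>R norm w)"
        by (rule Lim_transform_eventually)
    qed
  qed
  ultimately show "(\<lambda>m. (\<integral>x. ?F m x \<partial>lborel) / ?M m ^ CARD('n)) \<longlonglongrightarrow> (\<integral>w. indicator (cball 0 1) w * f (segment_end a v \<tau> w, w /\<^sub>R norm w) \<partial>lborel)"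
    by (simp only:)
qed


section \<open>The distance to a convex body along a line\<close>

text \<open>
  Throughout, \<open>D\<close> is the distance to \<open>K\<close> along the line with unit direction \<open>v\<close> through \<open>x\<close>. Outside of \<open>K\<close>
  its derivative is \<open>u \<bullet> v\<close> for the outer normal \<open>u\<close>, so that integrals of the positive part of
  \<open>u \<bullet> v\<close> along the line are increments of \<open>D\<close>.
\<close>

context
  fixes K :: "(real^'n) set" and x v :: "real^'n"
  assumes K: "convex_body K" and v: "norm v = 1"
begin

abbreviation (input) pt where "pt s \<equiv> x + s *\<^sub>R v"
abbreviation (input) D where "D s \<equiv> infdist (x + s *\<^sub>R v) K"
abbreviation (input) slope where "slope s \<equiv> outer_normal K (x + s *\<^sub>R v) \<bullet> v"

definition rising where "rising = {s. D s > 0 \<and> slope s > 0}"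

lemma unit_facts: assumes "D s > 0"
  shows "pt s \<notin> K" "norm (outer_normal K (pt s)) = 1"
    "outer_normal K (pt s) \<bullet> (pt s - closest_point K (pt s)) = D s"
    "pt s - closest_point K (pt s) = D s *\<^sub>R outer_normal K (pt s)"
proof -
  show 1: "pt s \<notin> K" using assms infdist_pos_iff[OF K] by blast
  show 2: "norm (outer_normal K (pt s)) = 1" by (rule norm_outer_normal[OF K 1])
  show 3: "pt s - closest_point K (pt s) = D s *\<^sub>R outer_normal K (pt s)"
    using assms unfolding outer_normal_def infdist_closest[OF K] by simp
  show "outer_normal K (pt s) \<bullet> (pt s - closest_point K (pt s)) = D s"
    unfolding 3 using 2 by (simp add: norm_eq_1)
qed

text \<open>
  The distance function is convex and its gradient outside of \<open>K\<close> is the outer unit normal at the foot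
  point.
\<close>

lemma subgradient: assumes "D s > 0" shows "D t \<ge> D s + (t - s) * slope s"
proof -
  let ?u = "outer_normal K (pt s)" and ?p = "closest_point K (pt s)" and ?q = "closest_point K (pt t)"
  note uf = unit_facts[OF assms]
  have "(pt s - ?p) \<bullet> (?q - ?p) \<le> 0" using closest_point_iff[OF K, of "pt s" ?p] closest_in[OF K, of "pt t"] by blast
  then have "D s * (?u \<bullet> (?q - ?p)) \<le> 0" unfolding uf(4) by simp
  then have q: "?u \<bullet> (?q - ?p) \<le> 0" using assms by (simp add: mult_le_0_iff)
  have "?u \<bullet> (pt t - ?q) \<le> norm ?u * norm (pt t - ?q)" by (rule norm_cauchy_schwarz)
  then have "?u \<bullet> (pt t - ?q) \<le> D t" using uf(2) by (simp add: infdist_closest[OF K])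
  moreover have "?u \<bullet> (pt t - ?q) = ?u \<bullet> (pt s - ?p) + (t - s) * (?u \<bullet> v) - ?u \<bullet> (?q - ?p)"
    by (simp add: inner_diff_right inner_add_right algebra_simps)
  ultimately show ?thesis using q uf(3) by linarith
qed

lemma continuous_D: "continuous_on S (\<lambda>s. D s)"
  by (intro continuous_intros)

lemma isCont_D: "isCont (\<lambda>s. D s) s"
  using continuous_D[of UNIV] continuous_on_eq_continuous_at[OF open_UNIV] by blast

lemma isCont_slope: assumes "D s > 0" shows "isCont (\<lambda>s. slope s) s"
proof -
  have c: "isCont (closest_point K) z" for z
    by (rule continuous_at_closest_point[OF bodyD(3,4,1)[OF K]])
  have "isCont (\<lambda>s. closest_point K (pt s)) s"
    by (rule isCont_o2[OF _ c]) (intro continuous_intros)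
  moreover have "norm (pt s - closest_point K (pt s)) \<noteq> 0" using assms infdist_closest[OF K, of "pt s"] by simp
  ultimately show ?thesis unfolding outer_normal_def by (intro continuous_intros) auto
qed

lemma D_derivative: assumes s: "D s > 0" shows "((\<lambda>s. D s) has_real_derivative slope s) (at s)"
proof -
  have pos: "\<forall>\<^sub>F t in at s. D t > 0"
    using order_tendstoD(1)[OF isContD[OF isCont_D[of s]] s] .
  have lim: "((\<lambda>t. slope t) \<longlongrightarrow> slope s) (at s)" using isCont_slope[OF s] by (simp add: isCont_def)
  have q1: "\<forall>\<^sub>F t in at s. min (slope s) (slope t) \<le> (D t - D s) / (t - s)"
    using pos eventually_neq_at_within[of s s UNIV]
  proof eventually_elim
    case (elim t)
    have 1: "D t - D s \<ge> (t - s) * slope s" using subgradient[OF s, of t] by linarith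
    have 2: "D t - D s \<le> (t - s) * slope t" using subgradient[OF elim(1), of s] by (simp add: algebra_simps)
    show ?case
    proof (cases "t > s")
      case True then have "slope s \<le> (D t - D s) / (t - s)" using 1 by (simp add: le_divide_eq mult.commute)
      then show ?thesis by linarith
    next
      case False then have "t < s" using elim(2) by simp
      then have "slope t \<le> (D t - D s) / (t - s)" using 2 by (simp add: le_divide_eq mult.commute)
      then show ?thesis by linarith
    qed
  qed
  have q2: "\<forall>\<^sub>F t in at s. (D t - D s) / (t - s) \<le> max (slope s) (slope t)"
    using pos eventually_neq_at_within[of s s UNIV]
  proof eventually_elim
    case (elim t)
    have 1: "D t - D s \<ge> (t - s) * slope s" using subgradient[OF s, of t] by linarith
    have 2: "D t - D s \<le> (t - s) * slope t" using subgradient[OF elim(1), of s] by (simp add: algebra_simps)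
    show ?case
    proof (cases "t > s")
      case True then have "(D t - D s) / (t - s) \<le> slope t" using 2 by (simp add: divide_le_eq mult.commute)
      then show ?thesis by linarith
    next
      case False then have "t < s" using elim(2) by simp
      then have "(D t - D s) / (t - s) \<le> slope s" using 1 by (simp add: divide_le_eq mult.commute)
      then show ?thesis by linarith
    qed
  qed
  have "((\<lambda>t. min (slope s) (slope t)) \<longlongrightarrow> min (slope s) (slope s)) (at s)" by (intro tendsto_min tendsto_const lim)
  then have l1: "((\<lambda>t. min (slope s) (slope t)) \<longlongrightarrow> slope s) (at s)" by simp
  have "((\<lambda>t. max (slope s) (slope t)) \<longlongrightarrow> max (slope s) (slope s)) (at s)" by (intro tendsto_max tendsto_const lim)
  then have l2: "((\<lambda>t. max (slope s) (slope t)) \<longlongrightarrow> slope s) (at s)" by simp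
  have "((\<lambda>t. (D t - D s) / (t - s)) \<longlongrightarrow> slope s) (at s)" by (rule tendsto_sandwich[OF q1 q2 l1 l2])
  then show ?thesis by (simp only: has_field_derivative_iff)
qed

lemma rising_up: assumes "s \<in> rising" "s \<le> t" shows "t \<in> rising" "D s \<le> D t"
proof -
  have s: "D s > 0" "slope s > 0" using assms by (auto simp: rising_def)
  have ge: "D t \<ge> D s + (t - s) * slope s" by (rule subgradient[OF s(1)])
  moreover have p: "(t - s) * slope s \<ge> 0" using assms(2) s(2) by simp
  ultimately show "D s \<le> D t" by linarith
  then have t: "D t > 0" using s by linarith
  show "t \<in> rising"
  proof (cases "t = s")
    case False
    then have lt: "s < t" using assms(2) by simp
    have "D s \<ge> D t + (s - t) * slope t" by (rule subgradient[OF t])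
    then have "(t - s) * slope t \<ge> D t - D s" by (simp add: algebra_simps)
    also have "D t - D s \<ge> (t - s) * slope s" using ge by linarith
    finally have "slope s \<le> slope t" using lt by (simp add: mult_le_cancel_left_pos)
    then show ?thesis using t s by (simp add: rising_def)
  qed (use assms in simp)
qed

lemma D_ge: obtains c where "\<And>s. D s \<ge> \<bar>s\<bar> - c"
proof -
  obtain R where R: "R \<ge> 0" "K \<subseteq> cball 0 R" using bounded_cball_superset[OF K] by blast
  have "D s \<ge> \<bar>s\<bar> - (norm x + R)" for s
  proof -
    have "norm (closest_point K (pt s)) \<le> R" using R closest_in[OF K, of "pt s"] by auto
    moreover have "norm (s *\<^sub>R v) \<le> norm (pt s - closest_point K (pt s)) + norm x + norm (closest_point K (pt s))"
    proof -
      have "s *\<^sub>R v = (pt s - closest_point K (pt s)) + (closest_point K (pt s) - x)" by simp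
      then have "norm (s *\<^sub>R v) \<le> norm (pt s - closest_point K (pt s)) + norm (closest_point K (pt s) - x)"
        by (metis norm_triangle_ineq)
      moreover have "norm (closest_point K (pt s) - x) \<le> norm (closest_point K (pt s)) + norm x" by (rule norm_triangle_ineq4)
      ultimately show ?thesis by linarith
    qed
    ultimately show ?thesis using v by (simp add: infdist_closest[OF K])
  qed
  then show ?thesis using that by blast
qed

text \<open>
  By convexity the distance along the line increases from some parameter \<open>a\<close> on. If the line meets \<open>K\<close>, the
  point at \<open>a\<close> is the last point of \<open>K\<close> on the line.
\<close>

lemma rising_threshold: obtains a where "{a<..} \<subseteq> rising" "rising \<subseteq> {a..}"
proof -
  obtain c where c: "\<And>s. D s \<ge> \<bar>s\<bar> - c" using D_ge by metis
  have "rising \<noteq> {}"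
  proof -
    let ?s = "D 0 + \<bar>c\<bar> + 1"
    have s: "?s > 0" using infdist_nonneg[of "pt 0" K] by linarith
    have big: "D ?s > D 0" using c[of ?s] s by linarith
    then have p: "D ?s > 0" using infdist_nonneg[of "pt 0" K] by linarith
    have "D 0 \<ge> D ?s + (0 - ?s) * slope ?s" by (rule subgradient[OF p])
    then have "?s * slope ?s > 0" using big by (simp add: algebra_simps)
    then have "slope ?s > 0" using s by (simp add: zero_less_mult_iff)
    then have "?s \<in> rising" using p by (simp add: rising_def)
    then show ?thesis by blast
  qed
  moreover have bb: "bdd_below rising"
  proof (rule bdd_belowI)
    fix s assume "s \<in> rising"
    show "- (D 0 + \<bar>c\<bar>) - 1 \<le> s"
    proof (rule ccontr)
      assume "\<not> - (D 0 + \<bar>c\<bar>) - 1 \<le> s"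
      then have lt: "s < - (D 0 + \<bar>c\<bar>) - 1" by simp
      then have "s \<le> 0" using infdist_nonneg[of "pt 0" K] by linarith
      then have "D s \<le> D 0" using rising_up(2)[OF \<open>s \<in> rising\<close>] by blast
      then show False using c[of s] lt by linarith
    qed
  qed
  ultimately have ne: "rising \<noteq> {}" by blast
  have "{Inf rising<..} \<subseteq> rising"
  proof
    fix t assume "t \<in> {Inf rising<..}"
    then obtain s where "s \<in> rising" "s < t" using cInf_lessD[OF ne] by auto
    then show "t \<in> rising" using rising_up(1) by simp
  qed
  moreover have "rising \<subseteq> {Inf rising..}" using bb by (auto intro: cInf_lower)
  ultimately show ?thesis using that by blast
qed

lemma D_strict_mono: assumes a: "{a<..} \<subseteq> rising" "a \<le> s" "s < t" shows "D s < D t"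
proof -
  have m: "D s' < D t" if "a < s'" "s' < t" for s' t
  proof -
    have r: "D s' > 0" "slope s' > 0" using a(1) that by (auto simp: rising_def)
    have "D t \<ge> D s' + (t - s') * slope s'" by (rule subgradient[OF r(1)])
    moreover have "(t - s') * slope s' > 0" using r that by simp
    ultimately show ?thesis by linarith
  qed
  show ?thesis
  proof (cases "a = s")
    case False then show ?thesis using m a by simp
  next
    case True
    let ?m = "(s + t) / 2"
    have "D s \<le> D ?m"
    proof (rule tendsto_upperbound)
      show "((\<lambda>s. D s) \<longlongrightarrow> D s) (at_right s)"
        using isCont_D[of s] by (simp add: isCont_def filterlim_at_split)
      have "\<forall>\<^sub>F s' in at_right s. s' < ?m" using a(3) by (intro eventually_at_rightI[of s ?m]) auto
      moreover have "\<forall>\<^sub>F s' in at_right s. s < s'" by (simp add: eventually_at_filter)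
      ultimately show "\<forall>\<^sub>F s' in at_right s. D s' \<le> D ?m"
        by eventually_elim (use m True in \<open>auto intro: less_imp_le\<close>)
    qed simp
    also have "D ?m < D t" using m[of ?m t] True a(3) by simp
    finally show ?thesis .
  qed
qed

text \<open>
  The slope is the derivative of the distance, so this is the fundamental theorem of calculus.
\<close>

lemma nn_integral_slope:
  assumes a: "{a<..} \<subseteq> rising" and b: "a \<le> b"
  shows "(\<integral>\<^sup>+s. indicator {a<..b} s * ennreal (slope s) \<partial>lborel) = ennreal (D b - D a)"
proof -
  note [measurable] = borel_measurable_outer_normal[OF K]
  have "(slope has_integral (D b - D a)) {a..b}"
  proof (rule fundamental_theorem_of_calculus_interior[OF b continuous_D])
    fix s assume "s \<in> {a<..<b}"
    then have "D s > 0" using a by (auto simp: rising_def)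
    from D_derivative[OF this] show "((\<lambda>s. D s) has_vector_derivative slope s) (at s)"
      by (simp add: has_real_derivative_iff_has_vector_derivative)
  qed
  then have "((\<lambda>s. if s \<in> {a..b} then slope s else 0) has_integral (D b - D a)) UNIV"
    by (simp only: has_integral_restrict_UNIV)
  then have "((\<lambda>s. indicator {a<..b} s * slope s) has_integral (D b - D a)) UNIV"
    by (rule has_integral_spike[OF negligible_sing[of a], rotated]) (auto simp: indicator_def)
  then have "(\<integral>\<^sup>+s. ennreal (indicator {a<..b} s * slope s) \<partial>lborel) = ennreal (D b - D a)"
  proof (rule nn_integral_has_integral_lborel[rotated 2])
    show "(\<lambda>s. indicator {a<..b} s * slope s) \<in> borel_measurable borel" by measurable
    show "0 \<le> indicator {a<..b} s * slope s" for s
      using a by (auto simp: indicator_def rising_def)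
  qed
  moreover have "(\<integral>\<^sup>+s. ennreal (indicator {a<..b} s * slope s) \<partial>lborel) = (\<integral>\<^sup>+s. indicator {a<..b} s * ennreal (slope s) \<partial>lborel)"
    by (intro nn_integral_cong) (auto simp: indicator_def)
  ultimately show ?thesis by simp
qed

lemma level_point:
  assumes a: "{a<..} \<subseteq> rising" and e: "D a \<le> eps"
  obtains b where "a \<le> b" "D b = eps" "{s. a < s \<and> D s \<le> eps} = {a<..b}"
proof -
  obtain c where c: "\<And>s. D s \<ge> \<bar>s\<bar> - c" using D_ge by metis
  let ?t = "max a (eps + \<bar>c\<bar>)"
  have "\<exists>b\<ge>a. b \<le> ?t \<and> D b = eps"
    by (rule IVT'[OF e _ _ continuous_D]) (use c[of ?t] in auto)
  then obtain b where b: "a \<le> b" "D b = eps" by blast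
  have "{s. a < s \<and> D s \<le> eps} = {a<..b}"
  proof -
    have "D s \<le> eps \<longleftrightarrow> s \<le> b" if "a < s" for s
    proof
      assume "s \<le> b"
      then consider "s = b" | "s < b" by linarith
      then show "D s \<le> eps" using D_strict_mono[OF a, of s b] b(2) that by cases auto
    next
      assume le: "D s \<le> eps"
      show "s \<le> b" using D_strict_mono[OF a b(1), of s] b(2) le by (rule_tac ccontr) auto
    qed
    then show ?thesis by auto
  qed
  then show ?thesis using that b by blast
qed

text \<open>
  The contribution of a single line to the shell integral of \<open>g p * max 0 (u \<bullet> v)\<close>. The factor is nonzero only
  where the distance increases along the line.
\<close>

definition layer :: "(real^'n \<Rightarrow> real) \<Rightarrow> real \<Rightarrow> ennreal" where
  "layer g eps = (\<integral>\<^sup>+s. indicator (shell K eps) (pt s) * ennreal (g (closest_point K (pt s)) * max 0 (slope s)) \<partial>lborel)"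

lemma layer_eq:
  assumes a: "{a<..} \<subseteq> rising" "rising \<subseteq> {a..}" and g: "\<And>z. 0 \<le> g z"
  shows "layer g eps = (\<integral>\<^sup>+s. indicator {s. a < s \<and> D s \<le> eps} s * ennreal (slope s) * ennreal (g (closest_point K (pt s))) \<partial>lborel)"
  unfolding layer_def
proof (intro nn_integral_cong_AE eventually_mono[OF AE_lborel_singleton[of a]])
  fix s assume s: "s \<noteq> a"
  show "indicator (shell K eps) (pt s) * ennreal (g (closest_point K (pt s)) * max 0 (slope s)) = indicator {s. a < s \<and> D s \<le> eps} s * ennreal (slope s) * ennreal (g (closest_point K (pt s)))"
  proof (cases "a < s")
    case True
    then have "s \<in> rising" using a by auto
    then have "D s > 0" "slope s > 0" by (auto simp: rising_def)
    then show ?thesis using True g[of "closest_point K (pt s)"]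
      by (auto simp: shell_def indicator_def ennreal_mult[symmetric] mult.commute)
  next
    case False
    then have "s \<notin> rising" using a s by auto
    then have "\<not> (D s > 0 \<and> slope s > 0)" by (simp add: rising_def)
    then show ?thesis using False by (auto simp: shell_def indicator_def max_def)
  qed
qed

text \<open>
  The slope integrates over the layer to a difference of distances, which is at most \<open>eps\<close>. This uniform
  bound is the dominating function for the limit \<open>eps \<rightarrow> 0\<close>.
\<close>

lemma layer_le:
  assumes g: "\<And>z. 0 \<le> g z" "\<And>z. g z \<le> C" and e: "eps > 0"
  shows "layer g eps \<le> ennreal C * ennreal eps"
proof -
  note [measurable] = borel_measurable_outer_normal[OF K]
  obtain a where a: "{a<..} \<subseteq> rising" "rising \<subseteq> {a..}" using rising_threshold by blast
  show ?thesis
  proof (cases "D a \<le> eps")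
    case True
    obtain b where b: "a \<le> b" "D b = eps" "{s. a < s \<and> D s \<le> eps} = {a<..b}" by (rule level_point[OF a(1) True])
    have "layer g eps \<le> (\<integral>\<^sup>+s. ennreal C * (indicator {a<..b} s * ennreal (slope s)) \<partial>lborel)"
      unfolding layer_eq[OF a g(1)] b(3)
    proof (rule nn_integral_mono)
      fix s
      have "ennreal (g (closest_point K (pt s))) \<le> ennreal C" by (intro ennreal_leI g)
      then show "indicator {a<..b} s * ennreal (slope s) * ennreal (g (closest_point K (pt s))) \<le> ennreal C * (indicator {a<..b} s * ennreal (slope s))"
        by (subst mult.commute) (rule mult_right_mono, auto)
    qed
    also have "\<dots> = ennreal C * (\<integral>\<^sup>+s. indicator {a<..b} s * ennreal (slope s) \<partial>lborel)"
      by (rule nn_integral_cmult) measurable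
    also have "\<dots> = ennreal C * ennreal (D b - D a)" by (simp only: nn_integral_slope[OF a(1) b(1)])
    also have "\<dots> \<le> ennreal C * ennreal eps"
      using b(2) infdist_nonneg[of "pt a" K] by (intro mult_left_mono ennreal_leI) auto
    finally show ?thesis .
  next
    case False
    have "{s. a < s \<and> D s \<le> eps} = {}"
      using False D_strict_mono[OF a(1) order_refl] by force
    then show ?thesis unfolding layer_eq[OF a g(1)] by simp
  qed
qed

text \<open>
  Along a line that misses \<open>K\<close> the distance has a positive minimum.
\<close>

lemma layer_miss:
  assumes miss: "\<And>s. pt s \<notin> K" and g: "\<And>z. 0 \<le> g z"
  shows "\<forall>\<^sub>F eps in at_right 0. layer g eps = 0"
proof -
  obtain a where a: "{a<..} \<subseteq> rising" "rising \<subseteq> {a..}" using rising_threshold by blast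
  have "D a > 0" using miss infdist_pos_iff[OF K] by blast
  then have "\<forall>\<^sub>F eps in at_right 0. eps < D a" by (intro eventually_at_rightI[of 0 "D a"]) auto
  then show ?thesis
  proof eventually_elim
    case (elim eps)
    have "{s. a < s \<and> D s \<le> eps} = {}"
      using elim D_strict_mono[OF a(1) order_refl] by force
    then show ?case unfolding layer_eq[OF a g] by simp
  qed
qed

lemma threshold_top:
  assumes a: "{a<..} \<subseteq> rising" "rising \<subseteq> {a..}" and hit: "pt s0 \<in> K"
  shows "pt a \<in> K" "\<And>s. pt s \<in> K \<Longrightarrow> s \<le> a"
proof -
  show le: "s \<le> a" if "pt s \<in> K" for s
  proof (rule ccontr)
    assume "\<not> s \<le> a"
    then have "s \<in> rising" using a(1) by auto
    then have "D s > 0" by (simp add: rising_def)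
    then show False using that infdist_pos_iff[OF K, of "pt s"] by simp
  qed
  show "pt a \<in> K"
  proof (rule ccontr)
    assume "pt a \<notin> K"
    then have Da: "D a > 0" using infdist_pos_iff[OF K] by blast
    have D0: "D s0 = 0" using hit by simp
    have lt: "s0 < a" using le[OF hit] Da D0 by (cases "s0 = a") auto
    have "\<forall>\<^sub>F t in at_left a. D t > 0"
      using isCont_D[of a] Da by (auto simp: isCont_def filterlim_at_split intro: order_tendstoD(1))
    moreover have "\<forall>\<^sub>F t in at_left a. t \<in> {s0<..<a}" using lt by (rule eventually_at_left_real)
    ultimately have "\<forall>\<^sub>F t in at_left a. D t > 0 \<and> s0 < t \<and> t < a" by eventually_elim auto
    then obtain t where t: "D t > 0" "s0 < t" "t < a" using eventually_happens[of _ "at_left a"] by auto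
    have "t \<notin> rising" using a(2) t(3) by auto
    then have "slope t \<le> 0" using t(1) by (simp add: rising_def)
    then have "(s0 - t) * slope t \<ge> 0" using t(2) by (simp add: mult_nonpos_nonpos)
    then show False using subgradient[OF t(1), of s0] D0 t(1) by linarith
  qed
qed

text \<open>
  If the line hits \<open>K\<close>, then the slope has total mass \<open>eps\<close> on the rising part of the layer, and this mass
  concentrates at the last point of \<open>K\<close> on the line.
\<close>

lemma layer_hit:
  assumes a: "{a<..} \<subseteq> rising" "rising \<subseteq> {a..}" and top: "pt a \<in> K"
    and g: "\<And>z. 0 \<le> g z" "isCont g (pt a)"
  shows "((\<lambda>eps. ennreal (1 / eps) * layer g eps) \<longlongrightarrow> ennreal (g (pt a))) (at_right 0)"
proof -
  note [measurable] = borel_measurable_outer_normal[OF K]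
  have Da: "D a = 0" using top by simp
  have main: "\<forall>\<^sub>F eps in at_right 0. ennreal (g (pt a) - \<eta>) \<le> ennreal (1 / eps) * layer g eps \<and> ennreal (1 / eps) * layer g eps \<le> ennreal (g (pt a) + \<eta>)" if \<eta>: "\<eta> > 0" for \<eta>
  proof -
    obtain \<delta> where \<delta>: "\<delta> > 0" "\<And>z. dist z (pt a) < \<delta> \<Longrightarrow> \<bar>g z - g (pt a)\<bar> < \<eta>"
      using g(2) \<eta> unfolding continuous_at_eps_delta dist_real_def by blast
    have Dd: "D (a + \<delta> / 2) > 0" using D_strict_mono[OF a(1) order_refl, of "a + \<delta> / 2"] \<delta>(1) Da by simp
    have "\<forall>\<^sub>F eps in at_right 0. eps \<in> {0<..<D (a + \<delta> / 2)}" using Dd by (rule eventually_at_right_real)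
    then show ?thesis
    proof eventually_elim
      case (elim eps)
      then have e: "0 < eps" "eps < D (a + \<delta> / 2)" by auto
      have "D a \<le> eps" using Da e by simp
      then obtain b where b: "a \<le> b" "D b = eps" "{s. a < s \<and> D s \<le> eps} = {a<..b}" by (rule level_point[OF a(1)])
      have "b < a + \<delta> / 2"
      proof (rule ccontr)
        assume "\<not> b < a + \<delta> / 2"
        then consider "b = a + \<delta> / 2" | "a + \<delta> / 2 < b" by linarith
        then show False using D_strict_mono[OF a(1), of "a + \<delta> / 2" b] \<delta>(1) e(2) b(2) by cases auto
      qed
      have near: "\<bar>g (closest_point K (pt s)) - g (pt a)\<bar> < \<eta>" if "s \<in> {a<..b}" for s
      proof (rule \<delta>(2))
        have "dist (closest_point K (pt s)) (closest_point K (pt a)) \<le> dist (pt s) (pt a)"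
          by (rule closest_point_lipschitz[OF bodyD(3,4,1)[OF K]])
        moreover have "dist (pt s) (pt a) = \<bar>s - a\<bar>"
          using v by (simp add: dist_norm scaleR_diff_left[symmetric])
        ultimately show "dist (closest_point K (pt s)) (pt a) < \<delta>"
          using that \<open>b < a + \<delta> / 2\<close> \<delta>(1) closest_point_self[OF top] by auto
      qed
      have sl: "0 \<le> slope s" if "s \<in> {a<..b}" for s using that a(1) by (auto simp: rising_def)
      have I: "(\<integral>\<^sup>+s. indicator {a<..b} s * ennreal (slope s) * ennreal c \<partial>lborel) = ennreal eps * ennreal c" for c
        by (subst nn_integral_multc) (auto simp: nn_integral_slope[OF a(1) b(1)] b(2) Da)
      have lay: "layer g eps = (\<integral>\<^sup>+s. indicator {a<..b} s * ennreal (slope s) * ennreal (g (closest_point K (pt s))) \<partial>lborel)"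
        unfolding layer_eq[OF a g(1)] b(3) ..
      have "ennreal eps * ennreal (g (pt a) - \<eta>) \<le> layer g eps"
        unfolding lay I[symmetric]
      proof (rule nn_integral_mono)
        fix s show "indicator {a<..b} s * ennreal (slope s) * ennreal (g (pt a) - \<eta>) \<le> indicator {a<..b} s * ennreal (slope s) * ennreal (g (closest_point K (pt s)))"
          using near[of s] by (cases "s \<in> {a<..b}") (auto intro!: mult_left_mono ennreal_leI)
      qed
      moreover have "layer g eps \<le> ennreal eps * ennreal (g (pt a) + \<eta>)"
        unfolding lay I[symmetric]
      proof (rule nn_integral_mono)
        fix s show "indicator {a<..b} s * ennreal (slope s) * ennreal (g (closest_point K (pt s))) \<le> indicator {a<..b} s * ennreal (slope s) * ennreal (g (pt a) + \<eta>)"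
          using near[of s] by (cases "s \<in> {a<..b}") (auto intro!: mult_left_mono ennreal_leI)
      qed
      ultimately have "ennreal (1 / eps) * (ennreal eps * ennreal (g (pt a) - \<eta>)) \<le> ennreal (1 / eps) * layer g eps"
        "ennreal (1 / eps) * layer g eps \<le> ennreal (1 / eps) * (ennreal eps * ennreal (g (pt a) + \<eta>))"
        by (auto intro: mult_left_mono)
      moreover have "ennreal (1 / eps) * (ennreal eps * y) = y" for y
        using e(1) by (simp add: mult.assoc[symmetric] ennreal_mult[symmetric])
      ultimately show ?case by (simp only:)
    qed
  qed
  let ?L = "\<lambda>eps. ennreal (1 / eps) * layer g eps"
  have main': "\<forall>\<^sub>F eps in at_right 0. ?L eps < \<top> \<and> \<bar>enn2real (?L eps) - g (pt a)\<bar> \<le> \<eta>" if \<eta>: "\<eta> > 0" for \<eta>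
    using main[OF \<eta>]
  proof eventually_elim
    case (elim eps)
    have g0: "0 \<le> g (pt a)" by (rule g)
    have fin: "?L eps < \<top>" using elim by (meson ennreal_less_top le_less_trans)
    then obtain r where r: "?L eps = ennreal r" "r \<ge> 0" by (cases "?L eps") auto
    have "ennreal r \<le> ennreal (g (pt a) + \<eta>)" using elim unfolding r(1) by blast
    then have "r \<le> g (pt a) + \<eta>" using g0 \<eta> by (subst (asm) ennreal_le_iff) auto
    moreover have "g (pt a) - \<eta> \<le> r"
      using elim r by (cases "g (pt a) - \<eta> \<le> 0") (auto simp: ennreal_le_iff)
    ultimately show ?case using fin r by (simp add: abs_le_iff)
  qed
  have "((\<lambda>eps. enn2real (?L eps)) \<longlongrightarrow> g (pt a)) (at_right 0)"
    unfolding tendsto_iff dist_real_def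
  proof (intro allI impI)
    fix e :: real assume "e > 0"
    then have "e / 2 > 0" by simp
    from main'[OF this] show "\<forall>\<^sub>F eps in at_right 0. \<bar>enn2real (?L eps) - g (pt a)\<bar> < e"
      by eventually_elim (use \<open>e > 0\<close> in linarith)
  qed
  then have "((\<lambda>eps. ennreal (enn2real (?L eps))) \<longlongrightarrow> ennreal (g (pt a))) (at_right 0)"
    by (rule tendsto_ennrealI)
  moreover have "\<forall>\<^sub>F eps in at_right 0. ennreal (enn2real (?L eps)) = ?L eps"
    using main'[OF zero_less_one] by eventually_elim (auto simp: ennreal_enn2real)
  ultimately show ?thesis by (rule Lim_transform_eventually)
qed

end


section \<open>Rotation invariant measures on the sphere\<close>

text \<open>
  In dimension one the identity is the only rotation; from dimension two on, rotations act transitively on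
  the sphere.
\<close>

lemma emeasure_ball_rotation:
  fixes \<mu> :: "(real^'n) measure"
  assumes s: "sets \<mu> = sets borel" and n: "CARD('n) \<ge> 2"
    and inv: "\<And>\<rho>. rotation \<rho> \<Longrightarrow> distr \<mu> borel \<rho> = \<mu>" and xy: "norm x = 1" "norm y = 1"
  shows "emeasure \<mu> (ball x r) = emeasure \<mu> (ball y r)"
proof -
  obtain \<rho> where \<rho>: "orthogonal_transformation \<rho>" "det (matrix \<rho>) = 1" "\<rho> x = y"
    using rotation_exists_1[OF n xy] by metis
  have m: "\<rho> \<in> measurable \<mu> borel"
    unfolding measurable_cong_sets[OF s refl]
    using \<rho>(1) by (intro borel_measurable_continuous_onI linear_continuous_on linear_conv_bounded_linear[THEN iffD1] orthogonal_transformation_linear)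
  have sp: "space \<mu> = UNIV" using sets_eq_imp_space_eq[OF s] by simp
  have "\<rho> -` ball y r = ball x r"
  proof -
    have "dist y (\<rho> z) = dist x z" for z
      using \<rho>(1) unfolding orthogonal_transformation_isometry \<rho>(3)[symmetric] by blast
    then show ?thesis by auto
  qed
  then have "emeasure (distr \<mu> borel \<rho>) (ball y r) = emeasure \<mu> (ball x r)"
    by (subst emeasure_distr[OF m]) (auto simp: sp)
  then show ?thesis using inv[of \<rho>] \<rho> by (simp add: rotation_def)
qed

text \<open>
  Christensen's argument for uniformly distributed measures. Balls of radius \<open>r\<close> centred on the sphere have
  a mass that does not depend on the centre, and Fubini's theorem for the relation \<open>dist x y < r\<close> shows that this mass
  is the same for both measures. Applying Fubini's theorem to the same relation restricted to \<open>U \<times> U\<close> and normalized by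
  that mass, and Fatou's lemma for \<open>r \<rightarrow> 0\<close>, gives the inequality.
\<close>

lemma spherical_measure_le:
  fixes \<mu> \<nu> :: "(real^'n) measure"
  assumes fin: "finite_measure \<mu>" "finite_measure \<nu>" and s: "sets \<mu> = sets borel" "sets \<nu> = sets borel"
    and conc: "emeasure \<mu> (- sphere 0 1) = 0" "emeasure \<nu> (- sphere 0 1) = 0"
    and tot: "emeasure \<mu> (sphere 0 1) = emeasure \<nu> (sphere 0 1)" "emeasure \<nu> (sphere 0 1) > 0"
    and ball: "\<And>r x y. norm x = 1 \<Longrightarrow> norm y = 1 \<Longrightarrow> emeasure \<mu> (ball x r) = emeasure \<mu> (ball y r)"
      "\<And>r x y. norm x = 1 \<Longrightarrow> norm y = 1 \<Longrightarrow> emeasure \<nu> (ball x r) = emeasure \<nu> (ball y r)"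
    and U: "open U"
  shows "emeasure \<mu> U \<le> emeasure \<nu> U"
proof -
  interpret M: finite_measure \<mu> by fact
  interpret N: finite_measure \<nu> by fact
  interpret pair_sigma_finite \<mu> \<nu> ..
  have sp: "space \<mu> = UNIV" "space \<nu> = UNIV" using s[THEN sets_eq_imp_space_eq] by simp_all
  let ?S = "sphere (0::real^'n) 1"
  have Sb: "?S \<in> sets borel" "- ?S \<in> sets borel" by auto
  have AES: "AE x in \<mu>. x \<in> ?S" "AE x in \<nu>. x \<in> ?S"
    using conc Sb s by (auto intro!: AE_I[where N="- ?S"])
  obtain e where e: "norm (e::real^'n) = 1" using norm_axis_1 by blast
  have prodsets: "sets (\<mu> \<Otimes>\<^sub>M \<nu>) = sets (borel :: ((real^'n) \<times> (real^'n)) measure)"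
    using sets_pair_measure_cong[OF s] by (metis borel_prod)
  have near[measurable]: "{z. dist (fst z) (snd z) < r} \<in> sets (borel :: ((real^'n) \<times> (real^'n)) measure)" for r
    by (intro borel_open open_Collect_less continuous_intros)
  let ?I = "\<lambda>r x y. indicator {z. dist (fst z) (snd z) < r} (x, y) :: ennreal"
  have Im: "(\<lambda>z. indicator A (fst z) * indicator B (snd z) * ?I r (fst z) (snd z)) \<in> borel_measurable (\<mu> \<Otimes>\<^sub>M \<nu>)"
    if [measurable]: "A \<in> sets borel" "B \<in> sets borel" for A B :: "(real^'n) set" and r
    unfolding measurable_cong_sets[OF prodsets refl] borel_prod[symmetric]
    using near[of r, folded borel_prod] by measurable
  have Ix: "(\<integral>\<^sup>+y. ?I r x y \<partial>\<nu>) = emeasure \<nu> (ball x r)" for r x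
  proof -
    have "(\<integral>\<^sup>+y. ?I r x y \<partial>\<nu>) = (\<integral>\<^sup>+y. indicator (ball x r) y \<partial>\<nu>)"
      by (intro nn_integral_cong) (auto simp: indicator_def)
    then show ?thesis using s by simp
  qed
  have Iy: "(\<integral>\<^sup>+x. ?I r x y \<partial>\<mu>) = emeasure \<mu> (ball y r)" for r y
  proof -
    have "(\<integral>\<^sup>+x. ?I r x y \<partial>\<mu>) = (\<integral>\<^sup>+x. indicator (ball y r) x \<partial>\<mu>)"
      by (intro nn_integral_cong) (auto simp: indicator_def dist_commute)
    then show ?thesis using s by simp
  qed
  have totS: "emeasure \<mu> UNIV = emeasure \<mu> ?S" "emeasure \<nu> UNIV = emeasure \<nu> ?S"
    using AES s Sb sp emeasure_eq_AE[of UNIV ?S \<mu>] emeasure_eq_AE[of UNIV ?S \<nu>] by auto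
  have h_eq: "emeasure \<mu> (ball e r) = emeasure \<nu> (ball e r)" for r
  proof -
    have "(\<integral>\<^sup>+x. (\<integral>\<^sup>+y. ?I r x y \<partial>\<nu>) \<partial>\<mu>) = (\<integral>\<^sup>+y. (\<integral>\<^sup>+x. ?I r x y \<partial>\<mu>) \<partial>\<nu>)"
      by (rule Fubini'[symmetric]) (use Im[of UNIV UNIV r] in \<open>simp add: split_beta'\<close>)
    moreover have "(\<integral>\<^sup>+x. (\<integral>\<^sup>+y. ?I r x y \<partial>\<nu>) \<partial>\<mu>) = (\<integral>\<^sup>+x. emeasure \<nu> (ball e r) \<partial>\<mu>)"
      unfolding Ix using AES(1) by (intro nn_integral_cong_AE) (auto elim!: eventually_mono intro!: ball(2) e)
    moreover have "(\<integral>\<^sup>+y. (\<integral>\<^sup>+x. ?I r x y \<partial>\<mu>) \<partial>\<nu>) = (\<integral>\<^sup>+y. emeasure \<mu> (ball e r) \<partial>\<nu>)"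
      unfolding Iy using AES(2) by (intro nn_integral_cong_AE) (auto elim!: eventually_mono intro!: ball(1) e)
    ultimately have "emeasure \<nu> (ball e r) * emeasure \<nu> ?S = emeasure \<mu> (ball e r) * emeasure \<nu> ?S"
      using tot totS sp by simp
    then have "emeasure \<nu> ?S * emeasure \<nu> (ball e r) = emeasure \<nu> ?S * emeasure \<mu> (ball e r)"
      by (simp only: mult.commute)
    moreover have "emeasure \<nu> ?S \<noteq> \<top>" by simp
    ultimately show ?thesis using tot(2) by (subst (asm) ennreal_mult_cancel_left) auto
  qed
  have h_pos: "emeasure \<nu> (ball e r) > 0" if r: "r > 0" for r
  proof (rule ccontr)
    assume "\<not> emeasure \<nu> (ball e r) > 0"
    then have z0: "emeasure \<nu> (ball e r) = 0" by (simp only: zero_less_iff_neq_zero simp_thms)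
    have z: "emeasure \<nu> (ball x r) = 0" if "norm x = 1" for x using ball(2)[OF that e, of r] z0 by (simp only:)
    obtain k where k: "finite k" "k \<subseteq> ?S" "?S \<subseteq> (\<Union>x\<in>k. ball x r)"
      using seq_compact_imp_totally_bounded[OF compact_imp_seq_compact[OF compact_sphere[of "0::real^'n" 1]], rule_format, OF r]
      by (elim exE conjE) (rule that)
    have "(\<Union>x\<in>k. ball x r) \<in> null_sets \<nu>"
    proof (rule null_sets_UN'[OF countable_finite[OF k(1)]])
      fix x assume "x \<in> k"
      then have "norm x = 1" using k(2) by auto
      then show "ball x r \<in> null_sets \<nu>" using z[of x] s by (intro null_setsI) auto
    qed
    then have "emeasure \<nu> ?S \<le> emeasure \<nu> (\<Union>x\<in>k. ball x r)" "emeasure \<nu> (\<Union>x\<in>k. ball x r) = 0"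
      using k(3) by (auto intro!: emeasure_mono)
    then show False using tot(2) by simp
  qed
  have Ub: "U \<in> sets borel" using U by simp
  define r where "r k = 1 / real (Suc k)" for k
  have r: "r k > 0" for k by (simp add: r_def)
  define h where "h k = emeasure \<nu> (ball e (r k))" for k
  let ?J = "\<lambda>k x. \<integral>\<^sup>+y. indicator U x * indicator U y * ?I (r k) x y \<partial>\<nu>" and ?J' = "\<lambda>k y. \<integral>\<^sup>+x. indicator U x * indicator U y * ?I (r k) x y \<partial>\<mu>"
  have h: "h k > 0" "h k \<noteq> \<top>" for k using h_pos[OF r] by (auto simp: h_def)
  \<comment> \<open>the proportion of the ball around \<open>x\<close> that lies in \<open>U\<close>, cut off to \<open>U\<close>\<close>
  let ?\<phi> = "\<lambda>k x. ?J k x / h k"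
  have ev: "indicator U x \<le> liminf (\<lambda>k. ?\<phi> k x)" if x: "x \<in> ?S" for x
  proof (cases "x \<in> U")
    case True
    obtain \<delta> where \<delta>: "\<delta> > 0" "ball x \<delta> \<subseteq> U" using U True open_contains_ball by blast
    obtain N where N: "1 / real (Suc N) < \<delta>" using \<delta>(1) reals_Archimedean by (auto simp: inverse_eq_divide)
    have "?\<phi> k x = 1" if k: "N \<le> k" for k
    proof -
      have "r k \<le> 1 / real (Suc N)" unfolding r_def using k by (simp add: frac_le)
      then have sub: "ball x (r k) \<subseteq> U" using \<delta>(2) N by (auto simp: subset_iff)
      have "?J k x = (\<integral>\<^sup>+y. ?I (r k) x y \<partial>\<nu>)"
        using sub True by (intro nn_integral_cong) (auto simp: indicator_def subset_iff)
      also have "\<dots> = h k" unfolding Ix h_def using ball(2)[of x e] x e by simp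
      finally have e: "?J k x = h k" .
      have "h k / h k = 1" by (rule ennreal_divide_self) (use h[of k] in \<open>simp_all only: less_top zero_less_iff_neq_zero simp_thms\<close>)
      then show ?thesis unfolding e .
    qed
    then have "\<forall>\<^sub>F k in sequentially. 1 \<le> ?\<phi> k x" by (intro eventually_sequentiallyI[of N]) simp
    then have "1 \<le> liminf (\<lambda>k. ?\<phi> k x)" by (rule Liminf_bounded)
    then show ?thesis using True by simp
  qed simp
  have Im': "case_prod (\<lambda>x y. indicator U x * indicator U y * ?I (r k) x y) \<in> borel_measurable (\<mu> \<Otimes>\<^sub>M \<nu>)" for k
    using Im[OF Ub Ub, of "r k"] by (simp add: split_beta')
  have J: "(\<lambda>x. \<integral>\<^sup>+y. indicator U x * indicator U y * ?I (r k) x y \<partial>\<nu>) \<in> borel_measurable \<mu>" for k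
    by (rule N.borel_measurable_nn_integral[OF Im'])
  have meas: "(\<lambda>x. ?\<phi> k x) \<in> borel_measurable \<mu>" for k
    unfolding divide_ennreal_def by (intro borel_measurable_times_ennreal J borel_measurable_const)
  have bound: "(\<integral>\<^sup>+x. ?\<phi> k x \<partial>\<mu>) \<le> emeasure \<nu> U" for k
  proof -
    have "(\<integral>\<^sup>+x. ?\<phi> k x \<partial>\<mu>) = (\<integral>\<^sup>+x. ?J k x \<partial>\<mu>) / h k"
      by (rule nn_integral_divide[OF J])
    also have "(\<integral>\<^sup>+x. ?J k x \<partial>\<mu>) = (\<integral>\<^sup>+y. ?J' k y \<partial>\<nu>)"
      by (rule Fubini'[OF Im', symmetric])
    also have "\<dots> \<le> (\<integral>\<^sup>+y. indicator U y * h k \<partial>\<nu>)"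
    proof (rule nn_integral_mono_AE, rule eventually_mono[OF AES(2)])
      fix y assume y: "y \<in> ?S"
      have "?J' k y \<le> (\<integral>\<^sup>+x. indicator U y * indicator (ball y (r k)) x \<partial>\<mu>)"
        by (intro nn_integral_mono) (auto simp: indicator_def dist_commute)
      also have "\<dots> = indicator U y * emeasure \<mu> (ball y (r k))" using s by (simp add: nn_integral_cmult_indicator)
      also have "emeasure \<mu> (ball y (r k)) = h k" unfolding h_def using ball(1)[of y e "r k"] y e h_eq by simp
      finally show "?J' k y \<le> indicator U y * h k" .
    qed
    also have "(\<integral>\<^sup>+y. indicator U y * h k \<partial>\<nu>) = emeasure \<nu> U * h k"
      using Ub s by (subst nn_integral_multc) auto
    finally have "(\<integral>\<^sup>+x. ?\<phi> k x \<partial>\<mu>) \<le> emeasure \<nu> U * h k / h k" by (simp add: divide_right_mono_ennreal)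
    then show ?thesis using h[of k] by (simp add: ennreal_mult_divide_eq)
  qed
  have "emeasure \<mu> U = (\<integral>\<^sup>+x. indicator U x \<partial>\<mu>)" using Ub s by simp
  also have "\<dots> \<le> (\<integral>\<^sup>+x. liminf (\<lambda>k. ?\<phi> k x) \<partial>\<mu>)"
    by (rule nn_integral_mono_AE, rule eventually_mono[OF AES(1)]) (rule ev)
  also have "\<dots> \<le> liminf (\<lambda>k. \<integral>\<^sup>+x. ?\<phi> k x \<partial>\<mu>)" by (rule nn_integral_liminf[OF meas])
  also have "\<dots> \<le> liminf (\<lambda>k. emeasure \<nu> U)" by (rule Liminf_mono) (simp add: bound)
  also have "\<dots> = emeasure \<nu> U" by (simp add: Liminf_const)
  finally show ?thesis .
qed

lemma spherical_measure_unique: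
  fixes \<mu> \<nu> :: "(real^'n) measure"
  assumes n: "CARD('n) \<ge> 2" and fin: "finite_measure \<mu>" "finite_measure \<nu>" and s: "sets \<mu> = sets borel" "sets \<nu> = sets borel"
    and conc: "emeasure \<mu> (- sphere 0 1) = 0" "emeasure \<nu> (- sphere 0 1) = 0"
    and tot: "emeasure \<mu> (sphere 0 1) = emeasure \<nu> (sphere 0 1)" "emeasure \<nu> (sphere 0 1) > 0"
    and inv: "\<And>\<rho>. rotation \<rho> \<Longrightarrow> distr \<mu> borel \<rho> = \<mu>" "\<And>\<rho>. rotation \<rho> \<Longrightarrow> distr \<nu> borel \<rho> = \<nu>"
  shows "\<mu> = \<nu>"
proof (rule measure_eqI_generator_eq[where E="{S. open S}" and \<Omega>=UNIV and A="\<lambda>_. UNIV"])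
  show "Int_stable {S :: (real^'n) set. open S}" by (auto simp: Int_stable_def)
  show "emeasure \<mu> X = emeasure \<nu> X" if "X \<in> {S. open S}" for X
  proof (rule antisym)
    note b = emeasure_ball_rotation[OF s(1) n inv(1)] emeasure_ball_rotation[OF s(2) n inv(2)]
    show "emeasure \<mu> X \<le> emeasure \<nu> X"
      by (rule spherical_measure_le[OF fin s conc tot b]) (use that in auto)
    show "emeasure \<nu> X \<le> emeasure \<mu> X"
      by (rule spherical_measure_le[OF fin(2,1) s(2,1) conc(2,1) tot(1)[symmetric] _ b(2,1)]) (use that tot in auto)
  qed
  show "sets \<mu> = sigma_sets UNIV {S. open S}" "sets \<nu> = sigma_sets UNIV {S. open S}"
    using s by (simp_all add: borel_def)
  show "emeasure \<mu> UNIV \<noteq> \<infinity>" using fin(1) s sets_eq_imp_space_eq[OF s(1)] by (metis finite_measure.emeasure_finite infinity_ennreal_def)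
qed auto


section \<open>Lines and the invariant measure on lines through the origin\<close>

text \<open>
  The value at \<open>0\<close> is some unit vector, so that \<open>dir w\<close> is a unit vector for every \<open>w\<close>.
\<close>

definition dir :: "real^'n \<Rightarrow> real^'n" where
  "dir w = (if w = 0 then axis undefined 1 else w /\<^sub>R norm w)"

lemma norm_dir[simp]: "norm (dir w) = 1"
  by (simp add: dir_def norm_axis_1)

lemma dir_unit: "norm w = 1 \<Longrightarrow> dir w = w"
  by (auto simp: dir_def)

lemma borel_measurable_dir[measurable]: "dir \<in> borel_measurable borel"
  unfolding dir_def[abs_def] by measurable

definition line :: "real^'n \<Rightarrow> real^'n \<Rightarrow> (real^'n) set" where
  "line v x = (\<lambda>z. z + x) ` span {v}"

lemma mem_line: "z \<in> line v x \<longleftrightarrow> (\<exists>t. z = x + t *\<^sub>R v)"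
  by (auto simp: line_def span_singleton image_iff add.commute)

lemma line_0: "line v 0 = span {v}" by (simp add: line_def)

lemma line_uminus: "line (- v) x = line v x"
  unfolding set_eq_iff mem_line by (metis minus_minus scaleR_minus_left scaleR_minus_right)

lemma span_unit_line: "norm v = 1 \<Longrightarrow> span {v} \<in> linear_subspaces 1"
  by (auto simp: linear_subspaces_def dim_singleton)

lemma line_flat: "norm v = 1 \<Longrightarrow> line v x \<in> affine_flats 1"
proof -
  assume v: "norm v = 1"
  have "aff_dim (span {v}) = 1" using v by (subst aff_dim_subspace) (auto simp: dim_singleton)
  moreover have l: "line v x = (\<lambda>z. x + z) ` span {v}" by (simp add: line_def add.commute)
  moreover have "affine ((+) x ` span {v})" using affine_translation subspace_imp_affine[OF subspace_span] by blast
  ultimately show ?thesis unfolding affine_flats_def mem_Collect_eq l using aff_dim_translation_eq[of x "span {v}"] by simp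
qed

lemma linear_subspace_1E:
  assumes "L \<in> linear_subspaces 1"
  obtains l where "norm l = 1" "L = span {l}"
proof -
  have L: "subspace L" "dim L = 1" using assms by (auto simp: linear_subspaces_def)
  obtain B where B: "B \<subseteq> L" "\<And>x. x \<in> B \<Longrightarrow> norm x = 1" "card B = 1" "span B = L"
    using orthonormal_basis_subspace[OF L(1)] L(2) by metis
  then obtain l where "B = {l}" by (auto simp: card_1_singleton_iff)
  then show ?thesis using that B by auto
qed

lemma affine_flat_1E:
  assumes "E \<in> affine_flats 1"
  obtains v x where "norm v = 1" "E = line v x"
proof -
  have E: "affine E" "aff_dim E = 1" using assms by (auto simp: affine_flats_def)
  then obtain x where x: "x \<in> E" by fastforce
  let ?L = "(\<lambda>z. - x + z) ` E"
  have sub: "subspace ?L" using affine_diffs_subspace[OF E(1) x] by (simp add: image_def)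
  have "aff_dim ?L = 1" using E(2) aff_dim_translation_eq[of "- x" E] by simp
  then have "?L \<in> linear_subspaces 1" using sub aff_dim_subspace[OF sub] by (simp add: linear_subspaces_def)
  then obtain l where l: "norm l = 1" "?L = span {l}" by (rule linear_subspace_1E)
  have "E = (\<lambda>z. z + x) ` ?L" by (auto simp: image_image)
  then have "E = line l x" unfolding line_def l(2) .
  then show ?thesis using that l(1) by blast
qed

text \<open>
  Closedness of the set of parameters for which a line hits a compact set is what makes the
  parametrization of lines measurable for the hit algebra.
\<close>

lemma line_hit_closed:
  assumes C: "compact (C :: (real^'n) set)"
  shows "closed {z :: (real^'n) \<times> (real^'n). norm (fst z) = 1 \<and> line (fst z) (snd z) \<inter> C \<noteq> {}}"
  unfolding closed_sequential_limits
proof (intro allI impI)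
  fix f :: "nat \<Rightarrow> (real^'n) \<times> (real^'n)" and l
  assume "(\<forall>k. f k \<in> {z. norm (fst z) = 1 \<and> line (fst z) (snd z) \<inter> C \<noteq> {}}) \<and> f \<longlonglongrightarrow> l"
  then have f: "\<And>k. norm (fst (f k)) = 1" "\<And>k. line (fst (f k)) (snd (f k)) \<inter> C \<noteq> {}" and lim: "f \<longlonglongrightarrow> l" by auto
  have "\<exists>c. \<forall>k. c k \<in> C \<and> c k \<in> line (fst (f k)) (snd (f k))" by (intro choice allI) (use f(2) in blast)
  then obtain c where c: "\<And>k. c k \<in> C" "\<And>k. c k \<in> line (fst (f k)) (snd (f k))" by blast
  obtain z r where zr: "z \<in> C" "strict_mono (r :: nat \<Rightarrow> nat)" "(c \<circ> r) \<longlonglongrightarrow> z"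
    using seq_compactE[OF compact_imp_seq_compact[OF C], of c] c(1) by blast
  have fr: "(\<lambda>k. fst (f (r k))) \<longlonglongrightarrow> fst l" "(\<lambda>k. snd (f (r k))) \<longlonglongrightarrow> snd l"
    using LIMSEQ_subseq_LIMSEQ[OF lim zr(2)] by (auto simp: o_def intro: tendsto_fst tendsto_snd)
  have cr: "(\<lambda>k. c (r k)) \<longlonglongrightarrow> z" using zr(3) by (simp add: o_def)
  have n1: "norm (fst l) = 1"
    using LIMSEQ_unique[OF tendsto_norm[OF fr(1)], of 1] f(1) by simp
  have eq: "c k = snd (f k) + ((c k - snd (f k)) \<bullet> fst (f k)) *\<^sub>R fst (f k)" for k
  proof -
    obtain t where t: "c k = snd (f k) + t *\<^sub>R fst (f k)" using c(2)[of k] by (auto simp: mem_line)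
    have "(c k - snd (f k)) \<bullet> fst (f k) = t" unfolding t using f(1)[of k] by (simp add: norm_eq_1)
    then show ?thesis using t by simp
  qed
  have "(\<lambda>k. snd (f (r k)) + ((c (r k) - snd (f (r k))) \<bullet> fst (f (r k))) *\<^sub>R fst (f (r k))) \<longlonglongrightarrow> snd l + ((z - snd l) \<bullet> fst l) *\<^sub>R fst l"
    by (intro tendsto_intros cr fr)
  then have "(\<lambda>k. c (r k)) \<longlonglongrightarrow> snd l + ((z - snd l) \<bullet> fst l) *\<^sub>R fst l" unfolding eq[symmetric] .
  then have "z = snd l + ((z - snd l) \<bullet> fst l) *\<^sub>R fst l" using cr LIMSEQ_unique by blast
  then have "z \<in> line (fst l) (snd l)" by (auto simp: mem_line)
  then show "l \<in> {z. norm (fst z) = 1 \<and> line (fst z) (snd z) \<inter> C \<noteq> {}}" using n1 zr(1) by blast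
qed

lemma space_hit_algebra[simp]: "space (hit_algebra X) = X"
  by (simp add: hit_algebra_def space_measure_of_conv)

lemma sets_hit_algebra_hit: "compact C \<Longrightarrow> {E \<in> X. E \<inter> C \<noteq> {}} \<in> sets (hit_algebra X)"
  unfolding hit_algebra_def by (subst sets_measure_of) auto

lemma measurable_hit_algebra:
  assumes "\<And>z. z \<in> space M \<Longrightarrow> f z \<in> X" and "\<And>C. compact C \<Longrightarrow> {z \<in> space M. f z \<inter> C \<noteq> {}} \<in> sets M"
  shows "f \<in> measurable M (hit_algebra X)"
  unfolding hit_algebra_def
proof (rule measurable_measure_of)
  fix A assume "A \<in> {{E \<in> X. E \<inter> C \<noteq> {}} | C. compact C}"
  then obtain C where C: "compact C" "A = {E \<in> X. E \<inter> C \<noteq> {}}" by blast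
  have "f -` A \<inter> space M = {z \<in> space M. f z \<inter> C \<noteq> {}}" using assms(1) C(2) by auto
  then show "f -` A \<inter> space M \<in> sets M" using assms(2)[OF C(1)] by simp
qed (use assms(1) in auto)

lemma measurable_line:
  "(\<lambda>z. line (dir (fst z)) (snd z)) \<in> measurable (borel :: ((real^'n) \<times> (real^'n)) measure) (hit_algebra (affine_flats 1))"
proof (rule measurable_hit_algebra)
  show "line (dir (fst z)) (snd z) \<in> affine_flats 1" for z :: "(real^'n) \<times> (real^'n)" by (rule line_flat) simp
  fix C :: "(real^'n) set" assume C: "compact C"
  let ?S = "{z :: (real^'n) \<times> (real^'n). norm (fst z) = 1 \<and> line (fst z) (snd z) \<inter> C \<noteq> {}}"
  have m: "(\<lambda>z :: (real^'n) \<times> (real^'n). (dir (fst z), snd z)) \<in> measurable borel borel"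
    unfolding borel_prod[symmetric] by measurable
  have "(\<lambda>z. (dir (fst z), snd z)) -` ?S \<inter> space borel \<in> sets borel"
    by (rule measurable_sets[OF m]) (use line_hit_closed[OF C] in simp)
  then show "{z \<in> space borel. line (dir (fst z)) (snd z) \<inter> C \<noteq> {}} \<in> sets (borel :: ((real^'n) \<times> (real^'n)) measure)"
    by (simp add: vimage_def)
qed

lemma measurable_span_dir:
  "(\<lambda>w. span {dir w}) \<in> measurable (borel :: (real^'n) measure) (hit_algebra (linear_subspaces 1))"
proof (rule measurable_hit_algebra)
  show "span {dir w} \<in> linear_subspaces 1" for w :: "real^'n" by (rule span_unit_line) simp
  fix C :: "(real^'n) set" assume C: "compact C"
  have m: "(\<lambda>w :: real^'n. (w, 0 :: real^'n)) \<in> measurable borel borel"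
    unfolding borel_prod[symmetric] by measurable
  have "{z \<in> space borel. line (dir (fst z)) (snd z) \<inter> C \<noteq> {}} \<in> sets (borel :: ((real^'n) \<times> (real^'n)) measure)"
    using measurable_sets[OF measurable_line sets_hit_algebra_hit[OF C]]
    by (simp add: vimage_def line_flat del: One_nat_def)
  from measurable_sets[OF m this]
  show "{w \<in> space borel. span {dir w} \<inter> C \<noteq> {}} \<in> sets (borel :: (real^'n) measure)"
    by (simp add: vimage_def line_0)
qed

definition gen :: "(real^'n) set \<Rightarrow> real^'n" where
  "gen L = (SOME l. norm l = 1 \<and> L = span {l})"

lemma gen: assumes "L \<in> linear_subspaces 1" shows "norm (gen L) = 1" "L = span {gen L}"
proof -
  have "\<exists>l. norm l = 1 \<and> L = span {l}" using linear_subspace_1E[OF assms] by metis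
  from someI_ex[OF this] show "norm (gen L) = 1" "L = span {gen L}" unfolding gen_def by auto
qed

lemma unit_span_cases: assumes "norm l = 1" "norm m = 1" "l \<in> span {m}" shows "l = m \<or> l = - m"
proof -
  obtain t where t: "l = t *\<^sub>R m" using assms(3) by (auto simp: span_singleton)
  then have "\<bar>t\<bar> = 1" using assms by simp
  then show ?thesis using t by (auto simp: abs_if split: if_splits)
qed

text \<open>
  A function on the sphere is pushed down to lines through the origin by summing over the two unit
  generators; in this way the choice of a generator has no influence.
\<close>

definition gen_sum :: "(real^'n \<Rightarrow> ennreal) \<Rightarrow> (real^'n) set \<Rightarrow> ennreal" where
  "gen_sum F L = F (gen L) + F (- gen L)"

lemma gen_sum_span: assumes "norm l = 1" shows "gen_sum F (span {l}) = F l + F (- l)"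
proof -
  have "span {l} \<in> linear_subspaces 1" by (rule span_unit_line[OF assms])
  then have "norm (gen (span {l})) = 1" "gen (span {l}) \<in> span {l}" using gen span_superset[of "{gen (span {l})}"] by auto
  from unit_span_cases[OF this(1) assms this(2)] show ?thesis by (auto simp: gen_sum_def add.commute)
qed

text \<open>
  For a closed set the number of unit generators in it is expressed by two hit conditions: at least one
  generator lies in the set, and both do.
\<close>

lemma gen_sum_closed_measurable:
  assumes A: "closed (A :: (real^'n) set)"
  shows "gen_sum (indicator A) \<in> borel_measurable (hit_algebra (linear_subspaces 1))"
proof -
  let ?G = "linear_subspaces 1 :: (real^'n) set set" and ?S = "sphere (0::real^'n) 1"
  have C: "compact (A \<inter> ?S)" "compact (A \<inter> uminus ` A \<inter> ?S)"
    using A by (auto intro!: closed_Int_compact closed_Int closed_negations)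
  have eq: "gen_sum (indicator A) L = indicator {L \<in> ?G. L \<inter> (A \<inter> ?S) \<noteq> {}} L + indicator {L \<in> ?G. L \<inter> (A \<inter> uminus ` A \<inter> ?S) \<noteq> {}} L"
    if L: "L \<in> ?G" for L
  proof -
    let ?l = "gen L"
    note s = gen[OF L]
    have mem: "z \<in> L \<and> norm z = 1 \<longleftrightarrow> z = ?l \<or> z = - ?l" for z
    proof
      assume "z \<in> L \<and> norm z = 1" then show "z = ?l \<or> z = - ?l" using unit_span_cases[of z ?l] s by metis
    next
      assume "z = ?l \<or> z = - ?l" then show "z \<in> L \<and> norm z = 1"
        using s span_base[of ?l "{?l}"] span_neg[of ?l "{?l}"] by auto
    qed
    have 1: "L \<inter> (A \<inter> ?S) \<noteq> {} \<longleftrightarrow> ?l \<in> A \<or> - ?l \<in> A"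
      using mem by (auto simp: set_eq_iff)
    have neg: "z \<in> uminus ` A \<longleftrightarrow> - z \<in> A" for z by (metis image_eqI imageE minus_minus)
    have 2: "L \<inter> (A \<inter> uminus ` A \<inter> ?S) \<noteq> {} \<longleftrightarrow> ?l \<in> A \<and> - ?l \<in> A"
    proof
      assume "L \<inter> (A \<inter> uminus ` A \<inter> ?S) \<noteq> {}"
      then obtain z where z: "z \<in> L" "z \<in> A" "z \<in> uminus ` A" "z \<in> ?S" by blast
      then have "z \<in> L" "z \<in> A" "- z \<in> A" "norm z = 1" using neg[of z] by auto
      then show "?l \<in> A \<and> - ?l \<in> A" using mem[of z] by auto
    next
      assume "?l \<in> A \<and> - ?l \<in> A"
      then have "?l \<in> L \<inter> (A \<inter> uminus ` A \<inter> ?S)" using neg[of ?l] mem[of ?l] by auto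
      then show "L \<inter> (A \<inter> uminus ` A \<inter> ?S) \<noteq> {}" by blast
    qed
    show ?thesis unfolding gen_sum_def using L by (auto simp: indicator_def 1 2 one_add_one)
  qed
  have "(\<lambda>L. indicator {L \<in> ?G. L \<inter> (A \<inter> ?S) \<noteq> {}} L + indicator {L \<in> ?G. L \<inter> (A \<inter> uminus ` A \<inter> ?S) \<noteq> {}} L :: ennreal) \<in> borel_measurable (hit_algebra ?G)"
    using sets_hit_algebra_hit[OF C(1), of ?G] sets_hit_algebra_hit[OF C(2), of ?G] by (intro borel_measurable_add borel_measurable_indicator) auto
  then show ?thesis by (subst measurable_cong) (use eq in auto)
qed

lemma gen_sum_indicator_measurable:
  assumes "A \<in> sets (borel :: (real^'n) measure)"
  shows "gen_sum (indicator A) \<in> borel_measurable (hit_algebra (linear_subspaces 1))"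
proof -
  let ?G = "linear_subspaces 1 :: (real^'n) set set"
  have cs: "Int_stable {S :: (real^'n) set. closed S}" "{S :: (real^'n) set. closed S} \<subseteq> Pow UNIV" "A \<in> sigma_sets UNIV {S. closed S}"
    using assms by (auto simp: borel_eq_closed Int_stable_def)
  show ?thesis
    using cs
  proof (induction rule: sigma_sets_induct_disjoint)
    case (basic A) then show ?case using gen_sum_closed_measurable by (simp del: One_nat_def)
  next
    case empty then show ?case by (simp add: gen_sum_def[abs_def])
  next
    case (compl A)
    have "gen_sum (indicator (UNIV - A)) L = 2 - gen_sum (indicator A) L" for L
      using ennreal_add_diff_cancel_right[of 1 1] by (auto simp: gen_sum_def indicator_def one_add_one)
    then show ?case using compl by (simp cong: measurable_cong)
  next
    case (union A)
    have "gen_sum (indicator (\<Union>i. A i)) L = (\<Sum>i. gen_sum (indicator (A i)) L)" for L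
      unfolding gen_sum_def by (simp add: suminf_add[symmetric] suminf_indicator[OF union(1)])
    then show ?case using union by simp
  qed
qed

lemma gen_sum_measurable:
  assumes "F \<in> borel_measurable (borel :: (real^'n) measure)"
  shows "gen_sum F \<in> borel_measurable (hit_algebra (linear_subspaces 1))"
  using assms
proof (induction rule: borel_measurable_induct)
  case (cong f g)
  then have "f = g" by auto
  then show ?case using cong by simp
next
  case (set A) then show ?case by (rule gen_sum_indicator_measurable)
next
  case (mult u c)
  have "gen_sum (\<lambda>x. c * u x) L = c * gen_sum u L" for L by (simp add: gen_sum_def distrib_left)
  then show ?case using mult.IH by (simp add: gen_sum_def[abs_def])
next
  case (add u v)
  have "gen_sum (\<lambda>x. v x + u x) L = gen_sum v L + gen_sum u L" for L by (simp add: gen_sum_def ac_simps)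
  then have "gen_sum (\<lambda>x. v x + u x) = (\<lambda>L. gen_sum v L + gen_sum u L)" by blast
  then show ?case using add.IH by simp
next
  case (seq U)
  have "gen_sum (SUP i. U i) = (\<lambda>L. SUP i. gen_sum (U i) L)"
  proof
    fix L
    have inc: "incseq (\<lambda>i. U i z)" for z
      unfolding incseq_def using le_funD[OF incseqD[OF seq.hyps(3)]] by blast
    show "gen_sum (SUP i. U i) L = (SUP i. gen_sum (U i) L)"
      unfolding gen_sum_def by (simp add: image_image ennreal_SUP_add[OF inc inc, symmetric])
  qed
  then show ?case by (simp only:) (intro borel_measurable_SUP seq.IH, simp)
qed

lemma linear_image_span1: "linear \<rho> \<Longrightarrow> \<rho> ` span {l} = span {\<rho> l}"
  using linear_span_image[of \<rho> "{l}"] by simp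

lemma measurable_image_rotation:
  assumes \<rho>: "orthogonal_transformation (\<rho> :: real^'n \<Rightarrow> real^'n)"
  shows "image \<rho> \<in> measurable (hit_algebra (linear_subspaces 1)) (hit_algebra (linear_subspaces 1))"
proof (rule measurable_hit_algebra)
  have lin: "linear \<rho>" using \<rho> by (simp add: orthogonal_transformation_linear)
  have nrm: "norm (\<rho> x) = norm x" for x by (rule orthogonal_transformation_norm[OF \<rho>])
  fix L :: "(real^'n) set" assume "L \<in> space (hit_algebra (linear_subspaces 1))"
  then obtain l where "norm l = 1" "L = span {l}" using linear_subspace_1E by auto
  then show "\<rho> ` L \<in> linear_subspaces 1" using span_unit_line[of "\<rho> l"] nrm by (simp only: linear_image_span1[OF lin])
next
  fix C :: "(real^'n) set" assume C: "compact C"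
  obtain \<rho>' where \<rho>': "orthogonal_transformation \<rho>'" "\<And>x. \<rho>' (\<rho> x) = x" "\<And>x. \<rho> (\<rho>' x) = x"
    using orthogonal_transformation_inv[OF \<rho>] orthogonal_transformation_bij[OF \<rho>] bij_inv_eq_iff[of \<rho>] by (metis bij_is_inj inv_f_f)
  have "compact (\<rho>' ` C)"
    using \<rho>'(1) C by (intro compact_continuous_image linear_continuous_on linear_conv_bounded_linear[THEN iffD1] orthogonal_transformation_linear)
  moreover have "\<rho> ` L \<inter> C \<noteq> {} \<longleftrightarrow> L \<inter> \<rho>' ` C \<noteq> {}" for L
  proof
    assume "\<rho> ` L \<inter> C \<noteq> {}"
    then obtain x where "x \<in> L" "\<rho> x \<in> C" by auto
    then have "x \<in> L \<inter> \<rho>' ` C" using \<rho>'(2)[of x] by (metis IntI image_eqI)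
    then show "L \<inter> \<rho>' ` C \<noteq> {}" by blast
  next
    assume "L \<inter> \<rho>' ` C \<noteq> {}"
    then obtain c where "c \<in> C" "\<rho>' c \<in> L" by auto
    then have "c \<in> \<rho> ` L \<inter> C" using \<rho>'(3)[of c] by (metis IntI image_eqI)
    then show "\<rho> ` L \<inter> C \<noteq> {}" by blast
  qed
  ultimately show "{L \<in> space (hit_algebra (linear_subspaces 1)). \<rho> ` L \<inter> C \<noteq> {}} \<in> sets (hit_algebra (linear_subspaces 1))"
    using sets_hit_algebra_hit[of "\<rho>' ` C" "linear_subspaces 1"] by simp
qed

definition invariant_line_measure :: "(real^'n) set measure \<Rightarrow> bool" where
  "invariant_line_measure \<nu> \<longleftrightarrow> sets \<nu> = sets (hit_algebra (linear_subspaces 1)) \<and> prob_space \<nu> \<and>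
        (\<forall>\<rho>. rotation \<rho> \<longrightarrow> distr \<nu> \<nu> (image \<rho>) = \<nu>)"

text \<open>
  The measure on the sphere that gives both unit generators of a line the mass of the line; the lift of a
  probability measure has total mass two.
\<close>

definition lifted :: "(real^'n) set measure \<Rightarrow> (real^'n) measure" where
  "lifted \<nu> = measure_of UNIV (sets borel) (\<lambda>A. \<integral>\<^sup>+L. gen_sum (indicator A) L \<partial>\<nu>)"

context
  fixes \<nu> :: "(real^'n) set measure"
  assumes \<nu>: "invariant_line_measure \<nu>"
begin

lemma sets_lines: "sets \<nu> = sets (hit_algebra (linear_subspaces 1))" "space \<nu> = linear_subspaces 1" "prob_space \<nu>"
  using \<nu> sets_eq_imp_space_eq[of \<nu> "hit_algebra (linear_subspaces 1)"] by (auto simp: invariant_line_measure_def)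

lemma gen_sum_meas: "F \<in> borel_measurable borel \<Longrightarrow> gen_sum F \<in> borel_measurable \<nu>"
  using gen_sum_measurable measurable_cong_sets[OF sets_lines(1) refl] by blast

lemma sets_lifted: "sets (lifted \<nu>) = sets borel"
  unfolding lifted_def using sets.sigma_sets_eq[of "borel :: (real^'n) measure"] by (simp add: sets_measure_of_conv)

lemma emeasure_lifted:
  assumes A: "A \<in> sets borel" shows "emeasure (lifted \<nu>) A = (\<integral>\<^sup>+L. gen_sum (indicator A) L \<partial>\<nu>)"
  unfolding lifted_def
proof (rule emeasure_measure_of_sigma)
  show "sigma_algebra UNIV (sets (borel :: (real^'n) measure))" by (metis sets.sigma_algebra_axioms space_borel)
  show "positive (sets borel) (\<lambda>A. \<integral>\<^sup>+L. gen_sum (indicator A) L \<partial>\<nu>)" by (simp add: positive_def gen_sum_def)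
  show "countably_additive (sets borel) (\<lambda>A. \<integral>\<^sup>+L. gen_sum (indicator A) L \<partial>\<nu>)"
  proof (rule countably_additiveI)
    fix A :: "nat \<Rightarrow> (real^'n) set" assume A: "range A \<subseteq> sets borel" "disjoint_family A"
    have "gen_sum (indicator (\<Union>i. A i)) L = (\<Sum>i. gen_sum (indicator (A i)) L)" for L
      unfolding gen_sum_def by (simp add: suminf_add[symmetric] suminf_indicator[OF A(2)])
    moreover have "gen_sum (indicator (A i)) \<in> borel_measurable \<nu>" for i using A(1) by (intro gen_sum_meas) auto
    ultimately show "(\<Sum>i. \<integral>\<^sup>+L. gen_sum (indicator (A i)) L \<partial>\<nu>) = (\<integral>\<^sup>+L. gen_sum (indicator (\<Union>i. A i)) L \<partial>\<nu>)"
      by (simp add: nn_integral_suminf)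
  qed
qed (rule A)

lemma lifted_concentrated: "emeasure (lifted \<nu>) (- sphere 0 1) = 0" "emeasure (lifted \<nu>) (sphere 0 1) = 2"
  "finite_measure (lifted \<nu>)"
proof -
  interpret prob_space \<nu> by (rule sets_lines)
  have b: "gen_sum (indicator (- sphere 0 1)) L = 0" "gen_sum (indicator (sphere 0 1)) L = 2" "gen_sum (indicator UNIV) L = 2" if "L \<in> space \<nu>" for L
    using that gen[of L] by (auto simp: gen_sum_def sets_lines one_add_one)
  have "emeasure (lifted \<nu>) (- sphere 0 1) = (\<integral>\<^sup>+L. 0 \<partial>\<nu>)"
    by (subst emeasure_lifted[OF borel_comp[OF borel_closed[OF closed_sphere]]]) (intro nn_integral_cong b)
  then show "emeasure (lifted \<nu>) (- sphere 0 1) = 0" by simp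
  have "emeasure (lifted \<nu>) (sphere 0 1) = (\<integral>\<^sup>+L. 2 \<partial>\<nu>)"
    by (subst emeasure_lifted[OF borel_closed[OF closed_sphere]]) (intro nn_integral_cong b)
  then show "emeasure (lifted \<nu>) (sphere 0 1) = 2" using emeasure_space_1 by simp
  have "emeasure (lifted \<nu>) UNIV = (\<integral>\<^sup>+L. 2 \<partial>\<nu>)"
    by (subst emeasure_lifted[OF borel_closed[OF closed_UNIV]]) (intro nn_integral_cong b)
  moreover have "space (lifted \<nu>) = UNIV" using sets_eq_imp_space_eq[OF sets_lifted] by simp
  ultimately show "finite_measure (lifted \<nu>)" using emeasure_space_1 by (intro finite_measureI) simp
qed

lemma lifted_rotation:
  assumes \<rho>: "rotation \<rho>" shows "distr (lifted \<nu>) borel \<rho> = lifted \<nu>"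
proof (rule measure_eqI)
  have o: "orthogonal_transformation \<rho>" using \<rho> by (simp add: rotation_def)
  have lin: "linear \<rho>" using o by (simp add: orthogonal_transformation_linear)
  have m: "\<rho> \<in> measurable borel borel"
    by (intro borel_measurable_continuous_onI linear_continuous_on linear_conv_bounded_linear[THEN iffD1] lin)
  have m': "\<rho> \<in> measurable (lifted \<nu>) borel" using m measurable_cong_sets[OF sets_lifted refl] by blast
  have sp: "space (lifted \<nu>) = UNIV" using sets_eq_imp_space_eq[OF sets_lifted] by simp
  show "sets (distr (lifted \<nu>) borel \<rho>) = sets (lifted \<nu>)" by (simp add: sets_lifted)
  fix A assume "A \<in> sets (distr (lifted \<nu>) borel \<rho>)"
  then have A: "A \<in> sets borel" by simp
  have im: "image \<rho> \<in> measurable \<nu> \<nu>"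
    using measurable_image_rotation[OF o] measurable_cong_sets[OF sets_lines(1) sets_lines(1)] by blast
  have "emeasure (distr (lifted \<nu>) borel \<rho>) A = emeasure (lifted \<nu>) (\<rho> -` A)"
    by (subst emeasure_distr[OF m' A]) (simp add: sp)
  also have "\<dots> = (\<integral>\<^sup>+L. gen_sum (indicator (\<rho> -` A)) L \<partial>\<nu>)"
    using measurable_sets[OF m A] by (intro emeasure_lifted) simp
  also have "\<dots> = (\<integral>\<^sup>+L. gen_sum (indicator A) (\<rho> ` L) \<partial>\<nu>)"
  proof (rule nn_integral_cong)
    fix L assume "L \<in> space \<nu>"
    then have L: "L \<in> linear_subspaces 1" by (simp only: sets_lines(2))
    have "\<rho> ` L = span {\<rho> (gen L)}" using gen(2)[OF L] linear_image_span1[OF lin] by metis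
    moreover have "norm (\<rho> (gen L)) = 1" using gen(1)[OF L] orthogonal_transformation_norm[OF o] by simp
    ultimately have "gen_sum (indicator A) (\<rho> ` L) = indicator A (\<rho> (gen L)) + indicator A (- \<rho> (gen L))"
      using gen_sum_span by simp
    then show "gen_sum (indicator (\<rho> -` A)) L = gen_sum (indicator A) (\<rho> ` L)"
      by (simp add: gen_sum_def indicator_def linear_neg[OF lin])
  qed
  also have "\<dots> = (\<integral>\<^sup>+L. gen_sum (indicator A) L \<partial>distr \<nu> \<nu> (image \<rho>))"
    by (rule nn_integral_distr[OF im, symmetric]) (simp only: measurable_distr_eq1, rule gen_sum_meas[OF borel_measurable_indicator[OF A]])
  also have "distr \<nu> \<nu> (image \<rho>) = \<nu>" using \<nu> \<rho> by (simp add: invariant_line_measure_def)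
  also have "(\<integral>\<^sup>+L. gen_sum (indicator A) L \<partial>\<nu>) = emeasure (lifted \<nu>) A" by (rule emeasure_lifted[OF A, symmetric])
  finally show "emeasure (distr (lifted \<nu>) borel \<rho>) A = emeasure (lifted \<nu>) A" .
qed

lemma emeasure_from_lifted:
  assumes A: "A \<in> sets \<nu>"
  shows "2 * emeasure \<nu> A = emeasure (lifted \<nu>) {x. span {dir x} \<in> A}"
proof -
  have A': "A \<in> sets (hit_algebra (linear_subspaces 1))" using A sets_lines(1) by simp
  have b: "{x. span {dir x} \<in> A} \<in> sets borel"
    using measurable_sets[OF measurable_span_dir A'] by (simp add: vimage_def)
  have "emeasure (lifted \<nu>) {x. span {dir x} \<in> A} = (\<integral>\<^sup>+L. 2 * indicator A L \<partial>\<nu>)"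
    unfolding emeasure_lifted[OF b]
  proof (rule nn_integral_cong)
    fix L assume "L \<in> space \<nu>"
    then have L: "L \<in> linear_subspaces 1" by (simp only: sets_lines(2))
    have "span {- gen L} = span {gen L}"
      using line_uminus[of "gen L" 0] by (simp add: line_0)
    then show "gen_sum (indicator {x. span {dir x} \<in> A}) L = 2 * indicator A L"
      using gen[OF L] by (auto simp: gen_sum_def indicator_def dir_unit one_add_one)
  qed
  also have "\<dots> = 2 * emeasure \<nu> A" using A by (rule nn_integral_cmult_indicator)
  finally show ?thesis ..
qed

end

text \<open>
  The lifts to the sphere are rotation invariant and have the same total mass, hence coincide, and a
  measure on lines is determined by its lift.
\<close>

lemma invariant_line_measure_unique:
  fixes \<mu> \<nu> :: "(real^'n) set measure"
  assumes n: "CARD('n) \<ge> 2" and \<mu>: "invariant_line_measure \<mu>" and \<nu>: "invariant_line_measure \<nu>"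
  shows "\<mu> = \<nu>"
proof (rule measure_eqI)
  show s: "sets \<mu> = sets \<nu>" using sets_lines(1)[OF \<mu>] sets_lines(1)[OF \<nu>] by simp
  have lift: "lifted \<mu> = lifted \<nu>"
    by (rule spherical_measure_unique[OF n])
      (simp_all add: lifted_concentrated[OF \<mu>] lifted_concentrated[OF \<nu>] sets_lifted[OF \<mu>] sets_lifted[OF \<nu>] lifted_rotation[OF \<mu>] lifted_rotation[OF \<nu>])
  fix A assume A: "A \<in> sets \<mu>"
  have "2 * emeasure \<mu> A = 2 * emeasure \<nu> A"
    using emeasure_from_lifted[OF \<mu> A] emeasure_from_lifted[OF \<nu>, of A] A s lift by simp
  then show "emeasure \<mu> A = emeasure \<nu> A" by (simp add: ennreal_mult_cancel_left)
qed

text \<open>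
  A uniformly distributed direction is sampled as the direction of a uniformly distributed point of the
  unit ball; this replaces the normalized surface measure of the sphere.
\<close>

definition uniform_ball :: "(real^'n) measure" where
  "uniform_ball = uniform_measure lborel (cball 0 1)"

lemma prob_space_uniform_ball: "prob_space (uniform_ball :: (real^'n) measure)"
  unfolding uniform_ball_def using emeasure_cball_pos_finite[where 'b="real^'n"]
  by (intro prob_space_uniform_measure) auto

lemma sets_uniform_ball[simp]: "sets uniform_ball = sets borel" "space uniform_ball = UNIV"
  by (simp_all add: uniform_ball_def)

lemma measurable_uniform_ball[simp]: "measurable uniform_ball N = measurable borel N"
  by (rule measurable_cong_sets) simp_all

lemma nn_integral_uniform_ball:
  fixes f :: "real^'n \<Rightarrow> ennreal"
  assumes [measurable]: "f \<in> borel_measurable borel"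
  shows "(\<integral>\<^sup>+w. f w \<partial>uniform_ball) = (\<integral>\<^sup>+w. f w * indicator (cball 0 1) w \<partial>lborel) / emeasure lborel (cball (0::real^'n) 1)"
  unfolding uniform_ball_def by (rule nn_integral_uniform_measure) auto

lemma uniform_ball_rotation:
  assumes "orthogonal_transformation (\<rho> :: real^'n \<Rightarrow> real^'n)" and f[measurable]: "f \<in> borel_measurable borel"
  shows "(\<integral>\<^sup>+w. f (\<rho> w) \<partial>uniform_ball) = (\<integral>\<^sup>+w. f w \<partial>uniform_ball)"
proof -
  have m[measurable]: "\<rho> \<in> measurable borel borel"
    using assms(1) by (intro borel_measurable_continuous_onI linear_continuous_on linear_conv_bounded_linear[THEN iffD1] orthogonal_transformation_linear)
  have "indicator (cball 0 1) w = (indicator (cball 0 1) (\<rho> w) :: ennreal)" for w :: "real^'n"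
    by (simp add: indicator_def orthogonal_transformation_norm[OF assms(1)])
  then have "(\<integral>\<^sup>+w. f (\<rho> w) * indicator (cball 0 1) w \<partial>lborel) = (\<integral>\<^sup>+w. f (\<rho> w) * indicator (cball 0 1) (\<rho> w) \<partial>lborel)" by simp
  also have "\<dots> = (\<integral>\<^sup>+w. f w * indicator (cball 0 1) w \<partial>lborel)"
    by (rule nn_integral_orthogonal_transformation[OF assms(1), of "\<lambda>w. f w * indicator (cball 0 1) w"])
      (intro borel_measurable_times_ennreal f borel_measurable_indicator, simp)
  finally show ?thesis by (subst (1 2) nn_integral_uniform_ball) simp_all
qed

lemma AE_uniform_ball: "(AE w in lborel. P w) \<Longrightarrow> AE w in (uniform_ball :: (real^'n) measure). P w"
  unfolding uniform_ball_def by (rule AE_uniform_measureI) (auto elim: eventually_mono)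

lemma invariant_line_measure_uniform:
  "invariant_line_measure (distr uniform_ball (hit_algebra (linear_subspaces 1)) (\<lambda>w. span {dir w}) :: (real^'n) set measure)"
  (is "invariant_line_measure ?\<nu>")
  unfolding invariant_line_measure_def
proof (intro conjI allI impI)
  interpret prob_space "uniform_ball :: (real^'n) measure" by (rule prob_space_uniform_ball)
  let ?H = "hit_algebra (linear_subspaces 1) :: (real^'n) set measure"
  have m: "(\<lambda>w. span {dir w}) \<in> measurable uniform_ball ?H" using measurable_span_dir by simp
  show "sets ?\<nu> = sets ?H" by simp
  show "prob_space ?\<nu>" by (rule prob_space_distr[OF m])
  fix \<rho> :: "real^'n \<Rightarrow> real^'n" assume "rotation \<rho>"
  then have o: "orthogonal_transformation \<rho>" by (simp add: rotation_def)
  have lin: "linear \<rho>" using o by (simp add: orthogonal_transformation_linear)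
  have im: "image \<rho> \<in> measurable ?H ?H" by (rule measurable_image_rotation[OF o])
  show "distr ?\<nu> ?\<nu> (image \<rho>) = ?\<nu>"
  proof (rule measure_eqI)
    fix A assume "A \<in> sets (distr ?\<nu> ?\<nu> (image \<rho>))"
    then have A: "A \<in> sets ?H" by simp
    have ind: "(\<lambda>w. indicator A (span {dir w}) :: ennreal) \<in> borel_measurable borel"
      by (rule measurable_compose[OF measurable_span_dir]) (use A in simp)
    have sp: "span {dir (\<rho> w)} = \<rho> ` span {dir w}" if "w \<noteq> 0" for w
    proof -
      have "dir (\<rho> w) = \<rho> (dir w)"
        using that o orthogonal_transformation_norm[OF o, of w] linear_scale[OF lin] by (auto simp: dir_def)
      then show ?thesis by (simp add: linear_image_span1[OF lin])
    qed
    have "emeasure (distr ?\<nu> ?\<nu> (image \<rho>)) A = (\<integral>\<^sup>+L. indicator A L \<partial>distr ?\<nu> ?\<nu> (image \<rho>))" using A by simp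
    also have "\<dots> = (\<integral>\<^sup>+L. indicator A (\<rho> ` L) \<partial>?\<nu>)"
      by (rule nn_integral_distr) (use im A in auto)
    also have "\<dots> = (\<integral>\<^sup>+w. indicator A (\<rho> ` span {dir w}) \<partial>uniform_ball)"
      by (rule nn_integral_distr[OF m]) (simp only: measurable_distr_eq1, rule measurable_compose[OF im borel_measurable_indicator[OF A]])
    also have "\<dots> = (\<integral>\<^sup>+w. indicator A (span {dir (\<rho> w)}) \<partial>uniform_ball)"
      by (intro nn_integral_cong_AE AE_uniform_ball eventually_mono[OF AE_lborel_singleton[of 0]]) (simp add: sp)
    also have "\<dots> = (\<integral>\<^sup>+w. indicator A (span {dir w}) \<partial>uniform_ball)"
      by (rule uniform_ball_rotation[OF o ind])
    also have "\<dots> = (\<integral>\<^sup>+L. indicator A L \<partial>?\<nu>)"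
      by (rule nn_integral_distr[OF m, symmetric]) (use A in auto)
    finally show "emeasure (distr ?\<nu> ?\<nu> (image \<rho>)) A = emeasure ?\<nu> A" using A by simp
  qed simp
qed

lemma grassmannian_measure_1:
  assumes "CARD('n) \<ge> 2"
  shows "(grassmannian_measure 1 :: (real^'n) set measure) = distr uniform_ball (hit_algebra (linear_subspaces 1)) (\<lambda>w. span {dir w})"
  unfolding grassmannian_measure_def invariant_line_measure_def[symmetric]
proof (rule the_equality)
  show "invariant_line_measure (distr uniform_ball (hit_algebra (linear_subspaces 1)) (\<lambda>w. span {dir w}) :: (real^'n) set measure)"
    by (rule invariant_line_measure_uniform)
  show "\<nu> = distr uniform_ball (hit_algebra (linear_subspaces 1)) (\<lambda>w. span {dir w})" if "invariant_line_measure \<nu>" for \<nu> :: "(real^'n) set measure"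
    by (rule invariant_line_measure_unique[OF assms that invariant_line_measure_uniform])
qed


section \<open>Projection of the top support measure along a direction\<close>

lemma measurable_line_fixed:
  assumes v: "norm v = 1"
  shows "(\<lambda>x. line v x) \<in> measurable (borel :: (real^'n) measure) (hit_algebra (affine_flats 1))"
proof -
  have m: "(\<lambda>x :: real^'n. (v, x)) \<in> measurable borel borel" unfolding borel_prod[symmetric] by measurable
  show ?thesis using measurable_compose[OF m measurable_line] by (simp add: dir_unit[OF v])
qed

lemma hit_borel:
  assumes v: "norm v = 1" and K: "compact (K :: (real^'n) set)"
  shows "{x. line v x \<inter> K \<noteq> {}} \<in> sets borel"
  using measurable_sets[OF measurable_line_fixed[OF v] sets_hit_algebra_hit[OF K]] line_flat[OF v] by (simp add: vimage_def)

text \<open>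
  Along the line the squared norm changes by \<open>2 s (x \<bullet> v) + s\<^sup>2 \<ge> \<bar>s\<bar> (\<bar>s\<bar> - 1) \<ge> - 1/4\<close>, where \<open>v\<close> is a unit
  vector. Thus lines through far points of the slab miss a given ball.
\<close>

lemma slab_escape:
  fixes x v :: "'a::real_inner"
  assumes v: "norm v = 1" and x: "\<bar>x \<bullet> v\<bar> \<le> 1/2" and far: "R \<ge> 0" "norm x > R + 2"
  shows "norm (x + s *\<^sub>R v) > R + 1"
proof -
  have "(norm (x + s *\<^sub>R v))\<^sup>2 = (norm x)\<^sup>2 + 2 * (s * (x \<bullet> v)) + s\<^sup>2"
    unfolding power2_norm_eq_inner using v by (simp add: inner_add inner_commute norm_eq_1 power2_eq_square)
  moreover have "2 * (s * (x \<bullet> v)) \<ge> - \<bar>s\<bar>"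
  proof -
    have "\<bar>s * (x \<bullet> v)\<bar> \<le> \<bar>s\<bar> * (1/2)" unfolding abs_mult by (intro mult_left_mono x) simp
    then show ?thesis by linarith
  qed
  moreover have "s\<^sup>2 - \<bar>s\<bar> \<ge> - 1/4"
    using zero_le_power2[of "\<bar>s\<bar> - 1/2"] by (simp add: power2_eq_square algebra_simps)
  moreover have "(norm x)\<^sup>2 > (R + 1)\<^sup>2 + 1/4"
  proof -
    have "(norm x)\<^sup>2 \<ge> (R + 2)\<^sup>2" using far by (intro power_mono) auto
    moreover have "(R + 2)\<^sup>2 = (R + 1)\<^sup>2 + 2 * R + 3" by (simp add: power2_eq_square algebra_simps)
    ultimately show ?thesis using far(1) by linarith
  qed
  ultimately have "(norm (x + s *\<^sub>R v))\<^sup>2 > (R + 1)\<^sup>2" by linarith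
  then show ?thesis using power_less_imp_less_base[of "R + 1" 2 "norm (x + s *\<^sub>R v)"] by simp
qed

text \<open>
  The last point of \<open>K\<close> on the line in direction \<open>v\<close>.
\<close>

definition is_top :: "(real^'n) set \<Rightarrow> real^'n \<Rightarrow> real^'n \<Rightarrow> real^'n \<Rightarrow> bool" where
  "is_top K v x p \<longleftrightarrow> p \<in> K \<and> (\<exists>a. p = x + a *\<^sub>R v \<and> (\<forall>s. x + s *\<^sub>R v \<in> K \<longrightarrow> s \<le> a))"

lemma is_top_unique: "is_top K v x p \<Longrightarrow> is_top K v x q \<Longrightarrow> p = q"
  unfolding is_top_def using antisym by metis

text \<open>
  The layers of all lines through the slab add up to the shell integral of \<open>g p * max 0 (u \<bullet> v)\<close>. Divided by \<open>eps\<close>,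
  it tends to twice the integral with respect to the top support measure, whereas on each line the layer tends to
  the value of \<open>g\<close> at the last point of \<open>K\<close>.
\<close>

lemma projection_formula_continuous:
  fixes K :: "(real^'n) set" and g :: "real^'n \<Rightarrow> real"
  assumes K: "convex_body K" and v: "norm v = 1" and g: "continuous_on UNIV g" "\<And>z. 0 \<le> g z" "\<And>z. g z \<le> C"
    and tp: "\<And>x. line v x \<inter> K \<noteq> {} \<Longrightarrow> is_top K v x (tp x)" and tpm[measurable]: "tp \<in> borel_measurable borel"
  shows "(\<integral>\<^sup>+x. indicator {x. \<bar>x \<bullet> v\<bar> \<le> 1/2} x * (indicator {x. line v x \<inter> K \<noteq> {}} x * ennreal (g (tp x))) \<partial>lborel)
    = ennreal (2 * (\<integral>z. g (fst z) * max 0 (snd z \<bullet> v) \<partial>support_measure K (CARD('n) - 1)))"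
proof (rule LIMSEQ_unique)
  note [measurable] = borel_measurable_foot_normal[OF K] borel_shell[OF K] borel_measurable_closest_point[OF K] borel_measurable_outer_normal[OF K]
    hit_borel[OF v bodyD(2)[OF K]]
  have gm[measurable]: "g \<in> borel_measurable borel" using g(1) by (rule borel_measurable_continuous_onI)
  obtain R where R: "R \<ge> 0" "K \<subseteq> cball 0 R" using bounded_cball_superset[OF K] by blast
  have C: "0 \<le> C" using g(2,3) order_trans by blast
  let ?f = "\<lambda>z :: (real^'n) \<times> (real^'n). g (fst z) * max 0 (snd z \<bullet> v)"
  let ?e = "\<lambda>m. 1 / real (Suc m)"
  let ?S = "{x. \<bar>x \<bullet> v\<bar> \<le> 1/2}"
  let ?lay = "\<lambda>x m. ennreal (real (Suc m)) * layer K x v g (?e m)"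
  have fm: "?f \<in> borel_measurable borel" unfolding borel_prod[symmetric] by measurable
  have fC: "\<bar>?f (x, u)\<bar> \<le> C" if "norm u = 1" for x u
  proof -
    have "max 0 (u \<bullet> v) \<le> 1" using norm_cauchy_schwarz[of u v] that v by simp
    then have "g x * max 0 (u \<bullet> v) \<le> C * 1" using g(2,3) C by (intro mult_mono) auto
    then show ?thesis using g(2)[of x] by (simp add: abs_mult)
  qed
  have f0: "0 \<le> ?f z" for z using g(2) by simp
  \<comment> \<open>the shell integrand, normalized by the width of the shell\<close>
  define F where "F m y = ennreal (real (Suc m)) * (indicator (shell K (?e m)) y * ennreal (?f (foot_normal K y)))" for m y
  have Fm[measurable]: "F m \<in> borel_measurable borel" for m
    unfolding F_def foot_normal_def by simp
  have lay: "(\<integral>\<^sup>+s. F m (x + s *\<^sub>R v) \<partial>lborel) = ?lay x m" for m x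
    unfolding F_def layer_def[OF K v] foot_normal_def fst_conv snd_conv
    by (rule nn_integral_cmult) measurable
  have lay_meas: "(\<lambda>x. ?lay x m) \<in> borel_measurable borel" for m
  proof -
    have "(\<lambda>z :: (real^'n) \<times> real. F m (fst z + snd z *\<^sub>R v)) \<in> borel_measurable borel"
      by (rule measurable_compose[OF _ Fm]) (simp add: borel_prod[symmetric])
    then have "(\<lambda>(x, s). F m (x + s *\<^sub>R v)) \<in> borel_measurable ((borel :: (real^'n) measure) \<Otimes>\<^sub>M (lborel :: real measure))"
      by (simp add: split_beta' borel_prod[symmetric] cong: measurable_cong_sets sets_pair_measure_cong)
    from lborel.borel_measurable_nn_integral[OF this] show ?thesis unfolding lay .
  qed
  have tot: "(\<integral>\<^sup>+x. indicator ?S x * ?lay x m \<partial>lborel) = ennreal (real (Suc m) * (\<integral>x. indicator (shell K (?e m)) x * ?f (foot_normal K x) \<partial>lborel))" for m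
  proof -
    have "(\<integral>\<^sup>+x. indicator ?S x * ?lay x m \<partial>lborel) = (\<integral>\<^sup>+y. F m y \<partial>lborel)"
      unfolding lay[symmetric] by (rule nn_integral_slab[OF Fm v])
    also have "\<dots> = ennreal (real (Suc m)) * (\<integral>\<^sup>+y. ennreal (indicator (shell K (?e m)) y * ?f (foot_normal K y)) \<partial>lborel)"
      unfolding F_def foot_normal_def by (subst nn_integral_cmult[symmetric]) (auto intro!: nn_integral_cong simp: indicator_def)
    also have "(\<integral>\<^sup>+y. ennreal (indicator (shell K (?e m)) y * ?f (foot_normal K y)) \<partial>lborel) = ennreal (\<integral>x. indicator (shell K (?e m)) x * ?f (foot_normal K x) \<partial>lborel)"
      by (intro nn_integral_eq_integral integrable_shell[OF K fm fC] AE_I2 mult_nonneg_nonneg f0) auto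
    finally show ?thesis by (simp add: ennreal_mult' del: of_nat_Suc)
  qed
  show "(\<lambda>m. \<integral>\<^sup>+x. indicator ?S x * ?lay x m \<partial>lborel) \<longlonglongrightarrow> ennreal (2 * (\<integral>z. ?f z \<partial>support_measure K (CARD('n) - 1)))"
    unfolding tot by (intro tendsto_ennrealI support_measure_top_limit[OF K fm fC])
  have Sb[measurable]: "?S \<in> sets borel" by measurable
  have e0: "filterlim ?e (at_right 0) sequentially"
    by (intro tendsto_imp_filterlim_at_right LIMSEQ_Suc lim_1_over_n always_eventually allI) simp
  show "(\<lambda>m. \<integral>\<^sup>+x. indicator ?S x * ?lay x m \<partial>lborel) \<longlonglongrightarrow>
     (\<integral>\<^sup>+x. indicator ?S x * (indicator {x. line v x \<inter> K \<noteq> {}} x * ennreal (g (tp x))) \<partial>lborel)"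
  proof (rule nn_integral_dominated_convergence[where w="\<lambda>x. ennreal C * indicator (cball 0 (R + 2)) x"])
    show "(\<lambda>x. indicator ?S x * ?lay x m) \<in> borel_measurable lborel" for m
      unfolding measurable_lborel2 by (intro borel_measurable_times_ennreal borel_measurable_indicator Sb lay_meas)
    show "(\<lambda>x. indicator ?S x * (indicator {x. line v x \<inter> K \<noteq> {}} x * ennreal (g (tp x)))) \<in> borel_measurable lborel"
      unfolding measurable_lborel2 using hit_borel[OF v bodyD(2)[OF K]]
      by (intro borel_measurable_times_ennreal borel_measurable_indicator Sb measurable_compose[OF measurable_compose[OF tpm gm] measurable_ennreal])
    show "(\<lambda>x. ennreal C * indicator (cball (0::real^'n) (R + 2)) x) \<in> borel_measurable lborel"
      unfolding measurable_lborel2 by (intro borel_measurable_times_ennreal borel_measurable_const borel_measurable_indicator) simp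
    show "(\<integral>\<^sup>+x. ennreal C * indicator (cball (0::real^'n) (R + 2)) x \<partial>lborel) < \<infinity>"
      using emeasure_bounded_finite[OF bounded_cball[of "0::real^'n" "R + 2"]]
      by (simp add: nn_integral_cmult_indicator ennreal_mult_less_top)
    show "AE x in lborel. indicator ?S x * ?lay x m \<le> ennreal C * indicator (cball 0 (R + 2)) x" for m
    proof (rule AE_I2)
      fix x
      show "indicator ?S x * ?lay x m \<le> ennreal C * indicator (cball 0 (R + 2)) x"
      proof (cases "x \<in> ?S \<and> norm x > R + 2")
        case True
        have "x + s *\<^sub>R v \<notin> shell K (?e m)" for s
        proof
          assume "x + s *\<^sub>R v \<in> shell K (?e m)"
          then have "norm (x + s *\<^sub>R v) \<le> R + ?e m" using shell_subset_cball[OF K R(2), of "?e m"] by (auto simp del: of_nat_Suc)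
          also have "\<dots> \<le> R + 1" by simp
          finally show False using slab_escape[OF v _ R(1), of x s] True by auto
        qed
        then have "layer K x v g (?e m) = 0" unfolding layer_def[OF K v] by (simp del: of_nat_Suc)
        then show ?thesis by simp
      next
        case False
        have "?lay x m \<le> ennreal (real (Suc m)) * (ennreal C * ennreal (?e m))"
          by (intro mult_left_mono layer_le[OF K v g(2,3)]) auto
        also have "\<dots> = ennreal (real (Suc m)) * ennreal (C * ?e m)" by (subst ennreal_mult[OF C]) (simp, rule refl)
        also have "\<dots> = ennreal (real (Suc m) * (C * ?e m))" by (rule ennreal_mult'[symmetric]) simp
        also have "real (Suc m) * (C * ?e m) = C" by (simp del: of_nat_Suc)
        finally show ?thesis using False by (auto simp: indicator_def not_less)
      qed
    qed
    show "AE x in lborel. (\<lambda>m. indicator ?S x * ?lay x m) \<longlonglongrightarrow> indicator ?S x * (indicator {x. line v x \<inter> K \<noteq> {}} x * ennreal (g (tp x)))"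
    proof (rule AE_I2)
      fix x
      obtain a where a: "{a<..} \<subseteq> rising K x v" "rising K x v \<subseteq> {a..}" using rising_threshold[OF K v] by blast
      have "(\<lambda>m. ?lay x m) \<longlonglongrightarrow> indicator {x. line v x \<inter> K \<noteq> {}} x * ennreal (g (tp x))"
      proof (cases "line v x \<inter> K \<noteq> {}")
        case True
        then obtain s0 where s0: "x + s0 *\<^sub>R v \<in> K" by (auto simp: mem_line)
        note top = threshold_top[OF K v a s0]
        have "is_top K v x (x + a *\<^sub>R v)" using top by (auto simp: is_top_def)
        then have eq: "tp x = x + a *\<^sub>R v" using is_top_unique[OF tp[OF True]] by blast
        have "isCont g (x + a *\<^sub>R v)" using g(1) continuous_on_eq_continuous_at[OF open_UNIV] by blast
        from filterlim_compose[OF layer_hit[OF K v a top(1) g(2) this] e0]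
        show ?thesis using True by (simp add: eq del: of_nat_Suc)
      next
        case False
        moreover have "x + s *\<^sub>R v \<in> line v x" for s unfolding mem_line by (rule exI[of _ s]) (rule refl)
        ultimately have "\<And>s. x + s *\<^sub>R v \<notin> K" by blast
        from layer_miss[OF K v this g(2)] have "\<forall>\<^sub>F eps in at_right 0. layer K x v g eps = 0" by simp
        then have "\<forall>\<^sub>F m in sequentially. layer K x v g (?e m) = 0" using e0 unfolding filterlim_iff by blast
        then have "\<forall>\<^sub>F m in sequentially. 0 = ?lay x m" by eventually_elim simp
        from Lim_transform_eventually[OF tendsto_const this] show ?thesis using False by simp
      qed
      then show "(\<lambda>m. indicator ?S x * ?lay x m) \<longlonglongrightarrow> indicator ?S x * (indicator {x. line v x \<inter> K \<noteq> {}} x * ennreal (g (tp x)))"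
        by (cases "x \<in> ?S") auto
    qed
  qed
qed

lemma finite_measure_eqI_continuous:
  fixes M N :: "('a :: metric_space) measure"
  assumes fin: "finite_measure M" "finite_measure N" and s: "sets M = sets borel" "sets N = sets borel"
    and eq: "\<And>g :: 'a \<Rightarrow> real. continuous_on UNIV g \<Longrightarrow> (\<And>z. 0 \<le> g z) \<Longrightarrow> (\<And>z. g z \<le> 1) \<Longrightarrow> (\<integral>\<^sup>+z. ennreal (g z) \<partial>M) = (\<integral>\<^sup>+z. ennreal (g z) \<partial>N)"
  shows "M = N"
proof -
  have sp: "space M = UNIV" "space N = UNIV" using s[THEN sets_eq_imp_space_eq] by simp_all
  have "emeasure M A = emeasure N A" if A: "closed A" for A
  proof (cases "A = {}")
    case False
    let ?g = "\<lambda>m z. max 0 (1 - real m * infdist z A)"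
    have g: "continuous_on UNIV (?g m)" for m by (intro continuous_intros)
    have b: "0 \<le> ?g m z" "?g m z \<le> 1" for m z using infdist_nonneg[of z A] by auto
    note lim = closed_indicator_limit[OF A False]
    have conv: "(\<lambda>m. \<integral>\<^sup>+z. ennreal (?g m z) \<partial>L) \<longlonglongrightarrow> emeasure L A" if L: "finite_measure L" "sets L = sets borel" for L
    proof -
      interpret L: finite_measure L by fact
      have gm: "(\<lambda>z. ennreal (?g m z)) \<in> borel_measurable L" for m
        unfolding measurable_cong_sets[OF L(2) refl]
        by (rule measurable_compose[OF borel_measurable_continuous_onI[OF g] measurable_ennreal])
      have "(\<lambda>m. \<integral>\<^sup>+z. ennreal (?g m z) \<partial>L) \<longlonglongrightarrow> (\<integral>\<^sup>+z. indicator A z \<partial>L)"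
      proof (rule nn_integral_dominated_convergence[where w="\<lambda>_. 1"])
        show "AE z in L. ennreal (?g m z) \<le> 1" for m using b(2) by (intro AE_I2) (simp only: ennreal_le_1)
        show "indicator A \<in> borel_measurable L" using A L(2) by (intro borel_measurable_indicator) simp
        show "(\<integral>\<^sup>+z. 1 \<partial>L) < \<infinity>" using L.emeasure_finite[of "space L"] by (simp add: less_top[symmetric])
      qed (use gm lim in simp_all)
      then show ?thesis using A L(2) by simp
    qed
    show ?thesis
      by (rule LIMSEQ_unique[OF conv[OF fin(1) s(1)]]) (use conv[OF fin(2) s(2)] eq[OF g b] in simp)
  qed simp
  then show ?thesis
  proof (intro measure_eqI_generator_eq[where E="{S. closed S}" and \<Omega>=UNIV and A="\<lambda>_. UNIV"])
    show "emeasure M UNIV \<noteq> \<infinity>" using fin(1) sp by (metis finite_measure.emeasure_finite infinity_ennreal_def)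
    show "sets M = sigma_sets UNIV {S. closed S}" "sets N = sigma_sets UNIV {S. closed S}" using s by (simp_all add: borel_eq_closed)
  qed (auto simp: Int_stable_def)
qed

text \<open>
  Both sides are integrals with respect to finite measures, so equality for continuous integrands
  extends to Borel functions.
\<close>

lemma projection_formula:
  fixes K :: "(real^'n) set" and G :: "real^'n \<Rightarrow> ennreal"
  assumes K: "convex_body K" and v: "norm v = 1" and G[measurable]: "G \<in> borel_measurable borel"
    and tp: "\<And>x. line v x \<inter> K \<noteq> {} \<Longrightarrow> is_top K v x (tp x)" and tpm[measurable]: "tp \<in> borel_measurable borel"
  shows "(\<integral>\<^sup>+x. indicator {x. \<bar>x \<bullet> v\<bar> \<le> 1/2} x * indicator {x. line v x \<inter> K \<noteq> {}} x * G (tp x) \<partial>lborel)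
    = (\<integral>\<^sup>+z. ennreal (2 * max 0 (snd z \<bullet> v)) * G (fst z) \<partial>support_measure K (CARD('n) - 1))"
proof -
  let ?Lam = "support_measure K (CARD('n) - 1)"
  have n: "CARD('n) - 1 < CARD('n)" by simp
  interpret L: finite_measure ?Lam by (rule sets_support_measure[OF K n])
  let ?S = "\<lambda>x. indicator {x. \<bar>x \<bullet> v\<bar> \<le> 1/2} x * indicator {x. line v x \<inter> K \<noteq> {}} x :: ennreal"
  let ?w = "\<lambda>z. ennreal (2 * max 0 (snd z \<bullet> v))"
  have Sm: "?S \<in> borel_measurable lborel"
    unfolding measurable_lborel2 by (intro borel_measurable_times_ennreal borel_measurable_indicator hit_borel[OF v bodyD(2)[OF K]]) measurable
  have wm: "?w \<in> borel_measurable ?Lam"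
    by (rule measurable_support_measure[OF K n]) (unfold borel_prod[symmetric], measurable)
  have fstm: "fst \<in> measurable ?Lam borel"
    by (rule measurable_support_measure[OF K n]) (unfold borel_prod[symmetric], measurable)
  let ?M = "distr (density lborel ?S) borel tp" and ?N = "distr (density ?Lam ?w) borel fst"
  have M: "(\<integral>\<^sup>+z. H z \<partial>?M) = (\<integral>\<^sup>+x. ?S x * H (tp x) \<partial>lborel)" if [measurable]: "H \<in> borel_measurable borel" for H :: "real^'n \<Rightarrow> ennreal"
  proof -
    have "(\<integral>\<^sup>+z. H z \<partial>?M) = (\<integral>\<^sup>+x. H (tp x) \<partial>density lborel ?S)"
      using tpm by (intro nn_integral_distr) simp_all
    also have "\<dots> = (\<integral>\<^sup>+x. ?S x * H (tp x) \<partial>lborel)" by (rule nn_integral_density[OF Sm]) simp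
    finally show ?thesis .
  qed
  have N: "(\<integral>\<^sup>+z. H z \<partial>?N) = (\<integral>\<^sup>+z. ?w z * H (fst z) \<partial>?Lam)" if H: "H \<in> borel_measurable borel" for H :: "real^'n \<Rightarrow> ennreal"
  proof -
    have "(\<integral>\<^sup>+z. H z \<partial>?N) = (\<integral>\<^sup>+z. H (fst z) \<partial>density ?Lam ?w)"
    proof (rule nn_integral_distr)
      show "fst \<in> measurable (density ?Lam ?w) borel"
        unfolding measurable_cong_sets[OF sets_density refl] by (rule fstm)
      show "H \<in> borel_measurable (distr (density ?Lam ?w) borel fst)" using H by (simp only: measurable_distr_eq1)
    qed
    also have "\<dots> = (\<integral>\<^sup>+z. ?w z * H (fst z) \<partial>?Lam)" by (rule nn_integral_density[OF wm measurable_compose[OF fstm H]])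
    finally show ?thesis .
  qed
  have eq: "(\<integral>\<^sup>+z. ennreal (g z) \<partial>?M) = (\<integral>\<^sup>+z. ennreal (g z) \<partial>?N)"
    "(\<integral>\<^sup>+z. ennreal (g z) \<partial>?N) < \<top>"
    if g: "continuous_on UNIV g" "\<And>z. 0 \<le> g z" "\<And>z. g z \<le> 1" for g
  proof -
    let ?f = "\<lambda>z :: (real^'n) \<times> (real^'n). g (fst z) * max 0 (snd z \<bullet> v)"
    have gm[measurable]: "g \<in> borel_measurable borel" using g(1) by (rule borel_measurable_continuous_onI)
    have fm: "?f \<in> borel_measurable borel" unfolding borel_prod[symmetric] by measurable
    have fC: "\<bar>?f (x, u)\<bar> \<le> 1" if "norm u = 1" for x u
    proof -
      have "max 0 (u \<bullet> v) \<le> 1" using norm_cauchy_schwarz[of u v] that v by simp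
      then have "g x * max 0 (u \<bullet> v) \<le> 1 * 1" using g(2,3) by (intro mult_mono) auto
      then show ?thesis using g(2)[of x] by (simp add: abs_mult)
    qed
    have "(\<integral>\<^sup>+z. ennreal (g z) \<partial>?M) = (\<integral>\<^sup>+x. indicator {x. \<bar>x \<bullet> v\<bar> \<le> 1/2} x * (indicator {x. line v x \<inter> K \<noteq> {}} x * ennreal (g (tp x))) \<partial>lborel)"
      by (subst M) (auto simp: mult.assoc)
    also have "\<dots> = ennreal (2 * (\<integral>z. ?f z \<partial>?Lam))"
      by (rule projection_formula_continuous[OF K v g tp tpm])
    also have "\<dots> = ennreal (\<integral>z. 2 * ?f z \<partial>?Lam)" by simp
    also have e: "\<dots> = (\<integral>\<^sup>+z. ennreal (2 * ?f z) \<partial>?Lam)"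
      using g(2) by (intro nn_integral_eq_integral[symmetric] integrable_mult_right integrable_support_measure[OF K n fm fC] AE_I2) auto
    also have "\<dots> = (\<integral>\<^sup>+z. ?w z * ennreal (g (fst z)) \<partial>?Lam)"
      using g(2) by (intro nn_integral_cong) (simp add: ennreal_mult'[symmetric] mult_ac)
    also have "\<dots> = (\<integral>\<^sup>+z. ennreal (g z) \<partial>?N)" by (rule N[symmetric]) simp
    finally show *: "(\<integral>\<^sup>+z. ennreal (g z) \<partial>?M) = (\<integral>\<^sup>+z. ennreal (g z) \<partial>?N)" .
    have "(\<integral>\<^sup>+z. ennreal (2 * ?f z) \<partial>?Lam) < \<top>"
      unfolding e[symmetric] by simp
    also have "(\<integral>\<^sup>+z. ennreal (2 * ?f z) \<partial>?Lam) = (\<integral>\<^sup>+z. ?w z * ennreal (g (fst z)) \<partial>?Lam)"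
      using g(2) by (intro nn_integral_cong) (simp add: ennreal_mult'[symmetric] mult_ac)
    also have "\<dots> = (\<integral>\<^sup>+z. ennreal (g z) \<partial>?N)" by (rule N[symmetric]) simp
    finally show "(\<integral>\<^sup>+z. ennreal (g z) \<partial>?N) < \<top>" .
  qed
  have "?M = ?N"
  proof (rule finite_measure_eqI_continuous)
    have 1: "(\<integral>\<^sup>+z. ennreal 1 \<partial>?M) = (\<integral>\<^sup>+z. ennreal 1 \<partial>?N)" "(\<integral>\<^sup>+z. ennreal 1 \<partial>?N) < \<top>" by (rule eq; simp)+
    show "finite_measure ?N" using 1(2) by (intro finite_measureI) simp
    show "finite_measure ?M" using 1 by (intro finite_measureI) simp
  qed (use eq(1) in simp_all)
  then show ?thesis using M[OF G] N[OF G] by simp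
qed


section \<open>Extreme points of chords\<close>

text \<open>
  The support function of \<open>S\<close>.
\<close>

definition supf :: "(real^'n) set \<Rightarrow> real^'n \<Rightarrow> real" where
  "supf S w = (if S = {} then 0 else Sup ((\<lambda>z. z \<bullet> w) ` S))"

lemma supf_bdd:
  assumes "compact (S :: (real^'n) set)" shows "bdd_above ((\<lambda>z. z \<bullet> w) ` S)"
  by (intro bounded_imp_bdd_above compact_imp_bounded compact_continuous_image continuous_intros assms)

lemma supf_ge: assumes "compact S" "z \<in> S" shows "z \<bullet> w \<le> supf S w"
  unfolding supf_def using assms supf_bdd[OF assms(1)] by (auto intro: cSup_upper)

lemma supf_le: assumes "S \<noteq> {}" "\<And>z. z \<in> S \<Longrightarrow> z \<bullet> w \<le> c" shows "supf S w \<le> c"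
  unfolding supf_def using assms by (auto intro: cSup_least)

lemma supf_eq: assumes "z \<in> S" "\<And>z'. z' \<in> S \<Longrightarrow> z' \<bullet> w \<le> z \<bullet> w" shows "supf S w = z \<bullet> w"
proof -
  have "Sup ((\<lambda>z. z \<bullet> w) ` S) = z \<bullet> w" using assms by (intro cSup_eq_maximum) auto
  then show ?thesis using assms(1) by (auto simp: supf_def)
qed

lemma supf_attained: assumes "compact S" "S \<noteq> {}" obtains z where "z \<in> S" "supf S w = z \<bullet> w"
proof -
  have "continuous_on S (\<lambda>z. z \<bullet> w)" by (intro continuous_intros)
  from continuous_attains_sup[OF assms this] obtain z where "z \<in> S" "\<forall>y\<in>S. y \<bullet> w \<le> z \<bullet> w" by blast
  then show ?thesis using that supf_eq by blast
qed

lemma supf_lipschitz: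
  assumes "compact S" "S \<subseteq> cball 0 R" "R \<ge> 0"
  shows "supf S w \<le> supf S w' + R * norm (w - w')"
proof (cases "S = {}")
  case True then show ?thesis using assms(3) by (simp add: supf_def)
next
  case False
  show ?thesis
  proof (rule supf_le[OF False])
    fix z assume z: "z \<in> S"
    have "z \<bullet> w = z \<bullet> w' + z \<bullet> (w - w')" by (simp add: inner_diff_right)
    moreover have "z \<bullet> (w - w') \<le> norm z * norm (w - w')" by (rule norm_cauchy_schwarz)
    moreover have "norm z * norm (w - w') \<le> R * norm (w - w')" using z assms(2) by (intro mult_right_mono) auto
    ultimately show "z \<bullet> w \<le> supf S w' + R * norm (w - w')" using supf_ge[OF assms(1) z, of w'] by linarith
  qed
qed

lemma closed_flat: "E \<in> affine_flats 1 \<Longrightarrow> closed E"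
  unfolding affine_flats_def by (metis (no_types, lifting) affine_hull_eq closed_affine_hull mem_Collect_eq)

text \<open>
  A superlevel set of the support function of \<open>K \<inter> E\<close> consists of the lines \<open>E\<close> that hit the compact part of \<open>K\<close> in
  a half-space, up to the lines that miss \<open>K\<close>.
\<close>

lemma supf_measurable_fixed:
  assumes K: "compact (K :: (real^'n) set)"
  shows "(\<lambda>E. supf (K \<inter> E) w) \<in> borel_measurable (hit_algebra (affine_flats 1))"
proof (rule borel_measurableI_ge)
  fix \<alpha>
  let ?A = "affine_flats 1 :: (real^'n) set set"
  have C: "compact (K \<inter> {z. z \<bullet> w \<ge> \<alpha>})"
    using K by (intro compact_Int_closed closed_Collect_le continuous_intros)
  have eq: "{E \<in> ?A. \<alpha> \<le> supf (K \<inter> E) w} = {E \<in> ?A. E \<inter> (K \<inter> {z. z \<bullet> w \<ge> \<alpha>}) \<noteq> {}} \<union> (if \<alpha> \<le> 0 then ?A - {E \<in> ?A. E \<inter> K \<noteq> {}} else {})"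
  proof -
    have "\<alpha> \<le> supf (K \<inter> E) w \<longleftrightarrow> E \<inter> (K \<inter> {z. z \<bullet> w \<ge> \<alpha>}) \<noteq> {} \<or> (\<alpha> \<le> 0 \<and> E \<inter> K = {})" if E: "E \<in> ?A" for E
    proof (cases "K \<inter> E = {}")
      case True then show ?thesis by (auto simp: supf_def)
    next
      case False
      have cE: "compact (K \<inter> E)" using K closed_flat[OF E] by (intro compact_Int_closed)
      obtain z where z: "z \<in> K \<inter> E" "supf (K \<inter> E) w = z \<bullet> w" by (rule supf_attained[OF cE False])
      show ?thesis
      proof
        assume "\<alpha> \<le> supf (K \<inter> E) w" then show "E \<inter> (K \<inter> {z. z \<bullet> w \<ge> \<alpha>}) \<noteq> {} \<or> (\<alpha> \<le> 0 \<and> E \<inter> K = {})" using z by auto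
      next
        assume "E \<inter> (K \<inter> {z. z \<bullet> w \<ge> \<alpha>}) \<noteq> {} \<or> (\<alpha> \<le> 0 \<and> E \<inter> K = {})"
        then obtain y where "y \<in> K \<inter> E" "y \<bullet> w \<ge> \<alpha>" using False by auto
        then show "\<alpha> \<le> supf (K \<inter> E) w" using supf_ge[OF cE, of y w] by linarith
      qed
    qed
    then show ?thesis by auto
  qed
  have top: "?A \<in> sets (hit_algebra ?A)" using sets.top[of "hit_algebra ?A"] by simp
  show "{E \<in> space (hit_algebra ?A). \<alpha> \<le> supf (K \<inter> E) w} \<in> sets (hit_algebra ?A)"
    unfolding space_hit_algebra eq using sets_hit_algebra_hit[OF C, of ?A] sets_hit_algebra_hit[OF K, of ?A] top by auto
qed

text \<open>
  The support function is Lipschitz in \<open>w\<close> with a constant that works for all lines, so it is the supremum of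
  countably many Lipschitz minorants, each of which is measurable in the line.
\<close>

lemma supf_measurable:
  assumes K: "compact (K :: (real^'n) set)"
  shows "(\<lambda>z. supf (K \<inter> fst z) (snd z)) \<in> borel_measurable (hit_algebra (affine_flats 1) \<Otimes>\<^sub>M borel)"
proof -
  let ?H = "hit_algebra (affine_flats 1) :: (real^'n) set measure"
  obtain D :: "(real^'n) set" where D: "countable D" "\<And>X. open X \<Longrightarrow> X \<noteq> {} \<Longrightarrow> \<exists>d\<in>D. d \<in> X"
    using countable_dense_exists[where 'a="real^'n"] by blast
  obtain R where R: "R \<ge> 0" "K \<subseteq> cball 0 R"
    using compact_imp_bounded[OF K] unfolding bounded_iff subset_iff mem_cball_0 by (metis norm_ge_zero order_trans linear)
  have Dne: "D \<noteq> {}" using D(2)[of UNIV] by auto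
  \<comment> \<open>Lipschitz minorants, one for each point of a countable dense set\<close>
  let ?F = "\<lambda>q z. supf (K \<inter> fst z) q - R * norm (snd z - q)"
  have Fm: "?F q \<in> borel_measurable (?H \<Otimes>\<^sub>M borel)" for q
    using measurable_compose[OF measurable_fst supf_measurable_fixed[OF K, of q], of "borel :: (real^'n) measure"] by measurable
  have le: "?F q z \<le> supf (K \<inter> fst z) (snd z)" if "z \<in> space (?H \<Otimes>\<^sub>M borel)" for q z
  proof -
    have "fst z \<in> affine_flats 1" using that by (auto simp: space_pair_measure)
    then have "compact (K \<inter> fst z)" using K closed_flat by (intro compact_Int_closed) auto
    moreover have "K \<inter> fst z \<subseteq> cball 0 R" using R(2) by blast
    ultimately show ?thesis using supf_lipschitz[OF _ _ R(1), of "K \<inter> fst z" q "snd z"] by (simp add: norm_minus_commute)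
  qed
  have "(\<lambda>z. SUP q\<in>D. ?F q z) \<in> borel_measurable (?H \<Otimes>\<^sub>M borel)"
    by (intro borel_measurable_cSUP D(1) Fm bdd_aboveI2[OF le])
  moreover have "(SUP q\<in>D. ?F q z) = supf (K \<inter> fst z) (snd z)" if z: "z \<in> space (?H \<Otimes>\<^sub>M borel)" for z
  proof (rule antisym)
    show "(SUP q\<in>D. ?F q z) \<le> supf (K \<inter> fst z) (snd z)" by (intro cSUP_least Dne le z)
    show "supf (K \<inter> fst z) (snd z) \<le> (SUP q\<in>D. ?F q z)"
    proof (rule field_le_epsilon)
      fix e :: real assume e: "e > 0"
      have "fst z \<in> affine_flats 1" using z by (auto simp: space_pair_measure)
      then have cE: "compact (K \<inter> fst z)" using K closed_flat by (intro compact_Int_closed) auto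
      have "e / (2 * (R + 1)) > 0" using e R(1) by (intro divide_pos_pos) auto
      then have "ball (snd z) (e / (2 * (R + 1))) \<noteq> {}" unfolding ball_eq_empty by linarith
      then obtain q where q: "q \<in> D" "q \<in> ball (snd z) (e / (2 * (R + 1)))" using D(2)[OF open_ball] by blast
      have "R * norm (snd z - q) \<le> e / 2"
      proof -
        have "norm (snd z - q) \<le> e / (2 * (R + 1))" using q(2) by (simp add: dist_norm)
        then have "R * norm (snd z - q) \<le> (R + 1) * (e / (2 * (R + 1)))" using R(1) by (intro mult_mono) auto
        also have "\<dots> = e / 2" using R(1) by (simp add: field_simps)
        finally show ?thesis .
      qed
      moreover have "supf (K \<inter> fst z) (snd z) \<le> supf (K \<inter> fst z) q + R * norm (snd z - q)"
        using R by (intro supf_lipschitz cE) auto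
      moreover have "?F q z \<le> (SUP q\<in>D. ?F q z)" by (intro cSUP_upper q(1) bdd_aboveI2[OF le[OF z]])
      ultimately show "supf (K \<inter> fst z) (snd z) \<le> (SUP q\<in>D. ?F q z) + e" by linarith
    qed
  qed
  ultimately show ?thesis by (subst measurable_cong[symmetric]) auto
qed

text \<open>
  The gradient of the support function, written as a limit of difference quotients: this formula is
  measurable jointly in the set and in \<open>w\<close>. If one point of \<open>S\<close> is maximal in all directions close
  to \<open>w\<close>, the gradient is that point.
\<close>

definition apex :: "(real^'n) set \<Rightarrow> real^'n \<Rightarrow> real^'n" where
  "apex S w = (\<chi> i. lim (\<lambda>k. real (Suc k) * (supf S (w + (1 / real (Suc k)) *\<^sub>R axis i 1) - supf S w)))"

lemma apex_measurable:
  assumes K: "compact (K :: (real^'n) set)"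
  shows "(\<lambda>z. apex (K \<inter> fst z) (snd z)) \<in> borel_measurable (hit_algebra (affine_flats 1) \<Otimes>\<^sub>M borel)"
proof -
  let ?H = "hit_algebra (affine_flats 1) :: (real^'n) set measure"
  have shift: "(\<lambda>z. supf (K \<inter> fst z) (snd z + c)) \<in> borel_measurable (?H \<Otimes>\<^sub>M borel)" for c
  proof -
    have "(\<lambda>z :: (real^'n) set \<times> (real^'n). (fst z, snd z + c)) \<in> measurable (?H \<Otimes>\<^sub>M borel) (?H \<Otimes>\<^sub>M borel)" by measurable
    from measurable_compose[OF this supf_measurable[OF K]] show ?thesis by simp
  qed
  have c: "(\<lambda>z. apex (K \<inter> fst z) (snd z) $ i) \<in> borel_measurable (?H \<Otimes>\<^sub>M borel)" for i
    unfolding apex_def vec_lambda_beta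
    by (intro borel_measurable_lim_metric borel_measurable_times borel_measurable_diff borel_measurable_const shift supf_measurable[OF K])
  have "(\<lambda>z. apex (K \<inter> fst z) (snd z) \<bullet> b) \<in> borel_measurable (?H \<Otimes>\<^sub>M borel)" if "b \<in> Basis" for b
    using that c by (auto simp: Basis_vec_def inner_axis)
  then show ?thesis using borel_measurable_euclidean_space by blast
qed

lemma apex_eq:
  assumes S: "z \<in> S" and ev: "\<forall>\<^sub>F w' in nhds w. \<forall>z'\<in>S. z' \<bullet> w' \<le> z \<bullet> w'"
  shows "apex S w = z"
proof -
  let ?w = "\<lambda>k i. w + (1 / real (Suc k)) *\<^sub>R axis i 1"
  have "lim (\<lambda>k. real (Suc k) * (supf S (?w k i) - supf S w)) = z $ i" for i
  proof (rule limI)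
    have "(\<lambda>k. w + (1 / real (Suc k)) *\<^sub>R axis i 1) \<longlonglongrightarrow> w + 0 *\<^sub>R axis i 1"
      by (intro tendsto_intros LIMSEQ_Suc lim_1_over_n)
    then have "filterlim (\<lambda>k. w + (1 / real (Suc k)) *\<^sub>R axis i 1) (nhds w) sequentially" by simp
    then have e1: "\<forall>\<^sub>F k in sequentially. \<forall>z'\<in>S. z' \<bullet> (?w k i) \<le> z \<bullet> (?w k i)"
      using ev unfolding filterlim_iff by blast
    have e2: "supf S w = z \<bullet> w" using eventually_nhds_x_imp_x[OF ev] S by (intro supf_eq) auto
    have "\<forall>\<^sub>F k in sequentially. z $ i = real (Suc k) * (supf S (?w k i) - supf S w)"
      using e1
    proof eventually_elim
      case (elim k)
      have "supf S (?w k i) = z \<bullet> (?w k i)"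
        using elim S by (intro supf_eq) auto
      then show ?case unfolding e2 by (simp add: inner_add_right inner_axis del: of_nat_Suc)
    qed
    then show "(\<lambda>k. real (Suc k) * (supf S (?w k i) - supf S w)) \<longlonglongrightarrow> z $ i"
      by (rule Lim_transform_eventually[OF tendsto_const])
  qed
  then show ?thesis by (simp add: apex_def vec_eq_iff)
qed

lemma apex_segment:
  fixes a v w :: "real^'n"
  assumes t: "\<tau> \<ge> 0" and w: "w \<bullet> v \<noteq> 0"
  shows "apex (segment a v \<tau>) w = segment_end a v \<tau> w"
proof (rule apex_eq)
  show "segment_end a v \<tau> w \<in> segment a v \<tau>" using t by (auto simp: segment_end_def segment_def)
  have lim: "((\<lambda>w'. w' \<bullet> v) \<longlongrightarrow> w \<bullet> v) (nhds w)" by (intro tendsto_intros) (simp add: filterlim_ident)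
  show "\<forall>\<^sub>F w' in nhds w. \<forall>z'\<in>segment a v \<tau>. z' \<bullet> w' \<le> segment_end a v \<tau> w \<bullet> w'"
  proof (cases "w \<bullet> v > 0")
    case True
    from order_tendstoD(1)[OF lim this] show ?thesis
    proof eventually_elim
      case (elim w')
      show ?case
      proof
        fix z' assume "z' \<in> segment a v \<tau>"
        then obtain s where s: "0 \<le> s" "s \<le> \<tau>" "z' = a + s *\<^sub>R v" by (auto simp: segment_def)
        have "s * (w' \<bullet> v) \<le> \<tau> * (w' \<bullet> v)" using s elim by (intro mult_right_mono) auto
        then show "z' \<bullet> w' \<le> segment_end a v \<tau> w \<bullet> w'"
          using True by (simp add: s(3) segment_end_def inner_add_left inner_commute[of v w'])
      qed
    qed
  next
    case False
    then have "w \<bullet> v < 0" using w by simp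
    from order_tendstoD(2)[OF lim this] show ?thesis
    proof eventually_elim
      case (elim w')
      show ?case
      proof
        fix z' assume "z' \<in> segment a v \<tau>"
        then obtain s where s: "0 \<le> s" "s \<le> \<tau>" "z' = a + s *\<^sub>R v" by (auto simp: segment_def)
        have "s * (w' \<bullet> v) \<le> 0" using s elim by (simp add: mult_nonneg_nonpos)
        then show "z' \<bullet> w' \<le> segment_end a v \<tau> w \<bullet> w'"
          using False by (simp add: s(3) segment_end_def inner_add_left inner_commute[of v w'])
      qed
    qed
  qed
qed

text \<open>
  The parameters of a chord form a compact interval.
\<close>

lemma line_section:
  fixes K :: "(real^'n) set"
  assumes K: "convex_body K" and v: "norm v = 1" and hit: "line v x \<inter> K \<noteq> {}"
  obtains s0 s1 where "s0 \<le> s1" "K \<inter> line v x = segment (x + s0 *\<^sub>R v) v (s1 - s0)"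
    "\<And>s. x + s *\<^sub>R v \<in> K \<longleftrightarrow> s0 \<le> s \<and> s \<le> s1"
proof -
  let ?S = "{s. x + s *\<^sub>R v \<in> K}"
  have "closed ?S"
  proof -
    have "closed ((\<lambda>s. x + s *\<^sub>R v) -` K)" by (intro continuous_closed_vimage bodyD(4)[OF K]) (intro continuous_intros)
    then show ?thesis by (simp add: vimage_def)
  qed
  moreover have "bounded ?S"
  proof -
    obtain R where R: "R \<ge> 0" "K \<subseteq> cball 0 R" using bounded_cball_superset[OF K] by blast
    have "\<bar>s\<bar> \<le> R + norm x" if "x + s *\<^sub>R v \<in> K" for s
    proof -
      have "norm (s *\<^sub>R v) \<le> norm (x + s *\<^sub>R v) + norm x" using norm_triangle_ineq4[of "x + s *\<^sub>R v" x] by simp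
      then show ?thesis using that R v by auto
    qed
    then show ?thesis unfolding bounded_iff by auto
  qed
  moreover have "convex ?S"
  proof (rule convexI)
    fix s t u w :: real assume a: "s \<in> ?S" "t \<in> ?S" "0 \<le> u" "0 \<le> w" "u + w = 1"
    have "u *\<^sub>R (x + s *\<^sub>R v) + w *\<^sub>R (x + t *\<^sub>R v) \<in> K" using a by (intro convexD[OF bodyD(3)[OF K]]) auto
    moreover have "u *\<^sub>R (x + s *\<^sub>R v) + w *\<^sub>R (x + t *\<^sub>R v) = (u + w) *\<^sub>R x + (u * s + w * t) *\<^sub>R v"
      by (simp add: algebra_simps)
    ultimately show "u *\<^sub>R s + w *\<^sub>R t \<in> ?S" using a(5) by simp
  qed
  ultimately have "compact ?S" "connected ?S" by (auto simp: compact_eq_bounded_closed convex_connected)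
  then obtain s0 s1 where S: "?S = {s0..s1}" using connected_compact_interval_1 by blast
  have "?S \<noteq> {}" using hit by (auto simp: mem_line)
  then have le: "s0 \<le> s1" using S by auto
  have iff: "x + s *\<^sub>R v \<in> K \<longleftrightarrow> s0 \<le> s \<and> s \<le> s1" for s using S by (metis atLeastAtMost_iff mem_Collect_eq)
  have "K \<inter> line v x = segment (x + s0 *\<^sub>R v) v (s1 - s0)"
  proof -
    have "z \<in> K \<inter> line v x \<longleftrightarrow> (\<exists>s. s0 \<le> s \<and> s \<le> s1 \<and> z = x + s *\<^sub>R v)" for z by (auto simp: mem_line iff)
    moreover have "z \<in> segment (x + s0 *\<^sub>R v) v (s1 - s0) \<longleftrightarrow> (\<exists>s. s0 \<le> s \<and> s \<le> s1 \<and> z = x + s *\<^sub>R v)" for z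
    proof
      assume "z \<in> segment (x + s0 *\<^sub>R v) v (s1 - s0)"
      then obtain r where "0 \<le> r" "r \<le> s1 - s0" "z = x + s0 *\<^sub>R v + r *\<^sub>R v" by (auto simp: segment_def)
      then show "\<exists>s. s0 \<le> s \<and> s \<le> s1 \<and> z = x + s *\<^sub>R v" by (intro exI[of _ "s0 + r"]) (auto simp: scaleR_left_distrib)
    next
      assume "\<exists>s. s0 \<le> s \<and> s \<le> s1 \<and> z = x + s *\<^sub>R v"
      then obtain s where "s0 \<le> s" "s \<le> s1" "z = x + s *\<^sub>R v" by blast
      then show "z \<in> segment (x + s0 *\<^sub>R v) v (s1 - s0)"
        unfolding segment_def by (intro image_eqI[of _ _ "s - s0"]) (auto simp: scaleR_diff_left)
    qed
    ultimately show ?thesis by blast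
  qed
  then show ?thesis using that le iff by blast
qed

lemma apex_line:
  fixes K :: "(real^'n) set"
  assumes K: "convex_body K" and v: "norm v = 1" and hit: "line v x \<inter> K \<noteq> {}" and w: "w \<bullet> v > 0"
  shows "is_top K v x (apex (K \<inter> line v x) w)"
proof -
  obtain s0 s1 where s: "s0 \<le> s1" "K \<inter> line v x = segment (x + s0 *\<^sub>R v) v (s1 - s0)"
    "\<And>s. x + s *\<^sub>R v \<in> K \<longleftrightarrow> s0 \<le> s \<and> s \<le> s1" using line_section[OF K v hit] by metis
  have "apex (K \<inter> line v x) w = segment_end (x + s0 *\<^sub>R v) v (s1 - s0) w"
    unfolding s(2) by (rule apex_segment) (use s(1) w in auto)
  also have "\<dots> = x + s1 *\<^sub>R v" using w by (simp add: segment_end_def scaleR_diff_left)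
  finally show ?thesis using s(1,3) by (auto simp: is_top_def)
qed

text \<open>
  The end of the chord that is extreme in direction \<open>w\<close> is its last point in the direction \<open>v\<close> or \<open>- v\<close>,
  whichever forms an acute angle with \<open>w\<close>.
\<close>

lemma apex_line_sgn:
  fixes K :: "(real^'n) set"
  assumes K: "convex_body K" and v: "norm v = 1" and hit: "line v x \<inter> K \<noteq> {}" and w: "w \<bullet> v \<noteq> 0"
  defines "e \<equiv> sgn (w \<bullet> v) *\<^sub>R v"
  shows "apex (K \<inter> line v x) w = apex (K \<inter> line e x) e" "line e x = line v x"
proof -
  have e: "e = v \<or> e = - v" unfolding e_def using w by (auto simp: sgn_if)
  then show l: "line e x = line v x" using line_uminus by metis
  have ne: "norm e = 1" using e v by auto
  have we: "w \<bullet> e > 0" unfolding e_def using w by (auto simp: sgn_if)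
  have ee: "e \<bullet> e > 0" using ne by (simp add: norm_eq_1)
  have hit': "line e x \<inter> K \<noteq> {}" using hit l by simp
  from is_top_unique[OF apex_line[OF K ne hit' we] apex_line[OF K ne hit' ee]]
  show "apex (K \<inter> line v x) w = apex (K \<inter> line e x) e" unfolding l .
qed


section \<open>The motion invariant measure on lines\<close>

abbreviation slab :: "real^'n \<Rightarrow> (real^'n) set" where
  "slab v \<equiv> {x. \<bar>x \<bullet> v\<bar> \<le> 1/2}"

text \<open>
  The orthonormal basis of the complement of \<open>v\<close> is completed by \<open>v\<close> itself; the coordinate along \<open>v\<close>
  ranges over an interval of length one on the slab.
\<close>

lemma nn_integral_subspace_lebesgue:
  fixes v :: "real^'n" and f :: "real^'n \<Rightarrow> ennreal"
  assumes v: "norm v = 1" and f: "f \<in> borel_measurable borel"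
  shows "(\<integral>\<^sup>+t. f t \<partial>subspace_lebesgue ((span {v})\<^sup>\<bottom>)) = (\<integral>\<^sup>+x. indicator (slab v) x * f (x - (x \<bullet> v) *\<^sub>R v) \<partial>lborel)"
proof -
  let ?V = "(span {v})\<^sup>\<bottom>"
  define B where "B = (SOME B. orthonormal_basis ?V B)"
  have "\<exists>B. orthonormal_basis ?V B"
    using orthonormal_basis_subspace[OF subspace_orthogonal_comp[of "span {v}"]] unfolding orthonormal_basis_def by metis
  then have ob: "orthonormal_basis ?V B" unfolding B_def by (rule someI_ex)
  then have B: "pairwise orthogonal B" "\<forall>b\<in>B. norm b = 1" "span B = ?V" by (auto simp: orthonormal_basis_def)
  have "0 \<notin> B" using B(2) by auto
  then have fB: "finite B" using pairwise_orthogonal_independent[OF B(1)] independent_imp_finite by blast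
  have perp: "b \<bullet> v = 0" if "b \<in> ?V" for b
    using that span_base[of v "{v}"] by (auto simp: orthogonal_comp_def orthogonal_def inner_commute)
  have BV: "b \<in> ?V" if "b \<in> B" for b using that B(3) span_base by blast
  have vB: "v \<notin> B" using perp[of v] BV[of v] v by (auto simp: norm_eq_1)
  have onb: "onb (insert v B)"
    unfolding onb_def
  proof (intro conjI)
    show "pairwise orthogonal (insert v B)"
      using B(1) perp[OF BV] by (auto simp: pairwise_insert orthogonal_def inner_commute)
    show "span (insert v B) = UNIV"
    proof -
      have "x \<in> span (insert v B)" for x
      proof -
        have "x \<in> span {v} + ?V" using subspace_sum_orthogonal_comp[of "span {v}"] by simp
        then obtain y z where yz: "x = y + z" "y \<in> span {v}" "z \<in> span B" unfolding B(3) by (auto simp: set_plus_def)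
        have "y \<in> span (insert v B)" "z \<in> span (insert v B)"
          using yz span_mono[of "{v}" "insert v B"] span_mono[of B "insert v B"] by auto
        then show ?thesis unfolding yz(1) by (rule span_add)
      qed
      then show ?thesis by blast
    qed
  qed (use fB B(2) v in auto)
  interpret P: product_sigma_finite "\<lambda>i::real^'n. lborel :: real measure" ..
  let ?s = "\<lambda>c. \<Sum>b\<in>B. c b *\<^sub>R b"
  let ?i = "\<lambda>c. \<integral>\<^sup>+s. indicator {-1/2..1/2} ((c(v := s)) v) * f (\<Sum>b\<in>B. (c(v := s)) b *\<^sub>R b) \<partial>lborel"
  let ?PB = "\<Pi>\<^sub>M b\<in>B. (lborel :: real measure)"
  have hm: "?s \<in> measurable ?PB borel" by measurable
  have sl: "subspace_lebesgue ?V = distr ?PB (restrict_space borel ?V) ?s"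
    by (simp add: subspace_lebesgue_def B_def Let_def)
  have "(\<integral>\<^sup>+t. f t \<partial>subspace_lebesgue ?V) = (\<integral>\<^sup>+c. f (?s c) \<partial>?PB)"
    unfolding sl
  proof (rule nn_integral_distr)
    show "?s \<in> measurable ?PB (restrict_space borel ?V)"
    proof (rule measurable_restrict_space2[OF _ hm])
      have "(?s c) \<in> span B" for c by (intro span_sum span_scale span_base)
      then show "?s \<in> space ?PB \<rightarrow> ?V" unfolding B(3) by auto
    qed
    show "f \<in> borel_measurable (distr ?PB (restrict_space borel ?V) ?s)"
      unfolding measurable_distr_eq1 by (rule measurable_restrict_space1[OF f])
  qed
  also have "\<dots> = (\<integral>\<^sup>+x. indicator (slab v) x * f (x - (x \<bullet> v) *\<^sub>R v) \<partial>lborel)"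
  proof -
    let ?g = "\<lambda>x. indicator (slab v) x * f (x - (x \<bullet> v) *\<^sub>R v)"
    let ?q = "\<lambda>c. \<Sum>b\<in>insert v B. (1 * c b) *\<^sub>R b"
    have Sb: "slab v \<in> sets borel" by measurable
    have gm: "?g \<in> borel_measurable borel"
      by (intro borel_measurable_times_ennreal borel_measurable_indicator Sb measurable_compose[OF _ f]) measurable
    have one: "?g (?q c) = indicator {-1/2..1/2} (c v) * f (?s c)" for c
    proof -
      have i: "?q c \<bullet> v = c v"
        using onb onb_inner_sum[of "insert v B" v c] by (simp add: onb_def)
      have "?q c - (?q c \<bullet> v) *\<^sub>R v = (?s c)" unfolding i using vB fB by simp
      moreover have "indicator (slab v) (?q c) = (indicator {-1/2..1/2} (c v) :: ennreal)"
        unfolding indicator_def mem_Collect_eq i by (auto simp: abs_le_iff)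
      ultimately show ?thesis by simp
    qed
    have "(\<integral>\<^sup>+x. ?g x \<partial>lborel) = (\<integral>\<^sup>+c. ?g (?q c) \<partial>(\<Pi>\<^sub>M b\<in>insert v B. lborel))"
      by (subst nn_integral_orthonormal_coordinates[OF onb _ gm]) auto
    also have "\<dots> = (\<integral>\<^sup>+c. indicator {-1/2..1/2} (c v) * f (?s c) \<partial>(\<Pi>\<^sub>M b\<in>insert v B. lborel))"
      by (simp only: one)
    also have "\<dots> = (\<integral>\<^sup>+c. ?i c \<partial>?PB)"
    proof (rule P.product_nn_integral_insert[OF fB vB])
      have "?s \<in> measurable (\<Pi>\<^sub>M b\<in>insert v B. lborel) borel" by measurable
      from measurable_compose[OF this f]
      show "(\<lambda>c. indicator {-1/2..1/2} (c v) * f (?s c)) \<in> borel_measurable (\<Pi>\<^sub>M b\<in>insert v B. lborel)"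
        by measurable
    qed
    also have "\<dots> = (\<integral>\<^sup>+c. f (?s c) \<partial>?PB)"
    proof (rule nn_integral_cong)
      fix c
      have "(\<Sum>b\<in>B. (c(v := s)) b *\<^sub>R b) = (?s c)" for s using vB by (intro sum.cong) auto
      then have "?i c
        = (\<integral>\<^sup>+s. indicator {-1/2..1/2::real} s * f (?s c) \<partial>lborel)" by simp
      also have "\<dots> = f (?s c)" by (subst nn_integral_multc) auto
      finally show "?i c = f (?s c)" .
    qed
    finally show ?thesis ..
  qed
  finally show ?thesis .
qed

lemma line_projection: "line v (x - c *\<^sub>R v) = line v x"
proof -
  have "z \<in> line v (x - c *\<^sub>R v) \<longleftrightarrow> z \<in> line v x" for z
  proof
    assume "z \<in> line v (x - c *\<^sub>R v)"
    then obtain t where "z = x - c *\<^sub>R v + t *\<^sub>R v" by (auto simp: mem_line)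
    then have "z = x + (t - c) *\<^sub>R v" by (simp add: scaleR_diff_left)
    then show "z \<in> line v x" unfolding mem_line by blast
  next
    assume "z \<in> line v x"
    then obtain t where "z = x + t *\<^sub>R v" by (auto simp: mem_line)
    then have "z = x - c *\<^sub>R v + (t + c) *\<^sub>R v" by (simp add: scaleR_left_distrib)
    then show "z \<in> line v (x - c *\<^sub>R v)" unfolding mem_line by blast
  qed
  then show ?thesis by blast
qed

text \<open>
  The density that restricts the second parameter to the slab orthogonal to the direction given by the
  first one.
\<close>

definition slab_weight :: "(real^'n) \<times> (real^'n) \<Rightarrow> ennreal" where
  "slab_weight z = indicator {z. \<bar>snd z \<bullet> dir (fst z)\<bar> \<le> 1/2} z"

definition line_parameters :: "((real^'n) \<times> (real^'n)) measure" where
  "line_parameters = density (uniform_ball \<Otimes>\<^sub>M lborel) slab_weight"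

definition param_line :: "(real^'n) \<times> (real^'n) \<Rightarrow> (real^'n) set" where
  "param_line z = line (dir (fst z)) (snd z)"

lemma sets_ball_prod: "sets (uniform_ball \<Otimes>\<^sub>M lborel) = sets (borel :: ((real^'n) \<times> (real^'n)) measure)"
proof -
  have "sets (uniform_ball \<Otimes>\<^sub>M lborel) = sets ((borel :: (real^'n) measure) \<Otimes>\<^sub>M (borel :: (real^'n) measure))"
    by (rule sets_pair_measure_cong) simp_all
  then show ?thesis by (metis borel_prod)
qed

lemma measurable_ball_prod: "f \<in> measurable (uniform_ball \<Otimes>\<^sub>M lborel) N \<longleftrightarrow> f \<in> measurable (borel :: ((real^'n) \<times> (real^'n)) measure) N"
  using measurable_cong_sets[OF sets_ball_prod refl] by blast

lemma slab_weight_measurable: "slab_weight \<in> borel_measurable (borel :: ((real^'n) \<times> (real^'n)) measure)"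
proof -
  have "{z :: (real^'n) \<times> (real^'n). \<bar>snd z \<bullet> dir (fst z)\<bar> \<le> 1/2} \<in> sets borel"
  proof -
    have "(\<lambda>z :: (real^'n) \<times> (real^'n). \<bar>snd z \<bullet> dir (fst z)\<bar>) \<in> borel_measurable (borel \<Otimes>\<^sub>M borel)" by measurable
    from measurable_sets[OF this, of "{..1/2}"] show ?thesis by (simp add: vimage_def borel_prod[symmetric] space_pair_measure)
  qed
  then show ?thesis unfolding slab_weight_def[abs_def] by (rule borel_measurable_indicator)
qed

lemma param_line_measurable: "param_line \<in> measurable (borel :: ((real^'n) \<times> (real^'n)) measure) (hit_algebra (affine_flats 1))"
  unfolding param_line_def[abs_def] by (rule measurable_line)

lemma param_line_flat: "param_line z \<in> affine_flats 1"
  unfolding param_line_def by (rule line_flat) simp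

lemma sets_line_parameters: "sets line_parameters = sets (borel :: ((real^'n) \<times> (real^'n)) measure)"
  unfolding line_parameters_def using sets_ball_prod by simp

text \<open>
  The inner integral in the definition runs over the orthogonal complement of the line and is replaced by an
  integral over the slab. The result depends on the direction only up to sign, so it is a function of the line
  through the origin, and the outer integral can be taken over uniform directions.
\<close>

lemma flat_measure_1:
  assumes n: "CARD('n) \<ge> 2"
  shows "(flat_measure 1 :: (real^'n) set measure) = distr line_parameters (hit_algebra (affine_flats 1)) param_line"
proof -
  let ?H = "hit_algebra (affine_flats 1) :: (real^'n) set measure"
  let ?G = "hit_algebra (linear_subspaces 1) :: (real^'n) set measure"
  let ?D = "distr line_parameters ?H param_line"
  let ?\<Phi> = "\<lambda>A. \<integral>\<^sup>+L. (\<integral>\<^sup>+t. indicator A ((\<lambda>x. x + t) ` L) \<partial>subspace_lebesgue (L\<^sup>\<bottom>)) \<partial>grassmannian_measure 1"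
  have pm: "param_line \<in> measurable line_parameters ?H"
    using param_line_measurable measurable_cong_sets[OF sets_line_parameters refl] by blast
  have eq: "?\<Phi> A = emeasure ?D A" if A: "A \<in> sets ?H" for A
  proof -
    have ind: "(indicator A :: _ \<Rightarrow> ennreal) \<in> borel_measurable ?H" using A by simp
    let ?J = "\<lambda>w. \<integral>\<^sup>+x. slab_weight (w, x) * indicator A (param_line (w, x)) \<partial>lborel"
    have in1: "(\<integral>\<^sup>+t. indicator A ((\<lambda>x. x + t) ` span {v}) \<partial>subspace_lebesgue ((span {v})\<^sup>\<bottom>)) = (\<integral>\<^sup>+x. indicator (slab v) x * indicator A (line v x) \<partial>lborel)"
      if v: "norm v = 1" for v :: "real^'n"
    proof -
      have m: "(\<lambda>t. indicator A (line v t) :: ennreal) \<in> borel_measurable borel"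
        by (rule measurable_compose[OF measurable_line_fixed[OF v] ind])
      have "(\<integral>\<^sup>+t. indicator A (line v t) \<partial>subspace_lebesgue ((span {v})\<^sup>\<bottom>)) = (\<integral>\<^sup>+x. indicator (slab v) x * indicator A (line v x) \<partial>lborel)"
        unfolding nn_integral_subspace_lebesgue[OF v m] line_projection ..
      then show ?thesis by (simp only: line_def)
    qed
    have Jm: "(\<lambda>z. slab_weight z * indicator A (param_line z)) \<in> borel_measurable borel"
      by (intro borel_measurable_times_ennreal slab_weight_measurable measurable_compose[OF param_line_measurable ind])
    have Jmeas: "?J \<in> borel_measurable borel"
    proof -
      have "(\<lambda>(w, x). slab_weight (w, x) * indicator A (param_line (w, x))) \<in> borel_measurable (uniform_ball \<Otimes>\<^sub>M lborel)"
        unfolding measurable_ball_prod using Jm by (simp add: split_beta')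
      from lborel.borel_measurable_nn_integral[OF this] show ?thesis by simp
    qed
    let ?K = "\<lambda>L. \<integral>\<^sup>+t. indicator A ((\<lambda>x. x + t) ` L) \<partial>subspace_lebesgue (L\<^sup>\<bottom>)"
    have KJ: "?K (span {v}) = ?J v" if "norm v = 1" for v
      unfolding in1[OF that] slab_weight_def param_line_def by (simp add: dir_unit[OF that] indicator_def)
    have half: "a / 2 + a / 2 = a" for a :: ennreal
    proof -
      have "a / 2 + a / 2 = a * 2 / 2" by (simp only: mult_2[symmetric] ennreal_times_divide mult.commute)
      also have "\<dots> = a" by (rule ennreal_mult_divide_eq) simp_all
      finally show ?thesis .
    qed
    have "?K L = gen_sum (\<lambda>w. ?J w / 2) L" if L: "L \<in> linear_subspaces 1" for L
    proof -
      let ?l = "gen L"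
      note s = gen[OF L]
      have m: "norm (- ?l) = 1" using s by simp
      have sp: "span {- ?l} = span {?l}" using line_uminus[of ?l 0] by (simp add: line_0)
      have "?J (- ?l) = ?J ?l" using KJ[OF m] KJ[OF s(1)] sp by simp
      then have "gen_sum (\<lambda>w. ?J w / 2) L = ?J ?l / 2 + ?J ?l / 2" unfolding gen_sum_def by (simp only:)
      also have "\<dots> = ?J ?l" by (rule half)
      also have "\<dots> = ?K L" using KJ[OF s(1)] s(2) by simp
      finally show ?thesis ..
    qed
    moreover have "gen_sum (\<lambda>w. ?J w / 2) \<in> borel_measurable ?G"
      by (rule gen_sum_measurable) (unfold divide_ennreal_def, intro borel_measurable_times_ennreal Jmeas borel_measurable_const)
    ultimately have Km: "?K \<in> borel_measurable ?G" by (subst measurable_cong[of ?G ?K]) auto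
    have "?\<Phi> A = (\<integral>\<^sup>+w. ?K (span {dir w}) \<partial>uniform_ball)"
      unfolding grassmannian_measure_1[OF n]
      by (rule nn_integral_distr) (use measurable_span_dir Km in \<open>simp_all only: measurable_uniform_ball measurable_distr_eq1\<close>)
    also have "\<dots> = (\<integral>\<^sup>+w. ?J w \<partial>uniform_ball)"
      unfolding in1[OF norm_dir] slab_weight_def param_line_def by (simp add: indicator_def)
    also have "\<dots> = (\<integral>\<^sup>+z. slab_weight z * indicator A (param_line z) \<partial>(uniform_ball \<Otimes>\<^sub>M lborel))"
      by (rule lborel.nn_integral_fst) (unfold measurable_ball_prod, rule Jm)
    also have "\<dots> = (\<integral>\<^sup>+z. indicator A (param_line z) \<partial>line_parameters)"
      unfolding line_parameters_def
      by (rule nn_integral_density[symmetric]) (unfold measurable_ball_prod, rule slab_weight_measurable, rule measurable_compose[OF param_line_measurable ind])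
    also have "\<dots> = (\<integral>\<^sup>+E. indicator A E \<partial>?D)"
      by (rule nn_integral_distr[OF pm, symmetric]) (simp only: measurable_distr_eq1 ind)
    finally show ?thesis using A by simp
  qed
  have "flat_measure 1 = measure_of (affine_flats 1) (sets ?H) ?\<Phi>" by (simp only: flat_measure_def)
  also have "\<dots> = measure_of (affine_flats 1) (sets ?H) (emeasure ?D)"
  proof (rule measure_of_eq)
    show "sets ?H \<subseteq> Pow (affine_flats 1)" using sets.space_closed[of ?H] by simp
    show "?\<Phi> A = emeasure ?D A" if "A \<in> sigma_sets (affine_flats 1) (sets ?H)" for A
      using that sets.sigma_sets_eq[of ?H] by (intro eq) simp
  qed
  also have "\<dots> = ?D"
    using measure_of_of_measure[of ?D] by simp
  finally show ?thesis .
qed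


section \<open>Moments of a uniformly distributed direction\<close>

lemma integrable_uniform_ball:
  fixes f :: "real^'n \<Rightarrow> real"
  assumes "f \<in> borel_measurable borel" "\<And>w. \<bar>f w\<bar> \<le> C"
  shows "integrable uniform_ball f"
proof -
  interpret prob_space "uniform_ball :: (real^'n) measure" by (rule prob_space_uniform_ball)
  show ?thesis by (rule integrable_const_bound[of _ C]) (use assms in auto)
qed

lemma dir_rotation:
  assumes "orthogonal_transformation \<rho>" "w \<noteq> 0"
  shows "dir (\<rho> w) = \<rho> (dir w)"
  using assms(2) orthogonal_transformation_norm[OF assms(1), of w] linear_scale[OF orthogonal_transformation_linear[OF assms(1)]]
  by (auto simp: dir_def)

lemma distr_uniform_ball_rotation:
  assumes o: "orthogonal_transformation (\<rho> :: real^'n \<Rightarrow> real^'n)"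
  shows "distr uniform_ball borel \<rho> = uniform_ball" "\<rho> \<in> borel_measurable borel"
proof -
  show m: "\<rho> \<in> borel_measurable borel"
    using o by (intro borel_measurable_continuous_onI linear_continuous_on linear_conv_bounded_linear[THEN iffD1] orthogonal_transformation_linear)
  show "distr uniform_ball borel \<rho> = uniform_ball"
  proof (rule measure_eqI)
    fix A assume "A \<in> sets (distr uniform_ball borel \<rho>)"
    then have A: "A \<in> sets borel" by simp
    have "emeasure (distr uniform_ball borel \<rho>) A = (\<integral>\<^sup>+w. indicator A w \<partial>distr uniform_ball borel \<rho>)" using A by simp
    also have "\<dots> = (\<integral>\<^sup>+w. indicator A (\<rho> w) \<partial>uniform_ball)" using m A by (intro nn_integral_distr) simp_all
    also have "\<dots> = (\<integral>\<^sup>+w. indicator A w \<partial>uniform_ball)"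
      by (rule uniform_ball_rotation[OF o borel_measurable_indicator[OF A]])
    also have "\<dots> = emeasure uniform_ball A" using A by simp
    finally show "emeasure (distr uniform_ball borel \<rho>) A = emeasure uniform_ball A" .
  qed simp
qed

lemma AE_uniform_ball_neq_0: "AE w in (uniform_ball :: (real^'n) measure). w \<noteq> 0"
  by (intro AE_uniform_ball AE_lborel_singleton)

lemma integral_dir_rotation:
  fixes g :: "real^'n \<Rightarrow> real" and \<rho> :: "real^'n \<Rightarrow> real^'n"
  assumes o: "orthogonal_transformation \<rho>" and g: "g \<in> borel_measurable borel"
  shows "(\<integral>w. g (\<rho> (dir w)) \<partial>uniform_ball) = (\<integral>w. g (dir w) \<partial>uniform_ball)"
proof -
  note \<rho> = distr_uniform_ball_rotation[OF o]
  have gd: "(\<lambda>w. g (dir w)) \<in> borel_measurable borel" by (rule measurable_compose[OF borel_measurable_dir g])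
  have "(\<integral>w. g (\<rho> (dir w)) \<partial>uniform_ball) = (\<integral>w. g (dir (\<rho> w)) \<partial>uniform_ball)"
  proof (rule integral_cong_AE)
    show "AE w in uniform_ball. g (\<rho> (dir w)) = g (dir (\<rho> w))"
      using AE_uniform_ball_neq_0 by eventually_elim (simp add: dir_rotation[OF o])
  qed (simp_all add: measurable_compose[OF measurable_compose[OF borel_measurable_dir \<rho>(2)] g] measurable_compose[OF \<rho>(2) gd])
  also have "\<dots> = (\<integral>w. g (dir w) \<partial>distr uniform_ball borel \<rho>)"
    using \<rho>(2) gd by (intro integral_distr[symmetric]) simp_all
  finally show ?thesis unfolding \<rho>(1) .
qed

text \<open>
  An isometry that changes the sign of \<open>g\<close> makes the integral equal to its negative.
\<close>

lemma integral_dir_odd: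
  fixes g :: "real^'n \<Rightarrow> real" and \<rho> :: "real^'n \<Rightarrow> real^'n"
  assumes o: "orthogonal_transformation \<rho>" and g: "g \<in> borel_measurable borel" and odd: "\<And>x. g (\<rho> x) = - g x"
  shows "(\<integral>w. g (dir w) \<partial>uniform_ball) = 0"
  using integral_dir_rotation[OF o g] by (simp add: odd)

lemma abs_dir_inner_le: "\<bar>dir w \<bullet> z\<bar> \<le> norm z"
  using Cauchy_Schwarz_ineq2[of "dir w" z] by simp

text \<open>
  The \<open>m\<close>-th absolute moment of one coordinate of a uniformly distributed direction in dimension \<open>n\<close>.
\<close>

definition axis_moment :: "nat \<Rightarrow> nat \<Rightarrow> real" where
  "axis_moment n m = Gamma ((real m + 1) / 2) * Gamma (real n / 2) / (sqrt pi * Gamma ((real n + real m) / 2))"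

lemma integral_dir_abs_power:
  fixes e :: "real^'n"
  assumes e: "norm e = 1"
  shows "(\<integral>w. \<bar>dir w \<bullet> e\<bar> ^ m \<partial>uniform_ball) = axis_moment CARD('n) m"
proof -
  define n where "n = real CARD('n)"
  have n0: "n > 0" by (simp add: n_def)
  let ?A = "2 / n * Gamma ((real m + 1) / 2) * sqrt pi ^ (CARD('n) - 1) / Gamma ((n + real m) / 2)"
  have gm: "(\<lambda>w. \<bar>dir w \<bullet> e\<bar> ^ m) \<in> borel_measurable borel" by measurable
  have "(\<integral>\<^sup>+w. ennreal (\<bar>dir w \<bullet> e\<bar> ^ m) \<partial>uniform_ball) = (\<integral>\<^sup>+w. ennreal (\<bar>dir w \<bullet> e\<bar> ^ m) * indicator (cball 0 1) w \<partial>lborel) / emeasure lborel (cball (0::real^'n) 1)"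
    by (rule nn_integral_uniform_ball) (rule measurable_compose[OF gm measurable_ennreal])
  also have "(\<integral>\<^sup>+w. ennreal (\<bar>dir w \<bullet> e\<bar> ^ m) * indicator (cball 0 1) w \<partial>lborel) = (\<integral>\<^sup>+x. indicator (cball 0 1) x * ennreal ((\<bar>x \<bullet> e\<bar> / norm x) ^ m) \<partial>lborel)"
  proof (rule nn_integral_cong_AE, rule eventually_mono[OF AE_lborel_singleton[of 0]])
    fix x :: "real^'n" assume "x \<noteq> 0"
    then have "\<bar>dir x \<bullet> e\<bar> = \<bar>x \<bullet> e\<bar> / norm x" by (simp add: dir_def abs_mult divide_inverse mult.commute)
    then show "ennreal (\<bar>dir x \<bullet> e\<bar> ^ m) * indicator (cball 0 1) x = indicator (cball 0 1) x * ennreal ((\<bar>x \<bullet> e\<bar> / norm x) ^ m)"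
      by (simp only: mult.commute)
  qed
  also have "\<dots> = ennreal ?A" unfolding n_def by (rule nn_integral_ball_direction_moment[OF e])
  also have "emeasure lborel (cball (0::real^'n) 1) = ennreal (unit_ball_vol n)"
    by (simp add: emeasure_cball n_def)
  also have "ennreal ?A / ennreal (unit_ball_vol n) = ennreal (?A / unit_ball_vol n)"
    using n0 by (intro divide_ennreal) (auto intro!: divide_nonneg_nonneg mult_nonneg_nonneg Gamma_real_nonneg unit_ball_vol_pos)
  also have "?A / unit_ball_vol n = axis_moment CARD('n) m"
  proof -
    have G: "Gamma (n / 2 + 1) = n / 2 * Gamma (n / 2)" using n0 Gamma_plus1[of "n / 2"] nonpos_Ints_nonpos[of "n / 2"] by (auto simp: add.commute)
    have "pi powr (n / 2) = sqrt pi powr n" by (simp add: powr_half_sqrt[symmetric] powr_powr)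
    also have "\<dots> = sqrt pi ^ CARD('n)" unfolding n_def by (rule powr_realpow) simp
    also have "\<dots> = sqrt pi * sqrt pi ^ (CARD('n) - 1)" using power_Suc[of "sqrt pi" "CARD('n) - 1"] by simp
    finally have p: "pi powr (n / 2) = sqrt pi * sqrt pi ^ (CARD('n) - 1)" .
    have "Gamma (n / 2) > 0" "Gamma ((n + real m) / 2) > 0" using n0 by (auto intro!: Gamma_real_pos)
    then show ?thesis
      unfolding unit_ball_vol_def G p axis_moment_def n_def[symmetric] using n0 by (simp add: field_simps)
  qed
  finally have "(\<integral>\<^sup>+w. ennreal (\<bar>dir w \<bullet> e\<bar> ^ m) \<partial>uniform_ball) = ennreal (axis_moment CARD('n) m)" .
  moreover have "axis_moment CARD('n) m \<ge> 0" by (auto simp: axis_moment_def intro!: divide_nonneg_nonneg mult_nonneg_nonneg Gamma_real_nonneg add_pos_nonneg)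
  ultimately show ?thesis using gm by (subst integral_eq_nn_integral) simp_all
qed

text \<open>
  The reflection in the hyperplane orthogonal to \<open>e\<close> shows that the component of \<open>u\<close> orthogonal to \<open>e\<close> does
  not contribute.
\<close>

lemma integral_dir_odd_linear:
  fixes e u :: "real^'n" and h :: "real \<Rightarrow> real"
  assumes e: "norm e = 1" and h: "h \<in> borel_measurable borel" and odd: "\<And>t. h (- t) = - h t" and C: "\<And>t. \<bar>t\<bar> \<le> 1 \<Longrightarrow> \<bar>h t\<bar> \<le> C"
  shows "(\<integral>w. h (dir w \<bullet> e) * (dir w \<bullet> u) \<partial>uniform_ball) = (u \<bullet> e) * (\<integral>w. h (dir w \<bullet> e) * (dir w \<bullet> e) \<partial>uniform_ball)"
proof -
  let ?r = "\<lambda>x. x - (2 * (x \<bullet> e)) *\<^sub>R e"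
  \<comment> \<open>the component orthogonal to \<open>e\<close>, which the reflection fixes\<close>
  define u' where "u' = u - (u \<bullet> e) *\<^sub>R e"
  have ee: "e \<bullet> e = 1" using e by (simp add: norm_eq_1)
  have u'e: "u' \<bullet> e = 0" "e \<bullet> u' = 0" by (simp_all add: u'_def inner_diff_left inner_diff_right ee inner_commute)
  have o: "orthogonal_transformation ?r"
  proof -
    have "linear ?r" by (rule linearI) (simp_all add: inner_add_left algebra_simps)
    moreover have "?r x \<bullet> ?r y = x \<bullet> y" for x y
      by (simp add: inner_diff_left inner_diff_right ee inner_commute algebra_simps)
    ultimately show ?thesis unfolding orthogonal_transformation_def by blast
  qed
  have m: "(\<lambda>x. h (x \<bullet> e) * (x \<bullet> a)) \<in> borel_measurable borel" for a
    using measurable_compose[OF _ h, of "\<lambda>x. x \<bullet> e"] by measurable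
  have md: "(\<lambda>w. h (dir w \<bullet> e) * (dir w \<bullet> a)) \<in> borel_measurable borel" for a
    using measurable_compose[OF borel_measurable_dir m] .
  have int: "integrable uniform_ball (\<lambda>w. h (dir w \<bullet> e) * (dir w \<bullet> a))" for a
  proof (rule integrable_uniform_ball[OF md])
    fix w
    have "\<bar>h (dir w \<bullet> e)\<bar> \<le> C" using C abs_dir_inner_le[of w e] e by simp
    then have "\<bar>h (dir w \<bullet> e)\<bar> * \<bar>dir w \<bullet> a\<bar> \<le> C * norm a" using abs_dir_inner_le[of w a] by (intro mult_mono) auto
    then show "\<bar>h (dir w \<bullet> e) * (dir w \<bullet> a)\<bar> \<le> C * norm a" by (simp add: abs_mult)
  qed
  have zero: "(\<integral>w. h (dir w \<bullet> e) * (dir w \<bullet> u') \<partial>uniform_ball) = 0"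
  proof (rule integral_dir_odd[OF o m])
    fix x
    have "?r x \<bullet> e = - (x \<bullet> e)" by (simp add: inner_diff_left ee)
    moreover have "?r x \<bullet> u' = x \<bullet> u'" by (simp add: inner_diff_left u'e)
    ultimately show "h (?r x \<bullet> e) * (?r x \<bullet> u') = - (h (x \<bullet> e) * (x \<bullet> u'))" by (simp add: odd)
  qed
  have "h (dir w \<bullet> e) * (dir w \<bullet> u) = (u \<bullet> e) * (h (dir w \<bullet> e) * (dir w \<bullet> e)) + h (dir w \<bullet> e) * (dir w \<bullet> u')" for w
    by (simp add: u'_def inner_diff_right algebra_simps)
  then have "(\<integral>w. h (dir w \<bullet> e) * (dir w \<bullet> u) \<partial>uniform_ball) = (\<integral>w. (u \<bullet> e) * (h (dir w \<bullet> e) * (dir w \<bullet> e)) + h (dir w \<bullet> e) * (dir w \<bullet> u') \<partial>uniform_ball)" by simp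
  also have "\<dots> = (u \<bullet> e) * (\<integral>w. h (dir w \<bullet> e) * (dir w \<bullet> e) \<partial>uniform_ball)"
    by (subst Bochner_Integration.integral_add[OF integrable_mult_right[OF int] int]) (simp add: zero)
  finally show ?thesis .
qed

lemma norm_scaleR_dir: "norm z *\<^sub>R dir z = z"
  by (simp add: dir_def)

text \<open>
  By symmetry only one of the two terms of \<open>1 + u \<bullet> w\<close> contributes: the constant for even powers, the linear
  one for odd powers. This is where the parity of the power enters the Crofton formula.
\<close>

lemma integral_dir_power_affine:
  fixes z u :: "real^'n"
  assumes j: "j \<le> 1"
  shows "(\<integral>w. (dir w \<bullet> z) ^ (2 * k + j) * (1 + u \<bullet> dir w) \<partial>uniform_ball) = axis_moment CARD('n) (2 * (k + j)) * (norm z ^ (2 * k) * (u \<bullet> z) ^ j)"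
proof -
  let ?m = "2 * k + j"
  let ?e = "dir z"
  have int: "integrable uniform_ball (\<lambda>w. (dir w \<bullet> z) ^ ?m)"
    by (rule integrable_uniform_ball[where C="norm z ^ ?m"]) (measurable, simp only: power_abs, intro power_mono abs_dir_inner_le, simp)
  have int2: "integrable uniform_ball (\<lambda>w. (dir w \<bullet> z) ^ ?m * (dir w \<bullet> u))"
    by (rule integrable_uniform_ball[where C="norm z ^ ?m * norm u"])
      (measurable, simp only: abs_mult power_abs, intro mult_mono power_mono abs_dir_inner_le, simp_all)
  have neg: "orthogonal_transformation (uminus :: real^'n \<Rightarrow> real^'n)"
    by (auto simp: orthogonal_transformation_def intro!: linearI)
  have dz: "x \<bullet> z = norm z * (x \<bullet> ?e)" for x by (metis inner_scaleR_right norm_scaleR_dir)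
  have split: "(\<integral>w. (dir w \<bullet> z) ^ ?m * (1 + u \<bullet> dir w) \<partial>uniform_ball) = (\<integral>w. (dir w \<bullet> z) ^ ?m \<partial>uniform_ball) + (\<integral>w. (dir w \<bullet> z) ^ ?m * (dir w \<bullet> u) \<partial>uniform_ball)"
    by (subst Bochner_Integration.integral_add[OF int int2, symmetric]) (simp add: algebra_simps inner_commute)
  consider "j = 0" | "j = 1" using j by linarith
  then show ?thesis
  proof cases
    case 1
    have "(\<integral>w. (dir w \<bullet> z) ^ ?m * (dir w \<bullet> u) \<partial>uniform_ball) = 0"
      by (rule integral_dir_odd[OF neg, of "\<lambda>x. (x \<bullet> z) ^ ?m * (x \<bullet> u)"]) (use 1 in \<open>measurable, simp\<close>)
    moreover have "(\<integral>w. (dir w \<bullet> z) ^ (2 * k) \<partial>uniform_ball) = (\<integral>w. norm z ^ (2 * k) * \<bar>dir w \<bullet> ?e\<bar> ^ (2 * k) \<partial>uniform_ball)"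
      by (rule Bochner_Integration.integral_cong[OF refl]) (simp add: dz[of "dir _"] power_mult_distrib power_even_abs)
    ultimately show ?thesis unfolding split using 1 by (simp add: integral_dir_abs_power)
  next
    case 2
    have "(\<integral>w. (dir w \<bullet> z) ^ ?m \<partial>uniform_ball) = 0"
      by (rule integral_dir_odd[OF neg, of "\<lambda>x. (x \<bullet> z) ^ ?m"]) (use 2 in \<open>measurable, simp\<close>)
    moreover have "(\<integral>w. (dir w \<bullet> z) ^ ?m * (dir w \<bullet> u) \<partial>uniform_ball) = norm z ^ ?m * (\<integral>w. (dir w \<bullet> ?e) ^ ?m * (dir w \<bullet> u) \<partial>uniform_ball)"
      unfolding dz[of "dir _"] power_mult_distrib mult.assoc by simp
    moreover have "(\<integral>w. (dir w \<bullet> ?e) ^ ?m * (dir w \<bullet> u) \<partial>uniform_ball) = (u \<bullet> ?e) * (\<integral>w. (dir w \<bullet> ?e) ^ ?m * (dir w \<bullet> ?e) \<partial>uniform_ball)"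
    proof (rule integral_dir_odd_linear[where h="\<lambda>t. t ^ ?m" and C=1])
      show "\<bar>t ^ ?m\<bar> \<le> 1" if "\<bar>t\<bar> \<le> 1" for t :: real using that unfolding power_abs by (intro power_le_one) auto
    qed (use 2 in simp_all)
    moreover have "(\<integral>w. (dir w \<bullet> ?e) ^ ?m * (dir w \<bullet> ?e) \<partial>uniform_ball) = (\<integral>w. \<bar>dir w \<bullet> ?e\<bar> ^ (2 * (k + 1)) \<partial>uniform_ball)"
      by (rule Bochner_Integration.integral_cong[OF refl]) (simp add: 2 power_even_abs mult_ac)
    ultimately show ?thesis unfolding split integral_dir_abs_power[OF norm_dir] using 2 dz[of u] by (simp add: mult_ac)
  qed
qed

text \<open>
  The positive part is half the sum of the absolute value and the number itself. The mean of the
  absolute value is the first absolute moment, and the mean of the number is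
  this moment times \<open>u \<bullet> dir w\<close>, since the sign is an odd function of the component along \<open>w\<close>.
\<close>

lemma integral_orientation_weight:
  fixes u w :: "real^'n"
  assumes w: "w \<noteq> 0" and u: "norm u = 1"
  shows "(\<integral>v. max 0 (u \<bullet> (sgn (w \<bullet> dir v) *\<^sub>R dir v)) \<partial>uniform_ball) = axis_moment CARD('n) 1 / 2 * (1 + u \<bullet> dir w)"
proof -
  let ?a = "dir w"
  have sg: "sgn (w \<bullet> x) = sgn (x \<bullet> ?a)" for x
  proof -
    have "w \<bullet> x = norm w * (x \<bullet> ?a)" by (metis inner_commute inner_scaleR_right norm_scaleR_dir)
    then show ?thesis using w by (simp add: sgn_mult)
  qed
  have int: "integrable uniform_ball (\<lambda>v. \<bar>dir v \<bullet> u\<bar>)"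
    by (rule integrable_uniform_ball[where C="norm u"]) (measurable, simp add: abs_dir_inner_le)
  have m: "(\<lambda>v. sgn (dir v \<bullet> ?a) * (dir v \<bullet> u)) \<in> borel_measurable borel" unfolding sgn_if by measurable
  have b: "\<bar>sgn t\<bar> \<le> 1" for t :: real by (simp add: sgn_if)
  have int2: "integrable uniform_ball (\<lambda>v. sgn (dir v \<bullet> ?a) * (dir v \<bullet> u))"
  proof (rule integrable_uniform_ball[OF m])
    fix v
    have "\<bar>sgn (dir v \<bullet> ?a)\<bar> * \<bar>dir v \<bullet> u\<bar> \<le> 1 * norm u" using b abs_dir_inner_le[of v u] by (intro mult_mono) auto
    then show "\<bar>sgn (dir v \<bullet> ?a) * (dir v \<bullet> u)\<bar> \<le> norm u" by (simp only: abs_mult mult_1)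
  qed
  have mm: "(\<lambda>v. max 0 (u \<bullet> (sgn (dir v \<bullet> ?a) *\<^sub>R dir v))) \<in> borel_measurable borel" unfolding sgn_if by measurable
  have "?a \<noteq> 0" using norm_dir[of w] by (metis norm_zero zero_neq_one)
  have AE1: "AE v in (uniform_ball :: (real^'n) measure). v \<bullet> ?a \<noteq> 0"
    using AE_uniform_ball[OF AE_inner_neq_0[OF \<open>?a \<noteq> 0\<close>]] .
  have "(\<integral>v. max 0 (u \<bullet> (sgn (w \<bullet> dir v) *\<^sub>R dir v)) \<partial>uniform_ball) = (\<integral>v. (\<bar>dir v \<bullet> u\<bar> + sgn (dir v \<bullet> ?a) * (dir v \<bullet> u)) / 2 \<partial>uniform_ball)"
    unfolding sg
  proof (rule integral_cong_AE)
    show "AE v in uniform_ball. max 0 (u \<bullet> (sgn (dir v \<bullet> ?a) *\<^sub>R dir v)) = (\<bar>dir v \<bullet> u\<bar> + sgn (dir v \<bullet> ?a) * (dir v \<bullet> u)) / 2"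
      using AE1
    proof eventually_elim
      case (elim v)
      have "v = norm v *\<^sub>R dir v" by (rule norm_scaleR_dir[symmetric])
      then have "dir v \<bullet> ?a \<noteq> 0" using elim by (metis inner_scaleR_left mult_zero_right)
      then show ?case by (auto simp: sgn_if max_def inner_commute)
    qed
  qed (use mm m in simp_all)
  also have "\<dots> = ((\<integral>v. \<bar>dir v \<bullet> u\<bar> \<partial>uniform_ball) + (\<integral>v. sgn (dir v \<bullet> ?a) * (dir v \<bullet> u) \<partial>uniform_ball)) / 2"
    by (subst Bochner_Integration.integral_add[OF int int2, symmetric]) simp
  also have "(\<integral>v. \<bar>dir v \<bullet> u\<bar> \<partial>uniform_ball) = axis_moment CARD('n) 1"
    using integral_dir_abs_power[OF u, of 1] by simp
  also have "(\<integral>v. sgn (dir v \<bullet> ?a) * (dir v \<bullet> u) \<partial>uniform_ball) = (u \<bullet> ?a) * (\<integral>v. sgn (dir v \<bullet> ?a) * (dir v \<bullet> ?a) \<partial>uniform_ball)"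
  proof (rule integral_dir_odd_linear[OF norm_dir _ _ b])
    show "(sgn :: real \<Rightarrow> real) \<in> borel_measurable borel" unfolding sgn_if[abs_def] by measurable
  qed (rule sgn_minus)
  also have "(\<integral>v. sgn (dir v \<bullet> ?a) * (dir v \<bullet> ?a) \<partial>uniform_ball) = axis_moment CARD('n) 1"
    using integral_dir_abs_power[OF norm_dir[of w], of 1] by (simp add: sgn_mult_self_eq mult_sgn_abs abs_sgn mult.commute)
  finally show ?thesis by (simp add: field_simps)
qed


section \<open>A Crofton formula for lines\<close>

lemma integral_uniform_ball:
  fixes g :: "real^'n \<Rightarrow> real"
  assumes g[measurable]: "g \<in> borel_measurable borel"
  shows "(\<integral>w. g w \<partial>uniform_ball) = (\<integral>w. indicator (cball 0 1) w * g w \<partial>lborel) / unit_ball_vol (real CARD('n))"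
proof -
  have k: "emeasure lborel (cball (0::real^'n) 1) = ennreal (unit_ball_vol (real CARD('n)))" by (simp add: emeasure_cball)
  have pos: "unit_ball_vol (real CARD('n)) > 0" by (rule unit_ball_vol_pos) simp
  have D: "(uniform_ball :: (real^'n) measure) = density lborel (\<lambda>w. ennreal (indicator (cball (0::real^'n) 1) w / unit_ball_vol (real CARD('n))))"
    unfolding uniform_ball_def uniform_measure_def k
  proof (rule arg_cong[where f="density lborel"], rule ext)
    fix w :: "real^'n"
    show "indicator (cball 0 1) w / ennreal (unit_ball_vol (real CARD('n))) = ennreal (indicator (cball 0 1) w / unit_ball_vol (real CARD('n)))"
      using pos by (simp add: divide_ennreal[symmetric] ennreal_indicator)
  qed
  have "(\<integral>w. g w \<partial>uniform_ball) = (\<integral>w. (indicator (cball 0 1) w / unit_ball_vol (real CARD('n))) *\<^sub>R g w \<partial>lborel)"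
    unfolding D
  proof (rule integral_density)
    show "(\<lambda>w. indicator (cball (0::real^'n) 1) w / unit_ball_vol (real CARD('n))) \<in> borel_measurable lborel"
      unfolding measurable_lborel2 by (intro borel_measurable_divide borel_measurable_indicator borel_measurable_const) simp
    show "AE w in lborel. 0 \<le> indicator (cball (0::real^'n) 1) w / unit_ball_vol (real CARD('n))"
      using pos by (intro AE_I2 divide_nonneg_nonneg) auto
  qed simp
  then show ?thesis by simp
qed

lemma apex_fixed_measurable:
  assumes K: "compact (K :: (real^'n) set)" and E: "E \<in> affine_flats 1"
  shows "apex (K \<inter> E) \<in> borel_measurable borel"
proof -
  have "(\<lambda>w :: real^'n. (E, w)) \<in> measurable borel (hit_algebra (affine_flats 1) \<Otimes>\<^sub>M borel)"
    by (rule measurable_Pair1') (use E in simp)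
  from measurable_compose[OF this apex_measurable[OF K]] show ?thesis by simp
qed

lemma measurable_apex_dir:
  fixes f :: "(real^'n) \<times> (real^'n) \<Rightarrow> 'b :: topological_space"
  assumes K: "compact (K :: (real^'n) set)" and f: "f \<in> borel_measurable borel"
  shows "(\<lambda>z. f (apex (K \<inter> fst z) (snd z), dir (snd z))) \<in> borel_measurable (hit_algebra (affine_flats 1) \<Otimes>\<^sub>M borel)"
proof (rule measurable_compose[OF _ f])
  show "(\<lambda>z. (apex (K \<inter> fst z) (snd z), dir (snd z))) \<in> borel_measurable (hit_algebra (affine_flats 1) \<Otimes>\<^sub>M borel)"
    unfolding borel_prod[symmetric] using apex_measurable[OF K] by measurable
qed

lemma measurable_apex_dir_fixed:
  fixes f :: "(real^'n) \<times> (real^'n) \<Rightarrow> 'b :: topological_space"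
  assumes K: "compact (K :: (real^'n) set)" and f: "f \<in> borel_measurable borel" and E: "E \<in> affine_flats 1"
  shows "(\<lambda>w. f (apex (K \<inter> E) w, dir w)) \<in> borel_measurable borel"
proof (rule measurable_compose[OF _ f])
  show "(\<lambda>w. (apex (K \<inter> E) w, dir w)) \<in> borel_measurable borel"
    unfolding borel_prod[symmetric] using apex_fixed_measurable[OF K E] by measurable
qed

text \<open>
  For a uniformly distributed direction \<open>w\<close>, the pair of \<open>w\<close> and the end of the chord that is extreme in
  direction \<open>w\<close> is distributed according to the support measure of index zero.
\<close>

lemma integral_support_measure_zero_chord:
  fixes K :: "(real^'n) set" and f :: "(real^'n) \<times> (real^'n) \<Rightarrow> real"
  assumes K: "convex_body K" and E: "E \<in> affine_flats 1" and hit: "K \<inter> E \<noteq> {}" and f: "f \<in> borel_measurable borel"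
    and C: "\<And>x u. norm u = 1 \<Longrightarrow> \<bar>f (x, u)\<bar> \<le> C" and cont: "\<And>x u. isCont (\<lambda>u. f (x, u)) u"
  shows "(\<integral>z. f z \<partial>support_measure (K \<inter> E) 0) = (\<integral>w. f (apex (K \<inter> E) w, dir w) \<partial>uniform_ball)"
proof -
  obtain v x where v: "norm v = 1" and Ev: "E = line v x" using affine_flat_1E[OF E] by metis
  have "line v x \<inter> K \<noteq> {}" using hit Ev by blast
  from line_section[OF K v this] obtain s0 s1 where s: "s0 \<le> s1" "K \<inter> line v x = segment (x + s0 *\<^sub>R v) v (s1 - s0)" by metis
  let ?a = "x + s0 *\<^sub>R v" and ?\<tau> = "s1 - s0"
  have KE: "K \<inter> E = segment ?a v ?\<tau>" using s(2) Ev by simp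
  have v0: "v \<noteq> 0" using v by auto
  have pos: "unit_ball_vol (real CARD('n)) \<noteq> 0" by (rule less_imp_neq[OF unit_ball_vol_pos, symmetric]) simp
  let ?g = "\<lambda>w. f (apex (K \<inter> E) w, dir w)"
  have gm: "?g \<in> borel_measurable borel" by (rule measurable_apex_dir_fixed[OF bodyD(2)[OF K] f E])
  have sm: "(\<lambda>w. segment_end ?a v ?\<tau> w) \<in> borel_measurable borel" unfolding segment_end_def by measurable
  have "(\<lambda>w. (segment_end ?a v ?\<tau> w, w /\<^sub>R norm w)) \<in> borel_measurable borel"
    unfolding borel_prod[symmetric] using sm by measurable
  from measurable_compose[OF this f] have fm[measurable]: "(\<lambda>w. f (segment_end ?a v ?\<tau> w, w /\<^sub>R norm w)) \<in> borel_measurable borel" .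
  have "unit_ball_vol (real CARD('n)) * (\<integral>z. f z \<partial>support_measure (K \<inter> E) 0)
     = (\<integral>w. indicator (cball 0 1) w * f (segment_end ?a v ?\<tau> w, w /\<^sub>R norm w) \<partial>lborel)"
    unfolding KE by (rule integral_support_measure_zero_segment[OF _ v0 f C cont]) (use s(1) in auto)
  also have "\<dots> = (\<integral>w. indicator (cball 0 1) w * ?g w \<partial>lborel)"
  proof (rule integral_cong_AE)
    show "AE w in lborel. indicator (cball 0 1) w * f (segment_end ?a v ?\<tau> w, w /\<^sub>R norm w) = indicator (cball 0 1) w * ?g w"
      using AE_inner_neq_0[OF v0]
    proof eventually_elim
      case (elim w)
      then have "w \<noteq> 0" by auto
      then show ?case using apex_segment[OF _ elim, of ?\<tau> ?a] s(1) by (simp add: KE dir_def)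
    qed
    show "(\<lambda>w. indicator (cball 0 1) w * f (segment_end ?a v ?\<tau> w, w /\<^sub>R norm w)) \<in> borel_measurable lborel"
      unfolding measurable_lborel2 by (intro borel_measurable_times borel_measurable_indicator fm) simp
    show "(\<lambda>w. indicator (cball 0 1) w * ?g w) \<in> borel_measurable lborel"
      unfolding measurable_lborel2 by (intro borel_measurable_times borel_measurable_indicator gm) simp
  qed
  also have "\<dots> = unit_ball_vol (real CARD('n)) * (\<integral>w. ?g w \<partial>uniform_ball)"
    unfolding integral_uniform_ball[OF gm] using pos by simp
  finally show ?thesis using pos by simp
qed

text \<open>
  Lines are sampled by a direction \<open>v\<close> and a point of the slab orthogonal to \<open>v\<close>, the support measure of a chord by a
  direction \<open>w\<close>. For fixed \<open>w\<close> and \<open>v\<close> the extreme point of the chord is its last point in the direction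
  \<open>\<plusminus> v\<close> closer to \<open>w\<close>, and the projection formula turns the integral over the slab into one over the top support
  measure. Averaging the resulting weight over \<open>v\<close> gives \<open>1 + u \<bullet> w\<close> up to a constant.
\<close>

lemma crofton_nn_integral:
  fixes K :: "(real^'n) set" and f :: "(real^'n) \<times> (real^'n) \<Rightarrow> ennreal"
  assumes n: "CARD('n) \<ge> 2" and K: "convex_body K" and f: "f \<in> borel_measurable borel"
  shows "(\<integral>\<^sup>+E. indicator {E \<in> affine_flats 1. E \<inter> K \<noteq> {}} E * (\<integral>\<^sup>+w. f (apex (K \<inter> E) w, dir w) \<partial>uniform_ball) \<partial>flat_measure 1)
    = (\<integral>\<^sup>+z. (\<integral>\<^sup>+w. ennreal (axis_moment CARD('n) 1 * (1 + snd z \<bullet> dir w)) * f (fst z, dir w) \<partial>uniform_ball) \<partial>support_measure K (CARD('n) - 1))"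
proof -
  let ?H = "hit_algebra (affine_flats 1) :: (real^'n) set measure"
  let ?U = "uniform_ball :: (real^'n) measure"
  let ?L = "lborel :: (real^'n) measure"
  let ?Lam = "support_measure K (CARD('n) - 1)"
  let ?c = "\<lambda>w z :: (real^'n) \<times> (real^'n). axis_moment CARD('n) 1 * (1 + snd z \<bullet> dir w)"
  let ?hit = "{E \<in> affine_flats 1. E \<inter> K \<noteq> {}}"
  have n1: "CARD('n) - 1 < CARD('n)" by simp
  have cK: "compact K" by (rule bodyD(2)[OF K])
  interpret U: prob_space ?U by (rule prob_space_uniform_ball)
  interpret \<Lambda>: finite_measure ?Lam by (rule sets_support_measure(2)[OF K n1])
  interpret UL: pair_sigma_finite ?U ?L ..
  interpret UUL: pair_sigma_finite ?U "?U \<Otimes>\<^sub>M ?L" ..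
  interpret U\<Lambda>: pair_sigma_finite ?U ?Lam ..
  have id\<Lambda>: "(\<lambda>z. z) \<in> measurable ?Lam borel" by (rule measurable_support_measure[OF K n1]) simp
  have hm: "indicator ?hit \<in> borel_measurable ?H"
    using sets_hit_algebra_hit[OF cK, of "affine_flats 1"] by simp
  have \<Psi>: "(\<lambda>z. f (apex (K \<inter> fst z) (snd z), dir (snd z))) \<in> borel_measurable (?H \<Otimes>\<^sub>M borel)"
    by (rule measurable_apex_dir[OF cK f])
  have \<Psi>1: "(\<lambda>w. f (apex (K \<inter> E) w, dir w)) \<in> borel_measurable borel" if "E \<in> affine_flats 1" for E
    by (rule measurable_apex_dir_fixed[OF cK f that])
  define X where "X E = indicator ?hit E * (\<integral>\<^sup>+w. f (apex (K \<inter> E) w, dir w) \<partial>?U)" for E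
  have sHU: "sets (?H \<Otimes>\<^sub>M ?U) = sets (?H \<Otimes>\<^sub>M borel)" by (rule sets_pair_measure_cong) simp_all
  have Xm: "X \<in> borel_measurable ?H"
    unfolding X_def
  proof (intro borel_measurable_times_ennreal hm)
    have "(\<lambda>(E, w). f (apex (K \<inter> E) w, dir w)) \<in> borel_measurable (?H \<Otimes>\<^sub>M ?U)"
      unfolding measurable_cong_sets[OF sHU refl] using \<Psi> by (simp add: split_beta')
    from U.borel_measurable_nn_integral[OF this] show "(\<lambda>E. \<integral>\<^sup>+w. f (apex (K \<inter> E) w, dir w) \<partial>?U) \<in> borel_measurable ?H" by simp
  qed
  \<comment> \<open>the joint integrand in the direction \<open>w\<close> and the parameters of the line\<close>
  define \<Phi> where "\<Phi> w z = slab_weight z * (indicator ?hit (param_line z) * f (apex (K \<inter> param_line z) w, dir w))" for w z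
  have \<Phi>m: "(\<lambda>(w, z). \<Phi> w z) \<in> borel_measurable (?U \<Otimes>\<^sub>M (?U \<Otimes>\<^sub>M ?L))"
  proof -
    have s: "sets (?U \<Otimes>\<^sub>M (?U \<Otimes>\<^sub>M ?L)) = sets ((borel :: (real^'n) measure) \<Otimes>\<^sub>M (borel :: ((real^'n) \<times> (real^'n)) measure))"
      by (rule sets_pair_measure_cong[OF sets_uniform_ball(1) sets_ball_prod])
    have 1: "(\<lambda>p :: (real^'n) \<times> (real^'n) \<times> (real^'n). (param_line (snd p), fst p)) \<in> measurable (borel \<Otimes>\<^sub>M borel) (?H \<Otimes>\<^sub>M borel)"
      by (intro measurable_Pair measurable_compose[OF measurable_snd param_line_measurable] measurable_fst)
    have 2: "(\<lambda>p :: (real^'n) \<times> (real^'n) \<times> (real^'n). indicator ?hit (param_line (snd p)) :: ennreal) \<in> borel_measurable (borel \<Otimes>\<^sub>M borel)"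
      by (rule measurable_compose[OF measurable_compose[OF measurable_snd param_line_measurable] hm])
    have 3: "(\<lambda>p :: (real^'n) \<times> (real^'n) \<times> (real^'n). f (apex (K \<inter> param_line (snd p)) (fst p), dir (fst p))) \<in> borel_measurable (borel \<Otimes>\<^sub>M borel)"
      using measurable_compose[OF 1 \<Psi>] by simp
    show ?thesis
      unfolding measurable_cong_sets[OF s refl] \<Phi>_def split_beta'
      by (intro borel_measurable_times_ennreal 2 3 measurable_compose[OF measurable_snd slab_weight_measurable])
  qed
  have pm: "param_line \<in> measurable line_parameters ?H"
    using param_line_measurable measurable_cong_sets[OF sets_line_parameters refl] by blast
  have Xp: "(\<lambda>z. X (param_line z)) \<in> borel_measurable (?U \<Otimes>\<^sub>M ?L)"
    unfolding measurable_ball_prod by (rule measurable_compose[OF param_line_measurable Xm])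
  have "(\<integral>\<^sup>+E. X E \<partial>flat_measure 1) = (\<integral>\<^sup>+z. X (param_line z) \<partial>line_parameters)"
    unfolding flat_measure_1[OF n] by (rule nn_integral_distr[OF pm]) (simp only: measurable_distr_eq1 Xm)
  also have "\<dots> = (\<integral>\<^sup>+z. slab_weight z * X (param_line z) \<partial>(?U \<Otimes>\<^sub>M ?L))"
    unfolding line_parameters_def
    by (rule nn_integral_density[OF _ Xp]) (unfold measurable_ball_prod, rule slab_weight_measurable)
  also have "\<dots> = (\<integral>\<^sup>+z. (\<integral>\<^sup>+w. \<Phi> w z \<partial>?U) \<partial>(?U \<Otimes>\<^sub>M ?L))"
  proof (rule nn_integral_cong)
    fix z :: "(real^'n) \<times> (real^'n)"
    have "(\<lambda>w. f (apex (K \<inter> param_line z) w, dir w)) \<in> borel_measurable ?U" using \<Psi>1[OF param_line_flat] by simp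
    from nn_integral_cmult[OF this, of "slab_weight z * indicator ?hit (param_line z)"]
    show "slab_weight z * X (param_line z) = (\<integral>\<^sup>+w. \<Phi> w z \<partial>?U)" by (simp only: X_def \<Phi>_def mult.assoc)
  qed
  also have "\<dots> = (\<integral>\<^sup>+w. (\<integral>\<^sup>+z. \<Phi> w z \<partial>(?U \<Otimes>\<^sub>M ?L)) \<partial>?U)"
    by (rule UUL.Fubini'[OF \<Phi>m])
  also have "\<dots> = (\<integral>\<^sup>+w. (\<integral>\<^sup>+z. ennreal (?c w z) * f (fst z, dir w) \<partial>?Lam) \<partial>?U)"
  proof (rule nn_integral_cong_AE, rule eventually_mono[OF AE_uniform_ball_neq_0])
    fix w :: "real^'n" assume w: "w \<noteq> 0"
    \<comment> \<open>the orientation of \<open>v\<close> that forms an acute angle with \<open>w\<close>\<close>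
    let ?e = "\<lambda>v. sgn (w \<bullet> dir v) *\<^sub>R dir v"
    have fw: "(\<lambda>p. f (p, dir w)) \<in> borel_measurable borel"
      by (rule measurable_compose[OF _ f]) (unfold borel_prod[symmetric], measurable)
    have \<Phi>w: "\<Phi> w \<in> borel_measurable (?U \<Otimes>\<^sub>M ?L)"
      using measurable_compose[OF measurable_Pair1'[of w ?U] \<Phi>m] by simp
    have AEv: "AE v in ?U. w \<bullet> dir v \<noteq> 0"
      using AE_uniform_ball[OF AE_inner_neq_0[OF w]]
    proof eventually_elim
      case (elim v)
      have "v = norm v *\<^sub>R dir v" by (rule norm_scaleR_dir[symmetric])
      then show ?case using elim by (metis inner_commute inner_scaleR_right mult_zero_right)
    qed
    have inner: "(\<integral>\<^sup>+x. \<Phi> w (v, x) \<partial>?L) = (\<integral>\<^sup>+z. ennreal (2 * max 0 (snd z \<bullet> ?e v)) * f (fst z, dir w) \<partial>?Lam)"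
      if v: "w \<bullet> dir v \<noteq> 0" for v
    proof -
      have c: "sgn (w \<bullet> dir v) = 1 \<or> sgn (w \<bullet> dir v) = - 1" using v by (auto simp: sgn_if)
      then have e: "?e v = dir v \<or> ?e v = - dir v" by auto
      have ne: "norm (?e v) = 1" using c by auto
      have sl: "\<bar>x \<bullet> ?e v\<bar> = \<bar>x \<bullet> dir v\<bar>" for x using c by auto
      have le: "line (?e v) x = line (dir v) x" for x using e line_uminus by metis
      let ?tp = "\<lambda>x. apex (K \<inter> line (?e v) x) (?e v)"
      have "\<Phi> w (v, x) = indicator {x. \<bar>x \<bullet> ?e v\<bar> \<le> 1/2} x * indicator {x. line (?e v) x \<inter> K \<noteq> {}} x * f (?tp x, dir w)" for x
      proof (cases "line (dir v) x \<inter> K \<noteq> {}")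
        case True
        have "apex (K \<inter> line (dir v) x) w = ?tp x" by (rule apex_line_sgn(1)[OF K norm_dir True v])
        then show ?thesis using True line_flat[OF norm_dir, of v x]
          unfolding \<Phi>_def slab_weight_def param_line_def indicator_def mem_Collect_eq fst_conv snd_conv sl by (simp add: le)
      next
        case False
        then show ?thesis unfolding \<Phi>_def param_line_def indicator_def mem_Collect_eq fst_conv snd_conv by (simp add: le)
      qed
      then have "(\<integral>\<^sup>+x. \<Phi> w (v, x) \<partial>?L) = (\<integral>\<^sup>+x. indicator {x. \<bar>x \<bullet> ?e v\<bar> \<le> 1/2} x * indicator {x. line (?e v) x \<inter> K \<noteq> {}} x * f (?tp x, dir w) \<partial>?L)" by (simp only:)
      also have "\<dots> = (\<integral>\<^sup>+z. ennreal (2 * max 0 (snd z \<bullet> ?e v)) * f (fst z, dir w) \<partial>?Lam)"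
      proof (rule projection_formula[OF K ne fw])
        have ee: "?e v \<bullet> ?e v > 0" using ne unfolding norm_eq_1 by linarith
        show "is_top K (?e v) x (?tp x)" if "line (?e v) x \<inter> K \<noteq> {}" for x
          by (rule apex_line[OF K ne that ee])
        have "(\<lambda>x. (line (?e v) x, ?e v)) \<in> measurable borel (?H \<Otimes>\<^sub>M borel)"
          using measurable_line_fixed[OF ne] by (intro measurable_Pair measurable_const) simp_all
        from measurable_compose[OF this apex_measurable[OF cK]] show "?tp \<in> borel_measurable borel" by simp
      qed
      finally show ?thesis .
    qed
    have em: "?e \<in> borel_measurable borel" unfolding sgn_if by measurable
    have jm: "(\<lambda>(v, z). ennreal (2 * max 0 (snd z \<bullet> ?e v)) * f (fst z, dir w)) \<in> borel_measurable (?U \<Otimes>\<^sub>M ?Lam)"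
    proof -
      have v: "(\<lambda>p. ?e (fst p)) \<in> borel_measurable (?U \<Otimes>\<^sub>M ?Lam)" by (rule measurable_compose[OF measurable_fst]) (simp add: em)
      have z: "snd \<in> borel_measurable (?U \<Otimes>\<^sub>M ?Lam)" using measurable_compose[OF measurable_snd id\<Lambda>] by simp
      note fs = borel_measurable_fst_snd
      note z1 = measurable_compose[OF z fs(1)] and z2 = measurable_compose[OF z fs(2)]
      show ?thesis unfolding split_beta'
        by (intro borel_measurable_times_ennreal measurable_compose[OF _ measurable_ennreal] borel_measurable_times borel_measurable_const borel_measurable_max borel_measurable_inner z2 v measurable_compose[OF z1 fw])
    qed
    have wt: "(\<integral>\<^sup>+v. ennreal (2 * max 0 (u \<bullet> ?e v)) \<partial>?U) = ennreal (axis_moment CARD('n) 1 * (1 + u \<bullet> dir w))" if u: "norm u = 1" for u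
    proof -
      have bd: "\<bar>2 * max 0 (u \<bullet> ?e v)\<bar> \<le> 2" for v
      proof -
        have "norm (?e v) \<le> 1" by (simp add: sgn_if)
        then have "norm u * norm (?e v) \<le> 1" using u by simp
        then have "\<bar>u \<bullet> ?e v\<bar> \<le> 1" using Cauchy_Schwarz_ineq2[of u "?e v"] by linarith
        then show ?thesis by auto
      qed
      have "integrable ?U (\<lambda>v. 2 * max 0 (u \<bullet> ?e v))"
        by (rule integrable_uniform_ball[OF _ bd]) (use em in measurable)
      then have "(\<integral>\<^sup>+v. ennreal (2 * max 0 (u \<bullet> ?e v)) \<partial>?U) = ennreal (\<integral>v. 2 * max 0 (u \<bullet> ?e v) \<partial>?U)"
        by (rule nn_integral_eq_integral) simp
      also have "(\<integral>v. 2 * max 0 (u \<bullet> ?e v) \<partial>?U) = axis_moment CARD('n) 1 * (1 + u \<bullet> dir w)"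
        by (simp only: integral_mult_right_zero integral_orientation_weight[OF w u])
      finally show ?thesis .
    qed
    have "(\<integral>\<^sup>+z. \<Phi> w z \<partial>(?U \<Otimes>\<^sub>M ?L)) = (\<integral>\<^sup>+v. (\<integral>\<^sup>+x. \<Phi> w (v, x) \<partial>?L) \<partial>?U)"
      by (rule lborel.nn_integral_fst[OF \<Phi>w, symmetric])
    also have "\<dots> = (\<integral>\<^sup>+v. (\<integral>\<^sup>+z. ennreal (2 * max 0 (snd z \<bullet> ?e v)) * f (fst z, dir w) \<partial>?Lam) \<partial>?U)"
      by (rule nn_integral_cong_AE, rule eventually_mono[OF AEv]) (rule inner)
    also have "\<dots> = (\<integral>\<^sup>+z. (\<integral>\<^sup>+v. ennreal (2 * max 0 (snd z \<bullet> ?e v)) * f (fst z, dir w) \<partial>?U) \<partial>?Lam)"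
      by (rule U\<Lambda>.Fubini'[OF jm, symmetric])
    also have "\<dots> = (\<integral>\<^sup>+z. ennreal (?c w z) * f (fst z, dir w) \<partial>?Lam)"
    proof (rule nn_integral_cong)
      fix z assume "z \<in> space ?Lam"
      then have u: "norm (snd z) = 1" using sets_support_measure(3)[OF K n1] by auto
      have "(\<lambda>v. ennreal (2 * max 0 (snd z \<bullet> ?e v))) \<in> borel_measurable ?U"
        by (intro measurable_compose[OF _ measurable_ennreal] borel_measurable_times borel_measurable_const borel_measurable_max borel_measurable_inner) (simp add: em)
      from nn_integral_multc[OF this, of "f (fst z, dir w)"] wt[OF u]
      show "(\<integral>\<^sup>+v. ennreal (2 * max 0 (snd z \<bullet> ?e v)) * f (fst z, dir w) \<partial>?U) = ennreal (?c w z) * f (fst z, dir w)" by simp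
    qed
    finally show "(\<integral>\<^sup>+z. \<Phi> w z \<partial>(?U \<Otimes>\<^sub>M ?L)) = (\<integral>\<^sup>+z. ennreal (?c w z) * f (fst z, dir w) \<partial>?Lam)" .
  qed
  also have "\<dots> = (\<integral>\<^sup>+z. (\<integral>\<^sup>+w. ennreal (?c w z) * f (fst z, dir w) \<partial>?U) \<partial>?Lam)"
  proof (rule U\<Lambda>.Fubini'[symmetric])
    have d: "(\<lambda>p. dir (fst p)) \<in> borel_measurable (?U \<Otimes>\<^sub>M ?Lam)" by (rule measurable_compose[OF measurable_fst]) simp
    have z: "snd \<in> borel_measurable (?U \<Otimes>\<^sub>M ?Lam)" using measurable_compose[OF measurable_snd id\<Lambda>] by simp
    note fs = borel_measurable_fst_snd
    note z1 = measurable_compose[OF z fs(1)] and z2 = measurable_compose[OF z fs(2)]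
    have "(\<lambda>p. (fst (snd p), dir (fst p))) \<in> borel_measurable (?U \<Otimes>\<^sub>M ?Lam)"
      using measurable_Pair[OF z1 d] by (simp only: borel_prod)
    from measurable_compose[OF this f]
    show "(\<lambda>(w, z). ennreal (?c w z) * f (fst z, dir w)) \<in> borel_measurable (?U \<Otimes>\<^sub>M ?Lam)"
      unfolding split_beta'
      by (intro borel_measurable_times_ennreal measurable_compose[OF _ measurable_ennreal] borel_measurable_times borel_measurable_add borel_measurable_const borel_measurable_inner z2 d)
  qed
  finally show ?thesis unfolding X_def .
qed


lemma sets_flat_measure_1:
  assumes "CARD('n) \<ge> 2"
  shows "sets (flat_measure 1 :: (real^'n) set measure) = sets (hit_algebra (affine_flats 1))"
    "space (flat_measure 1 :: (real^'n) set measure) = affine_flats 1"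
  unfolding flat_measure_1[OF assms] by (simp_all only: sets_distr space_distr space_hit_algebra)

lemma abs_integral_uniform_ball_le:
  fixes g :: "real^'n \<Rightarrow> real"
  assumes g: "g \<in> borel_measurable borel" and C: "\<And>w. \<bar>g w\<bar> \<le> C"
  shows "\<bar>\<integral>w. g w \<partial>uniform_ball\<bar> \<le> C"
proof -
  interpret prob_space "uniform_ball :: (real^'n) measure" by (rule prob_space_uniform_ball)
  have "\<bar>\<integral>w. g w \<partial>uniform_ball\<bar> \<le> (\<integral>w. \<bar>g w\<bar> \<partial>uniform_ball)" by (rule integral_abs_bound)
  also have "\<dots> \<le> C" by (rule integral_le_const) (use integrable_uniform_ball[OF g C] C in auto)
  finally show ?thesis .
qed

text \<open>
  The kernel of the Crofton formula: a boundary point with normal \<open>u\<close> contributes the values of \<open>f\<close> in all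
  directions \<open>w\<close>, with weight \<open>1 + u \<bullet> w\<close>.
\<close>

definition dir_average :: "((real^'n) \<times> (real^'n) \<Rightarrow> real) \<Rightarrow> (real^'n) \<times> (real^'n) \<Rightarrow> real" where
  "dir_average f z = (\<integral>w. f (fst z, dir w) * (1 + snd z \<bullet> dir w) \<partial>uniform_ball)"

lemma dir_average_integrand:
  fixes f :: "(real^'n) \<times> (real^'n) \<Rightarrow> real"
  assumes f: "f \<in> borel_measurable borel" and C: "\<And>x u. norm u = 1 \<Longrightarrow> \<bar>f (x, u)\<bar> \<le> C"
  shows "(\<lambda>w. f (x, dir w) * (1 + u \<bullet> dir w)) \<in> borel_measurable borel"
    "\<bar>f (x, dir w) * (1 + u \<bullet> dir w)\<bar> \<le> C * (1 + norm u)"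
proof -
  have fm: "(\<lambda>w. f (x, dir w)) \<in> borel_measurable borel"
    by (rule measurable_compose[OF _ f]) (unfold borel_prod[symmetric], measurable)
  then show "(\<lambda>w. f (x, dir w) * (1 + u \<bullet> dir w)) \<in> borel_measurable borel" by measurable
  have "\<bar>u \<bullet> dir w\<bar> \<le> norm u" using abs_dir_inner_le[of w u] by (simp add: inner_commute)
  then have "\<bar>1 + u \<bullet> dir w\<bar> \<le> 1 + norm u" by linarith
  then have "\<bar>f (x, dir w)\<bar> * \<bar>1 + u \<bullet> dir w\<bar> \<le> C * (1 + norm u)" using C[of "dir w" x] by (intro mult_mono) auto
  then show "\<bar>f (x, dir w) * (1 + u \<bullet> dir w)\<bar> \<le> C * (1 + norm u)" by (simp add: abs_mult)
qed

lemma integrable_dir_average: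
  fixes f :: "(real^'n) \<times> (real^'n) \<Rightarrow> real"
  assumes K: "convex_body K" and j: "j < CARD('n)"
    and f: "f \<in> borel_measurable borel" and C: "\<And>x u. norm u = 1 \<Longrightarrow> \<bar>f (x, u)\<bar> \<le> C"
  shows "integrable (support_measure K j) (dir_average f)"
proof (rule integrable_support_measure[OF K j])
  interpret U: prob_space "uniform_ball :: (real^'n) measure" by (rule prob_space_uniform_ball)
  have s: "sets ((borel :: ((real^'n) \<times> (real^'n)) measure) \<Otimes>\<^sub>M (uniform_ball :: (real^'n) measure)) = sets (borel \<Otimes>\<^sub>M borel)"
    by (rule sets_pair_measure_cong) simp_all
  note fs = borel_measurable_fst_snd
  let ?B = "(borel :: ((real^'n) \<times> (real^'n)) measure) \<Otimes>\<^sub>M (borel :: (real^'n) measure)"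
  have d: "(\<lambda>p. dir (snd p)) \<in> borel_measurable ?B" by (rule measurable_compose[OF measurable_snd]) simp
  have z1: "(\<lambda>p. fst (fst p)) \<in> borel_measurable ?B" by (rule measurable_compose[OF measurable_fst fs(1)])
  have z2: "(\<lambda>p. snd (fst p)) \<in> borel_measurable ?B" by (rule measurable_compose[OF measurable_fst fs(2)])
  have "(\<lambda>p. (fst (fst p), dir (snd p))) \<in> borel_measurable ?B" using measurable_Pair[OF z1 d] by (simp only: borel_prod)
  from measurable_compose[OF this f]
  have "(\<lambda>(z, w). f (fst z, dir w) * (1 + snd z \<bullet> dir w)) \<in> borel_measurable ?B"
    unfolding split_beta' by (intro borel_measurable_times borel_measurable_add borel_measurable_const borel_measurable_inner z2 d)
  then have "(\<lambda>(z, w). f (fst z, dir w) * (1 + snd z \<bullet> dir w)) \<in> borel_measurable (borel \<Otimes>\<^sub>M (uniform_ball :: (real^'n) measure))"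
    unfolding measurable_cong_sets[OF s refl] .
  from U.borel_measurable_lebesgue_integral[OF this]
  show "dir_average f \<in> borel_measurable borel" unfolding dir_average_def[abs_def] .
  show "\<bar>dir_average f (x, u)\<bar> \<le> C * (1 + 1)" if "norm u = 1" for x u
    unfolding dir_average_def fst_conv snd_conv
    using abs_integral_uniform_ball_le[OF dir_average_integrand[OF f C, where x=x and u=u]] that by simp
qed

lemma crofton_nonneg:
  fixes K :: "(real^'n) set" and f :: "(real^'n) \<times> (real^'n) \<Rightarrow> real"
  assumes n: "CARD('n) \<ge> 2" and K: "convex_body K" and f: "f \<in> borel_measurable borel"
    and f0: "\<And>x u. norm u = 1 \<Longrightarrow> 0 \<le> f (x, u)" and fC: "\<And>x u. norm u = 1 \<Longrightarrow> f (x, u) \<le> C"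
  shows "has_bochner_integral (flat_measure 1)
    (\<lambda>E. indicator {E \<in> affine_flats 1. E \<inter> K \<noteq> {}} E * (\<integral>w. f (apex (K \<inter> E) w, dir w) \<partial>uniform_ball))
    (axis_moment CARD('n) 1 * (\<integral>z. dir_average f z \<partial>support_measure K (CARD('n) - 1)))"
proof (rule has_bochner_integral_nn_integral)
  let ?H = "hit_algebra (affine_flats 1) :: (real^'n) set measure"
  let ?U = "uniform_ball :: (real^'n) measure"
  let ?Lam = "support_measure K (CARD('n) - 1)"
  let ?hit = "{E \<in> affine_flats 1. E \<inter> K \<noteq> {}}"
  let ?M = "axis_moment CARD('n) 1"
  let ?A = "\<lambda>E. \<integral>w. f (apex (K \<inter> E) w, dir w) \<partial>?U" and ?N = "\<lambda>E. \<integral>\<^sup>+w. ennreal (f (apex (K \<inter> E) w, dir w)) \<partial>?U"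
  interpret U: prob_space ?U by (rule prob_space_uniform_ball)
  have n1: "CARD('n) - 1 < CARD('n)" by simp
  have cK: "compact K" by (rule bodyD(2)[OF K])
  have C: "\<bar>f (x, u)\<bar> \<le> C" if "norm u = 1" for x u using f0[OF that, of x] fC[OF that, of x] by simp
  have M0: "?M \<ge> 0" by (auto simp: axis_moment_def intro!: divide_nonneg_nonneg mult_nonneg_nonneg Gamma_real_nonneg)
  have pos1: "0 \<le> 1 + u \<bullet> dir w" if "norm u = 1" for u w :: "real^'n"
    using abs_dir_inner_le[of w u] that by (simp add: inner_commute)
  have spc: "norm (snd z) = 1" if "z \<in> space ?Lam" for z using that sets_support_measure(3)[OF K n1] by auto
  have sHU: "sets (?H \<Otimes>\<^sub>M ?U) = sets (?H \<Otimes>\<^sub>M borel)" by (rule sets_pair_measure_cong) simp_all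
  show "(\<lambda>E. indicator ?hit E * (?A E)) \<in> borel_measurable (flat_measure 1)"
    unfolding measurable_cong_sets[OF sets_flat_measure_1(1)[OF n] refl]
  proof (intro borel_measurable_times)
    show "indicator ?hit \<in> borel_measurable ?H" using sets_hit_algebra_hit[OF cK, of "affine_flats 1"] by simp
    have "(\<lambda>(E, w). f (apex (K \<inter> E) w, dir w)) \<in> borel_measurable (?H \<Otimes>\<^sub>M ?U)"
      unfolding measurable_cong_sets[OF sHU refl] using measurable_apex_dir[OF cK f] by (simp add: split_beta')
    from U.borel_measurable_lebesgue_integral[OF this]
    show "(\<lambda>E. \<integral>w. f (apex (K \<inter> E) w, dir w) \<partial>?U) \<in> borel_measurable ?H" .
  qed
  show "AE E in flat_measure 1. 0 \<le> indicator ?hit E * (?A E)"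
    by (intro AE_I2 mult_nonneg_nonneg integral_nonneg_AE f0) simp_all
  have av0: "0 \<le> dir_average f z" if "z \<in> space ?Lam" for z
    unfolding dir_average_def by (intro integral_nonneg_AE AE_I2 mult_nonneg_nonneg f0 pos1 spc[OF that]) simp
  show "0 \<le> ?M * (\<integral>z. dir_average f z \<partial>?Lam)"
    by (intro mult_nonneg_nonneg M0 integral_nonneg_AE AE_I2 av0)
  have "(\<integral>\<^sup>+E. ennreal (indicator ?hit E * (?A E)) \<partial>flat_measure 1)
     = (\<integral>\<^sup>+E. indicator ?hit E * (?N E) \<partial>flat_measure 1)"
  proof (rule nn_integral_cong)
    fix E :: "(real^'n) set" assume "E \<in> space (flat_measure 1)"
    then have E: "E \<in> affine_flats 1" unfolding sets_flat_measure_1(2)[OF n] .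
    have "integrable ?U (\<lambda>w. f (apex (K \<inter> E) w, dir w))"
      by (rule integrable_uniform_ball[OF measurable_apex_dir_fixed[OF cK f E]]) (rule C, simp)
    then have "(?N E) = ennreal (?A E)"
      by (rule nn_integral_eq_integral) (simp add: f0)
    then show "ennreal (indicator ?hit E * (?A E)) = indicator ?hit E * (?N E)"
      by (simp add: indicator_def)
  qed
  also have "\<dots> = (\<integral>\<^sup>+z. (\<integral>\<^sup>+w. ennreal (?M * (1 + snd z \<bullet> dir w)) * ennreal (f (fst z, dir w)) \<partial>?U) \<partial>?Lam)"
    by (rule crofton_nn_integral[OF n K measurable_compose[OF f measurable_ennreal]])
  also have "\<dots> = (\<integral>\<^sup>+z. ennreal (?M * dir_average f z) \<partial>?Lam)"
  proof (rule nn_integral_cong)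
    fix z assume z: "z \<in> space ?Lam"
    let ?g = "\<lambda>w. f (fst z, dir w) * (1 + snd z \<bullet> dir w)"
    have int: "integrable ?U ?g" by (rule integrable_uniform_ball[OF dir_average_integrand[OF f C]])
    have "(\<integral>\<^sup>+w. ennreal (?M * (1 + snd z \<bullet> dir w)) * ennreal (f (fst z, dir w)) \<partial>?U) = (\<integral>\<^sup>+w. ennreal (?M * ?g w) \<partial>?U)"
    proof (rule nn_integral_cong)
      fix w
      have "ennreal (?M * (1 + snd z \<bullet> dir w)) * ennreal (f (fst z, dir w)) = ennreal ((?M * (1 + snd z \<bullet> dir w)) * f (fst z, dir w))"
        by (rule ennreal_mult[symmetric]) (use M0 pos1[OF spc[OF z]] f0 in auto)
      then show "ennreal (?M * (1 + snd z \<bullet> dir w)) * ennreal (f (fst z, dir w)) = ennreal (?M * ?g w)" by (simp add: mult_ac)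
    qed
    also have "\<dots> = ennreal (\<integral>w. ?M * ?g w \<partial>?U)"
      by (intro nn_integral_eq_integral integrable_mult_right int AE_I2 mult_nonneg_nonneg M0 f0 pos1 spc[OF z]) simp
    finally show "(\<integral>\<^sup>+w. ennreal (?M * (1 + snd z \<bullet> dir w)) * ennreal (f (fst z, dir w)) \<partial>?U) = ennreal (?M * dir_average f z)"
      by (simp add: dir_average_def)
  qed
  also have "\<dots> = ennreal (\<integral>z. ?M * dir_average f z \<partial>?Lam)"
    by (intro nn_integral_eq_integral integrable_mult_right integrable_dir_average[OF K n1 f C] AE_I2 mult_nonneg_nonneg M0 av0)
  finally show "(\<integral>\<^sup>+E. ennreal (indicator ?hit E * (?A E)) \<partial>flat_measure 1) = ennreal (?M * (\<integral>z. dir_average f z \<partial>?Lam))" by simp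
qed

text \<open>
  Signed functions are reduced to nonnegative ones by adding the constant \<open>C\<close>; only the values of \<open>f\<close> at unit
  vectors enter on either side.
\<close>

lemma crofton_lines:
  fixes K :: "(real^'n) set" and f :: "(real^'n) \<times> (real^'n) \<Rightarrow> real"
  assumes n: "CARD('n) \<ge> 2" and K: "convex_body K" and f: "f \<in> borel_measurable borel"
    and C: "\<And>x u. norm u = 1 \<Longrightarrow> \<bar>f (x, u)\<bar> \<le> C" and cont: "\<And>x u. isCont (\<lambda>u. f (x, u)) u"
  shows "has_bochner_integral (flat_measure 1)
    (\<lambda>E. if K \<inter> E = {} then 0 else \<integral>z. f z \<partial>support_measure (K \<inter> E) 0)
    (axis_moment CARD('n) 1 * (\<integral>z. dir_average f z \<partial>support_measure K (CARD('n) - 1)))"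
proof -
  let ?U = "uniform_ball :: (real^'n) measure"
  let ?Lam = "support_measure K (CARD('n) - 1)"
  let ?hit = "{E \<in> affine_flats 1. E \<inter> K \<noteq> {}}"
  let ?M = "axis_moment CARD('n) 1"
  let ?I = "\<lambda>g E. indicator ?hit E * (\<integral>w. g (apex (K \<inter> E) w, dir w) \<partial>?U) :: real"
  let ?g = "\<lambda>z. f z + C" and ?c = "\<lambda>z :: (real^'n) \<times> (real^'n). C"
  interpret U: prob_space ?U by (rule prob_space_uniform_ball)
  have n1: "CARD('n) - 1 < CARD('n)" by simp
  have cK: "compact K" by (rule bodyD(2)[OF K])
  have C0: "0 \<le> C" using C[of "axis undefined 1"] by (meson abs_ge_zero norm_axis_1 order_trans)
  have gm: "?g \<in> borel_measurable borel" using f by simp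
  have b: "- C \<le> f (x, u)" "f (x, u) \<le> C" if "norm u = 1" for x u using C[OF that, of x] by simp_all
  have "has_bochner_integral (flat_measure 1) (?I ?g) (?M * (\<integral>z. dir_average ?g z \<partial>?Lam))"
  proof (rule crofton_nonneg[OF n K gm, where C="2 * C"])
    fix x u :: "real^'n" assume "norm u = 1"
    from b[OF this, of x] show "0 \<le> f (x, u) + C" "f (x, u) + C \<le> 2 * C" by linarith+
  qed
  moreover have "has_bochner_integral (flat_measure 1) (?I ?c) (?M * (\<integral>z. dir_average ?c z \<partial>?Lam))"
    by (rule crofton_nonneg[OF n K, where C=C]) (use C0 in simp_all)
  ultimately have *: "has_bochner_integral (flat_measure 1) (\<lambda>E. ?I ?g E - ?I ?c E)
     (?M * (\<integral>z. dir_average ?g z \<partial>?Lam) - ?M * (\<integral>z. dir_average ?c z \<partial>?Lam))"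
    by (rule has_bochner_integral_diff)
  have cm: "?c \<in> borel_measurable borel" by simp
  have cC: "\<bar>?c (x, u)\<bar> \<le> C" for x u using C0 by simp
  have "dir_average ?g z = dir_average f z + dir_average ?c z" for z
    unfolding dir_average_def distrib_right
    by (rule Bochner_Integration.integral_add[OF integrable_uniform_ball[OF dir_average_integrand[OF f C]] integrable_uniform_ball[OF dir_average_integrand[OF cm cC]]])
  then have "(\<integral>z. dir_average ?g z \<partial>?Lam) = (\<integral>z. dir_average f z \<partial>?Lam) + (\<integral>z. dir_average ?c z \<partial>?Lam)"
    using Bochner_Integration.integral_add[OF integrable_dir_average[OF K n1 f C] integrable_dir_average[OF K n1 cm cC]] by simp
  then have r: "?M * (\<integral>z. dir_average ?g z \<partial>?Lam) - ?M * (\<integral>z. dir_average ?c z \<partial>?Lam) = ?M * (\<integral>z. dir_average f z \<partial>?Lam)"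
    by (simp add: algebra_simps)
  have l: "?I ?g E - ?I ?c E = (if K \<inter> E = {} then 0 else \<integral>z. f z \<partial>support_measure (K \<inter> E) 0)"
    if "E \<in> space (flat_measure 1)" for E
  proof (cases "K \<inter> E = {}")
    case True
    then have "E \<inter> K = {}" by blast
    then show ?thesis using True by simp
  next
    case False
    have E: "E \<in> affine_flats 1" using that unfolding sets_flat_measure_1(2)[OF n] .
    have int: "integrable ?U (\<lambda>w. f (apex (K \<inter> E) w, dir w))"
      by (rule integrable_uniform_ball[OF measurable_apex_dir_fixed[OF cK f E]]) (rule C, simp)
    have h: "E \<in> ?hit" using E False by blast
    have "(\<integral>w. ?g (apex (K \<inter> E) w, dir w) \<partial>?U) = (\<integral>w. f (apex (K \<inter> E) w, dir w) \<partial>?U) + (\<integral>w. C \<partial>?U)"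
      by (rule Bochner_Integration.integral_add[OF int]) (rule U.integrable_const)
    then have "?I ?g E - ?I ?c E = (\<integral>w. f (apex (K \<inter> E) w, dir w) \<partial>?U)" using h by simp
    then show ?thesis using integral_support_measure_zero_chord[OF K E False f C cont] False by simp
  qed
  show ?thesis using * unfolding r by (subst (asm) has_bochner_integral_cong[OF refl l refl])
qed


section \<open>Symmetric tensors and polarization\<close>

text \<open>
  For each function the alternating sum over all sets containing its range vanishes unless the range is
  everything.
\<close>

lemma inclusion_exclusion_surjections:
  fixes F :: "('a \<Rightarrow> 'a) \<Rightarrow> real"
  assumes I: "finite I"
  shows "(\<Sum>S\<in>Pow I. (-1) ^ (card I - card S) * (\<Sum>f\<in>I \<rightarrow>\<^sub>E S. F f)) = (\<Sum>f | f \<in> I \<rightarrow>\<^sub>E I \<and> f ` I = I. F f)"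
proof -
  have fin: "finite (I \<rightarrow>\<^sub>E I)" using I by (intro finite_PiE) auto
  have sub: "I \<rightarrow>\<^sub>E S = {f \<in> I \<rightarrow>\<^sub>E I. f ` I \<subseteq> S}" if "S \<subseteq> I" for S
    using that by (auto simp: PiE_def Pi_def)
  have alt: "(\<Sum>S\<in>{S. T \<subseteq> S \<and> S \<subseteq> I}. (-1) ^ (card I - card S)) = (if T = I then 1 else 0 :: real)" if T: "T \<subseteq> I" for T
  proof -
    have "(\<Sum>S\<in>{S. T \<subseteq> S \<and> S \<subseteq> I}. (-1) ^ (card I - card S)) = (\<Sum>R\<in>Pow (I - T). (-1) ^ card R :: real)"
    proof (rule sum.reindex_bij_witness[of _ "\<lambda>R. I - R" "\<lambda>S. I - S"])
      fix S assume "S \<in> {S. T \<subseteq> S \<and> S \<subseteq> I}"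
      then show "(-1) ^ card (I - S) = ((-1) ^ (card I - card S) :: real)"
        using I finite_subset[of S I] by (simp add: card_Diff_subset)
    qed (use T in auto)
    also have "\<dots> = (\<Sum>R\<in>Pow (I - T). \<Prod>x\<in>R. (-1))" by simp
    also have "\<dots> = (\<Prod>x\<in>I - T. 1 + (-1))"
      using prod_add[of "I - T" "\<lambda>_. -1::real" "\<lambda>_. 1"] I by simp
    also have "\<dots> = (if T = I then 1 else 0)" using I T by (auto simp: card_eq_0_iff power_0_left)
    finally show ?thesis .
  qed
  have "(\<Sum>S\<in>Pow I. (-1) ^ (card I - card S) * (\<Sum>f\<in>I \<rightarrow>\<^sub>E S. F f))
     = (\<Sum>S\<in>Pow I. \<Sum>f\<in>I \<rightarrow>\<^sub>E I. if f ` I \<subseteq> S then (-1) ^ (card I - card S) * F f else 0)"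
  proof (rule sum.cong[OF refl])
    fix S assume "S \<in> Pow I"
    then have "(\<Sum>f\<in>I \<rightarrow>\<^sub>E S. F f) = (\<Sum>f\<in>I \<rightarrow>\<^sub>E I. if f ` I \<subseteq> S then F f else 0)"
      using fin sub[of S] by (simp add: sum.inter_filter)
    then show "(-1) ^ (card I - card S) * (\<Sum>f\<in>I \<rightarrow>\<^sub>E S. F f) = (\<Sum>f\<in>I \<rightarrow>\<^sub>E I. if f ` I \<subseteq> S then (-1) ^ (card I - card S) * F f else 0)"
      by (simp add: sum_distrib_left if_distrib cong: if_cong)
  qed
  also have "\<dots> = (\<Sum>f\<in>I \<rightarrow>\<^sub>E I. \<Sum>S\<in>Pow I. if f ` I \<subseteq> S then (-1) ^ (card I - card S) * F f else 0)"
    by (rule sum.swap)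
  also have "\<dots> = (\<Sum>f\<in>I \<rightarrow>\<^sub>E I. if f ` I = I then F f else 0)"
  proof (rule sum.cong[OF refl])
    fix f assume f: "f \<in> I \<rightarrow>\<^sub>E I"
    have "(\<Sum>S\<in>Pow I. if f ` I \<subseteq> S then (-1) ^ (card I - card S) * F f else 0) = (\<Sum>S\<in>{S \<in> Pow I. f ` I \<subseteq> S}. (-1) ^ (card I - card S) * F f)"
      using I by (intro sum.inter_filter[symmetric]) simp
    also have "{S \<in> Pow I. f ` I \<subseteq> S} = {S. f ` I \<subseteq> S \<and> S \<subseteq> I}" by auto
    also have "(\<Sum>S\<in>{S. f ` I \<subseteq> S \<and> S \<subseteq> I}. (-1) ^ (card I - card S) * F f) = (if f ` I = I then 1 else 0) * F f"
    proof -
      have "f ` I \<subseteq> I" using f by auto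
      then show ?thesis unfolding sum_distrib_right[symmetric] by (simp only: alt)
    qed
    finally show "(\<Sum>S\<in>Pow I. if f ` I \<subseteq> S then (-1) ^ (card I - card S) * F f else 0) = (if f ` I = I then F f else 0)" by simp
  qed
  also have "\<dots> = (\<Sum>f | f \<in> I \<rightarrow>\<^sub>E I \<and> f ` I = I. F f)"
    using fin by (subst sum.inter_filter[symmetric]) auto
  finally show ?thesis .
qed

text \<open>
  Surjections of a finite set onto itself are permutations, so a sum over permutations is an alternating
  sum of sums over all functions into subsets.
\<close>

lemma polarization_sum:
  fixes F :: "('a \<Rightarrow> 'a) \<Rightarrow> real"
  assumes I: "finite I" and F: "\<And>f g. (\<And>i. i \<in> I \<Longrightarrow> f i = g i) \<Longrightarrow> F f = F g"
  shows "(\<Sum>S\<in>Pow I. (-1) ^ (card I - card S) * (\<Sum>f\<in>I \<rightarrow>\<^sub>E S. F f)) = (\<Sum>\<sigma> | \<sigma> permutes I. F \<sigma>)"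
  unfolding inclusion_exclusion_surjections[OF I]
proof (rule sum.reindex_bij_witness[of _ "\<lambda>\<sigma>. restrict \<sigma> I" "\<lambda>f x. if x \<in> I then f x else x"])
  fix f assume f: "f \<in> {f. f \<in> I \<rightarrow>\<^sub>E I \<and> f ` I = I}"
  then have inj: "inj_on f I" using I by (simp add: eq_card_imp_inj_on)
  show "restrict (\<lambda>x. if x \<in> I then f x else x) I = f" using f by (auto simp: fun_eq_iff PiE_def extensional_def)
  show "(\<lambda>x. if x \<in> I then f x else x) \<in> {\<sigma>. \<sigma> permutes I}"
  proof -
    have "bij_betw (\<lambda>x. if x \<in> I then f x else x) I I"
      using inj f by (auto simp: bij_betw_def inj_on_def)
    then show ?thesis by (auto intro!: bij_imp_permutes)
  qed
  show "F (\<lambda>x. if x \<in> I then f x else x) = F f" by (rule F) simp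
next
  fix \<sigma> assume \<sigma>: "\<sigma> \<in> {\<sigma>. \<sigma> permutes I}"
  then have p: "\<sigma> permutes I" by simp
  show "(\<lambda>x. if x \<in> I then restrict \<sigma> I x else x) = \<sigma>" using permutes_not_in[OF p] by (auto simp: fun_eq_iff)
  show "restrict \<sigma> I \<in> {f. f \<in> I \<rightarrow>\<^sub>E I \<and> f ` I = I}"
    using permutes_image[OF p] permutes_in_image[OF p] by auto
qed

text \<open>
  Polarization: values of a symmetrized product at arbitrary vectors are recovered from values on the
  diagonal, at the partial sums of the vectors.
\<close>

lemma polarization_inner:
  fixes z v :: "nat \<Rightarrow> 'a :: real_inner"
  shows "(\<Sum>S\<in>Pow {..<m}. (-1) ^ (m - card S) * (\<Prod>i<m. (\<Sum>a\<in>S. z a) \<bullet> v i)) = (\<Sum>\<sigma> | \<sigma> permutes {..<m}. \<Prod>i<m. z (\<sigma> i) \<bullet> v i)"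
proof -
  have "(\<Prod>i<m. (\<Sum>a\<in>S. z a) \<bullet> v i) = (\<Sum>f\<in>{..<m} \<rightarrow>\<^sub>E S. \<Prod>i<m. z (f i) \<bullet> v i)" if "S \<in> Pow {..<m}" for S
  proof -
    have "finite S" using that finite_subset by auto
    then show ?thesis using prod_sum_PiE[of "{..<m}" "\<lambda>_. S" "\<lambda>i a. z a \<bullet> v i"] by (simp add: inner_sum_left)
  qed
  then have "(\<Sum>S\<in>Pow {..<m}. (-1) ^ (m - card S) * (\<Prod>i<m. (\<Sum>a\<in>S. z a) \<bullet> v i)) = (\<Sum>S\<in>Pow {..<m}. (-1) ^ (card {..<m} - card S) * (\<Sum>f\<in>{..<m} \<rightarrow>\<^sub>E S. \<Prod>i<m. z (f i) \<bullet> v i))"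
    by (intro sum.cong) auto
  also have "\<dots> = (\<Sum>\<sigma> | \<sigma> permutes {..<m}. \<Prod>i<m. z (\<sigma> i) \<bullet> v i)"
    by (rule polarization_sum) auto
  finally show ?thesis .
qed

lemma polarization_power:
  fixes z :: "nat \<Rightarrow> 'a :: real_inner"
  shows "(\<Sum>S\<in>Pow {..<m}. (-1) ^ (m - card S) * ((\<Sum>a\<in>S. z a) \<bullet> e) ^ m) = fact m * (\<Prod>i<m. z i \<bullet> e)"
proof -
  have "(\<Sum>\<sigma> | \<sigma> permutes {..<m}. \<Prod>i<m. z (\<sigma> i) \<bullet> e) = (\<Sum>\<sigma> | \<sigma> permutes {..<m}. \<Prod>i<m. z i \<bullet> e)"
    using prod.permute[of _ "{..<m}" "\<lambda>i. z i \<bullet> e"] by (intro sum.cong refl) (auto simp: comp_def)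
  also have "\<dots> = fact m * (\<Prod>i<m. z i \<bullet> e)"
    by (simp add: card_permutations[OF card_lessThan finite_lessThan] del: prod.lessThan_Suc)
  finally show ?thesis using polarization_inner[of m z "\<lambda>_. e"] by simp
qed

lemma prod_pairs: "(\<Prod>i<2 * k. (g :: nat \<Rightarrow> 'a :: comm_monoid_mult) i) = (\<Prod>l<k. g (2 * l) * g (2 * l + 1))"
  by (induction k) (simp_all add: mult_ac)

lemma prod_lessThan_add: "(\<Prod>i<m + j. (g :: nat \<Rightarrow> 'a :: comm_monoid_mult) i) = (\<Prod>i<m. g i) * (\<Prod>i<j. g (m + i))"
  by (induction j) (simp_all add: mult_ac)

text \<open>
  Expanding each inner product of a pair in the standard basis turns the product into a sum of products of
  linear forms, to which polarization applies.
\<close>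

lemma prod_inner_pairs_expand:
  fixes p :: "nat \<Rightarrow> 'a :: euclidean_space"
  shows "(\<Prod>l<k. p (2 * l) \<bullet> p (2 * l + 1)) * (\<Prod>i<j. u \<bullet> p (2 * k + i))
    = (\<Sum>g\<in>{..<k} \<rightarrow>\<^sub>E Basis. \<Prod>i<2 * k + j. p i \<bullet> (if i < 2 * k then g (i div 2) else u))"
proof -
  have "(\<Prod>l<k. p (2 * l) \<bullet> p (2 * l + 1)) = (\<Prod>l<k. \<Sum>b\<in>Basis. (p (2 * l) \<bullet> b) * (p (2 * l + 1) \<bullet> b))"
    by (intro prod.cong refl euclidean_inner)
  also have "\<dots> = (\<Sum>g\<in>{..<k} \<rightarrow>\<^sub>E Basis. \<Prod>l<k. (p (2 * l) \<bullet> g l) * (p (2 * l + 1) \<bullet> g l))"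
    by (rule prod_sum_PiE) auto
  finally have "(\<Prod>l<k. p (2 * l) \<bullet> p (2 * l + 1)) * (\<Prod>i<j. u \<bullet> p (2 * k + i))
     = (\<Sum>g\<in>{..<k} \<rightarrow>\<^sub>E Basis. (\<Prod>l<k. (p (2 * l) \<bullet> g l) * (p (2 * l + 1) \<bullet> g l)) * (\<Prod>i<j. u \<bullet> p (2 * k + i)))"
    by (simp only: sum_distrib_right)
  also have "\<dots> = (\<Sum>g\<in>{..<k} \<rightarrow>\<^sub>E Basis. \<Prod>i<2 * k + j. p i \<bullet> (if i < 2 * k then g (i div 2) else u))"
    unfolding prod_lessThan_add prod_pairs
    by (intro sum.cong refl arg_cong2[where f="(*)"] prod.cong) (auto simp: inner_commute)
  finally show ?thesis .
qed

text \<open>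
  Tensors of rank \<open>p\<close> are functions of sequences in which only the first \<open>p\<close> entries matter.
\<close>

definition depends :: "nat \<Rightarrow> 'n tensor \<Rightarrow> bool" where
  "depends p a \<longleftrightarrow> (\<forall>y z. (\<forall>i<p. y i = z i) \<longrightarrow> a y = a z)"

definition symm :: "nat \<Rightarrow> 'n tensor \<Rightarrow> 'n tensor" where
  "symm p a y = (\<Sum>\<sigma> | \<sigma> permutes {..<p}. a (y \<circ> \<sigma>)) / fact p"

lemma dependsD: "depends p a \<Longrightarrow> (\<And>i. i < p \<Longrightarrow> y i = z i) \<Longrightarrow> a y = a z"
  by (auto simp: depends_def)

lemma depends_symm:
  fixes a :: "'n::finite tensor"
  assumes "depends p a" shows "depends p (symm p a)"
  unfolding depends_def
proof (intro allI impI)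
  fix y z :: "nat \<Rightarrow> real^'n" assume yz: "\<forall>i<p. y i = z i"
  show "symm p a y = symm p a z" unfolding symm_def
  proof (intro arg_cong2[where f="(/)"] sum.cong refl dependsD[OF assms])
    fix \<sigma> i assume "\<sigma> \<in> {\<sigma>. \<sigma> permutes {..<p}}" "i < p"
    then have "\<sigma> i < p" using permutes_in_image[of \<sigma> "{..<p}" i] by simp
    then show "(y \<circ> \<sigma>) i = (z \<circ> \<sigma>) i" using yz by simp
  qed
qed

definition tprod :: "nat \<Rightarrow> 'n tensor \<Rightarrow> 'n tensor \<Rightarrow> 'n tensor" where
  "tprod p a b y = a y * b (\<lambda>i. y (p + i))"

lemma sym_prod_symm: "sym_prod p q a b y = symm (p + q) (tprod p a b) y"
  by (simp add: sym_prod_def symm_def tprod_def comp_def)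

lemma depends_tprod:
  fixes a b :: "'n::finite tensor"
  assumes a: "depends p a" and b: "depends q b" shows "depends (p + q) (tprod p a b)"
  unfolding depends_def tprod_def
proof (intro allI impI)
  fix y z :: "nat \<Rightarrow> real^'n" assume yz: "\<forall>i<p + q. y i = z i"
  have "a y = a z" by (rule dependsD[OF a]) (use yz in simp)
  moreover have "b (\<lambda>i. y (p + i)) = b (\<lambda>i. z (p + i))" by (rule dependsD[OF b]) (use yz in simp)
  ultimately show "a y * b (\<lambda>i. y (p + i)) = a z * b (\<lambda>i. z (p + i))" by simp
qed

lemma depends_sym_prod:
  fixes a b :: "'n::finite tensor"
  assumes "depends p a" "depends q b" shows "depends (p + q) (sym_prod p q a b)"
proof -
  have "sym_prod p q a b = symm (p + q) (tprod p a b)" by (rule ext) (rule sym_prod_symm)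
  then show ?thesis using depends_symm[OF depends_tprod[OF assms]] by simp
qed

text \<open>
  Averaging over permutations first is absorbed by the symmetrization; symmetrizing one factor of a product
  is the special case of the permutations that move only the arguments of this factor.
\<close>

lemma symm_average:
  assumes T: "finite T" "T \<noteq> {}" "\<And>\<tau>. \<tau> \<in> T \<Longrightarrow> \<tau> permutes {..<p}"
  shows "symm p (\<lambda>y. (\<Sum>\<tau>\<in>T. a (y \<circ> \<tau>)) / real (card T)) y = symm p a y"
proof -
  have "(\<Sum>\<sigma> | \<sigma> permutes {..<p}. (\<Sum>\<tau>\<in>T. a ((y \<circ> \<sigma>) \<circ> \<tau>)) / real (card T)) = (\<Sum>\<tau>\<in>T. (\<Sum>\<sigma> | \<sigma> permutes {..<p}. a (y \<circ> (\<sigma> \<circ> \<tau>)))) / real (card T)"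
    by (simp add: sum_divide_distrib[symmetric] comp_assoc) (subst sum.swap, simp)
  also have "\<dots> = (\<Sum>\<tau>\<in>T. (\<Sum>\<sigma> | \<sigma> permutes {..<p}. a (y \<circ> \<sigma>))) / real (card T)"
  proof -
    have "(\<Sum>\<sigma> | \<sigma> permutes {..<p}. a (y \<circ> (\<sigma> \<circ> \<tau>))) = (\<Sum>\<sigma> | \<sigma> permutes {..<p}. a (y \<circ> \<sigma>))" if "\<tau> \<in> T" for \<tau>
      by (rule sum_permutations_compose_right[OF T(3)[OF that], symmetric])
    then show ?thesis by simp
  qed
  also have "\<dots> = (\<Sum>\<sigma> | \<sigma> permutes {..<p}. a (y \<circ> \<sigma>))" using T by simp
  finally show ?thesis by (simp add: symm_def)
qed

text \<open>
  The permutation \<open>\<tau>\<close> acting on the indices from \<open>p\<close> on.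
\<close>

definition shift_perm :: "nat \<Rightarrow> (nat \<Rightarrow> nat) \<Rightarrow> nat \<Rightarrow> nat" where
  "shift_perm p \<tau> i = (if i < p then i else p + \<tau> (i - p))"

lemma shift_perm_comp: "shift_perm p \<sigma> (shift_perm p \<tau> i) = shift_perm p (\<sigma> \<circ> \<tau>) i"
  by (simp add: shift_perm_def)

lemma permutes_shift_perm: assumes "\<tau> permutes {..<q}" shows "shift_perm p \<tau> permutes {..<p + q}"
proof (rule bij_imp_permutes)
  have id: "shift_perm p id i = i" for i by (simp add: shift_perm_def)
  have lt: "shift_perm p \<sigma> ` {..<p + q} \<subseteq> {..<p + q}" if "\<sigma> permutes {..<q}" for \<sigma>
  proof
    fix j assume "j \<in> shift_perm p \<sigma> ` {..<p + q}"
    then obtain i where i: "i < p + q" "j = shift_perm p \<sigma> i" by blast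
    then show "j \<in> {..<p + q}" using permutes_in_image[OF that, of "i - p"] by (auto simp: shift_perm_def)
  qed
  show "shift_perm p \<tau> i = i" if "i \<notin> {..<p + q}" for i
    using that permutes_not_in[OF assms, of "i - p"] by (auto simp: shift_perm_def)
  show "bij_betw (shift_perm p \<tau>) {..<p + q} {..<p + q}"
    by (rule bij_betw_byWitness[where f'="shift_perm p (inv \<tau>)"])
      (simp_all only: shift_perm_comp permutes_inv_o[OF assms] id lt[OF assms] lt[OF permutes_inv[OF assms]] ball_triv simp_thms)
qed

lemma inj_shift_perm: "inj (shift_perm p)"
proof (rule injI)
  fix \<sigma> \<tau> assume "shift_perm p \<sigma> = shift_perm p \<tau>"
  then have "shift_perm p \<sigma> (p + i) = shift_perm p \<tau> (p + i)" for i by simp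
  then show "\<sigma> = \<tau>" by (auto simp: shift_perm_def fun_eq_iff)
qed

lemma symm_tprod_right:
  assumes a: "depends p a"
  shows "symm (p + q) (tprod p a (symm q b)) y = symm (p + q) (tprod p a b) y"
proof -
  let ?T = "shift_perm p ` {\<tau>. \<tau> permutes {..<q}}"
  have card: "card ?T = fact q"
    using card_permutations[OF card_lessThan finite_lessThan, of q] inj_shift_perm[of p] by (subst card_image) (auto intro: inj_on_subset)
  have fin: "finite ?T" using finite_permutations[of "{..<q}"] by simp
  have "tprod p a (symm q b) y = (\<Sum>\<tau>\<in>?T. tprod p a b (y \<circ> \<tau>)) / real (card ?T)" for y
  proof -
    have "(\<Sum>\<tau>\<in>?T. tprod p a b (y \<circ> \<tau>)) = (\<Sum>\<tau> | \<tau> permutes {..<q}. tprod p a b (y \<circ> shift_perm p \<tau>))"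
      using inj_shift_perm[of p] by (subst sum.reindex) (auto intro: inj_on_subset)
    also have "\<dots> = (\<Sum>\<tau> | \<tau> permutes {..<q}. a y * b ((\<lambda>i. y (p + i)) \<circ> \<tau>))"
    proof (intro sum.cong refl)
      fix \<tau>
      have "a (y \<circ> shift_perm p \<tau>) = a y" by (rule dependsD[OF a]) (simp add: shift_perm_def)
      moreover have "(\<lambda>i. (y \<circ> shift_perm p \<tau>) (p + i)) = (\<lambda>i. y (p + i)) \<circ> \<tau>" by (simp add: fun_eq_iff shift_perm_def)
      ultimately show "tprod p a b (y \<circ> shift_perm p \<tau>) = a y * b ((\<lambda>i. y (p + i)) \<circ> \<tau>)" by (simp only: tprod_def)
    qed
    finally show ?thesis unfolding card by (simp add: tprod_def symm_def sum_distrib_left)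
  qed
  then have "tprod p a (symm q b) = (\<lambda>y. (\<Sum>\<tau>\<in>?T. tprod p a b (y \<circ> \<tau>)) / real (card ?T))" by blast
  moreover have "symm (p + q) (\<lambda>y. (\<Sum>\<tau>\<in>?T. tprod p a b (y \<circ> \<tau>)) / real (card ?T)) y = symm (p + q) (tprod p a b) y"
    by (rule symm_average[OF fin]) (use permutes_shift_perm in \<open>auto intro!: exI[of _ id] permutes_id\<close>)
  ultimately show ?thesis by simp
qed

lemma symm_tprod_left:
  assumes a: "depends p a"
  shows "symm (p + q) (tprod p (symm p a) b) y = symm (p + q) (tprod p a b) y"
proof -
  let ?T = "{\<tau>. \<tau> permutes {..<p}}"
  have fin: "finite ?T" using finite_permutations[of "{..<p}"] by simp
  have card: "card ?T = fact p" using card_permutations[OF card_lessThan finite_lessThan, of p] by simp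
  have "tprod p (symm p a) b y = (\<Sum>\<tau>\<in>?T. tprod p a b (y \<circ> \<tau>)) / real (card ?T)" for y
  proof -
    have "tprod p a b (y \<circ> \<tau>) = a (y \<circ> \<tau>) * b (\<lambda>i. y (p + i))" if "\<tau> \<in> ?T" for \<tau>
    proof -
      have "\<tau> (p + i) = p + i" for i using that by (auto intro: permutes_not_in)
      then show ?thesis by (simp add: tprod_def)
    qed
    then have "(\<Sum>\<tau>\<in>?T. tprod p a b (y \<circ> \<tau>)) = (\<Sum>\<tau>\<in>?T. a (y \<circ> \<tau>) * b (\<lambda>i. y (p + i)))" by (intro sum.cong refl)
    then show ?thesis unfolding card by (simp add: tprod_def symm_def sum_distrib_right)
  qed
  then have "tprod p (symm p a) b = (\<lambda>y. (\<Sum>\<tau>\<in>?T. tprod p a b (y \<circ> \<tau>)) / real (card ?T))" by blast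
  moreover have "symm (p + q) (\<lambda>y. (\<Sum>\<tau>\<in>?T. tprod p a b (y \<circ> \<tau>)) / real (card ?T)) y = symm (p + q) (tprod p a b) y"
    by (rule symm_average[OF fin]) (use permutes_subset[of _ "{..<p}" "{..<p + q}"] in \<open>auto intro!: exI[of _ id] permutes_id\<close>)
  ultimately show ?thesis by simp
qed

lemma depends_sym_power_metric: "depends (2 * k) (sym_power 2 metric_tensor k)"
proof (induction k)
  case 0 then show ?case by (simp add: depends_def)
next
  case (Suc k)
  have "depends 2 metric_tensor" by (auto simp: depends_def metric_tensor_def)
  from depends_sym_prod[OF this Suc] show ?case by (simp add: mult.commute)
qed

lemma sym_power_metric:
  "sym_power 2 metric_tensor k = symm (2 * k) (\<lambda>y :: nat \<Rightarrow> real^'n. \<Prod>l<k. y (2 * l) \<bullet> y (2 * l + 1))"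
proof (induction k)
  case 0
  show ?case by (rule ext) (simp add: symm_def)
next
  case (Suc k)
  let ?P = "\<lambda>k y :: nat \<Rightarrow> real^'n. \<Prod>l<k. y (2 * l) \<bullet> y (2 * l + 1)"
  have d2: "depends 2 (metric_tensor :: 'n tensor)" by (auto simp: depends_def metric_tensor_def)
  have t: "tprod 2 metric_tensor (?P k) = ?P (Suc k)"
    unfolding tprod_def metric_tensor_def prod.lessThan_Suc_shift by (auto simp: fun_eq_iff)
  have "sym_power 2 metric_tensor (Suc k) = symm (2 + 2 * k) (tprod 2 metric_tensor (symm (2 * k) (?P k)))"
    by (simp add: fun_eq_iff sym_prod_symm Suc mult.commute)
  also have "\<dots> = symm (2 + 2 * k) (tprod 2 metric_tensor (?P k))" by (rule ext) (rule symm_tprod_right[OF d2])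
  finally show ?case unfolding t by simp
qed

text \<open>
  On the diagonal the tensor \<open>Q\<^sup>k u\<^sup>j\<close> is \<open>\<parallel>w\<parallel> ^ (2 * k) * (u \<bullet> w) ^ j\<close>. Both sides are expanded into products
  of linear forms.
\<close>

lemma polarization_metric_power:
  fixes z :: "nat \<Rightarrow> real^'n"
  shows "(\<Sum>S\<in>Pow {..<2 * k + j}. (-1) ^ (2 * k + j - card S) * (norm (\<Sum>a\<in>S. z a) ^ (2 * k) * (u \<bullet> (\<Sum>a\<in>S. z a)) ^ j))
    = fact (2 * k + j) * sym_prod (2 * k) j (sym_power 2 metric_tensor k) (sym_power 1 (vec_tensor u) j) z"
proof -
  let ?m = "2 * k + j"
  let ?P = "\<lambda>y :: nat \<Rightarrow> real^'n. \<Prod>l<k. y (2 * l) \<bullet> y (2 * l + 1)"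
  let ?v = "\<lambda>g i. if i < 2 * k then g (i div 2) else u"
  let ?G = "{..<k} \<rightarrow>\<^sub>E (Basis :: (real^'n) set)"
  have P: "depends (2 * k) ?P"
    unfolding depends_def by (intro allI impI prod.cong refl arg_cong2[where f="(\<bullet>)"]) auto
  have diag: "norm w ^ (2 * k) * (u \<bullet> w) ^ j = (\<Sum>g\<in>?G. \<Prod>i<?m. w \<bullet> ?v g i)" for w
    using prod_inner_pairs_expand[where p="\<lambda>_. w" and k=k and j=j and u=u] by (simp add: power_mult power2_norm_eq_inner)
  have "(\<Sum>S\<in>Pow {..<?m}. (-1) ^ (?m - card S) * (norm (\<Sum>a\<in>S. z a) ^ (2 * k) * (u \<bullet> (\<Sum>a\<in>S. z a)) ^ j))
     = (\<Sum>S\<in>Pow {..<?m}. \<Sum>g\<in>?G. (-1) ^ (?m - card S) * (\<Prod>i<?m. (\<Sum>a\<in>S. z a) \<bullet> ?v g i))"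
    unfolding diag by (simp only: sum_distrib_left)
  also have "\<dots> = (\<Sum>g\<in>?G. \<Sum>\<sigma> | \<sigma> permutes {..<?m}. \<Prod>i<?m. z (\<sigma> i) \<bullet> ?v g i)"
    by (subst sum.swap) (simp only: polarization_inner)
  also have "\<dots> = (\<Sum>\<sigma> | \<sigma> permutes {..<?m}. (\<Prod>l<k. z (\<sigma> (2 * l)) \<bullet> z (\<sigma> (2 * l + 1))) * (\<Prod>i<j. u \<bullet> z (\<sigma> (2 * k + i))))"
    by (subst sum.swap) (intro sum.cong refl prod_inner_pairs_expand[symmetric])
  also have "\<dots> = fact ?m * symm ?m (tprod (2 * k) ?P (sym_power 1 (vec_tensor u) j)) z"
    by (simp add: symm_def tprod_def sym_power_vec_tensor[unfolded One_nat_def])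
  also have "symm ?m (tprod (2 * k) ?P (sym_power 1 (vec_tensor u) j)) z = symm ?m (tprod (2 * k) (symm (2 * k) ?P) (sym_power 1 (vec_tensor u) j)) z"
    by (rule symm_tprod_left[OF P, symmetric])
  finally show ?thesis by (simp only: sym_prod_symm sym_power_metric)
qed

text \<open>
  Both sides are the symmetrization of the same threefold product, up to the permutation \<open>\<tau>\<close> that exchanges
  the first two blocks of arguments.
\<close>

lemma sym_prod_left_commute:
  fixes y :: "nat \<Rightarrow> real^'n"
  assumes a: "depends p a" and b: "depends q b"
  shows "sym_prod p (q + l) a (sym_prod q l b c) y = sym_prod q (p + l) b (sym_prod p l a c) y"
proof -
  let ?m = "p + (q + l)"
  \<comment> \<open>\<open>\<tau>\<close> exchanges the blocks of lengths \<open>p\<close> and \<open>q\<close>\<close>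
  define \<tau> where "\<tau> i = (if i < q then p + i else if i < q + p then i - q else i)" for i
  have \<tau>: "\<tau> permutes {..<?m}"
  proof (rule bij_imp_permutes)
    show "bij_betw \<tau> {..<?m} {..<?m}"
      by (rule bij_betw_byWitness[where f'="\<lambda>i. if i < p then q + i else if i < p + q then i - p else i"])
        (auto simp: \<tau>_def)
  qed (auto simp: \<tau>_def)
  have e: "sym_prod u v f (sym_prod v' l f' c) = symm (u + v) (tprod u f (tprod v' f' c))"
    if "depends u f" "v = v' + l" for u v v' and f f' :: "'n tensor"
  proof
    fix y
    have "sym_prod u v f (sym_prod v' l f' c) y = symm (u + v) (tprod u f (symm v (tprod v' f' c))) y"
      unfolding sym_prod_symm[of u v] that(2) by (simp only: sym_prod_symm[abs_def])
    also have "\<dots> = symm (u + v) (tprod u f (tprod v' f' c)) y" by (rule symm_tprod_right[OF that(1)])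
    finally show "sym_prod u v f (sym_prod v' l f' c) y = symm (u + v) (tprod u f (tprod v' f' c)) y" .
  qed
  have swap: "tprod p a (tprod q b c) w = tprod q b (tprod p a c) (w \<circ> \<tau>)" for w :: "nat \<Rightarrow> real^'n"
  proof -
    have "b (w \<circ> \<tau>) = b (\<lambda>i. w (p + i))" by (rule dependsD[OF b]) (simp add: \<tau>_def)
    moreover have "a (\<lambda>i. (w \<circ> \<tau>) (q + i)) = a w" by (rule dependsD[OF a]) (simp add: \<tau>_def)
    moreover have "(\<lambda>i. (w \<circ> \<tau>) (q + (p + i))) = (\<lambda>i. w (p + (q + i)))" by (auto simp: \<tau>_def fun_eq_iff add_ac)
    ultimately show ?thesis unfolding tprod_def by (simp only: mult_ac)
  qed
  have "symm ?m (tprod p a (tprod q b c)) y = (\<Sum>\<sigma> | \<sigma> permutes {..<?m}. tprod q b (tprod p a c) (y \<circ> (\<sigma> \<circ> \<tau>))) / fact ?m"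
    unfolding symm_def swap by (simp only: comp_assoc)
  also have "\<dots> = symm ?m (tprod q b (tprod p a c)) y"
    unfolding symm_def by (rule arg_cong[where f="\<lambda>x. x / fact ?m"]) (rule sum_permutations_compose_right[OF \<tau>, symmetric])
  finally have *: "symm ?m (tprod p a (tprod q b c)) y = symm ?m (tprod q b (tprod p a c)) y" .
  have m: "q + (p + l) = ?m" by simp
  show ?thesis unfolding e[OF a refl] e[OF b refl] unfolding m by (rule *)
qed


section \<open>The tensorial Crofton formula\<close>

text \<open>
  By polarization it is enough to compare both sides on the diagonal, where they are the moments found
  above.
\<close>

lemma integral_dir_power_tensor:
  fixes z :: "nat \<Rightarrow> real^'n" and u :: "real^'n"
  assumes j: "j \<le> 1"
  shows "integrable uniform_ball (\<lambda>w. sym_power 1 (vec_tensor (dir w)) (2 * k + j) z * (1 + u \<bullet> dir w))"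
    "(\<integral>w. sym_power 1 (vec_tensor (dir w)) (2 * k + j) z * (1 + u \<bullet> dir w) \<partial>uniform_ball)
      = axis_moment CARD('n) (2 * (k + j)) * sym_prod (2 * k) j (sym_power 2 metric_tensor k) (sym_power 1 (vec_tensor u) j) z"
proof -
  let ?m = "2 * k + j"
  let ?M = "axis_moment CARD('n) (2 * (k + j))"
  let ?c = "\<lambda>S. (-1) ^ (?m - card S) :: real"
  let ?z = "\<lambda>S. \<Sum>a\<in>S. z a"
  let ?I = "\<lambda>S w. (dir w \<bullet> ?z S) ^ ?m * (1 + u \<bullet> dir w)"
  have int: "integrable uniform_ball (?I S)" for S
  proof (rule integrable_uniform_ball)
    show "\<bar>?I S w\<bar> \<le> norm (?z S) ^ ?m * (1 + norm u)" for w
    proof -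
      have "\<bar>1 + u \<bullet> dir w\<bar> \<le> 1 + norm u" using abs_dir_inner_le[of w u] by (simp add: inner_commute)
      then have "\<bar>dir w \<bullet> ?z S\<bar> ^ ?m * \<bar>1 + u \<bullet> dir w\<bar> \<le> norm (?z S) ^ ?m * (1 + norm u)"
        by (intro mult_mono power_mono abs_dir_inner_le) auto
      then show ?thesis by (simp only: abs_mult power_abs)
    qed
  qed measurable
  have eq: "sym_power 1 (vec_tensor (dir w)) ?m z * (1 + u \<bullet> dir w) = (\<Sum>S\<in>Pow {..<?m}. ?c S * ?I S w) / fact ?m" for w
  proof -
    have "fact ?m * sym_power 1 (vec_tensor (dir w)) ?m z = (\<Sum>S\<in>Pow {..<?m}. ?c S * (dir w \<bullet> ?z S) ^ ?m)"
      using polarization_power[of ?m z "dir w"] unfolding sym_power_vec_tensor by (simp only: inner_commute)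
    then have "sym_power 1 (vec_tensor (dir w)) ?m z = (\<Sum>S\<in>Pow {..<?m}. ?c S * (dir w \<bullet> ?z S) ^ ?m) / fact ?m"
      by (simp add: field_simps del: fact_Suc)
    then show ?thesis by (simp only: sum_distrib_right times_divide_eq_left mult.assoc)
  qed
  have int': "integrable uniform_ball (\<lambda>w. \<Sum>S\<in>Pow {..<?m}. ?c S * ?I S w)"
    by (intro Bochner_Integration.integrable_sum integrable_mult_right int)
  then show "integrable uniform_ball (\<lambda>w. sym_power 1 (vec_tensor (dir w)) ?m z * (1 + u \<bullet> dir w))"
    unfolding eq by (rule integrable_divide)
  have "(\<integral>w. sym_power 1 (vec_tensor (dir w)) ?m z * (1 + u \<bullet> dir w) \<partial>uniform_ball) = (\<Sum>S\<in>Pow {..<?m}. ?c S * (\<integral>w. ?I S w \<partial>uniform_ball)) / fact ?m"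
    unfolding eq integral_divide_zero
    by (subst Bochner_Integration.integral_sum) (intro integrable_mult_right int, simp only: integral_mult_right_zero)
  also have "\<dots> = (\<Sum>S\<in>Pow {..<?m}. ?M * (?c S * (norm (?z S) ^ (2 * k) * (u \<bullet> ?z S) ^ j))) / fact ?m"
    unfolding integral_dir_power_affine[OF j] by (simp only: mult.left_commute)
  also have "\<dots> = ?M * sym_prod (2 * k) j (sym_power 2 metric_tensor k) (sym_power 1 (vec_tensor u) j) z"
    unfolding sum_distrib_left[symmetric] polarization_metric_power by (simp del: fact_Suc)
  finally show "(\<integral>w. sym_power 1 (vec_tensor (dir w)) ?m z * (1 + u \<bullet> dir w) \<partial>uniform_ball)
      = ?M * sym_prod (2 * k) j (sym_power 2 metric_tensor k) (sym_power 1 (vec_tensor u) j) z" .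
qed

lemma integral_sym_prod:
  fixes y :: "nat \<Rightarrow> real^'n"
  assumes "\<And>z. integrable M (\<lambda>w. b w z)"
  shows "(\<integral>w. sym_prod p q a (b w) y \<partial>M) = sym_prod p q a (\<lambda>z. \<integral>w. b w z \<partial>M) y"
  unfolding sym_prod_def integral_divide_zero
  by (subst Bochner_Integration.integral_sum) (intro integrable_mult_right assms, simp only: integral_mult_right_zero)

lemma sym_prod_scale: "sym_prod p q a (\<lambda>z. b z * c) y = sym_prod p q a b y * c"
  "sym_prod p q a (\<lambda>z. c * b z) y = c * sym_prod p q a b y"
  unfolding sym_prod_def by (simp_all add: sum_distrib_left sum_distrib_right mult_ac)

text \<open>
  The average over \<open>w\<close> passes through the symmetric product with \<open>x\<^sup>r\<close>, and turns \<open>w\<^sup>s\<close> into a multiple of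
  \<open>Q\<^sup>k u\<^sup>j\<close>; then \<open>Q\<^sup>k\<close> is moved to the front.
\<close>

lemma dir_average_tensor:
  fixes x u :: "real^'n" and y :: "nat \<Rightarrow> real^'n"
  assumes j: "j \<le> 1"
  shows "dir_average (\<lambda>z. indicator B (fst z) * sym_prod r (2 * k + j) (sym_power 1 (vec_tensor (fst z)) r) (sym_power 1 (vec_tensor (snd z)) (2 * k + j)) y) (x, u)
    = axis_moment CARD('n) (2 * (k + j)) * (indicator B x *
       sym_prod (2 * k) (r + j) (sym_power 2 metric_tensor k) (sym_prod r j (sym_power 1 (vec_tensor x) r) (sym_power 1 (vec_tensor u) j)) y)"
proof -
  let ?s = "2 * k + j"
  let ?X = "sym_power 1 (vec_tensor x) r" and ?T = "\<lambda>w z. sym_power 1 (vec_tensor (dir w)) ?s z * (1 + u \<bullet> dir w)"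
  let ?Q = "sym_power 2 metric_tensor k :: (nat \<Rightarrow> real^'n) \<Rightarrow> real" and ?U = "sym_power 1 (vec_tensor u) j"
  have dX: "depends r ?X" unfolding depends_def sym_power_vec_tensor by auto
  have "dir_average (\<lambda>z. indicator B (fst z) * sym_prod r ?s (sym_power 1 (vec_tensor (fst z)) r) (sym_power 1 (vec_tensor (snd z)) ?s) y) (x, u)
     = (\<integral>w. indicator B x * sym_prod r ?s ?X (?T w) y \<partial>uniform_ball)"
    unfolding dir_average_def fst_conv snd_conv sym_prod_scale by (simp only: mult.assoc)
  also have "\<dots> = indicator B x * sym_prod r ?s ?X (\<lambda>z. \<integral>w. ?T w z \<partial>uniform_ball) y"
    unfolding integral_mult_right_zero integral_sym_prod[OF integral_dir_power_tensor(1)[OF j]] ..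
  also have "\<dots> = axis_moment CARD('n) (2 * (k + j)) * (indicator B x * sym_prod r ?s ?X (sym_prod (2 * k) j ?Q ?U) y)"
    unfolding integral_dir_power_tensor(2)[OF j] sym_prod_scale by (simp only: mult.left_commute)
  also have "sym_prod r ?s ?X (sym_prod (2 * k) j ?Q ?U) y = sym_prod (2 * k) (r + j) ?Q (sym_prod r j ?X ?U) y"
    by (rule sym_prod_left_commute[OF dX depends_sym_power_metric])
  finally show ?thesis .
qed

text \<open>
  Foot points lie in \<open>K\<close>, so the local parallel set of the complement is empty. All terms of its Steiner
  polynomial are nonnegative and hence vanish.
\<close>

lemma AE_support_measure_in_body:
  fixes K :: "(real^'n) set"
  assumes K: "convex_body K" and j: "j < CARD('n)"
  shows "AE z in support_measure K j. fst z \<in> K"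
proof -
  let ?\<eta> = "(- K) \<times> sphere 0 1 :: ((real^'n) \<times> (real^'n)) set"
  define t where "t i = unit_ball_vol (real (CARD('n) - i)) * measure (support_measure K i) ?\<eta>" for i
  have "?\<eta> = ((- K) \<times> UNIV) \<inter> (UNIV \<times> sphere 0 1)" by auto
  moreover have "(- K) \<times> (UNIV :: (real^'n) set) \<in> sets borel"
    using bodyD(4)[OF K] by (intro borel_open open_Times) (auto simp: open_closed)
  ultimately have \<eta>: "?\<eta> \<in> sets normal_space" by (auto simp: sets_restrict_space)
  have "closest_point K x \<in> K" for x by (rule closest_in[OF K])
  then have "(closest_point K x, outer_normal K x) \<notin> ?\<eta>" for x by simp
  then have empty: "local_parallel_set K 1 ?\<eta> = {}" unfolding local_parallel_set_def by blast
  have "\<forall>eps\<ge>0. \<forall>\<eta>\<in>sets normal_space. measure lborel (local_parallel_set K eps \<eta>) =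
      (\<Sum>i<CARD('n). unit_ball_vol (real (CARD('n) - i)) * measure (support_measure K i) \<eta> * eps ^ (CARD('n) - i))"
    using support_measures_of_support_measure[OF K] unfolding support_measures_of_def by (rule conjunct2)
  from this[rule_format, OF zero_le_one \<eta>] have "(\<Sum>i<CARD('n). t i * 1 ^ (CARD('n) - i)) = 0"
    unfolding empty t_def measure_empty by (rule sym)
  then have "(\<Sum>i<CARD('n). t i) = 0" by (simp only: power_one mult_1_right)
  moreover have "0 \<le> t i" for i unfolding t_def by (intro mult_nonneg_nonneg measure_nonneg) simp
  ultimately have "t j = 0" using j by (simp add: sum_nonneg_eq_0_iff)
  moreover have "unit_ball_vol (real (CARD('n) - j)) \<noteq> 0" by (rule less_imp_neq[OF unit_ball_vol_pos, symmetric]) simp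
  ultimately have m: "measure (support_measure K j) ?\<eta> = 0" unfolding t_def by (metis mult_eq_0_iff)
  interpret finite_measure "support_measure K j" by (rule sets_support_measure(2)[OF K j])
  have "?\<eta> \<in> null_sets (support_measure K j)"
    using m \<eta> sets_support_measure(1)[OF K j] by (intro null_setsI) (simp_all add: emeasure_eq_measure)
  then show ?thesis by (rule AE_I') (use sets_support_measure(3)[OF K j] in auto)
qed

text \<open>
  Support measures of \<open>K\<close> only see the points of \<open>K\<close> and unit normals. Thus \<open>\<beta> \<inter> E\<close> can be
  replaced by a set that does not depend on the line \<open>E\<close>.
\<close>

lemma set_integral_support_measure:
  fixes K :: "(real^'n) set" and h :: "(real^'n) \<times> (real^'n) \<Rightarrow> real"
  assumes K: "convex_body K" and j: "j < CARD('n)" and h: "h \<in> borel_measurable borel"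
    and A: "A \<in> sets borel" and B: "B \<in> sets borel" and AB: "A \<inter> K = B \<inter> K"
  shows "(LINT z : A \<times> sphere 0 1 | support_measure K j. h z) = (\<integral>z. indicator B (fst z) * h z \<partial>support_measure K j)"
  unfolding set_lebesgue_integral_def
proof (rule integral_cong_AE)
  note f = borel_measurable_fst_snd(1)
  have "A \<times> sphere (0 :: real^'n) 1 \<in> sets borel" unfolding borel_prod[symmetric] using A by (intro pair_measureI) auto
  then show "(\<lambda>z. indicator (A \<times> sphere 0 1) z *\<^sub>R h z) \<in> borel_measurable (support_measure K j)"
    by (intro measurable_support_measure[OF K j] borel_measurable_scaleR borel_measurable_indicator h)
  show "(\<lambda>z. indicator B (fst z) * h z) \<in> borel_measurable (support_measure K j)"
    by (intro measurable_support_measure[OF K j] borel_measurable_times measurable_compose[OF f borel_measurable_indicator[OF B]] h)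
  show "AE z in support_measure K j. indicator (A \<times> sphere 0 1) z *\<^sub>R h z = indicator B (fst z) * h z"
    using AE_support_measure_in_body[OF K j] AE_space
  proof eventually_elim
    case (elim z)
    then have "snd z \<in> sphere 0 1" using sets_support_measure(3)[OF K j] by auto
    moreover have "fst z \<in> A \<longleftrightarrow> fst z \<in> B" using AB elim by blast
    ultimately show ?case by (simp add: indicator_def mem_Times_iff)
  qed
qed

text \<open>
  The moments of order \<open>1\<close> and \<open>2 p\<close> come from the orientation of the line and from the tensor power; the
  factor \<open>2\<close> is the surface area of the zero-dimensional sphere, which is part of the right-hand side of the
  tensorial formula.
\<close>

lemma crofton_constant:
  assumes n: "(n::nat) > 0"
  shows "unit_sphere_area n * axis_moment n 1 * axis_moment n (2 * p) =
    2 * (pi powr ((real n - 2) / 2) * (Gamma (real n / 2) / Gamma ((real n + 1) / 2)) * (Gamma (real p + 1 / 2) / Gamma (real n / 2 + real p)))"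
proof -
  define m where "m = real n"
  have m0: "m > 0" using n by (simp add: m_def)
  have G: "Gamma (m / 2 + 1) = m / 2 * Gamma (m / 2)" using m0 Gamma_plus1[of "m / 2"] nonpos_Ints_nonpos[of "m / 2"] by (auto simp: add.commute)
  have pos: "Gamma (m / 2) > 0" "Gamma ((m + 1) / 2) > 0" "Gamma (m / 2 + real p) > 0" using m0 by (auto intro!: Gamma_real_pos)
  have area: "unit_sphere_area n = 2 * pi powr (m / 2) / Gamma (m / 2)"
    unfolding unit_sphere_area_def unit_ball_vol_def m_def[symmetric] G using m0 pos by (simp add: field_simps)
  have M1: "axis_moment n 1 = Gamma (m / 2) / (sqrt pi * Gamma ((m + 1) / 2))" by (simp add: axis_moment_def m_def)
  have M2: "axis_moment n (2 * p) = Gamma (real p + 1 / 2) * Gamma (m / 2) / (sqrt pi * Gamma (m / 2 + real p))"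
    by (simp add: axis_moment_def m_def add_divide_distrib)
  have "pi powr ((m - 2) / 2) = pi powr (m / 2 - 1)" by (simp add: diff_divide_distrib)
  also have "\<dots> = pi powr (m / 2) / pi" by (simp add: powr_diff)
  also have "\<dots> = pi powr (m / 2) / (sqrt pi * sqrt pi)" by simp
  finally have p: "pi powr ((m - 2) / 2) = pi powr (m / 2) / (sqrt pi * sqrt pi)" .
  have "sqrt pi \<noteq> 0" by simp
  then show ?thesis unfolding area M1 M2 m_def[symmetric] p using pos by (simp add: divide_simps del: real_sqrt_mult_self)
qed


lemma continuous_tensor_integrand:
  "continuous_on UNIV (\<lambda>z :: (real^'n) \<times> (real^'n). sym_prod r q (sym_power 1 (vec_tensor (fst z)) r) (sym_power 1 (vec_tensor (snd z)) q) y)"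
  unfolding sym_prod_def sym_power_vec_tensor by (intro continuous_intros) auto

text \<open>
  Cutting off at \<open>B \<subseteq> K\<close> makes the polynomial bounded on unit normals, as the Crofton formula requires.
\<close>

lemma tensor_integrand_bounded:
  fixes K B :: "(real^'n) set"
  assumes "convex_body K" "B \<subseteq> K"
  obtains C where "\<And>x u. norm u = 1 \<Longrightarrow>
    \<bar>indicator B x * sym_prod r q (sym_power 1 (vec_tensor x) r) (sym_power 1 (vec_tensor u) q) y\<bar> \<le> C"
proof -
  let ?g = "\<lambda>z :: (real^'n) \<times> (real^'n). sym_prod r q (sym_power 1 (vec_tensor (fst z)) r) (sym_power 1 (vec_tensor (snd z)) q) y"
  have "compact (?g ` (K \<times> sphere 0 1))"
    by (intro compact_continuous_image continuous_on_subset[OF continuous_tensor_integrand] compact_Times bodyD(2)[OF assms(1)]) auto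
  then have "bounded (?g ` (K \<times> sphere 0 1))" by (rule compact_imp_bounded)
  then obtain C where C: "C > 0" "\<forall>t\<in>?g ` (K \<times> sphere 0 1). norm t \<le> C" unfolding bounded_pos by blast
  have "\<bar>indicator B x * sym_prod r q (sym_power 1 (vec_tensor x) r) (sym_power 1 (vec_tensor u) q) y\<bar> \<le> C" if u: "norm u = 1" for x u
  proof (cases "x \<in> B")
    case True
    then have "?g (x, u) \<in> ?g ` (K \<times> sphere 0 1)" using assms(2) u by (intro imageI) auto
    then have "norm (?g (x, u)) \<le> C" using C(2) by blast
    then show ?thesis using True by simp
  qed (use C(1) in simp)
  then show ?thesis by (rule that)
qed

theorem theorem6:
  fixes K \<beta> :: "(real^'n) set" and r s :: nat and y :: "nat \<Rightarrow> real^'n"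
  assumes "CARD('n) \<ge> 2"
    and "convex_body K"
    and "\<beta> \<in> sets borel"
  shows "integrable (flat_measure 1)
           (\<lambda>E. tensorial_curvature_measure 0 r s (K \<inter> E) (\<beta> \<inter> E) y) \<and>
         (\<integral>E. tensorial_curvature_measure 0 r s (K \<inter> E) (\<beta> \<inter> E) y \<partial>flat_measure 1) =
         pi powr ((real CARD('n) - 2) / 2) *
         (Gamma (real CARD('n) / 2) / Gamma ((real CARD('n) + 1) / 2)) *
         (Gamma (real ((s + 1) div 2) + 1 / 2) / Gamma (real CARD('n) / 2 + real ((s + 1) div 2))) *
         sym_prod (2 * (s div 2)) (r + (s - 2 * (s div 2)))
           (sym_power 2 metric_tensor (s div 2))
           (tensorial_curvature_measure (CARD('n) - 1) r (s - 2 * (s div 2)) K \<beta>) y"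
proof -
  note n = assms(1) and K = assms(2) and \<beta> = assms(3)
  \<comment> \<open>\<open>k\<close> is the power of the metric tensor and \<open>j\<close> the parity of \<open>s\<close>\<close>
  define k where "k = s div 2"
  define j where "j = s - 2 * k"
  have s: "s = 2 * k + j" and j: "j \<le> 1" and p: "(s + 1) div 2 = k + j"
    unfolding k_def j_def by presburger+
  let ?Lam = "support_measure K (CARD('n) - 1)"
  let ?M = "axis_moment CARD('n)"
  let ?Q = "sym_power 2 metric_tensor k :: (nat \<Rightarrow> real^'n) \<Rightarrow> real"
  let ?area = "unit_sphere_area CARD('n)"
  define g where "g q z = sym_prod r q (sym_power 1 (vec_tensor (fst z)) r) (sym_power 1 (vec_tensor (snd z)) q)" for q and z :: "(real^'n) \<times> (real^'n)"
  \<comment> \<open>For every line \<open>E\<close> the sets \<open>\<beta> \<inter> E\<close> and \<open>B\<close> agree on \<open>K \<inter> E\<close>; unlike \<open>\<beta>\<close>, the set \<open>B\<close> is bounded.\<close>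
  define B where "B = \<beta> \<inter> K"
  let ?f = "\<lambda>q y z. indicator B (fst z) * g q z y"
  have n1: "CARD('n) - 1 < CARD('n)" by simp
  have Bb: "B \<in> sets borel" unfolding B_def using \<beta> bodyD(4)[OF K] by auto
  have gc: "continuous_on UNIV (\<lambda>z. g q z y)" for q y unfolding g_def by (rule continuous_tensor_integrand)
  have gm: "(\<lambda>z. g q z y) \<in> borel_measurable borel" for q y by (rule borel_measurable_continuous_onI[OF gc])
  note fst = borel_measurable_fst_snd(1)
  have fm: "?f q y \<in> borel_measurable borel" for q y
    by (intro borel_measurable_times measurable_compose[OF fst borel_measurable_indicator[OF Bb]] gm)
  have bounded: "\<exists>C. \<forall>x u. norm u = 1 \<longrightarrow> \<bar>?f q y (x, u)\<bar> \<le> C" for q y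
    using tensor_integrand_bounded[OF K, of B r q y] unfolding B_def g_def fst_conv snd_conv by blast
  have cont: "isCont (\<lambda>u. ?f q y (x, u)) u" for q y x u
  proof -
    have "continuous_on UNIV (\<lambda>u. g q (x, u) y)"
      by (rule continuous_on_compose2[OF gc[of q y]]) (auto intro!: continuous_intros)
    then show ?thesis by (simp add: continuous_on_eq_continuous_at)
  qed
  have int: "integrable ?Lam (?f q y)" for q y
    using bounded[of q y] integrable_support_measure[OF K n1 fm] by blast

  have chord: "tensorial_curvature_measure 0 r s (K \<inter> E) (\<beta> \<inter> E) y
      = ?area * (if K \<inter> E = {} then 0 else \<integral>z. ?f s y z \<partial>support_measure (K \<inter> E) 0)"
    if "E \<in> space (flat_measure 1)" for E
  proof (cases "K \<inter> E = {}")
    case False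
    have E: "E \<in> affine_flats 1" using that unfolding sets_flat_measure_1(2)[OF n] .
    have cE: "closed E" by (rule closed_flat[OF E])
    have KE: "convex_body (K \<inter> E)"
      using False bodyD(2,3)[OF K] cE affine_imp_convex[of E] E unfolding convex_body_def affine_flats_def
      by (auto intro!: compact_Int_closed convex_Int)
    have "(LINT z : (\<beta> \<inter> E) \<times> sphere 0 1 | support_measure (K \<inter> E) 0. g s z y) = (\<integral>z. ?f s y z \<partial>support_measure (K \<inter> E) 0)"
      by (rule set_integral_support_measure[OF KE _ gm _ Bb]) (use \<beta> cE in \<open>auto simp: B_def\<close>)
    then show ?thesis using False unfolding tensorial_curvature_measure_def g_def by simp
  qed (simp add: tensorial_curvature_measure_def)

  obtain C where "\<And>x u. norm u = 1 \<Longrightarrow> \<bar>?f s y (x, u)\<bar> \<le> C" using bounded[of s y] by blast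
  from crofton_lines[OF n K fm this cont]
  have "has_bochner_integral (flat_measure 1)
      (\<lambda>E. ?area * (if K \<inter> E = {} then 0 else \<integral>z. ?f s y z \<partial>support_measure (K \<inter> E) 0))
      (?area * (?M 1 * (\<integral>z. dir_average (?f s y) z \<partial>?Lam)))"
    by (rule has_bochner_integral_mult_right)
  then have crofton: "has_bochner_integral (flat_measure 1) (\<lambda>E. tensorial_curvature_measure 0 r s (K \<inter> E) (\<beta> \<inter> E) y)
      (?area * (?M 1 * (\<integral>z. dir_average (?f s y) z \<partial>?Lam)))"
    by (subst has_bochner_integral_cong[OF refl chord refl])

  have average: "dir_average (?f s y) z = ?M (2 * (k + j)) * sym_prod (2 * k) (r + j) ?Q (\<lambda>y. ?f j y z) y" for z
    using dir_average_tensor[OF j, of B r k y "fst z" "snd z"] unfolding s[symmetric] g_def sym_prod_scale by simp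
  let ?P = "sym_prod (2 * k) (r + j) ?Q (\<lambda>y. \<integral>z. ?f j y z \<partial>?Lam) y"
  let ?c = "pi powr ((real CARD('n) - 2) / 2) * (Gamma (real CARD('n) / 2) / Gamma ((real CARD('n) + 1) / 2)) *
      (Gamma (real (k + j) + 1 / 2) / Gamma (real CARD('n) / 2 + real (k + j)))"
  have integral_average: "(\<integral>z. dir_average (?f s y) z \<partial>?Lam) = ?M (2 * (k + j)) * ?P"
    unfolding average integral_mult_right_zero by (subst integral_sym_prod[OF int]) (rule refl)
  have top: "tensorial_curvature_measure (CARD('n) - 1) r j K \<beta> = (\<lambda>y. 2 * (\<integral>z. ?f j y z \<partial>?Lam))"
  proof
    fix y
    have "CARD('n) - (CARD('n) - 1) = 1" by simp
    moreover have "unit_sphere_area 1 = 2" by (simp add: unit_sphere_area_def)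
    moreover have "(LINT z : \<beta> \<times> sphere 0 1 | ?Lam. g j z y) = (\<integral>z. ?f j y z \<partial>?Lam)"
      by (rule set_integral_support_measure[OF K n1 gm \<beta> Bb]) (auto simp: B_def)
    ultimately show "tensorial_curvature_measure (CARD('n) - 1) r j K \<beta> y = 2 * (\<integral>z. ?f j y z \<partial>?Lam)"
      using bodyD(1)[OF K] unfolding tensorial_curvature_measure_def g_def by (simp only: if_False)
  qed
  have "?area * (?M 1 * (\<integral>z. dir_average (?f s y) z \<partial>?Lam)) = (?area * ?M 1 * ?M (2 * (k + j))) * ?P"
    unfolding integral_average by (simp only: mult.assoc)
  also have "?area * ?M 1 * ?M (2 * (k + j)) = 2 * ?c" by (rule crofton_constant) simp
  also have "2 * ?c * ?P = ?c * (2 * ?P)" by (simp only: mult.assoc mult.left_commute)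
  also have "2 * ?P = sym_prod (2 * k) (r + j) ?Q (tensorial_curvature_measure (CARD('n) - 1) r j K \<beta>) y"
    unfolding top by (rule sym_prod_scale(2)[symmetric])
  finally have total: "?area * (?M 1 * (\<integral>z. dir_average (?f s y) z \<partial>?Lam)) =
      ?c * sym_prod (2 * k) (r + j) ?Q (tensorial_curvature_measure (CARD('n) - 1) r j K \<beta>) y" .
  show ?thesis
    using crofton unfolding total has_bochner_integral_iff p k_def[symmetric] j_def[symmetric] .
qed

end
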